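(* Let $\mathbb{K}$ be a commutative ring, let $X$ be a quasimetric space and let $\mathbb{G}\subseteq\mathbb{R}$ be a subgroup such that $d(x,y)\in\mathbb{G}\cup\{\infty\}$ for all points $x,y\in X$. The category of $\Sigma_{\mathbb{G}}X$-modules is isomorphic to the category of $\mathbb{G}$-graded distance modules, $$\mathrm{DistMod}_{\mathbb{G}}(X,\mathbb{K})\cong\mathrm{Mod}(\Sigma_{\mathbb{G}}X),$$ and under this isomorphism the functors $\mathrm{Triv}$, $\mathrm{Inv}$, $\mathrm{Coinv}$ of trivial distance module, invariants and coinvariants of distance modules correspond to the functors $\varepsilon^*$, $\varepsilon_*$, $\varepsilon_!$ of trivial module, invariants and coinvariants of $\Sigma_{\mathbb{G}}X$-modules. In particular, $\mathrm{DistMod}_{\mathbb{G}}(X,\mathbb{K})$ has enough projectives and injectives and there are adjunctions $$\mathrm{Coinv}\dashv\mathrm{Triv}\dashv\mathrm{Inv}.$$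
   Context: Quasimetric space: a set $X$ with $d:X\times X\to[0,\infty]$ such that $d(x,y)+d(y,z)\ge d(x,z)$, and $d(x,y)=0$ iff $x=y$. Write $x\preccurlyeq y\preccurlyeq z$ if $d(x,y)+d(y,z)=d(x,z)$. Graded modules: $\mathcal{A}=\mathbb{G}\text{-}\mathrm{GrMod}(\mathbb{K})$ is the closed symmetric monoidal abelian category of families $A=(A_g)_{g\in\mathbb{G}}$ of $\mathbb{K}$-modules with degree $0$ morphisms; $(A\otimes B)_g=\bigoplus_{g_1+g_2=g}A_{g_1}\otimes B_{g_2}$; inner hom $[A,B]_d=\prod_{g_2-g_1=d}\mathrm{Hom}(A_{g_1},B_{g_2})$ (morphisms of degree $d$). $\mathbb{K}[\ell]$ is $\mathbb{K}$ concentrated in degree $\ell$; the unit is $\mathbb{K}[0]$. Distance modules: an object $M$ of $\mathrm{DistMod}_{\mathbb{G}}(X,\mathbb{K})$ consists of $\mathbb{G}$-graded $\mathbb{K}$-modules $M(x)$, $x\in X$, and morphisms $M(x,y):M(x)\to M(y)$ of degree $d(x,y)$ whenever $d(x,y)<\infty$, such that $M(x,x)=1$ and, whenever $d(x,y),d(y,z)<\infty$, $M(y,z)\circ M(x,y)=M(x,z)$ if $x\preccurlyeq y\preccurlyeq z$ and $=0$ otherwise. For $m\in M(x)$ write $m\cdot y:=M(x,y)(m)$. Morphisms are families of degree $0$ maps $\varphi(x):M(x)\to N(x)$ with $\varphi(x)(m)\cdot y=\varphi(y)(m\cdot y)$. Functors on distance modules: $\mathrm{Triv}(A)(x)=A$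 for all $x$, $\mathrm{Triv}(A)(x,y)=0$ for $x\ne y$. $\mathrm{Inv}(M)_\ell=\prod_{x}\{m\in M(x)_\ell\mid m\cdot y=0\text{ for all }y\ne x,\ d(x,y)<\infty\}$. $\mathrm{Coinv}(M)_\ell=\bigoplus_{x}M(x)_\ell/\langle m\cdot x\mid m\in M(y)_{\ell-d(y,x)},\ y\ne x,\ d(y,x)<\infty\rangle$. The $\mathcal{A}$-category $\Sigma_{\mathbb{G}}X$: objects are the points of $X$; $(\Sigma_{\mathbb{G}}X)(x,y)=\mathbb{K}[d(x,y)]$ with generator denoted $(x,y)$ if $d(x,y)<\infty$, and $0$ otherwise; $1_x=(x,x)$; $(y,z)\circ(x,y)=(x,z)$ if $x\preccurlyeq y\preccurlyeq z$ and $0$ otherwise. The augmentation $\varepsilon:\Sigma_{\mathbb{G}}X\to\mathsf{pt}$, where $\mathsf{pt}$ is the one-object $\mathcal{A}$-category with hom $\mathbb{K}[0]$, sends $(x,x)$ to $1$ and $(x,y)$ to $0$ for $x\ne y$. $\mathrm{Mod}(\Sigma_{\mathbb{G}}X)$ is the category of $\mathcal{A}$-functors $\Sigma_{\mathbb{G}}X\to\mathcal{A}$ and $\mathcal{A}$-natural transformations; identifying $\mathrm{Mod}(\mathsf{pt})$ with $\mathcal{A}$, $\varepsilon^*:\mathcal{A}\to\mathrm{Mod}(\Sigma_{\mathbb{G}}X)$ is restriction along $\varepsilon$, and $\varepsilon_!$, $\varepsilon_*$ are its left and right adjoints (enriched left and right Kan extensions along $\varepsilon$). *)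

theory Defs
  imports "HOL-Library.Extended_Nonnegative_Real" "HOL-Algebra.AbelCoset" "HOL-Algebra.Module"
begin

section \<open>Categories, functors, adjunctions\<close>

text \<open>
  Categories are given by hom-sets; composition \<open>Cmp C A B D g f\<close> is $g \circ f$ for
  $f : A \to B$ and $g : B \to D$, and the arrow part \<open>FArr F A B\<close> of a functor acts on
  arrows $A \to B$.  Arrows carry no domain or codomain of their own.
\<close>

record ('o, 'a) cat =
  Obj :: "'o set"
  Arr :: "'o \<Rightarrow> 'o \<Rightarrow> 'a set"
  Idt :: "'o \<Rightarrow> 'a"
  Cmp :: "'o \<Rightarrow> 'o \<Rightarrow> 'o \<Rightarrow> 'a \<Rightarrow> 'a \<Rightarrow> 'a"

definition category :: "('o, 'a) cat \<Rightarrow> bool" where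
  "category C \<longleftrightarrow>
     (\<forall>A\<in>Obj C. Idt C A \<in> Arr C A A) \<and>
     (\<forall>A\<in>Obj C. \<forall>B\<in>Obj C. \<forall>D\<in>Obj C. \<forall>f\<in>Arr C A B. \<forall>g\<in>Arr C B D.
        Cmp C A B D g f \<in> Arr C A D) \<and>
     (\<forall>A\<in>Obj C. \<forall>B\<in>Obj C. \<forall>f\<in>Arr C A B.
        Cmp C A A B f (Idt C A) = f \<and> Cmp C A B B (Idt C B) f = f) \<and>
     (\<forall>A\<in>Obj C. \<forall>B\<in>Obj C. \<forall>D\<in>Obj C. \<forall>E\<in>Obj C.
        \<forall>f\<in>Arr C A B. \<forall>g\<in>Arr C B D. \<forall>h\<in>Arr C D E.
        Cmp C A B E (Cmp C B D E h g) f = Cmp C A D E h (Cmp C A B D g f))"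

record ('o, 'a, 'p, 'b) ftor =
  FObj :: "'o \<Rightarrow> 'p"
  FArr :: "'o \<Rightarrow> 'o \<Rightarrow> 'a \<Rightarrow> 'b"

definition ftor_between ::
  "('o, 'a) cat \<Rightarrow> ('p, 'b) cat \<Rightarrow> ('o, 'a, 'p, 'b) ftor \<Rightarrow> bool" where
  "ftor_between C D F \<longleftrightarrow> category C \<and> category D \<and>
     (\<forall>A\<in>Obj C. FObj F A \<in> Obj D) \<and>
     (\<forall>A\<in>Obj C. \<forall>B\<in>Obj C. \<forall>f\<in>Arr C A B. FArr F A B f \<in> Arr D (FObj F A) (FObj F B)) \<and>
     (\<forall>A\<in>Obj C. FArr F A A (Idt C A) = Idt D (FObj F A)) \<and>
     (\<forall>A\<in>Obj C. \<forall>B\<in>Obj C. \<forall>E\<in>Obj C. \<forall>f\<in>Arr C A B. \<forall>g\<in>Arr C B E.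
        FArr F A E (Cmp C A B E g f) =
        Cmp D (FObj F A) (FObj F B) (FObj F E) (FArr F B E g) (FArr F A B f))"

definition ftor_id :: "('o, 'a, 'o, 'a) ftor" where
  "ftor_id = \<lparr>FObj = (\<lambda>A. A), FArr = (\<lambda>A B f. f)\<rparr>"

definition ftor_comp ::
  "('p, 'b, 'q, 'c) ftor \<Rightarrow> ('o, 'a, 'p, 'b) ftor \<Rightarrow> ('o, 'a, 'q, 'c) ftor" where
  "ftor_comp H F = \<lparr>FObj = (\<lambda>A. FObj H (FObj F A)),
     FArr = (\<lambda>A B f. FArr H (FObj F A) (FObj F B) (FArr F A B f))\<rparr>"

definition ftor_eq ::
  "('o, 'a) cat \<Rightarrow> ('o, 'a, 'p, 'b) ftor \<Rightarrow> ('o, 'a, 'p, 'b) ftor \<Rightarrow> bool" where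
  "ftor_eq C F H \<longleftrightarrow>
     (\<forall>A\<in>Obj C. FObj F A = FObj H A) \<and>
     (\<forall>A\<in>Obj C. \<forall>B\<in>Obj C. \<forall>f\<in>Arr C A B. FArr F A B f = FArr H A B f)"

definition cat_isomorphism ::
  "('o, 'a) cat \<Rightarrow> ('p, 'b) cat \<Rightarrow> ('o, 'a, 'p, 'b) ftor \<Rightarrow> bool" where
  "cat_isomorphism C D F \<longleftrightarrow> ftor_between C D F \<and>
     (\<exists>H. ftor_between D C H \<and>
        ftor_eq C (ftor_comp H F) ftor_id \<and> ftor_eq D (ftor_comp F H) ftor_id)"

definition iso_arr :: "('o, 'a) cat \<Rightarrow> 'o \<Rightarrow> 'o \<Rightarrow> 'a \<Rightarrow> bool" where
  "iso_arr C A B f \<longleftrightarrow> f \<in> Arr C A B \<and>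
     (\<exists>g\<in>Arr C B A. Cmp C A B A g f = Idt C A \<and> Cmp C B A B f g = Idt C B)"

definition nat_isomorphic ::
  "('o, 'a) cat \<Rightarrow> ('p, 'b) cat \<Rightarrow> ('o, 'a, 'p, 'b) ftor \<Rightarrow> ('o, 'a, 'p, 'b) ftor \<Rightarrow> bool" where
  "nat_isomorphic C D F H \<longleftrightarrow> ftor_between C D F \<and> ftor_between C D H \<and>
     (\<exists>\<tau>. (\<forall>A\<in>Obj C. iso_arr D (FObj F A) (FObj H A) (\<tau> A)) \<and>
        (\<forall>A\<in>Obj C. \<forall>B\<in>Obj C. \<forall>f\<in>Arr C A B.
           Cmp D (FObj F A) (FObj F B) (FObj H B) (\<tau> B) (FArr F A B f) =
           Cmp D (FObj F A) (FObj H A) (FObj H B) (FArr H A B f) (\<tau> A)))"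

text \<open>\<open>adjunction C D F H\<close> says $F \dashv H$ with $F : C \to D$ and $H : D \to C$.\<close>

definition adjunction ::
  "('o, 'a) cat \<Rightarrow> ('p, 'b) cat \<Rightarrow> ('o, 'a, 'p, 'b) ftor \<Rightarrow> ('p, 'b, 'o, 'a) ftor \<Rightarrow> bool" where
  "adjunction C D F H \<longleftrightarrow> ftor_between C D F \<and> ftor_between D C H \<and>
     (\<exists>\<theta>. (\<forall>A\<in>Obj C. \<forall>B\<in>Obj D. bij_betw (\<theta> A B) (Arr D (FObj F A) B) (Arr C A (FObj H B))) \<and>
        (\<forall>A'\<in>Obj C. \<forall>A\<in>Obj C. \<forall>B\<in>Obj D. \<forall>B'\<in>Obj D.
           \<forall>f\<in>Arr C A' A. \<forall>u\<in>Arr D (FObj F A) B. \<forall>g\<in>Arr D B B'.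
           \<theta> A' B' (Cmp D (FObj F A') B B' g (Cmp D (FObj F A') (FObj F A) B u (FArr F A' A f))) =
           Cmp C A' (FObj H B) (FObj H B') (FArr H B B' g)
             (Cmp C A' A (FObj H B) (\<theta> A B u) f)))"

definition mono_arr :: "('o, 'a) cat \<Rightarrow> 'o \<Rightarrow> 'o \<Rightarrow> 'a \<Rightarrow> bool" where
  "mono_arr C A B f \<longleftrightarrow> f \<in> Arr C A B \<and>
     (\<forall>Z\<in>Obj C. \<forall>g\<in>Arr C Z A. \<forall>h\<in>Arr C Z A. Cmp C Z A B f g = Cmp C Z A B f h \<longrightarrow> g = h)"

definition epi_arr :: "('o, 'a) cat \<Rightarrow> 'o \<Rightarrow> 'o \<Rightarrow> 'a \<Rightarrow> bool" where
  "epi_arr C A B f \<longleftrightarrow> f \<in> Arr C A B \<and>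
     (\<forall>Z\<in>Obj C. \<forall>g\<in>Arr C B Z. \<forall>h\<in>Arr C B Z. Cmp C A B Z g f = Cmp C A B Z h f \<longrightarrow> g = h)"

definition projective_obj :: "('o, 'a) cat \<Rightarrow> 'o \<Rightarrow> bool" where
  "projective_obj C P \<longleftrightarrow> P \<in> Obj C \<and>
     (\<forall>A\<in>Obj C. \<forall>B\<in>Obj C. \<forall>e f. epi_arr C A B e \<and> f \<in> Arr C P B \<longrightarrow>
        (\<exists>h\<in>Arr C P A. Cmp C P A B e h = f))"

definition injective_obj :: "('o, 'a) cat \<Rightarrow> 'o \<Rightarrow> bool" where
  "injective_obj C J \<longleftrightarrow> J \<in> Obj C \<and>
     (\<forall>A\<in>Obj C. \<forall>B\<in>Obj C. \<forall>i f. mono_arr C A B i \<and> f \<in> Arr C A J \<longrightarrow>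
        (\<exists>h\<in>Arr C B J. Cmp C A B J h i = f))"

definition enough_projectives :: "('o, 'a) cat \<Rightarrow> bool" where
  "enough_projectives C \<longleftrightarrow> (\<forall>A\<in>Obj C. \<exists>P e. projective_obj C P \<and> epi_arr C P A e)"

definition enough_injectives :: "('o, 'a) cat \<Rightarrow> bool" where
  "enough_injectives C \<longleftrightarrow> (\<forall>A\<in>Obj C. \<exists>J i. injective_obj C J \<and> mono_arr C A J i)"


section \<open>Graded modules\<close>

text \<open>
  HOL-Algebra modules carry ring fields \<open>mult\<close> and \<open>one\<close> which play no role for modules;
  the constructions below set them to \<open>undefined\<close>.

  A graded module is a family indexed by the subgroup $G$ of the reals; families and maps are
  extensional, i.e. \<open>undefined\<close> off their index set or domain, so that equality of families
  and of maps is equality on the index set or domain.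
\<close>

definition real_add_group :: "real monoid" where
  "real_add_group = \<lparr>carrier = UNIV, monoid.mult = (+), monoid.one = 0\<rparr>"

definition lin_maps :: "'k ring \<Rightarrow> ('k, 'u) module \<Rightarrow> ('k, 'v) module \<Rightarrow> ('u \<Rightarrow> 'v) set" where
  "lin_maps K M N = {f \<in> carrier M \<rightarrow>\<^sub>E carrier N.
     (\<forall>m\<in>carrier M. \<forall>n\<in>carrier M. f (m \<oplus>\<^bsub>M\<^esub> n) = f m \<oplus>\<^bsub>N\<^esub> f n) \<and>
     (\<forall>a\<in>carrier K. \<forall>m\<in>carrier M. f (a \<odot>\<^bsub>M\<^esub> m) = a \<odot>\<^bsub>N\<^esub> f m)}"

type_synonym ('k, 'u) gmod = "real \<Rightarrow> ('k, 'u) module"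

definition graded_modules :: "'k ring \<Rightarrow> real set \<Rightarrow> ('k, 'u) gmod set" where
  "graded_modules K G = (\<Pi>\<^sub>E g\<in>G. {M. Module.module K M})"

definition deg_maps ::
  "'k ring \<Rightarrow> real set \<Rightarrow> real \<Rightarrow> ('k, 'u) gmod \<Rightarrow> ('k, 'v) gmod \<Rightarrow> (real \<Rightarrow> 'u \<Rightarrow> 'v) set" where
  "deg_maps K G e A B = (\<Pi>\<^sub>E g\<in>G. lin_maps K (A g) (B (g + e)))"

definition deg_zero ::
  "real set \<Rightarrow> real \<Rightarrow> ('k, 'u) gmod \<Rightarrow> ('k, 'v) gmod \<Rightarrow> real \<Rightarrow> 'u \<Rightarrow> 'v" where
  "deg_zero G e A B = (\<lambda>g\<in>G. \<lambda>m\<in>carrier (A g). \<zero>\<^bsub>B (g + e)\<^esub>)"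

definition deg_id :: "real set \<Rightarrow> ('k, 'u) gmod \<Rightarrow> real \<Rightarrow> 'u \<Rightarrow> 'u" where
  "deg_id G A = (\<lambda>g\<in>G. \<lambda>m\<in>carrier (A g). m)"

text \<open>\<open>deg_comp G A e \<psi> \<phi>\<close> is $\psi \circ \varphi$ for $\varphi$ of degree $e$ with domain $A$.\<close>

definition deg_comp ::
  "real set \<Rightarrow> ('k, 'u) gmod \<Rightarrow> real \<Rightarrow> (real \<Rightarrow> 'v \<Rightarrow> 'w) \<Rightarrow> (real \<Rightarrow> 'u \<Rightarrow> 'v) \<Rightarrow> real \<Rightarrow> 'u \<Rightarrow> 'w" where
  "deg_comp G A e \<psi> \<phi> = (\<lambda>g\<in>G. \<lambda>m\<in>carrier (A g). \<psi> (g + e) (\<phi> g m))"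

definition inner_hom ::
  "'k ring \<Rightarrow> real set \<Rightarrow> ('k, 'u) gmod \<Rightarrow> ('k, 'v) gmod \<Rightarrow> ('k, real \<Rightarrow> 'u \<Rightarrow> 'v) gmod" where
  "inner_hom K G A B = (\<lambda>e\<in>G.
     \<lparr>carrier = deg_maps K G e A B, monoid.mult = undefined, monoid.one = undefined,
      ring.zero = deg_zero G e A B,
      ring.add = (\<lambda>\<phi> \<psi>. \<lambda>g\<in>G. \<lambda>m\<in>carrier (A g). \<phi> g m \<oplus>\<^bsub>B (g + e)\<^esub> \<psi> g m),
      module.smult = (\<lambda>a \<phi>. \<lambda>g\<in>G. \<lambda>m\<in>carrier (A g). a \<odot>\<^bsub>B (g + e)\<^esub> \<phi> g m)\<rparr>)"

text \<open>$K[\ell]$ and the zero graded module, both with elements in the type of $K$.\<close>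

definition shifted_ring :: "'k ring \<Rightarrow> real set \<Rightarrow> real \<Rightarrow> ('k, 'k) gmod" where
  "shifted_ring K G l = (\<lambda>g\<in>G.
     \<lparr>carrier = (if g = l then carrier K else {\<zero>\<^bsub>K\<^esub>}), monoid.mult = undefined, monoid.one = undefined,
      ring.zero = ring.zero K, ring.add = ring.add K, module.smult = monoid.mult K\<rparr>)"

definition zero_gmod :: "'k ring \<Rightarrow> real set \<Rightarrow> ('k, 'k) gmod" where
  "zero_gmod K G = (\<lambda>g\<in>G.
     \<lparr>carrier = {\<zero>\<^bsub>K\<^esub>}, monoid.mult = undefined, monoid.one = undefined,
      ring.zero = ring.zero K, ring.add = ring.add K, module.smult = monoid.mult K\<rparr>)"

definition GrMod :: "'k ring \<Rightarrow> real set \<Rightarrow> (('k, 'u) gmod, real \<Rightarrow> 'u \<Rightarrow> 'u) cat" where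
  "GrMod K G = \<lparr>Obj = graded_modules K G, Arr = deg_maps K G 0, Idt = deg_id G,
     Cmp = (\<lambda>A B C \<psi> \<phi>. deg_comp G A 0 \<psi> \<phi>)\<rparr>"


section \<open>Categories enriched in graded modules\<close>

text \<open>
  A morphism $\mathcal{C}(y,z) \otimes \mathcal{C}(x,y) \to \mathcal{C}(x,z)$ of graded modules is
  given as a family of $K$-bilinear maps
  $\mathcal{C}(y,z)_b \times \mathcal{C}(x,y)_a \to \mathcal{C}(x,z)_{a+b}$, written
  \<open>GCmp C x y z b a\<close>, and a morphism $K[0] \to \mathcal{C}(x,x)$ as an element \<open>GIdt C x\<close> of
  $\mathcal{C}(x,x)_0$.  The diagrams of enriched category theory are accordingly equations
  between homogeneous elements.
\<close>

record ('o, 'k, 'h) gcat =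
  GObj :: "'o set"
  GHom :: "'o \<Rightarrow> 'o \<Rightarrow> ('k, 'h) gmod"
  GIdt :: "'o \<Rightarrow> 'h"
  GCmp :: "'o \<Rightarrow> 'o \<Rightarrow> 'o \<Rightarrow> real \<Rightarrow> real \<Rightarrow> 'h \<Rightarrow> 'h \<Rightarrow> 'h"

definition gcategory :: "'k ring \<Rightarrow> real set \<Rightarrow> ('o, 'k, 'h) gcat \<Rightarrow> bool" where
  "gcategory K G C \<longleftrightarrow>
     (\<forall>x\<in>GObj C. \<forall>y\<in>GObj C. GHom C x y \<in> graded_modules K G) \<and>
     (\<forall>x\<in>GObj C. GIdt C x \<in> carrier (GHom C x x 0)) \<and>
     (\<forall>x\<in>GObj C. \<forall>y\<in>GObj C. \<forall>z\<in>GObj C. \<forall>a\<in>G. \<forall>b\<in>G.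
        (\<forall>r\<in>carrier (GHom C x y a).
           (\<lambda>s\<in>carrier (GHom C y z b). GCmp C x y z b a s r) \<in>
             lin_maps K (GHom C y z b) (GHom C x z (a + b))) \<and>
        (\<forall>s\<in>carrier (GHom C y z b).
           (\<lambda>r\<in>carrier (GHom C x y a). GCmp C x y z b a s r) \<in>
             lin_maps K (GHom C x y a) (GHom C x z (a + b)))) \<and>
     (\<forall>x\<in>GObj C. \<forall>y\<in>GObj C. \<forall>a\<in>G. \<forall>r\<in>carrier (GHom C x y a).
        GCmp C x x y a 0 r (GIdt C x) = r \<and> GCmp C x y y 0 a (GIdt C y) r = r) \<and>
     (\<forall>w\<in>GObj C. \<forall>x\<in>GObj C. \<forall>y\<in>GObj C. \<forall>z\<in>GObj C. \<forall>a\<in>G. \<forall>b\<in>G. \<forall>c\<in>G.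
        \<forall>r\<in>carrier (GHom C w x a). \<forall>s\<in>carrier (GHom C x y b). \<forall>t\<in>carrier (GHom C y z c).
        GCmp C w x z (b + c) a (GCmp C x y z c b t s) r =
        GCmp C w y z c (a + b) t (GCmp C w x y b a s r))"

record ('o, 'h, 'p, 'i) gftor =
  GFObj :: "'o \<Rightarrow> 'p"
  GFHom :: "'o \<Rightarrow> 'o \<Rightarrow> real \<Rightarrow> 'h \<Rightarrow> 'i"

definition gftors ::
  "'k ring \<Rightarrow> real set \<Rightarrow> ('o, 'k, 'h) gcat \<Rightarrow> ('p, 'k, 'i) gcat \<Rightarrow> ('o, 'h, 'p, 'i) gftor set" where
  "gftors K G C D = {F. GFObj F \<in> GObj C \<rightarrow>\<^sub>E GObj D \<and>
     (\<forall>x y. if x \<in> GObj C \<and> y \<in> GObj C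
            then GFHom F x y \<in> deg_maps K G 0 (GHom C x y) (GHom D (GFObj F x) (GFObj F y))
            else GFHom F x y = undefined) \<and>
     (\<forall>x\<in>GObj C. GFHom F x x 0 (GIdt C x) = GIdt D (GFObj F x)) \<and>
     (\<forall>x\<in>GObj C. \<forall>y\<in>GObj C. \<forall>z\<in>GObj C. \<forall>a\<in>G. \<forall>b\<in>G.
        \<forall>r\<in>carrier (GHom C x y a). \<forall>s\<in>carrier (GHom C y z b).
        GFHom F x z (a + b) (GCmp C x y z b a s r) =
        GCmp D (GFObj F x) (GFObj F y) (GFObj F z) b a (GFHom F y z b s) (GFHom F x y a r))}"

definition gnats ::
  "real set \<Rightarrow> ('o, 'k, 'h) gcat \<Rightarrow> ('p, 'k, 'i) gcat \<Rightarrow>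
   ('o, 'h, 'p, 'i) gftor \<Rightarrow> ('o, 'h, 'p, 'i) gftor \<Rightarrow> ('o \<Rightarrow> 'i) set" where
  "gnats G C D F H =
     {\<alpha> \<in> (\<Pi>\<^sub>E x\<in>GObj C. carrier (GHom D (GFObj F x) (GFObj H x) 0)).
        \<forall>x\<in>GObj C. \<forall>y\<in>GObj C. \<forall>g\<in>G. \<forall>r\<in>carrier (GHom C x y g).
          GCmp D (GFObj F x) (GFObj F y) (GFObj H y) 0 g (\<alpha> y) (GFHom F x y g r) =
          GCmp D (GFObj F x) (GFObj H x) (GFObj H y) g 0 (GFHom H x y g r) (\<alpha> x)}"

definition gftor_cat ::
  "'k ring \<Rightarrow> real set \<Rightarrow> ('o, 'k, 'h) gcat \<Rightarrow> ('p, 'k, 'i) gcat \<Rightarrow>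
   (('o, 'h, 'p, 'i) gftor, 'o \<Rightarrow> 'i) cat" where
  "gftor_cat K G C D = \<lparr>Obj = gftors K G C D, Arr = gnats G C D,
     Idt = (\<lambda>F. \<lambda>x\<in>GObj C. GIdt D (GFObj F x)),
     Cmp = (\<lambda>F H L \<beta> \<alpha>. \<lambda>x\<in>GObj C.
        GCmp D (GFObj F x) (GFObj H x) (GFObj L x) 0 0 (\<beta> x) (\<alpha> x))\<rparr>"

definition gftor_comp ::
  "('o, 'k, 'h) gcat \<Rightarrow> real set \<Rightarrow>
   ('p, 'i, 'q, 'j) gftor \<Rightarrow> ('o, 'h, 'p, 'i) gftor \<Rightarrow> ('o, 'h, 'q, 'j) gftor" where
  "gftor_comp C G F P = \<lparr>GFObj = (\<lambda>x\<in>GObj C. GFObj F (GFObj P x)),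
     GFHom = (\<lambda>x y. if x \<in> GObj C \<and> y \<in> GObj C
        then \<lambda>g\<in>G. \<lambda>r\<in>carrier (GHom C x y g). GFHom F (GFObj P x) (GFObj P y) g (GFHom P x y g r)
        else undefined)\<rparr>"

text \<open>The category of graded modules enriched over itself by its inner hom.\<close>

definition GrMod_enr ::
  "'k ring \<Rightarrow> real set \<Rightarrow> (('k, 'u) gmod, 'k, real \<Rightarrow> 'u \<Rightarrow> 'u) gcat" where
  "GrMod_enr K G = \<lparr>GObj = graded_modules K G, GHom = inner_hom K G, GIdt = deg_id G,
     GCmp = (\<lambda>A B C b a \<psi> \<phi>. deg_comp G A a \<psi> \<phi>)\<rparr>"

type_synonym ('o, 'k, 'h, 'u) gcat_module = "('o, 'h, ('k, 'u) gmod, real \<Rightarrow> 'u \<Rightarrow> 'u) gftor"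

definition ModCat ::
  "'k ring \<Rightarrow> real set \<Rightarrow> ('o, 'k, 'h) gcat \<Rightarrow>
   (('o, 'k, 'h, 'u) gcat_module, 'o \<Rightarrow> real \<Rightarrow> 'u \<Rightarrow> 'u) cat" where
  "ModCat K G C = gftor_cat K G C (GrMod_enr K G)"

definition restriction ::
  "('o, 'k, 'h) gcat \<Rightarrow> real set \<Rightarrow> ('o, 'h, 'p, 'i) gftor \<Rightarrow>
   (('p, 'k, 'i, 'u) gcat_module, 'p \<Rightarrow> real \<Rightarrow> 'u \<Rightarrow> 'u,
    ('o, 'k, 'h, 'u) gcat_module, 'o \<Rightarrow> real \<Rightarrow> 'u \<Rightarrow> 'u) ftor" where
  "restriction C G P = \<lparr>FObj = (\<lambda>F. gftor_comp C G F P),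
     FArr = (\<lambda>F H \<alpha>. \<lambda>x\<in>GObj C. \<alpha> (GFObj P x))\<rparr>"

definition pt_gcat :: "'k ring \<Rightarrow> real set \<Rightarrow> (unit, 'k, 'k) gcat" where
  "pt_gcat K G = \<lparr>GObj = UNIV, GHom = (\<lambda>x y. shifted_ring K G 0), GIdt = (\<lambda>x. \<one>\<^bsub>K\<^esub>),
     GCmp = (\<lambda>x y z b a s r. s \<otimes>\<^bsub>K\<^esub> r)\<rparr>"

text \<open>
  The identification of graded modules with modules over the point: on a graded module $A$ the
  morphism $K[0] \to [A,A]$ is $r \mapsto r \cdot 1_A$ in degree $0$.
\<close>

definition pt_module ::
  "'k ring \<Rightarrow> real set \<Rightarrow>
   (('k, 'u) gmod, real \<Rightarrow> 'u \<Rightarrow> 'u, (unit, 'k, 'k, 'u) gcat_module, unit \<Rightarrow> real \<Rightarrow> 'u \<Rightarrow> 'u) ftor" where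
  "pt_module K G = \<lparr>
     FObj = (\<lambda>A. \<lparr>GFObj = (\<lambda>x. A),
       GFHom = (\<lambda>x y. \<lambda>g\<in>G. \<lambda>r\<in>carrier (shifted_ring K G 0 g).
         if g = 0 then r \<odot>\<^bsub>inner_hom K G A A 0\<^esub> deg_id G A else \<zero>\<^bsub>inner_hom K G A A g\<^esub>)\<rparr>),
     FArr = (\<lambda>A B f. \<lambda>x. f)\<rparr>"


section \<open>Quasimetric spaces\<close>

definition quasimetric :: "'x set \<Rightarrow> ('x \<Rightarrow> 'x \<Rightarrow> ennreal) \<Rightarrow> bool" where
  "quasimetric X d \<longleftrightarrow>
     (\<forall>x\<in>X. \<forall>y\<in>X. \<forall>z\<in>X. d x z \<le> d x y + d y z) \<and>
     (\<forall>x\<in>X. \<forall>y\<in>X. d x y = 0 \<longleftrightarrow> x = y)"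

definition between :: "('x \<Rightarrow> 'x \<Rightarrow> ennreal) \<Rightarrow> 'x \<Rightarrow> 'x \<Rightarrow> 'x \<Rightarrow> bool" where
  "between d x y z \<longleftrightarrow> d x y + d y z = d x z"

text \<open>
  Elements of $K[d(x,y)]$ are scalars $r$, standing for $r \cdot (x,y)$.  The composite of
  $r \cdot (x,y)$ and $s \cdot (y,z)$ is $sr \cdot (x,z)$ or $0$; if a distance is infinite or a
  degree is wrong then the scalar is itself $0$.
\<close>

definition Sigma_gcat ::
  "'k ring \<Rightarrow> real set \<Rightarrow> 'x set \<Rightarrow> ('x \<Rightarrow> 'x \<Rightarrow> ennreal) \<Rightarrow> ('x, 'k, 'k) gcat" where
  "Sigma_gcat K G X d = \<lparr>GObj = X,
     GHom = (\<lambda>x y. if d x y < \<infinity> then shifted_ring K G (enn2real (d x y)) else zero_gmod K G),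
     GIdt = (\<lambda>x. \<one>\<^bsub>K\<^esub>),
     GCmp = (\<lambda>x y z b a s r. if between d x y z then s \<otimes>\<^bsub>K\<^esub> r else \<zero>\<^bsub>K\<^esub>)\<rparr>"

definition augmentation ::
  "'k ring \<Rightarrow> real set \<Rightarrow> 'x set \<Rightarrow> ('x \<Rightarrow> 'x \<Rightarrow> ennreal) \<Rightarrow> ('x, 'k, unit, 'k) gftor" where
  "augmentation K G X d = \<lparr>GFObj = (\<lambda>x\<in>X. ()),
     GFHom = (\<lambda>x y. if x \<in> X \<and> y \<in> X
        then \<lambda>g\<in>G. \<lambda>r\<in>carrier (GHom (Sigma_gcat K G X d) x y g). if x = y then r else \<zero>\<^bsub>K\<^esub>
        else undefined)\<rparr>"

definition eps_pullback ::
  "'k ring \<Rightarrow> real set \<Rightarrow> 'x set \<Rightarrow> ('x \<Rightarrow> 'x \<Rightarrow> ennreal) \<Rightarrow>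
   (('k, 'u) gmod, real \<Rightarrow> 'u \<Rightarrow> 'u, ('x, 'k, 'k, 'u) gcat_module, 'x \<Rightarrow> real \<Rightarrow> 'u \<Rightarrow> 'u) ftor" where
  "eps_pullback K G X d =
     ftor_comp (restriction (Sigma_gcat K G X d) G (augmentation K G X d)) (pt_module K G)"


section \<open>Distance modules\<close>

record ('x, 'k, 'u) dmod =
  pts :: "'x \<Rightarrow> ('k, 'u) gmod"
  act :: "'x \<Rightarrow> 'x \<Rightarrow> real \<Rightarrow> 'u \<Rightarrow> 'u"

definition dist_modules ::
  "'k ring \<Rightarrow> real set \<Rightarrow> 'x set \<Rightarrow> ('x \<Rightarrow> 'x \<Rightarrow> ennreal) \<Rightarrow> ('x, 'k, 'u) dmod set" where
  "dist_modules K G X d = {M. pts M \<in> X \<rightarrow>\<^sub>E graded_modules K G \<and>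
     (\<forall>x y. if x \<in> X \<and> y \<in> X \<and> d x y < \<infinity>
            then act M x y \<in> deg_maps K G (enn2real (d x y)) (pts M x) (pts M y)
            else act M x y = undefined) \<and>
     (\<forall>x\<in>X. act M x x = deg_id G (pts M x)) \<and>
     (\<forall>x\<in>X. \<forall>y\<in>X. \<forall>z\<in>X. d x y < \<infinity> \<and> d y z < \<infinity> \<longrightarrow>
        deg_comp G (pts M x) (enn2real (d x y)) (act M y z) (act M x y) =
        (if between d x y z then act M x z
         else deg_zero G (enn2real (d x y) + enn2real (d y z)) (pts M x) (pts M z)))}"

definition dist_maps ::
  "'k ring \<Rightarrow> real set \<Rightarrow> 'x set \<Rightarrow> ('x \<Rightarrow> 'x \<Rightarrow> ennreal) \<Rightarrow>
   ('x, 'k, 'u) dmod \<Rightarrow> ('x, 'k, 'u) dmod \<Rightarrow> ('x \<Rightarrow> real \<Rightarrow> 'u \<Rightarrow> 'u) set" where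
  "dist_maps K G X d M N = {\<phi> \<in> (\<Pi>\<^sub>E x\<in>X. deg_maps K G 0 (pts M x) (pts N x)).
     \<forall>x\<in>X. \<forall>y\<in>X. d x y < \<infinity> \<longrightarrow> (\<forall>g\<in>G. \<forall>m\<in>carrier (pts M x g).
       act N x y g (\<phi> x g m) = \<phi> y (g + enn2real (d x y)) (act M x y g m))}"

definition DistMod ::
  "'k ring \<Rightarrow> real set \<Rightarrow> 'x set \<Rightarrow> ('x \<Rightarrow> 'x \<Rightarrow> ennreal) \<Rightarrow>
   (('x, 'k, 'u) dmod, 'x \<Rightarrow> real \<Rightarrow> 'u \<Rightarrow> 'u) cat" where
  "DistMod K G X d = \<lparr>Obj = dist_modules K G X d, Arr = dist_maps K G X d,
     Idt = (\<lambda>M. \<lambda>x\<in>X. deg_id G (pts M x)),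
     Cmp = (\<lambda>M N P \<psi> \<phi>. \<lambda>x\<in>X. deg_comp G (pts M x) 0 (\<psi> x) (\<phi> x))\<rparr>"

definition Triv ::
  "real set \<Rightarrow> 'x set \<Rightarrow> ('x \<Rightarrow> 'x \<Rightarrow> ennreal) \<Rightarrow>
   (('k, 'u) gmod, real \<Rightarrow> 'u \<Rightarrow> 'u, ('x, 'k, 'u) dmod, 'x \<Rightarrow> real \<Rightarrow> 'u \<Rightarrow> 'u) ftor" where
  "Triv G X d = \<lparr>
     FObj = (\<lambda>A. \<lparr>pts = (\<lambda>x\<in>X. A),
       act = (\<lambda>x y. if x \<in> X \<and> y \<in> X \<and> d x y < \<infinity>
          then if x = y then deg_id G A else deg_zero G (enn2real (d x y)) A A
          else undefined)\<rparr>),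
     FArr = (\<lambda>A B f. \<lambda>x\<in>X. f)\<rparr>"


section \<open>Invariants and coinvariants\<close>

definition product_module :: "'i set \<Rightarrow> ('i \<Rightarrow> ('k, 'u) module) \<Rightarrow> ('k, 'i \<Rightarrow> 'u) module" where
  "product_module I M =
     \<lparr>carrier = (\<Pi>\<^sub>E i\<in>I. carrier (M i)), monoid.mult = undefined, monoid.one = undefined,
      ring.zero = (\<lambda>i\<in>I. \<zero>\<^bsub>M i\<^esub>),
      ring.add = (\<lambda>u v. \<lambda>i\<in>I. u i \<oplus>\<^bsub>M i\<^esub> v i),
      module.smult = (\<lambda>a u. \<lambda>i\<in>I. a \<odot>\<^bsub>M i\<^esub> u i)\<rparr>"

definition direct_sum_module :: "'i set \<Rightarrow> ('i \<Rightarrow> ('k, 'u) module) \<Rightarrow> ('k, 'i \<Rightarrow> 'u) module" where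
  "direct_sum_module I M = (product_module I M)
     \<lparr>carrier := {u \<in> (\<Pi>\<^sub>E i\<in>I. carrier (M i)). finite {i \<in> I. u i \<noteq> \<zero>\<^bsub>M i\<^esub>}}\<rparr>"

definition generated_submodule :: "'k ring \<Rightarrow> ('k, 'u) module \<Rightarrow> 'u set \<Rightarrow> 'u set" where
  "generated_submodule K M S = \<Inter>{H. submodule H K M \<and> S \<subseteq> H}"

definition quotient_module :: "('k, 'u) module \<Rightarrow> 'u set \<Rightarrow> ('k, 'u set) module" where
  "quotient_module M N =
     \<lparr>carrier = a_rcosets\<^bsub>M\<^esub> N, monoid.mult = undefined, monoid.one = undefined,
      ring.zero = N, ring.add = (\<lambda>C D. C <+>\<^bsub>M\<^esub> D), module.smult = (\<lambda>a C. \<Union>c\<in>C. N +>\<^bsub>M\<^esub> (a \<odot>\<^bsub>M\<^esub> c))\<rparr>"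

definition inv_part ::
  "'x set \<Rightarrow> ('x \<Rightarrow> 'x \<Rightarrow> ennreal) \<Rightarrow> ('x, 'k, 'u) dmod \<Rightarrow> real \<Rightarrow> 'x \<Rightarrow> 'u set" where
  "inv_part X d M l x = {m \<in> carrier (pts M x l).
     \<forall>y\<in>X. y \<noteq> x \<and> d x y < \<infinity> \<longrightarrow> act M x y l m = \<zero>\<^bsub>pts M y (l + enn2real (d x y))\<^esub>}"

definition Inv_big ::
  "'x set \<Rightarrow> ('x \<Rightarrow> 'x \<Rightarrow> ennreal) \<Rightarrow> ('x, 'k, 'u) dmod \<Rightarrow> real \<Rightarrow> ('k, 'x \<Rightarrow> 'u) module" where
  "Inv_big X d M l = product_module X (\<lambda>x. (pts M x l)\<lparr>carrier := inv_part X d M l x\<rparr>)"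

definition coinv_rel ::
  "'k ring \<Rightarrow> 'x set \<Rightarrow> ('x \<Rightarrow> 'x \<Rightarrow> ennreal) \<Rightarrow> ('x, 'k, 'u) dmod \<Rightarrow> real \<Rightarrow> 'x \<Rightarrow> 'u set" where
  "coinv_rel K X d M l x = generated_submodule K (pts M x l)
     {act M y x (l - enn2real (d y x)) m | y m.
        y \<in> X \<and> y \<noteq> x \<and> d y x < \<infinity> \<and> m \<in> carrier (pts M y (l - enn2real (d y x)))}"

definition Coinv_big ::
  "'k ring \<Rightarrow> 'x set \<Rightarrow> ('x \<Rightarrow> 'x \<Rightarrow> ennreal) \<Rightarrow> ('x, 'k, 'u) dmod \<Rightarrow> real \<Rightarrow>
   ('k, 'x \<Rightarrow> 'u set) module" where
  "Coinv_big K X d M l =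
     direct_sum_module X (\<lambda>x. quotient_module (pts M x l) (coinv_rel K X d M l x))"

definition Coinv_big_map ::
  "'k ring \<Rightarrow> 'x set \<Rightarrow> ('x \<Rightarrow> 'x \<Rightarrow> ennreal) \<Rightarrow> ('x, 'k, 'u) dmod \<Rightarrow>
   ('x \<Rightarrow> real \<Rightarrow> 'u \<Rightarrow> 'u) \<Rightarrow> real \<Rightarrow> ('x \<Rightarrow> 'u set) \<Rightarrow> 'x \<Rightarrow> 'u set" where
  "Coinv_big_map K X d N \<phi> l u =
     (\<lambda>x\<in>X. \<Union>m\<in>u x. coinv_rel K X d N l x +>\<^bsub>pts N x l\<^esub> \<phi> x l m)"

text \<open>
  All categories have modules with elements in one type \<open>'u\<close>, the universe.  The elements of
  \<open>Inv_big\<close> and \<open>Coinv_big\<close> are functions on $X$, so these modules are replaced by isomorphic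
  copies inside \<open>'u\<close> along a chosen injection; injections exist by the closure property of
  \<open>'u\<close> below.
\<close>

definition to_copy :: "('k, 'b) module \<Rightarrow> 'b \<Rightarrow> 'u" where
  "to_copy P = (SOME e. inj_on e (carrier P))"

definition of_copy :: "('k, 'b) module \<Rightarrow> 'u \<Rightarrow> 'b" where
  "of_copy P = inv_into (carrier P) (to_copy P)"

definition copy :: "('k, 'b) module \<Rightarrow> ('k, 'u) module" where
  "copy P = \<lparr>carrier = to_copy P ` carrier P, monoid.mult = undefined, monoid.one = undefined,
     ring.zero = to_copy P \<zero>\<^bsub>P\<^esub>,
     ring.add = (\<lambda>u v. to_copy P (of_copy P u \<oplus>\<^bsub>P\<^esub> of_copy P v)),
     module.smult = (\<lambda>a u. to_copy P (a \<odot>\<^bsub>P\<^esub> of_copy P u))\<rparr>"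

definition Inv ::
  "real set \<Rightarrow> 'x set \<Rightarrow> ('x \<Rightarrow> 'x \<Rightarrow> ennreal) \<Rightarrow>
   (('x, 'k, 'u) dmod, 'x \<Rightarrow> real \<Rightarrow> 'u \<Rightarrow> 'u, ('k, 'u) gmod, real \<Rightarrow> 'u \<Rightarrow> 'u) ftor" where
  "Inv G X d = \<lparr>
     FObj = (\<lambda>M. \<lambda>l\<in>G. copy (Inv_big X d M l)),
     FArr = (\<lambda>M N \<phi>. \<lambda>l\<in>G. \<lambda>u\<in>to_copy (Inv_big X d M l) ` carrier (Inv_big X d M l).
       to_copy (Inv_big X d N l) (\<lambda>x\<in>X. \<phi> x l (of_copy (Inv_big X d M l) u x)))\<rparr>"

definition Coinv ::
  "'k ring \<Rightarrow> real set \<Rightarrow> 'x set \<Rightarrow> ('x \<Rightarrow> 'x \<Rightarrow> ennreal) \<Rightarrow>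
   (('x, 'k, 'u) dmod, 'x \<Rightarrow> real \<Rightarrow> 'u \<Rightarrow> 'u, ('k, 'u) gmod, real \<Rightarrow> 'u \<Rightarrow> 'u) ftor" where
  "Coinv K G X d = \<lparr>
     FObj = (\<lambda>M. \<lambda>l\<in>G. copy (Coinv_big K X d M l)),
     FArr = (\<lambda>M N \<phi>. \<lambda>l\<in>G. \<lambda>u\<in>to_copy (Coinv_big K X d M l) ` carrier (Coinv_big K X d M l).
       to_copy (Coinv_big K X d N l)
         (Coinv_big_map K X d N \<phi> l (of_copy (Coinv_big K X d M l) u)))\<rparr>"

text \<open>
  \<open>closed_universe\<close> says that \<open>'u\<close> is closed under families indexed by \<open>'i\<close>.  It is the only
  consequence of the usual universe convention (modules have small underlying sets) which is
  needed, and by the next two lemmas every type embeds into a type with this property.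
\<close>

definition closed_universe :: "'i itself \<Rightarrow> 'u itself \<Rightarrow> bool" where
  "closed_universe _ _ \<longleftrightarrow> (\<exists>e :: ('i \<Rightarrow> 'u) \<Rightarrow> 'u. inj e)"

lemma closed_universe_fun:
  includes cardinal_syntax
  assumes "infinite (UNIV :: 'i set)"
  shows "closed_universe TYPE('i) TYPE('i \<Rightarrow> 'v)"
proof -
  have "|UNIV \<times> UNIV :: ('i \<times> 'i) set| =o |UNIV :: 'i set|"
    using assms by (rule card_of_Times_same_infinite)
  then obtain p :: "'i \<Rightarrow> 'i \<times> 'i" where p: "bij p"
    using card_of_ordIso ordIso_symmetric by (metis UNIV_Times_UNIV)
  define e where "e = (\<lambda>(F :: 'i \<Rightarrow> 'i \<Rightarrow> 'v) i. F (fst (p i)) (snd (p i)))"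
  have "inj e"
  proof (rule injI, intro ext)
    fix F H :: "'i \<Rightarrow> 'i \<Rightarrow> 'v" and a b
    assume "e F = e H"
    moreover obtain i where "p i = (a, b)"
      using p by (metis bij_pointE)
    ultimately show "F a b = H a b"
      unfolding e_def by (metis fst_conv snd_conv)
  qed
  then show ?thesis
    unfolding closed_universe_def by blast
qed

lemma universe_embedding: "inj (\<lambda>(v :: 'v) (i :: 'i). v)"
  by (auto simp: inj_def fun_eq_iff)


section \<open>The enriched categories and the augmentation are well defined\<close>

lemma shifted_ring_graded:
  assumes "cring K"
  shows "shifted_ring K G l \<in> graded_modules K G" "zero_gmod K G \<in> graded_modules K G"
proof -
  interpret K: cring K by fact
  have 1: "Module.module K \<lparr>carrier = carrier K, monoid.mult = undefined, monoid.one = undefined,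
      ring.zero = ring.zero K, ring.add = ring.add K, module.smult = monoid.mult K\<rparr>"
    apply (rule moduleI)
    apply (rule assms)
    apply (rule abelian_groupI)
    apply (auto simp: K.a_assoc K.m_assoc K.l_distr K.r_distr intro: K.a_comm K.a_lcomm)
    done
  have 2: "Module.module K \<lparr>carrier = {\<zero>\<^bsub>K\<^esub>}, monoid.mult = undefined, monoid.one = undefined,
      ring.zero = ring.zero K, ring.add = ring.add K, module.smult = monoid.mult K\<rparr>"
    apply (rule moduleI)
    apply (rule assms)
    apply (rule abelian_groupI)
    by (auto)
  show "shifted_ring K G l \<in> graded_modules K G" "zero_gmod K G \<in> graded_modules K G"
    using 1 2 by (auto simp: graded_modules_def shifted_ring_def zero_gmod_def)
qed

lemma subgroup_real_closed:
  assumes "subgroup G real_add_group"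
  shows "0 \<in> G" "a \<in> G \<Longrightarrow> b \<in> G \<Longrightarrow> a + b \<in> G"
  using assms subgroup.one_closed[OF assms] subgroup.m_closed[OF assms] by (auto simp: real_add_group_def)

lemma Sigma_gcategory:
  assumes "cring K" "quasimetric X d" and G: "subgroup G real_add_group"
    and dG: "\<And>x y. x \<in> X \<Longrightarrow> y \<in> X \<Longrightarrow> d x y < \<infinity> \<Longrightarrow> enn2real (d x y) \<in> G"
  shows "gcategory K G (Sigma_gcat K G X d)"
proof -
  interpret K: cring K by fact
  let ?H = "GHom (Sigma_gcat K G X d)"
  have car: "carrier (?H x y g) = (if d x y < \<infinity> \<and> g = enn2real (d x y) then carrier K else {\<zero>\<^bsub>K\<^esub>})"
    if "g \<in> G" for x y g using that by (auto simp: Sigma_gcat_def shifted_ring_def zero_gmod_def)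
  have ad: "ring.add (?H x y g) = ring.add K" "module.smult (?H x y g) = monoid.mult K"
    if "g \<in> G" for x y g using that by (auto simp: Sigma_gcat_def shifted_ring_def zero_gmod_def)
  have d0: "d x x = 0" if "x \<in> X" for x using assms that by (auto simp: quasimetric_def)
  have tri: "d x z \<le> d x y + d y z" if "x \<in> X" "y\<in>X" "z\<in>X" for x y z using assms that by (auto simp: quasimetric_def)
  have inK: "r \<in> carrier K" if "r \<in> carrier (?H x y g)" "g \<in> G" for r x y g
    using that car[of g x y] by (auto split: if_splits)
  have add_fin: "enn2real (a + b) = enn2real a + enn2real b" if "a < \<infinity>" "b < \<infinity>" for a b
    using that by (cases a; cases b) (auto simp flip: ennreal_plus)
  define c where "c x y z s r = (if between d x y z then s \<otimes>\<^bsub>K\<^esub> r else \<zero>\<^bsub>K\<^esub>)" for x y z s r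
  have cc: "GCmp (Sigma_gcat K G X d) x y z b a s r = c x y z s r" for x y z b a s r
    by (simp add: Sigma_gcat_def c_def)
  have cin: "c x y z s r \<in> carrier (?H x z (a + b))"
    if "a \<in> G" "b \<in> G" "r \<in> carrier (?H x y a)" "s \<in> carrier (?H y z b)" for x y z a b r s
  proof -
    have ab: "a + b \<in> G" using that subgroup_real_closed[OF G] by auto
    have rk: "r \<in> carrier K" "s \<in> carrier K" using that inK by auto
    have *: "c x y z s r = \<zero>\<^bsub>K\<^esub> \<or> (d x y < \<infinity> \<and> d y z < \<infinity> \<and> d x z = d x y + d y z \<and> a = enn2real (d x y) \<and> b = enn2real (d y z))"
      using that car[of a x y] car[of b y z] rk by (auto simp: c_def between_def split: if_splits)
    then show ?thesis
      using car[OF ab, of x z] rk by (auto simp: add_fin c_def)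
  qed
  show ?thesis unfolding gcategory_def
  proof (intro conjI ballI)
    fix x y assume "x \<in> GObj (Sigma_gcat K G X d)" "y \<in> GObj (Sigma_gcat K G X d)"
    show "?H x y \<in> graded_modules K G" using shifted_ring_graded[OF \<open>cring K\<close>] by (simp add: Sigma_gcat_def)
  next
    fix x assume "x \<in> GObj (Sigma_gcat K G X d)"
    then show "GIdt (Sigma_gcat K G X d) x \<in> carrier (?H x x 0)" using d0 subgroup_real_closed[OF G] by (auto simp: Sigma_gcat_def shifted_ring_def)
  next
    fix x y z a b r assume A: "a \<in> G" "b \<in> G" "r \<in> carrier (?H x y a)"
    then have ab: "a + b \<in> G" using subgroup_real_closed[OF G] by auto
    show "(\<lambda>s\<in>carrier (?H y z b). GCmp (Sigma_gcat K G X d) x y z b a s r) \<in> lin_maps K (?H y z b) (?H x z (a + b))"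
      using A ab cin[OF A] inK module.smult_closed 
      apply (auto simp: lin_maps_def cc ad)
         apply (auto simp: c_def K.l_distr car K.m_assoc split: if_splits)
      done
  next
    fix x y z a b s assume A: "a \<in> G" "b \<in> G" "s \<in> carrier (?H y z b)"
    then have ab: "a + b \<in> G" using subgroup_real_closed[OF G] by auto
    show "(\<lambda>r\<in>carrier (?H x y a). GCmp (Sigma_gcat K G X d) x y z b a s r) \<in> lin_maps K (?H x y a) (?H x z (a + b))"
      using A ab cin[OF A(1,2) _ A(3)] inK 
      apply (auto simp: lin_maps_def cc ad)
         apply (auto simp: c_def K.r_distr car K.m_lcomm split: if_splits)
      done
  next
    fix x y a r assume A: "x \<in> GObj (Sigma_gcat K G X d)" "y \<in> GObj (Sigma_gcat K G X d)" "a \<in> G" "r \<in> carrier (?H x y a)"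
    then show "GCmp (Sigma_gcat K G X d) x x y a 0 r (GIdt (Sigma_gcat K G X d) x) = r"
       "GCmp (Sigma_gcat K G X d) x y y 0 a (GIdt (Sigma_gcat K G X d) y) r = r"
      using inK[OF A(4,3)] d0 by (auto simp: Sigma_gcat_def between_def)
  next
    fix w x y z p q t r s u assume A: "w \<in> GObj (Sigma_gcat K G X d)" "x \<in> GObj (Sigma_gcat K G X d)" "y \<in> GObj (Sigma_gcat K G X d)" "z \<in> GObj (Sigma_gcat K G X d)"
      "p \<in> G" "q \<in> G" "t \<in> G"
      "r \<in> carrier (?H w x p)" "s \<in> carrier (?H x y q)" "u \<in> carrier (?H y z t)"
    have X: "w \<in> X" "x \<in> X" "y \<in> X" "z \<in> X" using A by (auto simp: Sigma_gcat_def)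
    have k: "r \<in> carrier K" "s \<in> carrier K" "u \<in> carrier K" using A inK by auto
    have "c w x z (c x y z u s) r = c w y z u (c w x y s r)"
    proof (cases "d w x < \<infinity> \<and> d x y < \<infinity> \<and> d y z < \<infinity>")
      case False
      then have "r = \<zero>\<^bsub>K\<^esub> \<or> s = \<zero>\<^bsub>K\<^esub> \<or> u = \<zero>\<^bsub>K\<^esub>" using A car by (auto split: if_splits)
      then show ?thesis using k by (auto simp: c_def)
    next
      case True
      have fin: "d w y < \<infinity>" "d x z < \<infinity>" "d w z < \<infinity>"
        using tri[of w x y] tri[of x y z] tri[of w x z] True X
        by (auto simp: less_top[symmetric] top_unique)
      have bt: "between d u v t \<longleftrightarrow> enn2real (d u v) + enn2real (d v t) = enn2real (d u t)"
        if "d u v < \<infinity>" "d v t < \<infinity>" "d u t < \<infinity>" for u v t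
        using that unfolding between_def
        by (metis add_fin enn2real_nonneg ennreal_enn2real ennreal_plus infinity_ennreal_def)
      have le: "enn2real (d u t) \<le> enn2real (d u v) + enn2real (d v t)"
        if "d u v < \<infinity>" "d v t < \<infinity>" "u \<in> X" "v \<in> X" "t \<in> X" for u v t
        using enn2real_mono[OF tri[OF that(3-5)]] that(1,2) by (simp add: add_fin)
      have "(between d w x z \<and> between d x y z) \<longleftrightarrow> (between d w y z \<and> between d w x y)"
        using le[of w x y] le[of x y z] le[of w x z] le[of w y z] True X fin by (auto simp: bt)
      then show ?thesis using k by (auto simp: c_def K.m_assoc)
    qed
    then show "GCmp (Sigma_gcat K G X d) w x z (q + t) p (GCmp (Sigma_gcat K G X d) x y z t q u s) r =
        GCmp (Sigma_gcat K G X d) w y z t (p + q) u (GCmp (Sigma_gcat K G X d) w x y q p s r)"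
      by (simp add: cc)
  qed
qed

lemma gcategory_cmp_closed:
  assumes "gcategory K G C" "x \<in> GObj C" "y \<in> GObj C" "z \<in> GObj C" "a \<in> G" "b \<in> G"
    and "r \<in> carrier (GHom C x y a)" "s \<in> carrier (GHom C y z b)"
  shows "GCmp C x y z b a s r \<in> carrier (GHom C x z (a + b))"
proof -
  have "(\<lambda>s\<in>carrier (GHom C y z b). GCmp C x y z b a s r) \<in>
      lin_maps K (GHom C y z b) (GHom C x z (a + b))"
    using assms unfolding gcategory_def by blast
  then show ?thesis
    using assms(8) by (auto simp: lin_maps_def PiE_iff)
qed

lemma pt_gcategory:
  assumes "cring K" and G: "subgroup G real_add_group"
  shows "gcategory K G (pt_gcat K G)"
proof -
  have "pt_gcat K G = Sigma_gcat K G UNIV (\<lambda>_ _. 0)"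
    by (simp add: pt_gcat_def Sigma_gcat_def between_def)
  moreover have "gcategory K G (Sigma_gcat K G (UNIV :: unit set) (\<lambda>_ _. 0))"
    by (rule Sigma_gcategory) (use assms subgroup_real_closed[OF G] in \<open>auto simp: quasimetric_def\<close>)
  ultimately show ?thesis by simp
qed

lemma augmentation_gftor:
  assumes "cring K" "quasimetric X d" and G: "subgroup G real_add_group"
    and dG: "\<And>x y. x \<in> X \<Longrightarrow> y \<in> X \<Longrightarrow> d x y < \<infinity> \<Longrightarrow> enn2real (d x y) \<in> G"
  shows "augmentation K G X d \<in> gftors K G (Sigma_gcat K G X d) (pt_gcat K G)"
proof -
  interpret K: cring K by fact
  have d0: "d x y = 0 \<longleftrightarrow> x = y" if "x \<in> X" "y\<in>X" for x y using assms that by (auto simp: quasimetric_def)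
  show ?thesis
    unfolding gftors_def mem_Collect_eq
  proof (intro conjI ballI allI)
    show "GFObj (augmentation K G X d) \<in> GObj (Sigma_gcat K G X d) \<rightarrow>\<^sub>E GObj (pt_gcat K G)"
      by (auto simp: augmentation_def Sigma_gcat_def pt_gcat_def)
  next
    fix x y
    show "if x \<in> GObj (Sigma_gcat K G X d) \<and> y \<in> GObj (Sigma_gcat K G X d)
          then GFHom (augmentation K G X d) x y \<in> deg_maps K G 0 (GHom (Sigma_gcat K G X d) x y) 
            (GHom (pt_gcat K G) (GFObj (augmentation K G X d) x) (GFObj (augmentation K G X d) y))
          else GFHom (augmentation K G X d) x y = undefined"
    proof (cases "x \<in> X \<and> y \<in> X")
      case True
      have "restrict (\<lambda>r. if x = y then r else \<zero>\<^bsub>K\<^esub>) (carrier (GHom (Sigma_gcat K G X d) x y g))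
          \<in> lin_maps K (GHom (Sigma_gcat K G X d) x y g) (shifted_ring K G 0 g)" if "g \<in> G" for g
      proof (cases "x = y")
        case e: True
        then have "d x y = 0" using True d0 by auto
        then show ?thesis
          using that e by (simp add: lin_maps_def Sigma_gcat_def shifted_ring_def)
      next
        case False
        then show ?thesis
          using that by (simp add: lin_maps_def Sigma_gcat_def shifted_ring_def zero_gmod_def)
      qed
      with True show ?thesis
        by (simp add: deg_maps_def augmentation_def pt_gcat_def) (simp add: Sigma_gcat_def)
    next
      case False
      then show ?thesis by (auto simp: augmentation_def Sigma_gcat_def)
    qed
  next
    fix x assume "x \<in> GObj (Sigma_gcat K G X d)"
    then show "GFHom (augmentation K G X d) x x 0 (GIdt (Sigma_gcat K G X d) x) = GIdt (pt_gcat K G) (GFObj (augmentation K G X d) x)"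
      using subgroup_real_closed(1)[OF G] d0[of x x] by (simp add: augmentation_def Sigma_gcat_def pt_gcat_def shifted_ring_def)
  next
    fix x y z a b r s
    assume A: "x \<in> GObj (Sigma_gcat K G X d)" "y \<in> GObj (Sigma_gcat K G X d)" "z \<in> GObj (Sigma_gcat K G X d)"
      "a \<in> G" "b \<in> G" "r \<in> carrier (GHom (Sigma_gcat K G X d) x y a)" "s \<in> carrier (GHom (Sigma_gcat K G X d) y z b)"
    then have X: "x \<in> X" "y \<in> X" "z \<in> X" by (auto simp: Sigma_gcat_def)
    have *: "GCmp (Sigma_gcat K G X d) x y z b a s r \<in> carrier (GHom (Sigma_gcat K G X d) x z (a + b))"
      using gcategory_cmp_closed[OF Sigma_gcategory[OF assms] A] .
    have k: "r \<in> carrier K" "s \<in> carrier K"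
      using A by (auto simp: Sigma_gcat_def shifted_ring_def zero_gmod_def split: if_splits)
    have ab: "a + b \<in> G" using subgroup_real_closed[OF G] A by auto
    have bt: "x = y \<and> y = z" if "between d x y z" "x = z" 
    proof -
      have "d x y + d y x = 0"
        using that d0[OF X(1) X(1)] by (simp add: between_def)
      then have "x = y"
        using d0[OF X(1,2)] by simp
      with that(2) show ?thesis by simp
    qed
    have aug: "GFHom (augmentation K G X d) u v g t = (if u = v then t else \<zero>\<^bsub>K\<^esub>)"
      if "u \<in> X" "v \<in> X" "g \<in> G" "t \<in> carrier (GHom (Sigma_gcat K G X d) u v g)" for u v g t
      using that by (simp add: augmentation_def)
    have cmp: "GCmp (Sigma_gcat K G X d) u v w b a s r = (if between d u v w then s \<otimes>\<^bsub>K\<^esub> r else \<zero>\<^bsub>K\<^esub>)"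
      for u v w
      by (simp add: Sigma_gcat_def)
    have bt': "between d x x x" using d0[OF X(1) X(1)] by (simp add: between_def)
    show "GFHom (augmentation K G X d) x z (a + b) (GCmp (Sigma_gcat K G X d) x y z b a s r) =
      GCmp (pt_gcat K G) (GFObj (augmentation K G X d) x) (GFObj (augmentation K G X d) y) (GFObj (augmentation K G X d) z) b a
        (GFHom (augmentation K G X d) y z b s) (GFHom (augmentation K G X d) x y a r)"
      unfolding aug[OF X(1,3) ab *] aug[OF X(2,3) A(5,7)] aug[OF X(1,2) A(4,6)]
      using k bt bt' by (auto simp: cmp pt_gcat_def)
  qed
qed


lemma inner_hom_graded:
  assumes "cring K" "A \<in> graded_modules K G" "B \<in> graded_modules K G" and G: "subgroup G real_add_group"
  shows "inner_hom K G A B \<in> graded_modules K G"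
proof -
  interpret K: cring K by fact
  have "Module.module K (inner_hom K G A B e)" if e: "e \<in> G" for e
  proof -
    have mA: "Module.module K (A g)" and mB: "Module.module K (B (g + e))" if "g \<in> G" for g
      using that e assms subgroup_real_closed[OF G] by (auto simp: graded_modules_def PiE_iff)
    note Bc = Module.module.smult_closed[OF mB] Module.module.smult_l_distr[OF mB]
      Module.module.smult_r_distr[OF mB] Module.module.smult_assoc1[OF mB] Module.module.smult_one[OF mB]
      Module.module.smult_closed[OF mA] Module.module.smult_r_null[OF mB] Module.module.smult_l_null[OF mB]
    have abA: "abelian_group (A g)" and abB: "abelian_group (B (g + e))" if "g \<in> G" for g
      using mA[OF that] mB[OF that] by (auto simp: Module.module_def)
    note Ba = abelian_monoid.a_closed[OF abelian_group.axioms(1)[OF abB]]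
       abelian_monoid.a_assoc[OF abelian_group.axioms(1)[OF abB]]
       abelian_monoid.a_comm[OF abelian_group.axioms(1)[OF abB]]
       abelian_monoid.a_lcomm[OF abelian_group.axioms(1)[OF abB]]
       abelian_monoid.zero_closed[OF abelian_group.axioms(1)[OF abB]]
       abelian_monoid.l_zero[OF abelian_group.axioms(1)[OF abB]]
       abelian_monoid.r_zero[OF abelian_group.axioms(1)[OF abB]]
       abelian_monoid.a_closed[OF abelian_group.axioms(1)[OF abA]]
    define D where "D = deg_maps K G e A B"
    have Din: "\<phi> g m \<in> carrier (B (g + e))" if "\<phi> \<in> D" "g \<in> G" "m \<in> carrier (A g)" for \<phi> g m
      using that by (auto simp: D_def deg_maps_def lin_maps_def PiE_iff)
    have Dadd: "\<phi> g (m \<oplus>\<^bsub>A g\<^esub> n) = \<phi> g m \<oplus>\<^bsub>B (g + e)\<^esub> \<phi> g n"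
      if "\<phi> \<in> D" "g \<in> G" "m \<in> carrier (A g)" "n \<in> carrier (A g)" for \<phi> g m n
      using that by (auto simp: D_def deg_maps_def lin_maps_def PiE_iff)
    have Dsm: "\<phi> g (a \<odot>\<^bsub>A g\<^esub> m) = a \<odot>\<^bsub>B (g + e)\<^esub> \<phi> g m"
      if "\<phi> \<in> D" "g \<in> G" "m \<in> carrier (A g)" "a \<in> carrier K" for \<phi> g m a
      using that by (auto simp: D_def deg_maps_def lin_maps_def PiE_iff)
    have Dext: "\<phi> = \<psi>" if "\<phi> \<in> D" "\<psi> \<in> D" "\<And>g m. g \<in> G \<Longrightarrow> m \<in> carrier (A g) \<Longrightarrow> \<phi> g m = \<psi> g m" for \<phi> \<psi>
    proof (rule PiE_ext)
      show "\<phi> \<in> (\<Pi>\<^sub>E g\<in>G. lin_maps K (A g) (B (g + e)))" "\<psi> \<in> (\<Pi>\<^sub>E g\<in>G. lin_maps K (A g) (B (g + e)))"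
        using that by (auto simp: D_def deg_maps_def)
      fix g assume g: "g \<in> G"
      show "\<phi> g = \<psi> g"
        by (rule PiE_ext[of _ "carrier (A g)" "\<lambda>_. carrier (B (g + e))"])
          (use that g in \<open>auto simp: D_def deg_maps_def lin_maps_def PiE_iff\<close>)
    qed
    have mkD: "(\<lambda>g\<in>G. \<lambda>m\<in>carrier (A g). f g m) \<in> D"
      if "\<And>g m. g \<in> G \<Longrightarrow> m \<in> carrier (A g) \<Longrightarrow> f g m \<in> carrier (B (g + e))"
         "\<And>g m n. g \<in> G \<Longrightarrow> m \<in> carrier (A g) \<Longrightarrow> n \<in> carrier (A g) \<Longrightarrow> f g (m \<oplus>\<^bsub>A g\<^esub> n) = f g m \<oplus>\<^bsub>B (g + e)\<^esub> f g n"
         "\<And>g m a. g \<in> G \<Longrightarrow> m \<in> carrier (A g) \<Longrightarrow> a \<in> carrier K \<Longrightarrow> f g (a \<odot>\<^bsub>A g\<^esub> m) = a \<odot>\<^bsub>B (g + e)\<^esub> f g m"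
       for f
      using that Bc(6) Ba(8) by (simp add: D_def deg_maps_def lin_maps_def)
    let ?I = "inner_hom K G A B e"
    have I: "carrier ?I = D" "\<zero>\<^bsub>?I\<^esub> = (\<lambda>g\<in>G. \<lambda>m\<in>carrier (A g). \<zero>\<^bsub>B (g + e)\<^esub>)"
      "\<phi> \<oplus>\<^bsub>?I\<^esub> \<psi> = (\<lambda>g\<in>G. \<lambda>m\<in>carrier (A g). \<phi> g m \<oplus>\<^bsub>B (g + e)\<^esub> \<psi> g m)"
      "a \<odot>\<^bsub>?I\<^esub> \<phi> = (\<lambda>g\<in>G. \<lambda>m\<in>carrier (A g). a \<odot>\<^bsub>B (g + e)\<^esub> \<phi> g m)" for \<phi> \<psi> a
      using e by (simp_all add: inner_hom_def D_def deg_zero_def)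
    have Ip: "(\<phi> \<oplus>\<^bsub>?I\<^esub> \<psi>) g m = \<phi> g m \<oplus>\<^bsub>B (g + e)\<^esub> \<psi> g m"
      "(a \<odot>\<^bsub>?I\<^esub> \<phi>) g m = a \<odot>\<^bsub>B (g + e)\<^esub> \<phi> g m" "\<zero>\<^bsub>?I\<^esub> g m = \<zero>\<^bsub>B (g + e)\<^esub>"
      if "g \<in> G" "m \<in> carrier (A g)" for \<phi> \<psi> a g m
      using that by (simp_all add: I)
    have cl: "\<phi> \<oplus>\<^bsub>?I\<^esub> \<psi> \<in> D" if "\<phi> \<in> D" "\<psi> \<in> D" for \<phi> \<psi>
      unfolding I by (rule mkD) (simp_all add: that Din Dadd Dsm Ba Bc)
    have cls: "a \<odot>\<^bsub>?I\<^esub> \<phi> \<in> D" if "\<phi> \<in> D" "a \<in> carrier K" for \<phi> a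
      unfolding I by (rule mkD) (simp_all add: that Din Dadd Dsm Ba Bc K.m_comm flip: Bc(4))
    have cl0: "\<zero>\<^bsub>?I\<^esub> \<in> D"
      unfolding I by (rule mkD) (simp_all add: Ba Bc)
    show ?thesis
    proof (rule moduleI[OF assms(1)])
      show "abelian_group ?I"
      proof (rule abelian_groupI)
        fix x assume x: "x \<in> carrier ?I"
        have "(\<ominus>\<^bsub>K\<^esub> \<one>\<^bsub>K\<^esub>) \<odot>\<^bsub>?I\<^esub> x \<oplus>\<^bsub>?I\<^esub> x = \<zero>\<^bsub>?I\<^esub>"
        proof (rule Dext)
          fix g m assume gm: "g \<in> G" "m \<in> carrier (A g)"
          have xg: "x g m \<in> carrier (B (g + e))" using x gm Din by (simp add: I)
          have "(\<ominus>\<^bsub>K\<^esub> \<one>\<^bsub>K\<^esub>) \<odot>\<^bsub>B (g + e)\<^esub> x g m \<oplus>\<^bsub>B (g + e)\<^esub> x g m = (\<ominus>\<^bsub>K\<^esub> \<one>\<^bsub>K\<^esub> \<oplus>\<^bsub>K\<^esub> \<one>\<^bsub>K\<^esub>) \<odot>\<^bsub>B (g + e)\<^esub> x g m"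
            using xg gm by (simp add: Bc(2) Bc(5))
          also have "\<dots> = \<zero>\<^bsub>B (g + e)\<^esub>" using xg gm by (simp add: K.l_neg Bc)
          finally show "((\<ominus>\<^bsub>K\<^esub> \<one>\<^bsub>K\<^esub>) \<odot>\<^bsub>?I\<^esub> x \<oplus>\<^bsub>?I\<^esub> x) g m = \<zero>\<^bsub>?I\<^esub> g m"
            using gm by (simp add: I)
        qed (use x cl cls cl0 in \<open>auto simp: I(1)\<close>)
        then show "\<exists>y\<in>carrier ?I. y \<oplus>\<^bsub>?I\<^esub> x = \<zero>\<^bsub>?I\<^esub>"
          using x cls by (auto simp: I(1))
      next
        fix x y z assume xyz: "x \<in> carrier ?I" "y \<in> carrier ?I" "z \<in> carrier ?I"
        show "x \<oplus>\<^bsub>?I\<^esub> y \<oplus>\<^bsub>?I\<^esub> z = x \<oplus>\<^bsub>?I\<^esub> (y \<oplus>\<^bsub>?I\<^esub> z)"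
          by (rule Dext) (use xyz cl in \<open>auto simp: I(1) Ip Din Ba\<close>)
      next
        fix x y assume xyz: "x \<in> carrier ?I" "y \<in> carrier ?I"
        show "x \<oplus>\<^bsub>?I\<^esub> y = y \<oplus>\<^bsub>?I\<^esub> x"
          by (rule Dext) (use xyz cl in \<open>auto simp: I(1) Ip Din Ba\<close>)
      next
        fix x assume xyz: "x \<in> carrier ?I"
        show "\<zero>\<^bsub>?I\<^esub> \<oplus>\<^bsub>?I\<^esub> x = x"
          by (rule Dext) (use xyz cl cl0 in \<open>auto simp: I(1) Ip Din Ba\<close>)
      qed (use cl cl0 I(1) in auto)
    next
      fix a b x assume as: "a \<in> carrier K" "b \<in> carrier K" "x \<in> carrier ?I"
      show "(a \<oplus>\<^bsub>K\<^esub> b) \<odot>\<^bsub>?I\<^esub> x = a \<odot>\<^bsub>?I\<^esub> x \<oplus>\<^bsub>?I\<^esub> b \<odot>\<^bsub>?I\<^esub> x"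
        by (rule Dext) (use as cl cls in \<open>auto simp: I(1) Ip Din Bc\<close>)
      show "(a \<otimes>\<^bsub>K\<^esub> b) \<odot>\<^bsub>?I\<^esub> x = a \<odot>\<^bsub>?I\<^esub> (b \<odot>\<^bsub>?I\<^esub> x)"
        by (rule Dext) (use as cl cls in \<open>auto simp: I(1) Ip Din Bc\<close>)
    next
      fix a x y assume as: "a \<in> carrier K" "x \<in> carrier ?I" "y \<in> carrier ?I"
      show "a \<odot>\<^bsub>?I\<^esub> (x \<oplus>\<^bsub>?I\<^esub> y) = a \<odot>\<^bsub>?I\<^esub> x \<oplus>\<^bsub>?I\<^esub> a \<odot>\<^bsub>?I\<^esub> y"
        by (rule Dext) (use as cl cls in \<open>auto simp: I(1) Ip Din Bc\<close>)
    next
      fix x assume as: "x \<in> carrier ?I"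
      show "\<one>\<^bsub>K\<^esub> \<odot>\<^bsub>?I\<^esub> x = x"
        by (rule Dext) (use as cl cls in \<open>auto simp: I(1) Ip Din Bc\<close>)
    qed (use cls I(1) in auto)
  qed
  then show ?thesis by (auto simp: graded_modules_def inner_hom_def)
qed

lemma GrMod_enr_gcategory:
  assumes "cring K" and G: "subgroup G real_add_group"
  shows "gcategory K G (GrMod_enr K G :: (('k, 'u) gmod, 'k, real \<Rightarrow> 'u \<Rightarrow> 'u) gcat)"
proof -
  note Gp = subgroup_real_closed[OF G]
  have hom: "carrier (inner_hom K G A B e) = deg_maps K G e A B"
    "\<phi> \<oplus>\<^bsub>inner_hom K G A B e\<^esub> \<psi> = (\<lambda>g\<in>G. \<lambda>m\<in>carrier (A g). \<phi> g m \<oplus>\<^bsub>B (g + e)\<^esub> \<psi> g m)"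
    "c \<odot>\<^bsub>inner_hom K G A B e\<^esub> \<phi> = (\<lambda>g\<in>G. \<lambda>m\<in>carrier (A g). c \<odot>\<^bsub>B (g + e)\<^esub> \<phi> g m)"
    if "e \<in> G" for A B :: "('k, 'u) gmod" and e \<phi> \<psi> c
    using that by (simp_all add: inner_hom_def)
  have val: "\<phi> g m \<in> carrier (B (g + e))"
    if "\<phi> \<in> deg_maps K G e A B" "g \<in> G" "m \<in> carrier (A g)"
    for A B :: "('k, 'u) gmod" and e \<phi> g m
    using that by (auto simp: deg_maps_def lin_maps_def PiE_iff)
  have lin: "n \<in> carrier (A g) \<Longrightarrow> \<phi> g (m \<oplus>\<^bsub>A g\<^esub> n) = \<phi> g m \<oplus>\<^bsub>B (g + e)\<^esub> \<phi> g n"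
    "c \<in> carrier K \<Longrightarrow> \<phi> g (c \<odot>\<^bsub>A g\<^esub> m) = c \<odot>\<^bsub>B (g + e)\<^esub> \<phi> g m"
    if "\<phi> \<in> deg_maps K G e A B" "g \<in> G" "m \<in> carrier (A g)"
    for A B :: "('k, 'u) gmod" and e \<phi> g m n c
    using that by (auto simp: deg_maps_def lin_maps_def PiE_iff)
  have rng: "(\<lambda>g\<in>G. \<lambda>m\<in>carrier (A g). \<phi> g m) = \<phi>" if "\<phi> \<in> deg_maps K G e A B"
    for A B :: "('k, 'u) gmod" and e \<phi>
  proof
    fix g
    show "(\<lambda>g\<in>G. \<lambda>m\<in>carrier (A g). \<phi> g m) g = \<phi> g"
    proof (cases "g \<in> G")
      case True
      then have "\<phi> g \<in> extensional (carrier (A g))"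
        using that by (auto simp: deg_maps_def lin_maps_def PiE_iff)
      with True show ?thesis
        by (simp add: extensional_restrict)
    next
      case False
      then show ?thesis
        using that by (auto simp: deg_maps_def PiE_iff extensional_def)
    qed
  qed
  have mod: "Module.module K (A g)" if "A \<in> graded_modules K G" "g \<in> G" for A :: "('k, 'u) gmod" and g
    using that by (auto simp: graded_modules_def PiE_iff)
  have acl: "n \<in> carrier (A g) \<Longrightarrow> m \<oplus>\<^bsub>A g\<^esub> n \<in> carrier (A g)" "c \<in> carrier K \<Longrightarrow> c \<odot>\<^bsub>A g\<^esub> m \<in> carrier (A g)"
    if "A \<in> graded_modules K G" "g \<in> G" "m \<in> carrier (A g)"
    for A :: "('k, 'u) gmod" and g m n c
    using mod[OF that(1,2)] that(3)
    by (auto intro: Module.module.smult_closed abelian_monoid.a_closed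
      abelian_group.axioms(1) simp: Module.module_def)
  have mod': "Module.module K (A g)" if "A \<in> graded_modules K G" "g \<in> G" for A :: "('k, real \<Rightarrow> 'u \<Rightarrow> 'u) gmod" and g
    using that by (auto simp: graded_modules_def PiE_iff)
  have acl': "n \<in> carrier (A g) \<Longrightarrow> m \<oplus>\<^bsub>A g\<^esub> n \<in> carrier (A g)" "c \<in> carrier K \<Longrightarrow> c \<odot>\<^bsub>A g\<^esub> m \<in> carrier (A g)"
    if "A \<in> graded_modules K G" "g \<in> G" "m \<in> carrier (A g)"
    for A :: "('k, real \<Rightarrow> 'u \<Rightarrow> 'u) gmod" and g m n c
    using mod'[OF that(1,2)] that(3)
    by (auto intro: Module.module.smult_closed abelian_monoid.a_closed
      abelian_group.axioms(1) simp: Module.module_def)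
  have cl: "deg_comp G A a \<psi> \<phi> \<in> deg_maps K G (a + b) A C"
    if "A \<in> graded_modules K G" "\<phi> \<in> deg_maps K G a A B" "\<psi> \<in> deg_maps K G b B C" "a \<in> G" "b \<in> G"
    for A B C :: "('k, 'u) gmod" and a b \<phi> \<psi>
  proof -
    note h = that
    have "(\<lambda>m\<in>carrier (A g). \<psi> (g + a) (\<phi> g m)) \<in> lin_maps K (A g) (C (g + (a + b)))" if g: "g \<in> G" for g
    proof -
      have ga: "g + a \<in> G" and e: "g + (a + b) = g + a + b" using Gp g \<open>a \<in> G\<close> by auto
      show ?thesis unfolding e lin_maps_def
        using acl[OF h(1) g] val[OF h(2) g] val[OF h(3) ga] lin[OF h(2) g] lin[OF h(3) ga]
        by auto
    qed
    then show ?thesis unfolding deg_comp_def deg_maps_def by auto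
  qed
  show ?thesis unfolding gcategory_def GrMod_enr_def gcat.simps
  proof (intro conjI ballI)
    fix A B :: "('k, 'u) gmod" assume "A \<in> graded_modules K G" "B \<in> graded_modules K G"
    then show "inner_hom K G A B \<in> graded_modules K G" using inner_hom_graded assms by blast
  next
    fix A :: "('k, 'u) gmod" assume "A \<in> graded_modules K G"
    then show "deg_id G A \<in> carrier (inner_hom K G A A 0)"
      using acl by (auto simp: hom Gp deg_id_def deg_maps_def lin_maps_def)
  next
    fix A B C :: "('k, 'u) gmod" and a b \<phi> assume *: "A \<in> graded_modules K G" "B \<in> graded_modules K G"
      "C \<in> graded_modules K G" "a \<in> G" "b \<in> G" "\<phi> \<in> carrier (inner_hom K G A B a)"
    then have ab: "a + b \<in> G" using Gp by auto
    have p: "\<phi> \<in> deg_maps K G a A B" using * hom by auto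
    show "(\<lambda>\<psi>\<in>carrier (inner_hom K G B C b). deg_comp G A a \<psi> \<phi>)
      \<in> lin_maps K (inner_hom K G B C b) (inner_hom K G A C (a + b))"
      using cl[OF *(1) p _ *(4,5)] acl'[OF inner_hom_graded[OF assms(1) *(2,3) G] *(5)] val[OF p] *(4,5) Gp
      unfolding lin_maps_def by (auto simp: hom ab deg_comp_def fun_eq_iff add.assoc)
  next
    fix A B C :: "('k, 'u) gmod" and a b \<psi> assume *: "A \<in> graded_modules K G" "B \<in> graded_modules K G"
      "C \<in> graded_modules K G" "a \<in> G" "b \<in> G" "\<psi> \<in> carrier (inner_hom K G B C b)"
    have ab: "a + b \<in> G" and p: "\<psi> \<in> deg_maps K G b B C" using * Gp hom by auto
    show "(\<lambda>\<phi>\<in>carrier (inner_hom K G A B a). deg_comp G A a \<psi> \<phi>)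
      \<in> lin_maps K (inner_hom K G A B a) (inner_hom K G A C (a + b))"
      using cl[OF *(1) _ p *(4,5)] acl'[OF inner_hom_graded[OF assms(1) *(1,2) G] *(4)] val[of _ a A B] lin[OF p] *(4,5) Gp
      unfolding lin_maps_def by (auto simp: hom ab deg_comp_def fun_eq_iff add.assoc)
  next
    fix A B :: "('k, 'u) gmod" and a \<phi> assume "A \<in> graded_modules K G" "B \<in> graded_modules K G" "a \<in> G"
      "\<phi> \<in> carrier (inner_hom K G A B a)"
    then have p: "\<phi> \<in> deg_maps K G a A B" using hom by auto
    show "deg_comp G A 0 \<phi> (deg_id G A) = \<phi>"
      unfolding deg_comp_def deg_id_def by (subst (2) rng[OF p, symmetric]) (auto simp: fun_eq_iff)
    show "deg_comp G A a (deg_id G B) \<phi> = \<phi>"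
      unfolding deg_comp_def deg_id_def using val[OF p] Gp(2) \<open>a \<in> G\<close>
      by (subst (2) rng[OF p, symmetric]) (auto simp: fun_eq_iff)
  next
    fix A B C D :: "('k, 'u) gmod" and a b c \<phi> \<psi> \<chi>
    assume *: "A \<in> graded_modules K G" "B \<in> graded_modules K G" "C \<in> graded_modules K G" "D \<in> graded_modules K G"
      "a \<in> G" "b \<in> G" "c \<in> G" "\<phi> \<in> carrier (inner_hom K G A B a)"
      "\<psi> \<in> carrier (inner_hom K G B C b)" "\<chi> \<in> carrier (inner_hom K G C D c)"
    then show "deg_comp G A a (deg_comp G B b \<chi> \<psi>) \<phi> = deg_comp G A (a + b) \<chi> (deg_comp G A a \<psi> \<phi>)"
      using val[of \<phi> a A B] Gp by (auto simp: hom deg_comp_def fun_eq_iff add.assoc)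
  qed
qed

end

theory Submission imports Defs "HOL-Algebra.Free_Abelian_Groups" begin

text \<open>
  An $\mathcal{A}$-functor $F$ on $\Sigma_{\mathbb{G}} X$ is determined by the images of the generators
  $(x,y)$ of the cyclic modules $(\Sigma_{\mathbb{G}} X)(x,y)$. These images are maps
  $F(x) \to F(y)$ of degree $d(x,y)$, and functoriality of $F$ is the composition rule of distance modules;
  this gives the isomorphism of categories, which carries Triv to $\varepsilon^*$.
  A map from a trivial module to $M$ lands in the elements killed by all actions, and a map from $M$ to a
  trivial module kills all images of actions, whence Coinv $\dashv$ Triv $\dashv$ Inv. Uniqueness of
  adjoints then identifies Inv and Coinv with every $\varepsilon_*$ and $\varepsilon_!$.

  Evaluation at a point $x$ and a degree $g$ has a left adjoint (induction) and a right adjoint (coinduction).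
  A direct sum of modules induced from projective $K$-modules is projective, a product of modules
  coinduced from injective ones is injective. Enough injective $K$-modules are obtained from a
  divisible hull of the additive group, a quotient of a rational vector space. All these modules are
  constructed on larger types first and then copied into the universe, which is possible because the universe
  has room for functions from the points, from the scalars and from the natural numbers.
\<close>

section \<open>Adjunctions\<close>

text \<open>Two constraints shape the development. All objects of one category have elements in a
  single type \<open>'u\<close>, whereas sums, products, quotients and sets of maps have other
  element types. Hence morphisms of distance modules may change the element type
  (\<open>dhom\<close>), and projectivity and injectivity over \<open>K\<close> are stated for
  modules of any type but tested only against modules over \<open>'u\<close>; only a finished object
  is copied. Conversely, an epimorphism can be cancelled only against objects over
  \<open>'u\<close>, so the cokernel that shows it to be surjective must itself be copied. Copying
  rests on coding finite sets and index elements by indicator functions, which needs two distinct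
  elements of \<open>'u\<close>. In a universe with one element all modules are zero, and that case
  is settled apart.

  Sums of induced and products of coinduced modules obey one rule: a step between points either
  keeps a component or kills it. The action law is then the same statement about four points on a
  geodesic, so both are instances of one construction.\<close>

lemma category_Idt: "category C \<Longrightarrow> A \<in> Obj C \<Longrightarrow> Idt C A \<in> Arr C A A"
  and category_Cmp: "\<lbrakk>category C; A \<in> Obj C; B \<in> Obj C; D \<in> Obj C; f \<in> Arr C A B; g \<in> Arr C B D\<rbrakk>
    \<Longrightarrow> Cmp C A B D g f \<in> Arr C A D"
  and category_idr: "\<lbrakk>category C; A \<in> Obj C; B \<in> Obj C; f \<in> Arr C A B\<rbrakk> \<Longrightarrow> Cmp C A A B f (Idt C A) = f"
  and category_idl: "\<lbrakk>category C; A \<in> Obj C; B \<in> Obj C; f \<in> Arr C A B\<rbrakk> \<Longrightarrow> Cmp C A B B (Idt C B) f = f"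
  and category_assoc: "\<lbrakk>category C; A \<in> Obj C; B \<in> Obj C; D \<in> Obj C; E \<in> Obj C;
    f \<in> Arr C A B; g \<in> Arr C B D; h \<in> Arr C D E\<rbrakk> \<Longrightarrow>
    Cmp C A B E (Cmp C B D E h g) f = Cmp C A D E h (Cmp C A B D g f)"
  unfolding category_def by blast+

lemmas category_simps = category_Idt category_Cmp category_idr category_idl

lemma ftor_between_cat: "ftor_between C D F \<Longrightarrow> category C" "ftor_between C D F \<Longrightarrow> category D"
  and ftor_between_Obj: "ftor_between C D F \<Longrightarrow> A \<in> Obj C \<Longrightarrow> FObj F A \<in> Obj D"
  and ftor_between_Arr: "\<lbrakk>ftor_between C D F; A \<in> Obj C; B \<in> Obj C; f \<in> Arr C A B\<rbrakk>
    \<Longrightarrow> FArr F A B f \<in> Arr D (FObj F A) (FObj F B)"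
  and ftor_between_Idt: "ftor_between C D F \<Longrightarrow> A \<in> Obj C \<Longrightarrow> FArr F A A (Idt C A) = Idt D (FObj F A)"
  and ftor_between_Cmp: "\<lbrakk>ftor_between C D F; A \<in> Obj C; B \<in> Obj C; E \<in> Obj C; f \<in> Arr C A B; g \<in> Arr C B E\<rbrakk>
    \<Longrightarrow> FArr F A E (Cmp C A B E g f) =
        Cmp D (FObj F A) (FObj F B) (FObj F E) (FArr F B E g) (FArr F A B f)"
  unfolding ftor_between_def by blast+

lemmas ftor_simps = ftor_between_Obj ftor_between_Arr ftor_between_Idt

lemma ftor_comp_simps [simp]:
  "FObj (ftor_comp H F) A = FObj H (FObj F A)"
  "FArr (ftor_comp H F) A B f = FArr H (FObj F A) (FObj F B) (FArr F A B f)"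
  by (simp_all add: ftor_comp_def)

lemma ftor_between_comp:
  assumes F: "ftor_between C D F" and H: "ftor_between D E H"
  shows "ftor_between C E (ftor_comp H F)"
  using ftor_between_cat[OF F] ftor_between_cat[OF H]
  unfolding ftor_between_def[of C E]
  by (auto simp: ftor_simps[OF F] ftor_simps[OF H] ftor_between_Cmp[OF F] ftor_between_Cmp[OF H])

text \<open>Functors are records of total functions, and two descriptions of the same functor need
  agree only on the objects and arrows of the source category.\<close>

lemma ftor_between_cong:
  assumes F: "ftor_between C D F" and eq: "ftor_eq C F H"
  shows "ftor_between C D H"
proof -
  note e = eq[unfolded ftor_eq_def]
  have 1: "FObj H A = FObj F A" if "A \<in> Obj C" for A using e that by auto
  have 2: "FArr H A B f = FArr F A B f" if "A \<in> Obj C" "B \<in> Obj C" "f \<in> Arr C A B" for A B f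
    using e that by auto
  show ?thesis
    using ftor_between_cat[OF F]
    unfolding ftor_between_def
    by (auto simp: 1 2 ftor_simps[OF F] ftor_between_Cmp[OF F] category_simps)
qed

text \<open>Naturality is split into one law for each variable, and the transposition
  \<open>\<theta>\<close> becomes a parameter so that proofs can name it.\<close>

definition adjoint_bij ::
  "('o, 'a) cat \<Rightarrow> ('p, 'b) cat \<Rightarrow> ('o, 'a, 'p, 'b) ftor \<Rightarrow> ('p, 'b, 'o, 'a) ftor \<Rightarrow>
   ('o \<Rightarrow> 'p \<Rightarrow> 'b \<Rightarrow> 'a) \<Rightarrow> bool" where
  "adjoint_bij C D F H \<theta> \<longleftrightarrow> ftor_between C D F \<and> ftor_between D C H \<and>
     (\<forall>A\<in>Obj C. \<forall>B\<in>Obj D. bij_betw (\<theta> A B) (Arr D (FObj F A) B) (Arr C A (FObj H B))) \<and>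
     (\<forall>A'\<in>Obj C. \<forall>A\<in>Obj C. \<forall>B\<in>Obj D. \<forall>f\<in>Arr C A' A. \<forall>u\<in>Arr D (FObj F A) B.
        \<theta> A' B (Cmp D (FObj F A') (FObj F A) B u (FArr F A' A f)) = Cmp C A' A (FObj H B) (\<theta> A B u) f) \<and>
     (\<forall>A\<in>Obj C. \<forall>B\<in>Obj D. \<forall>B'\<in>Obj D. \<forall>u\<in>Arr D (FObj F A) B. \<forall>g\<in>Arr D B B'.
        \<theta> A B' (Cmp D (FObj F A) B B' g u) = Cmp C A (FObj H B) (FObj H B') (FArr H B B' g) (\<theta> A B u))"

lemma adjoint_bijD:
  assumes "adjoint_bij C D F H \<theta>"
  shows "ftor_between C D F" "ftor_between D C H"
    and "\<And>A B. A \<in> Obj C \<Longrightarrow> B \<in> Obj D \<Longrightarrow> bij_betw (\<theta> A B) (Arr D (FObj F A) B) (Arr C A (FObj H B))"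
    and "\<And>A' A B f u. \<lbrakk>A' \<in> Obj C; A \<in> Obj C; B \<in> Obj D; f \<in> Arr C A' A; u \<in> Arr D (FObj F A) B\<rbrakk>
       \<Longrightarrow> \<theta> A' B (Cmp D (FObj F A') (FObj F A) B u (FArr F A' A f)) = Cmp C A' A (FObj H B) (\<theta> A B u) f"
    and "\<And>A B B' g u. \<lbrakk>A \<in> Obj C; B \<in> Obj D; B' \<in> Obj D; u \<in> Arr D (FObj F A) B; g \<in> Arr D B B'\<rbrakk>
       \<Longrightarrow> \<theta> A B' (Cmp D (FObj F A) B B' g u) = Cmp C A (FObj H B) (FObj H B') (FArr H B B' g) (\<theta> A B u)"
  using assms unfolding adjoint_bij_def by blast+

lemma adjunction_iff_adjoint_bij: "adjunction C D F H \<longleftrightarrow> (\<exists>\<theta>. adjoint_bij C D F H \<theta>)"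
proof
  assume "adjunction C D F H"
  then obtain \<theta> where F: "ftor_between C D F" and H: "ftor_between D C H"
    and bij: "\<And>A B. A \<in> Obj C \<Longrightarrow> B \<in> Obj D \<Longrightarrow> bij_betw (\<theta> A B) (Arr D (FObj F A) B) (Arr C A (FObj H B))"
    and nat: "\<And>A' A B B' f u g. \<lbrakk>A' \<in> Obj C; A \<in> Obj C; B \<in> Obj D; B' \<in> Obj D; f \<in> Arr C A' A;
        u \<in> Arr D (FObj F A) B; g \<in> Arr D B B'\<rbrakk> \<Longrightarrow>
        \<theta> A' B' (Cmp D (FObj F A') B B' g (Cmp D (FObj F A') (FObj F A) B u (FArr F A' A f))) =
        Cmp C A' (FObj H B) (FObj H B') (FArr H B B' g) (Cmp C A' A (FObj H B) (\<theta> A B u) f)"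
    unfolding adjunction_def by blast
  note C = ftor_between_cat(1)[OF F] and D = ftor_between_cat(2)[OF F]
  have th: "\<theta> A B u \<in> Arr C A (FObj H B)" if "A \<in> Obj C" "B \<in> Obj D" "u \<in> Arr D (FObj F A) B" for A B u
    using bij_betwE[OF bij] that by blast
  \<comment> \<open>Joint naturality with an identity arrow in the other slot; functors preserve
    that identity.\<close>
  have natl: "\<theta> A' B (Cmp D (FObj F A') (FObj F A) B u (FArr F A' A f)) = Cmp C A' A (FObj H B) (\<theta> A B u) f"
    if *: "A' \<in> Obj C" "A \<in> Obj C" "B \<in> Obj D" "f \<in> Arr C A' A" "u \<in> Arr D (FObj F A) B" for A' A B f u
    using nat[OF *(1-3,3-5) category_Idt[OF D *(3)]] *
    by (simp add: ftor_simps[OF F] ftor_simps[OF H] category_simps[OF C] category_simps[OF D] th)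
  have natr: "\<theta> A B' (Cmp D (FObj F A) B B' g u) = Cmp C A (FObj H B) (FObj H B') (FArr H B B' g) (\<theta> A B u)"
    if *: "A \<in> Obj C" "B \<in> Obj D" "B' \<in> Obj D" "u \<in> Arr D (FObj F A) B" "g \<in> Arr D B B'" for A B B' g u
    using nat[OF *(1,1-3) category_Idt[OF C *(1)] *(4,5)] *
    by (simp add: ftor_simps[OF F] ftor_simps[OF H] category_simps[OF C] category_simps[OF D] th)
  show "\<exists>\<theta>. adjoint_bij C D F H \<theta>"
    unfolding adjoint_bij_def
    by (intro exI[of _ \<theta>] conjI ballI) (simp_all only: F H bij natl natr)
next
  assume "\<exists>\<theta>. adjoint_bij C D F H \<theta>"
  then obtain \<theta> where a: "adjoint_bij C D F H \<theta>" ..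
  note F = adjoint_bijD(1)[OF a]
  have "\<theta> A' B' (Cmp D (FObj F A') B B' g (Cmp D (FObj F A') (FObj F A) B u (FArr F A' A f))) =
        Cmp C A' (FObj H B) (FObj H B') (FArr H B B' g) (Cmp C A' A (FObj H B) (\<theta> A B u) f)"
    if "A' \<in> Obj C" "A \<in> Obj C" "B \<in> Obj D" "B' \<in> Obj D" "f \<in> Arr C A' A"
        "u \<in> Arr D (FObj F A) B" "g \<in> Arr D B B'" for A' A B B' f u g
    by (subst adjoint_bijD(5)[OF a])
      (simp_all add: adjoint_bijD(4)[OF a] that category_simps[OF ftor_between_cat(2)[OF F]] ftor_simps[OF F])
  then show "adjunction C D F H"
    unfolding adjunction_def
    by (intro conjI exI[of _ \<theta>] ballI) (simp_all add: adjoint_bijD(1-3)[OF a])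
qed

lemma adjunctionI:
  assumes F: "ftor_between C D F" and H: "ftor_between D C H"
    and bij: "\<And>A B. A \<in> Obj C \<Longrightarrow> B \<in> Obj D \<Longrightarrow> bij_betw (\<theta> A B) (Arr D (FObj F A) B) (Arr C A (FObj H B))"
    and natl: "\<And>A' A B f u. \<lbrakk>A' \<in> Obj C; A \<in> Obj C; B \<in> Obj D; f \<in> Arr C A' A; u \<in> Arr D (FObj F A) B\<rbrakk>
       \<Longrightarrow> \<theta> A' B (Cmp D (FObj F A') (FObj F A) B u (FArr F A' A f)) = Cmp C A' A (FObj H B) (\<theta> A B u) f"
    and natr: "\<And>A B B' g u. \<lbrakk>A \<in> Obj C; B \<in> Obj D; B' \<in> Obj D; u \<in> Arr D (FObj F A) B; g \<in> Arr D B B'\<rbrakk>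
       \<Longrightarrow> \<theta> A B' (Cmp D (FObj F A) B B' g u) = Cmp C A (FObj H B) (FObj H B') (FArr H B B' g) (\<theta> A B u)"
  shows "adjunction C D F H"
  unfolding adjunction_iff_adjoint_bij adjoint_bij_def
  by (intro exI[of _ \<theta>] conjI ballI) (simp_all only: assms)

text \<open>An arrow is transposed first along the second adjunction and then along the
  first.\<close>

lemma adjunction_comp:
  assumes "adjunction C D F H" "adjunction D E F' H'"
  shows "adjunction C E (ftor_comp F' F) (ftor_comp H H')"
proof -
  obtain \<theta> where a': "adjoint_bij C D F H \<theta>"
    using assms(1) unfolding adjunction_iff_adjoint_bij by blast
  note a = adjoint_bijD[OF a']
  obtain \<theta>' where b': "adjoint_bij D E F' H' \<theta>'"
    using assms(2) unfolding adjunction_iff_adjoint_bij by blast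
  note b = adjoint_bijD[OF b']
  note th' = bij_betwE[OF b(3), rule_format]
  show ?thesis
  proof (rule adjunctionI[where \<theta>="\<lambda>A B. \<theta> A (FObj H' B) \<circ> \<theta>' (FObj F A) B"])
    fix A B assume "A \<in> Obj C" "B \<in> Obj E"
    then show "bij_betw (\<theta> A (FObj H' B) \<circ> \<theta>' (FObj F A) B) (Arr E (FObj (ftor_comp F' F) A) B)
      (Arr C A (FObj (ftor_comp H H') B))"
      using a(3)[of A "FObj H' B"] b(3)[of "FObj F A" B]
      by (auto intro: bij_betw_trans simp: ftor_simps[OF a(1)] ftor_simps[OF b(2)])
  next
    fix A' A B f u
    assume "A' \<in> Obj C" "A \<in> Obj C" "B \<in> Obj E" "f \<in> Arr C A' A" "u \<in> Arr E (FObj (ftor_comp F' F) A) B"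
    then show "(\<theta> A' (FObj H' B) \<circ> \<theta>' (FObj F A') B)
        (Cmp E (FObj (ftor_comp F' F) A') (FObj (ftor_comp F' F) A) B u (FArr (ftor_comp F' F) A' A f)) =
      Cmp C A' A (FObj (ftor_comp H H') B) ((\<theta> A (FObj H' B) \<circ> \<theta>' (FObj F A) B) u) f"
      by (simp add: a(4) b(4) ftor_simps[OF a(1)] ftor_simps[OF b(2)] th')
  qed (simp_all add: ftor_between_comp[OF a(1) b(1)] ftor_between_comp[OF b(2) a(2)]
        a(5) b(5) ftor_simps[OF a(1)] ftor_simps[OF b(2)] th')
qed

lemma adjunction_cong:
  assumes "adjunction C D F H" "ftor_eq C F F'" "ftor_eq D H H'"
  shows "adjunction C D F' H'"
proof -
  obtain \<theta> where a': "adjoint_bij C D F H \<theta>"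
    using assms(1) unfolding adjunction_iff_adjoint_bij by blast
  note a = adjoint_bijD[OF a']
  have F: "FObj F' A = FObj F A" if "A \<in> Obj C" for A using assms(2) that by (auto simp: ftor_eq_def)
  have Fa: "FArr F' A B f = FArr F A B f" if "A \<in> Obj C" "B \<in> Obj C" "f \<in> Arr C A B" for A B f
    using assms(2) that by (auto simp: ftor_eq_def)
  have H: "FObj H' A = FObj H A" if "A \<in> Obj D" for A using assms(3) that by (auto simp: ftor_eq_def)
  have Ha: "FArr H' A B f = FArr H A B f" if "A \<in> Obj D" "B \<in> Obj D" "f \<in> Arr D A B" for A B f
    using assms(3) that by (auto simp: ftor_eq_def)
  show ?thesis
    by (rule adjunctionI[where \<theta>=\<theta>])
      (use a in \<open>simp_all add: F Fa H Ha ftor_between_cong[OF _ assms(2)] ftor_between_cong[OF _ assms(3)]\<close>)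
qed

lemma ftor_eq_refl: "ftor_eq C F F"
  by (simp add: ftor_eq_def)

text \<open>Both counits are universal arrows from the same functor \<open>F\<close>, so each
  factors through the other, and the two factorisations are mutually inverse.\<close>

lemma adjunction_right_unique:
  assumes "adjunction C D F H" "adjunction C D F H'"
  shows "nat_isomorphic D C H H'"
proof -
  obtain \<theta> where a': "adjoint_bij C D F H \<theta>"
    using assms(1) unfolding adjunction_iff_adjoint_bij by blast
  note a = adjoint_bijD[OF a']
  obtain \<theta>' where b': "adjoint_bij C D F H' \<theta>'"
    using assms(2) unfolding adjunction_iff_adjoint_bij by blast
  note b = adjoint_bijD[OF b']
  note C = category_simps[OF ftor_between_cat(1)[OF a(1)]]
    and D = category_simps[OF ftor_between_cat(2)[OF a(1)]]
  note obj = ftor_between_Obj[OF a(1)] ftor_between_Obj[OF a(2)] ftor_between_Obj[OF b(2)]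
  have th: "\<theta> A B u \<in> Arr C A (FObj H B)" "\<theta>' A B u \<in> Arr C A (FObj H' B)"
    if "A \<in> Obj C" "B \<in> Obj D" "u \<in> Arr D (FObj F A) B" for A B u
    using bij_betwE[OF a(3)] bij_betwE[OF b(3)] that by blast+
  \<comment> \<open>\<open>u\<close> and \<open>u'\<close> are the two counits: the preimages of
    identities under transposition.\<close>
  define u where "u B = inv_into (Arr D (FObj F (FObj H B)) B) (\<theta> (FObj H B) B) (Idt C (FObj H B))" for B
  define u' where "u' B = inv_into (Arr D (FObj F (FObj H' B)) B) (\<theta>' (FObj H' B) B) (Idt C (FObj H' B))" for B
  have u: "u B \<in> Arr D (FObj F (FObj H B)) B" "\<theta> (FObj H B) B (u B) = Idt C (FObj H B)" if "B \<in> Obj D" for B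
    using bij_betw_imp_surj_on[OF a(3)[OF obj(2)[OF that] that]] C(1)[OF obj(2)[OF that]]
    unfolding u_def by (auto intro: inv_into_into f_inv_into_f)
  have u': "u' B \<in> Arr D (FObj F (FObj H' B)) B" "\<theta>' (FObj H' B) B (u' B) = Idt C (FObj H' B)" if "B \<in> Obj D" for B
    using bij_betw_imp_surj_on[OF b(3)[OF obj(3)[OF that] that]] C(1)[OF obj(3)[OF that]]
    unfolding u'_def by (auto intro: inv_into_into f_inv_into_f)
  \<comment> \<open>Every arrow out of \<open>F A\<close> is the counit after \<open>F\<close> of
    its transpose; injectivity of \<open>\<theta>\<close> reduces this to naturality in
    \<open>A\<close>.\<close>
  have rep: "v = Cmp D (FObj F A) (FObj F (FObj H B)) B (u B) (FArr F A (FObj H B) (\<theta> A B v))"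
    if "A \<in> Obj C" "B \<in> Obj D" "v \<in> Arr D (FObj F A) B" for A B v
  proof (rule inj_onD[OF bij_betw_imp_inj_on[OF a(3)[OF that(1,2)]]])
    show "\<theta> A B v = \<theta> A B (Cmp D (FObj F A) (FObj F (FObj H B)) B (u B) (FArr F A (FObj H B) (\<theta> A B v)))"
      using that by (simp add: a(4) th obj u C)
  qed (use that in \<open>simp_all add: D th obj u ftor_simps[OF a(1)]\<close>)
  have rep': "v = Cmp D (FObj F A) (FObj F (FObj H' B)) B (u' B) (FArr F A (FObj H' B) (\<theta>' A B v))"
    if "A \<in> Obj C" "B \<in> Obj D" "v \<in> Arr D (FObj F A) B" for A B v
  proof (rule inj_onD[OF bij_betw_imp_inj_on[OF b(3)[OF that(1,2)]]])
    show "\<theta>' A B v = \<theta>' A B (Cmp D (FObj F A) (FObj F (FObj H' B)) B (u' B) (FArr F A (FObj H' B) (\<theta>' A B v)))"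
      using that by (simp add: b(4) th obj u' C)
  qed (use that in \<open>simp_all add: D th obj u' ftor_simps[OF a(1)]\<close>)
  \<comment> \<open>Each comparison map transposes the counit of one adjunction along the other
    adjunction.\<close>
  define \<tau> where "\<tau> B = \<theta>' (FObj H B) B (u B)" for B
  define \<sigma> where "\<sigma> B = \<theta> (FObj H' B) B (u' B)" for B
  have "iso_arr C (FObj H B) (FObj H' B) (\<tau> B)" if B: "B \<in> Obj D" for B
    unfolding iso_arr_def
  proof (intro conjI bexI)
    show "Cmp C (FObj H B) (FObj H' B) (FObj H B) (\<sigma> B) (\<tau> B) = Idt C (FObj H B)"
      using rep'[OF obj(2)[OF B] B u(1)[OF B]]
      by (simp add: \<sigma>_def \<tau>_def a(4)[symmetric] th B obj u u')
    show "Cmp C (FObj H' B) (FObj H B) (FObj H' B) (\<tau> B) (\<sigma> B) = Idt C (FObj H' B)"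
      using rep[OF obj(3)[OF B] B u'(1)[OF B]]
      by (simp add: \<sigma>_def \<tau>_def b(4)[symmetric] th B obj u u')
  qed (simp_all add: \<sigma>_def \<tau>_def th obj u u' B)
  moreover have "Cmp C (FObj H A) (FObj H B) (FObj H' B) (\<tau> B) (FArr H A B f) =
           Cmp C (FObj H A) (FObj H' A) (FObj H' B) (FArr H' A B f) (\<tau> A)"
    if A: "A \<in> Obj D" and B: "B \<in> Obj D" and f: "f \<in> Arr D A B" for A B f
  proof -
    have "Cmp C (FObj H A) (FObj H B) (FObj H' B) (\<tau> B) (FArr H A B f)
      = \<theta>' (FObj H A) B (Cmp D (FObj F (FObj H A)) (FObj F (FObj H B)) B (u B) (FArr F (FObj H A) (FObj H B) (FArr H A B f)))"
      by (simp add: \<tau>_def b(4) A B f obj u ftor_simps[OF a(2)])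
    also have "\<dots> = \<theta>' (FObj H A) B (Cmp D (FObj F (FObj H A)) A B f (u A))"
    proof -
      have "FArr H A B f = \<theta> (FObj H A) B (Cmp D (FObj F (FObj H A)) A B f (u A))"
        by (simp add: a(5) A B f obj u C ftor_simps[OF a(2)])
      then show ?thesis
        using rep[of "FObj H A" B "Cmp D (FObj F (FObj H A)) A B f (u A)"] by (simp add: A B f obj u D)
    qed
    also have "\<dots> = Cmp C (FObj H A) (FObj H' A) (FObj H' B) (FArr H' A B f) (\<tau> A)"
      by (simp add: \<tau>_def b(5) A B f obj u)
    finally show ?thesis .
  qed
  ultimately show ?thesis
    using a(2) b(2) unfolding nat_isomorphic_def by blast
qed

section \<open>Duality: left adjoints from right adjoints\<close>

definition op_cat :: "('o, 'a) cat \<Rightarrow> ('o, 'a) cat" where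
  "op_cat C = \<lparr>Obj = Obj C, Arr = (\<lambda>A B. Arr C B A), Idt = Idt C, Cmp = (\<lambda>A B D g f. Cmp C D B A f g)\<rparr>"

definition op_ftor :: "('o, 'a, 'p, 'b) ftor \<Rightarrow> ('o, 'a, 'p, 'b) ftor" where
  "op_ftor F = \<lparr>FObj = FObj F, FArr = (\<lambda>A B. FArr F B A)\<rparr>"

lemma op_simps [simp]:
  "Obj (op_cat C) = Obj C" "Arr (op_cat C) A B = Arr C B A" "Idt (op_cat C) = Idt C"
  "Cmp (op_cat C) A B D g f = Cmp C D B A f g" "op_cat (op_cat C) = C"
  "FObj (op_ftor F) = FObj F" "FArr (op_ftor F) A B = FArr F B A" "op_ftor (op_ftor F) = F"
  by (simp_all add: op_cat_def op_ftor_def)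

lemma category_op:
  assumes C: "category C"
  shows "category (op_cat C)"
  unfolding category_def by (simp add: category_simps[OF C] category_assoc[OF C])

lemma ftor_between_op:
  assumes F: "ftor_between C D F"
  shows "ftor_between (op_cat C) (op_cat D) (op_ftor F)"
  unfolding ftor_between_def
  by (simp add: category_op ftor_between_cat[OF F] ftor_simps[OF F] ftor_between_Cmp[OF F])

text \<open>The inverse transposition exhibits the former right adjoint as a left adjoint between
  the opposite categories.\<close>

lemma adjunction_op:
  assumes "adjunction C D F H"
  shows "adjunction (op_cat D) (op_cat C) (op_ftor H) (op_ftor F)"
proof -
  obtain \<theta> where a': "adjoint_bij C D F H \<theta>"
    using assms(1) unfolding adjunction_iff_adjoint_bij by blast
  note a = adjoint_bijD[OF a']
  note C = category_simps[OF ftor_between_cat(1)[OF a(1)]]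
    and D = category_simps[OF ftor_between_cat(2)[OF a(1)]]
  define \<kappa> where "\<kappa> B A = inv_into (Arr D (FObj F A) B) (\<theta> A B)" for A B
  have \<kappa>: "\<kappa> B A v \<in> Arr D (FObj F A) B" "\<theta> A B (\<kappa> B A v) = v"
    if "A \<in> Obj C" "B \<in> Obj D" "v \<in> Arr C A (FObj H B)" for A B v
    using bij_betw_imp_surj_on[OF a(3)[OF that(1,2)]] that
    unfolding \<kappa>_def by (auto intro: inv_into_into f_inv_into_f)
  have eq: "\<kappa> B A v = w" if "A \<in> Obj C" "B \<in> Obj D" "w \<in> Arr D (FObj F A) B" "\<theta> A B w = v" for A B v w
    using inv_into_f_f[OF bij_betw_imp_inj_on[OF a(3)[OF that(1,2)]] that(3)] that(4)
    unfolding \<kappa>_def by simp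
  show ?thesis
  proof (rule adjunctionI[where \<theta>=\<kappa>])
    fix A B assume "A \<in> Obj (op_cat D)" "B \<in> Obj (op_cat C)"
    then show "bij_betw (\<kappa> A B) (Arr (op_cat C) (FObj (op_ftor H) A) B) (Arr (op_cat D) A (FObj (op_ftor F) B))"
      unfolding \<kappa>_def using bij_betw_inv_into[OF a(3)] by simp
  next
    fix A B B' g u
    assume "A \<in> Obj (op_cat D)" "B \<in> Obj (op_cat C)" "B' \<in> Obj (op_cat C)"
      "u \<in> Arr (op_cat C) (FObj (op_ftor H) A) B" "g \<in> Arr (op_cat C) B B'"
    then show "\<kappa> A B' (Cmp (op_cat C) (FObj (op_ftor H) A) B B' g u) =
      Cmp (op_cat D) A (FObj (op_ftor F) B) (FObj (op_ftor F) B') (FArr (op_ftor F) B B' g) (\<kappa> A B u)"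
      by (auto intro!: eq simp: a(4) \<kappa> C D ftor_simps[OF a(1)] ftor_simps[OF a(2)])
  qed (auto intro!: eq simp: ftor_between_op a(1,2,5) \<kappa> C D ftor_simps[OF a(1)] ftor_simps[OF a(2)])
qed

text \<open>The components stay the same arrows but change direction, which is why \<open>F\<close>
  and \<open>H\<close> change places in the conclusion.\<close>

lemma nat_isomorphic_op:
  assumes nat: "nat_isomorphic (op_cat C) (op_cat D) (op_ftor F) (op_ftor H)"
  shows "nat_isomorphic C D H F"
proof -
  obtain \<tau> where \<tau>: "\<And>A. A \<in> Obj C \<Longrightarrow> iso_arr (op_cat D) (FObj F A) (FObj H A) (\<tau> A)"
    and sq: "\<And>A B f. \<lbrakk>A \<in> Obj C; B \<in> Obj C; f \<in> Arr C B A\<rbrakk> \<Longrightarrow>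
           Cmp D (FObj H B) (FObj F B) (FObj F A) (FArr F B A f) (\<tau> B) =
           Cmp D (FObj H B) (FObj H A) (FObj F A) (\<tau> A) (FArr H B A f)"
    using nat unfolding nat_isomorphic_def op_simps by blast
  have "ftor_between C D F" "ftor_between C D H"
    using nat ftor_between_op[of "op_cat C" "op_cat D" "op_ftor F"]
      ftor_between_op[of "op_cat C" "op_cat D" "op_ftor H"]
    unfolding nat_isomorphic_def by simp_all
  moreover have "iso_arr D (FObj H A) (FObj F A) (\<tau> A)" if "A \<in> Obj C" for A
    using \<tau>[OF that] by (auto simp: iso_arr_def)
  ultimately show ?thesis
    unfolding nat_isomorphic_def using sq by metis
qed

text \<open>Dual of the uniqueness of right adjoints. The two adjunctions are used in exchanged
  order because passing to opposite categories reverses the comparison.\<close>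

lemma adjunction_left_unique:
  assumes "adjunction C D F H" "adjunction C D F' H"
  shows "nat_isomorphic C D F F'"
  by (rule nat_isomorphic_op, rule adjunction_right_unique[OF adjunction_op[OF assms(2)] adjunction_op[OF assms(1)]])

text \<open>Transposition is application of \<open>H\<close>, since \<open>H (F A) = A\<close> holds
  as an equality of objects. Stating an isomorphism as an adjunction lets other adjunctions be
  composed with it.\<close>

lemma isomorphism_adjunction:
  assumes F: "ftor_between C D F" and H: "ftor_between D C H"
    and HF: "ftor_eq C (ftor_comp H F) ftor_id" and FH: "ftor_eq D (ftor_comp F H) ftor_id"
  shows "adjunction C D F H"
proof -
  have o: "FObj H (FObj F A) = A" if "A \<in> Obj C" for A
    using HF that by (auto simp: ftor_eq_def ftor_id_def)
  have o': "FObj F (FObj H A) = A" if "A \<in> Obj D" for A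
    using FH that by (auto simp: ftor_eq_def ftor_id_def)
  have r: "FArr H (FObj F A) (FObj F B) (FArr F A B f) = f" if "A \<in> Obj C" "B \<in> Obj C" "f \<in> Arr C A B" for A B f
    using HF that by (auto simp: ftor_eq_def ftor_id_def)
  have r': "FArr F (FObj H A) (FObj H B) (FArr H A B f) = f" if "A \<in> Obj D" "B \<in> Obj D" "f \<in> Arr D A B" for A B f
    using FH that by (auto simp: ftor_eq_def ftor_id_def)
  have r2: "FArr H (FObj F A) B (FArr F A (FObj H B) f) = f"
    if "A \<in> Obj C" "B \<in> Obj D" "f \<in> Arr C A (FObj H B)" for A B f
    using r[of A "FObj H B" f] that by (simp add: o' ftor_simps[OF H])
  have r2': "FArr F A (FObj H B) (FArr H (FObj F A) B f) = f"
    if "A \<in> Obj C" "B \<in> Obj D" "f \<in> Arr D (FObj F A) B" for A B f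
    using r'[of "FObj F A" B f] that by (simp add: o ftor_simps[OF F])
  have t: "FArr H (FObj F A) B f \<in> Arr C A (FObj H B)"
    if "A \<in> Obj C" "B \<in> Obj D" "f \<in> Arr D (FObj F A) B" for A B f
    using ftor_between_Arr[OF H ftor_between_Obj[OF F that(1)] that(2,3)] that by (simp add: o)
  have t': "FArr F A (FObj H B) f \<in> Arr D (FObj F A) B"
    if "A \<in> Obj C" "B \<in> Obj D" "f \<in> Arr C A (FObj H B)" for A B f
    using ftor_between_Arr[OF F that(1) ftor_between_Obj[OF H that(2)] that(3)] that by (simp add: o')
  show ?thesis
  proof (rule adjunctionI[OF F H, where \<theta>="\<lambda>A B. FArr H (FObj F A) B"])
    fix A B assume *: "A \<in> Obj C" "B \<in> Obj D"
    show "bij_betw (FArr H (FObj F A) B) (Arr D (FObj F A) B) (Arr C A (FObj H B))"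
      by (rule bij_betw_byWitness[where f'="FArr F A (FObj H B)"]) (use * in \<open>auto simp: r2 r2' t t'\<close>)
  qed (simp_all add: ftor_between_Cmp[OF H] ftor_simps[OF F] ftor_simps[OF H] o r)
qed

text \<open>Made for a bijection on objects under which the hom-sets are literally equal, so that
  the functors act as the identity on arrows. The category laws of \<open>D\<close> are pulled back
  along \<open>Q\<close>.\<close>

lemma bijective_functor:
  assumes C: "category C"
    and P: "\<And>A. A \<in> Obj C \<Longrightarrow> P A \<in> Obj D" and Q: "\<And>A. A \<in> Obj D \<Longrightarrow> Q A \<in> Obj C"
    and QP: "\<And>A. A \<in> Obj C \<Longrightarrow> Q (P A) = A" and PQ: "\<And>A. A \<in> Obj D \<Longrightarrow> P (Q A) = A"
    and Arr: "\<And>A B. A \<in> Obj C \<Longrightarrow> B \<in> Obj C \<Longrightarrow> Arr D (P A) (P B) = Arr C A B"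
    and Idt: "\<And>A. A \<in> Obj C \<Longrightarrow> Idt D (P A) = Idt C A"
    and Cmp: "\<And>A B E f g. \<lbrakk>A \<in> Obj C; B \<in> Obj C; E \<in> Obj C; f \<in> Arr C A B; g \<in> Arr C B E\<rbrakk> \<Longrightarrow>
      Cmp D (P A) (P B) (P E) g f = Cmp C A B E g f"
  shows "ftor_between C D \<lparr>FObj = P, FArr = (\<lambda>A B f. f)\<rparr>"
    and "ftor_between D C \<lparr>FObj = Q, FArr = (\<lambda>A B f. f)\<rparr>"
    and "ftor_eq C (ftor_comp \<lparr>FObj = Q, FArr = (\<lambda>A B f. f)\<rparr> \<lparr>FObj = P, FArr = (\<lambda>A B f. f)\<rparr>) ftor_id"
    and "ftor_eq D (ftor_comp \<lparr>FObj = P, FArr = (\<lambda>A B f. f)\<rparr> \<lparr>FObj = Q, FArr = (\<lambda>A B f. f)\<rparr>) ftor_id"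
proof -
  have Arr': "Arr D A B = Arr C (Q A) (Q B)" if "A \<in> Obj D" "B \<in> Obj D" for A B
    using Arr[of "Q A" "Q B"] that by (simp add: Q PQ)
  have Idt': "Idt D A = Idt C (Q A)" if "A \<in> Obj D" for A
    using Idt[of "Q A"] that by (simp add: Q PQ)
  have Cmp': "Cmp D A B E g f = Cmp C (Q A) (Q B) (Q E) g f"
    if "A \<in> Obj D" "B \<in> Obj D" "E \<in> Obj D" "f \<in> Arr C (Q A) (Q B)" "g \<in> Arr C (Q B) (Q E)" for A B E f g
    using Cmp[of "Q A" "Q B" "Q E" f g] that by (simp add: Q PQ)
  have D: "category D"
    unfolding category_def
    by (simp add: Arr' Idt' Cmp' Q category_simps[OF C] category_assoc[OF C])
  show "ftor_between C D \<lparr>FObj = P, FArr = (\<lambda>A B f. f)\<rparr>"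
    unfolding ftor_between_def using C D by (simp add: P Arr Idt Cmp)
  show "ftor_between D C \<lparr>FObj = Q, FArr = (\<lambda>A B f. f)\<rparr>"
    unfolding ftor_between_def using C D by (simp add: Q Arr' Idt' Cmp')
  show "ftor_eq C (ftor_comp \<lparr>FObj = Q, FArr = (\<lambda>A B f. f)\<rparr> \<lparr>FObj = P, FArr = (\<lambda>A B f. f)\<rparr>) ftor_id"
    "ftor_eq D (ftor_comp \<lparr>FObj = P, FArr = (\<lambda>A B f. f)\<rparr> \<lparr>FObj = Q, FArr = (\<lambda>A B f. f)\<rparr>) ftor_id"
    by (simp_all add: ftor_eq_def ftor_id_def QP PQ)
qed

section \<open>Modules\<close>

lemma module_abelian: "Module.module K M \<Longrightarrow> abelian_group M"
  by (simp add: Module.module_def)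

lemma module_cring: "Module.module K M \<Longrightarrow> cring K"
  by (simp add: Module.module_def)

lemma moduleD:
  assumes "Module.module K M"
  shows "\<zero>\<^bsub>M\<^esub> \<in> carrier M"
    and "x \<in> carrier M \<Longrightarrow> y \<in> carrier M \<Longrightarrow> x \<oplus>\<^bsub>M\<^esub> y \<in> carrier M"
    and "x \<in> carrier M \<Longrightarrow> y \<in> carrier M \<Longrightarrow> z \<in> carrier M \<Longrightarrow> x \<oplus>\<^bsub>M\<^esub> y \<oplus>\<^bsub>M\<^esub> z = x \<oplus>\<^bsub>M\<^esub> (y \<oplus>\<^bsub>M\<^esub> z)"
    and "x \<in> carrier M \<Longrightarrow> y \<in> carrier M \<Longrightarrow> x \<oplus>\<^bsub>M\<^esub> y = y \<oplus>\<^bsub>M\<^esub> x"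
    and "x \<in> carrier M \<Longrightarrow> y \<in> carrier M \<Longrightarrow> z \<in> carrier M \<Longrightarrow> x \<oplus>\<^bsub>M\<^esub> (y \<oplus>\<^bsub>M\<^esub> z) = y \<oplus>\<^bsub>M\<^esub> (x \<oplus>\<^bsub>M\<^esub> z)"
    and "x \<in> carrier M \<Longrightarrow> \<zero>\<^bsub>M\<^esub> \<oplus>\<^bsub>M\<^esub> x = x"
    and "x \<in> carrier M \<Longrightarrow> x \<oplus>\<^bsub>M\<^esub> \<zero>\<^bsub>M\<^esub> = x"
    and "a \<in> carrier K \<Longrightarrow> x \<in> carrier M \<Longrightarrow> a \<odot>\<^bsub>M\<^esub> x \<in> carrier M"
    and "a \<in> carrier K \<Longrightarrow> b \<in> carrier K \<Longrightarrow> x \<in> carrier M \<Longrightarrow> (a \<oplus>\<^bsub>K\<^esub> b) \<odot>\<^bsub>M\<^esub> x = a \<odot>\<^bsub>M\<^esub> x \<oplus>\<^bsub>M\<^esub> b \<odot>\<^bsub>M\<^esub> x"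
    and "a \<in> carrier K \<Longrightarrow> x \<in> carrier M \<Longrightarrow> y \<in> carrier M \<Longrightarrow> a \<odot>\<^bsub>M\<^esub> (x \<oplus>\<^bsub>M\<^esub> y) = a \<odot>\<^bsub>M\<^esub> x \<oplus>\<^bsub>M\<^esub> a \<odot>\<^bsub>M\<^esub> y"
    and "a \<in> carrier K \<Longrightarrow> b \<in> carrier K \<Longrightarrow> x \<in> carrier M \<Longrightarrow> (a \<otimes>\<^bsub>K\<^esub> b) \<odot>\<^bsub>M\<^esub> x = a \<odot>\<^bsub>M\<^esub> (b \<odot>\<^bsub>M\<^esub> x)"
    and "x \<in> carrier M \<Longrightarrow> \<one>\<^bsub>K\<^esub> \<odot>\<^bsub>M\<^esub> x = x"
    and "x \<in> carrier M \<Longrightarrow> \<zero>\<^bsub>K\<^esub> \<odot>\<^bsub>M\<^esub> x = \<zero>\<^bsub>M\<^esub>"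
    and "a \<in> carrier K \<Longrightarrow> a \<odot>\<^bsub>M\<^esub> \<zero>\<^bsub>M\<^esub> = \<zero>\<^bsub>M\<^esub>"
proof -
  interpret Module.module K M by fact
  show "\<zero>\<^bsub>M\<^esub> \<in> carrier M"
    and "x \<in> carrier M \<Longrightarrow> y \<in> carrier M \<Longrightarrow> x \<oplus>\<^bsub>M\<^esub> y \<in> carrier M"
    and "x \<in> carrier M \<Longrightarrow> y \<in> carrier M \<Longrightarrow> z \<in> carrier M \<Longrightarrow> x \<oplus>\<^bsub>M\<^esub> y \<oplus>\<^bsub>M\<^esub> z = x \<oplus>\<^bsub>M\<^esub> (y \<oplus>\<^bsub>M\<^esub> z)"
    and "x \<in> carrier M \<Longrightarrow> y \<in> carrier M \<Longrightarrow> x \<oplus>\<^bsub>M\<^esub> y = y \<oplus>\<^bsub>M\<^esub> x"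
    and "x \<in> carrier M \<Longrightarrow> y \<in> carrier M \<Longrightarrow> z \<in> carrier M \<Longrightarrow> x \<oplus>\<^bsub>M\<^esub> (y \<oplus>\<^bsub>M\<^esub> z) = y \<oplus>\<^bsub>M\<^esub> (x \<oplus>\<^bsub>M\<^esub> z)"
    and "x \<in> carrier M \<Longrightarrow> \<zero>\<^bsub>M\<^esub> \<oplus>\<^bsub>M\<^esub> x = x"
    and "x \<in> carrier M \<Longrightarrow> x \<oplus>\<^bsub>M\<^esub> \<zero>\<^bsub>M\<^esub> = x"
    and "a \<in> carrier K \<Longrightarrow> x \<in> carrier M \<Longrightarrow> a \<odot>\<^bsub>M\<^esub> x \<in> carrier M"
    and "a \<in> carrier K \<Longrightarrow> b \<in> carrier K \<Longrightarrow> x \<in> carrier M \<Longrightarrow> (a \<oplus>\<^bsub>K\<^esub> b) \<odot>\<^bsub>M\<^esub> x = a \<odot>\<^bsub>M\<^esub> x \<oplus>\<^bsub>M\<^esub> b \<odot>\<^bsub>M\<^esub> x"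
    and "a \<in> carrier K \<Longrightarrow> x \<in> carrier M \<Longrightarrow> y \<in> carrier M \<Longrightarrow> a \<odot>\<^bsub>M\<^esub> (x \<oplus>\<^bsub>M\<^esub> y) = a \<odot>\<^bsub>M\<^esub> x \<oplus>\<^bsub>M\<^esub> a \<odot>\<^bsub>M\<^esub> y"
    and "a \<in> carrier K \<Longrightarrow> b \<in> carrier K \<Longrightarrow> x \<in> carrier M \<Longrightarrow> (a \<otimes>\<^bsub>K\<^esub> b) \<odot>\<^bsub>M\<^esub> x = a \<odot>\<^bsub>M\<^esub> (b \<odot>\<^bsub>M\<^esub> x)"
    and "x \<in> carrier M \<Longrightarrow> \<one>\<^bsub>K\<^esub> \<odot>\<^bsub>M\<^esub> x = x"
    and "x \<in> carrier M \<Longrightarrow> \<zero>\<^bsub>K\<^esub> \<odot>\<^bsub>M\<^esub> x = \<zero>\<^bsub>M\<^esub>"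
    and "a \<in> carrier K \<Longrightarrow> a \<odot>\<^bsub>M\<^esub> \<zero>\<^bsub>M\<^esub> = \<zero>\<^bsub>M\<^esub>"
    by (simp_all add: M.a_ac smult_l_distr smult_r_distr smult_assoc1)
qed

text \<open>Existence of negatives is traded for the law that the zero scalar annihilates: then
  (-1)x is a negative of x.\<close>

lemma module_intro:
  assumes K: "cring K"
    and zero: "\<zero>\<^bsub>M\<^esub> \<in> carrier M"
    and add: "\<And>x y. x \<in> carrier M \<Longrightarrow> y \<in> carrier M \<Longrightarrow> x \<oplus>\<^bsub>M\<^esub> y \<in> carrier M"
    and assoc: "\<And>x y z. x \<in> carrier M \<Longrightarrow> y \<in> carrier M \<Longrightarrow> z \<in> carrier M \<Longrightarrow> x \<oplus>\<^bsub>M\<^esub> y \<oplus>\<^bsub>M\<^esub> z = x \<oplus>\<^bsub>M\<^esub> (y \<oplus>\<^bsub>M\<^esub> z)"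
    and comm: "\<And>x y. x \<in> carrier M \<Longrightarrow> y \<in> carrier M \<Longrightarrow> x \<oplus>\<^bsub>M\<^esub> y = y \<oplus>\<^bsub>M\<^esub> x"
    and l_zero: "\<And>x. x \<in> carrier M \<Longrightarrow> \<zero>\<^bsub>M\<^esub> \<oplus>\<^bsub>M\<^esub> x = x"
    and smult: "\<And>a x. a \<in> carrier K \<Longrightarrow> x \<in> carrier M \<Longrightarrow> a \<odot>\<^bsub>M\<^esub> x \<in> carrier M"
    and l_distr: "\<And>a b x. a \<in> carrier K \<Longrightarrow> b \<in> carrier K \<Longrightarrow> x \<in> carrier M \<Longrightarrow> (a \<oplus>\<^bsub>K\<^esub> b) \<odot>\<^bsub>M\<^esub> x = a \<odot>\<^bsub>M\<^esub> x \<oplus>\<^bsub>M\<^esub> b \<odot>\<^bsub>M\<^esub> x"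
    and r_distr: "\<And>a x y. a \<in> carrier K \<Longrightarrow> x \<in> carrier M \<Longrightarrow> y \<in> carrier M \<Longrightarrow> a \<odot>\<^bsub>M\<^esub> (x \<oplus>\<^bsub>M\<^esub> y) = a \<odot>\<^bsub>M\<^esub> x \<oplus>\<^bsub>M\<^esub> a \<odot>\<^bsub>M\<^esub> y"
    and smult_assoc: "\<And>a b x. a \<in> carrier K \<Longrightarrow> b \<in> carrier K \<Longrightarrow> x \<in> carrier M \<Longrightarrow> (a \<otimes>\<^bsub>K\<^esub> b) \<odot>\<^bsub>M\<^esub> x = a \<odot>\<^bsub>M\<^esub> (b \<odot>\<^bsub>M\<^esub> x)"
    and one: "\<And>x. x \<in> carrier M \<Longrightarrow> \<one>\<^bsub>K\<^esub> \<odot>\<^bsub>M\<^esub> x = x"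
    and zero_smult: "\<And>x. x \<in> carrier M \<Longrightarrow> \<zero>\<^bsub>K\<^esub> \<odot>\<^bsub>M\<^esub> x = \<zero>\<^bsub>M\<^esub>"
  shows "Module.module K M"
proof -
  interpret K: cring K by fact
  have "\<exists>y\<in>carrier M. y \<oplus>\<^bsub>M\<^esub> x = \<zero>\<^bsub>M\<^esub>" if x: "x \<in> carrier M" for x
  proof (rule bexI)
    show "(\<ominus>\<^bsub>K\<^esub> \<one>\<^bsub>K\<^esub>) \<odot>\<^bsub>M\<^esub> x \<oplus>\<^bsub>M\<^esub> x = \<zero>\<^bsub>M\<^esub>"
      using l_distr[of "\<ominus>\<^bsub>K\<^esub> \<one>\<^bsub>K\<^esub>" "\<one>\<^bsub>K\<^esub>" x] x by (simp add: K.l_neg zero_smult one)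
  qed (simp add: x smult)
  with assms show ?thesis
    by (intro moduleI abelian_groupI) auto
qed

text \<open>The operations of \<open>Q\<close> are induced along the surjection \<open>p\<close>, so
  every module law descends. Quotients and copies are both of this form.\<close>

lemma module_image:
  assumes M: "Module.module K M"
    and Q: "carrier Q = p ` carrier M" "\<zero>\<^bsub>Q\<^esub> = p \<zero>\<^bsub>M\<^esub>"
      "\<And>m n. m \<in> carrier M \<Longrightarrow> n \<in> carrier M \<Longrightarrow> p m \<oplus>\<^bsub>Q\<^esub> p n = p (m \<oplus>\<^bsub>M\<^esub> n)"
      "\<And>a m. a \<in> carrier K \<Longrightarrow> m \<in> carrier M \<Longrightarrow> a \<odot>\<^bsub>Q\<^esub> p m = p (a \<odot>\<^bsub>M\<^esub> m)"
  shows "Module.module K Q"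
proof -
  interpret K: cring K by (rule module_cring[OF M])
  show ?thesis
    by (rule module_intro)
      (auto simp: Q moduleD[OF M] K.is_cring)
qed

lemma module_subset:
  assumes M: "Module.module K M" and H: "H \<subseteq> carrier M" "\<zero>\<^bsub>M\<^esub> \<in> H"
    "\<And>x y. x \<in> H \<Longrightarrow> y \<in> H \<Longrightarrow> x \<oplus>\<^bsub>M\<^esub> y \<in> H" "\<And>a x. a \<in> carrier K \<Longrightarrow> x \<in> H \<Longrightarrow> a \<odot>\<^bsub>M\<^esub> x \<in> H"
  shows "Module.module K (M\<lparr>carrier := H\<rparr>)"
proof -
  have *: "x \<in> carrier M" if "x \<in> H" for x using H(1) that by auto
  show ?thesis
    by (rule module_intro) (auto simp: module_cring[OF M] H moduleD[OF M] *)
qed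

text \<open>Closure under negatives comes from multiplication by -1.\<close>

lemma module_submoduleI:
  assumes M: "Module.module K M" and H: "H \<subseteq> carrier M" "\<zero>\<^bsub>M\<^esub> \<in> H"
    "\<And>x y. x \<in> H \<Longrightarrow> y \<in> H \<Longrightarrow> x \<oplus>\<^bsub>M\<^esub> y \<in> H" "\<And>a x. a \<in> carrier K \<Longrightarrow> x \<in> H \<Longrightarrow> a \<odot>\<^bsub>M\<^esub> x \<in> H"
  shows "submodule H K M"
proof -
  interpret Module.module K M by fact
  have "\<ominus>\<^bsub>M\<^esub> x \<in> H" if "x \<in> H" for x
    using H(4)[of "\<ominus>\<^bsub>K\<^esub> \<one>\<^bsub>K\<^esub>" x] that H(1) by (auto simp: smult_l_minus)
  with H show ?thesis by (intro submoduleI)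
qed

lemma module_submoduleD:
  assumes M: "Module.module K M" and H: "submodule H K M"
  shows "H \<subseteq> carrier M" "\<zero>\<^bsub>M\<^esub> \<in> H" "\<And>x y. x \<in> H \<Longrightarrow> y \<in> H \<Longrightarrow> x \<oplus>\<^bsub>M\<^esub> y \<in> H"
    "\<And>a x. a \<in> carrier K \<Longrightarrow> x \<in> H \<Longrightarrow> a \<odot>\<^bsub>M\<^esub> x \<in> H"
proof -
  interpret Module.module K M by fact
  show "H \<subseteq> carrier M" "\<And>x y. x \<in> H \<Longrightarrow> y \<in> H \<Longrightarrow> x \<oplus>\<^bsub>M\<^esub> y \<in> H"
    "\<And>a x. a \<in> carrier K \<Longrightarrow> x \<in> H \<Longrightarrow> a \<odot>\<^bsub>M\<^esub> x \<in> H"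
    using submoduleE[OF H] by auto
  show "\<zero>\<^bsub>M\<^esub> \<in> H"
    using subgroup.one_closed[OF submodule.axioms(1)[OF H]] by simp
qed

subsection \<open>Linear maps\<close>

lemma lin_mapsI:
  assumes "\<And>m. m \<in> carrier M \<Longrightarrow> f m \<in> carrier N"
    and "\<And>m n. m \<in> carrier M \<Longrightarrow> n \<in> carrier M \<Longrightarrow> f (m \<oplus>\<^bsub>M\<^esub> n) = f m \<oplus>\<^bsub>N\<^esub> f n"
    and "\<And>a m. a \<in> carrier K \<Longrightarrow> m \<in> carrier M \<Longrightarrow> f (a \<odot>\<^bsub>M\<^esub> m) = a \<odot>\<^bsub>N\<^esub> f m"
    and "Module.module K M"
  shows "(\<lambda>m\<in>carrier M. f m) \<in> lin_maps K M N"
  using assms(1-3) moduleD[OF assms(4)] by (auto simp: lin_maps_def)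

lemma lin_mapsD:
  assumes "f \<in> lin_maps K M N"
  shows "m \<in> carrier M \<Longrightarrow> f m \<in> carrier N"
    and "m \<in> carrier M \<Longrightarrow> n \<in> carrier M \<Longrightarrow> f (m \<oplus>\<^bsub>M\<^esub> n) = f m \<oplus>\<^bsub>N\<^esub> f n"
    and "a \<in> carrier K \<Longrightarrow> m \<in> carrier M \<Longrightarrow> f (a \<odot>\<^bsub>M\<^esub> m) = a \<odot>\<^bsub>N\<^esub> f m"
    and "m \<notin> carrier M \<Longrightarrow> f m = undefined"
  using assms by (auto simp: lin_maps_def PiE_iff extensional_def)

lemma lin_maps_zero:
  assumes "f \<in> lin_maps K M N" and M: "Module.module K M" and N: "Module.module K N"
  shows "f \<zero>\<^bsub>M\<^esub> = \<zero>\<^bsub>N\<^esub>"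
proof -
  interpret cring K by (rule module_cring[OF M])
  show ?thesis
    using lin_mapsD(3)[OF assms(1) zero_closed moduleD(1)[OF M]] lin_mapsD(1)[OF assms(1) moduleD(1)[OF M]]
    by (simp add: moduleD[OF M] moduleD[OF N])
qed

lemma lin_maps_minus:
  assumes f: "f \<in> lin_maps K M N" and M: "Module.module K M" and N: "Module.module K N"
    and m: "m \<in> carrier M" "n \<in> carrier M"
  shows "f (m \<ominus>\<^bsub>M\<^esub> n) = f m \<ominus>\<^bsub>N\<^esub> f n"
proof -
  interpret M: Module.module K M by fact
  interpret N: Module.module K N by fact
  have "f (\<ominus>\<^bsub>M\<^esub> n) = \<ominus>\<^bsub>N\<^esub> f n"
    using lin_mapsD(3)[OF f, of "\<ominus>\<^bsub>K\<^esub> \<one>\<^bsub>K\<^esub>" n] m lin_mapsD(1)[OF f m(2)]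
    by (simp add: M.smult_l_minus N.smult_l_minus)
  then show ?thesis using m by (simp add: a_minus_def lin_mapsD[OF f])
qed

lemma lin_maps_ext:
  assumes "f \<in> lin_maps K M N" "g \<in> lin_maps K M N'" "\<And>m. m \<in> carrier M \<Longrightarrow> f m = g m"
  shows "f = g"
proof
  fix m show "f m = g m"
    by (cases "m \<in> carrier M") (simp_all add: assms(3) lin_mapsD(4)[OF assms(1)] lin_mapsD(4)[OF assms(2)])
qed

lemma lin_maps_comp:
  assumes f: "f \<in> lin_maps K M N" and g: "g \<in> lin_maps K N P" and M: "Module.module K M"
  shows "(\<lambda>m\<in>carrier M. g (f m)) \<in> lin_maps K M P"
  by (rule lin_mapsI) (auto simp: lin_mapsD[OF f] lin_mapsD[OF g] M)

lemma module_minus_eq_zero: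
  assumes M: "Module.module K M" and m: "m \<in> carrier M" "n \<in> carrier M"
  shows "m \<ominus>\<^bsub>M\<^esub> n = \<zero>\<^bsub>M\<^esub> \<longleftrightarrow> m = n"
proof -
  interpret M: Module.module K M by fact
  have "m = (m \<ominus>\<^bsub>M\<^esub> n) \<oplus>\<^bsub>M\<^esub> n" using m by (simp add: a_minus_def M.a_assoc M.l_neg)
  then show ?thesis using m by (auto simp: a_minus_def M.r_neg)
qed

lemma lin_maps_injI:
  assumes f: "f \<in> lin_maps K M N" and M: "Module.module K M" and N: "Module.module K N"
    and ker: "\<And>m. m \<in> carrier M \<Longrightarrow> f m = \<zero>\<^bsub>N\<^esub> \<Longrightarrow> m = \<zero>\<^bsub>M\<^esub>"
  shows "inj_on f (carrier M)"
proof (rule inj_onI)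
  interpret M: Module.module K M by fact
  interpret N: Module.module K N by fact
  fix m n assume *: "m \<in> carrier M" "n \<in> carrier M" "f m = f n"
  then have "f (m \<ominus>\<^bsub>M\<^esub> n) = \<zero>\<^bsub>N\<^esub>"
    using lin_mapsD(1)[OF f] by (simp add: lin_maps_minus[OF f M N] module_minus_eq_zero[OF N])
  then have "m \<ominus>\<^bsub>M\<^esub> n = \<zero>\<^bsub>M\<^esub>" using ker * by simp
  then show "m = n" using * by (simp add: module_minus_eq_zero[OF M])
qed

subsection \<open>Products, direct sums, quotients\<close>

lemma product_module_simps [simp]:
  "carrier (product_module I M) = (\<Pi>\<^sub>E i\<in>I. carrier (M i))"
  "\<zero>\<^bsub>product_module I M\<^esub> = (\<lambda>i\<in>I. \<zero>\<^bsub>M i\<^esub>)"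
  "u \<oplus>\<^bsub>product_module I M\<^esub> v = (\<lambda>i\<in>I. u i \<oplus>\<^bsub>M i\<^esub> v i)"
  "a \<odot>\<^bsub>product_module I M\<^esub> u = (\<lambda>i\<in>I. a \<odot>\<^bsub>M i\<^esub> u i)"
  by (simp_all add: product_module_def)

lemma module_product:
  assumes K: "cring K" and M: "\<And>i. i \<in> I \<Longrightarrow> Module.module K (M i)"
  shows "Module.module K (product_module I M)"
proof -
  interpret K: cring K by fact
  show ?thesis
    by (rule module_intro)
      (auto simp: moduleD[OF M] K K.is_cring PiE_iff fun_eq_iff extensional_def)
qed

text \<open>The predicate \<open>Q\<close> restricts supports: \<open>finite\<close> gives the
  direct sum and the constant truth gives the product, so that induced and coinduced modules can
  share one construction.\<close>

definition sum_module :: "('i set \<Rightarrow> bool) \<Rightarrow> 'i set \<Rightarrow> ('i \<Rightarrow> ('k, 'u) module) \<Rightarrow> ('k, 'i \<Rightarrow> 'u) module" where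
  "sum_module Q I M = (product_module I M)
     \<lparr>carrier := {u \<in> (\<Pi>\<^sub>E i\<in>I. carrier (M i)). Q {i \<in> I. u i \<noteq> \<zero>\<^bsub>M i\<^esub>}}\<rparr>"

lemma direct_sum_module_eq: "direct_sum_module = sum_module finite"
  by (simp add: fun_eq_iff direct_sum_module_def sum_module_def)

lemma sum_module_simps [simp]:
  "carrier (sum_module Q I M) = {u \<in> (\<Pi>\<^sub>E i\<in>I. carrier (M i)). Q {i \<in> I. u i \<noteq> \<zero>\<^bsub>M i\<^esub>}}"
  "\<zero>\<^bsub>sum_module Q I M\<^esub> = (\<lambda>i\<in>I. \<zero>\<^bsub>M i\<^esub>)"
  "u \<oplus>\<^bsub>sum_module Q I M\<^esub> v = (\<lambda>i\<in>I. u i \<oplus>\<^bsub>M i\<^esub> v i)"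
  "a \<odot>\<^bsub>sum_module Q I M\<^esub> u = (\<lambda>i\<in>I. a \<odot>\<^bsub>M i\<^esub> u i)"
  by (simp_all add: sum_module_def product_module_def)

text \<open>The closure conditions on supports that make the families with support in
  \<open>Q\<close> a submodule of the product.\<close>

definition support_ideal :: "('i set \<Rightarrow> bool) \<Rightarrow> bool" where
  "support_ideal Q \<longleftrightarrow> Q {} \<and> (\<forall>A B. Q B \<longrightarrow> A \<subseteq> B \<longrightarrow> Q A) \<and> (\<forall>A B. Q A \<longrightarrow> Q B \<longrightarrow> Q (A \<union> B))"

lemma support_ideal_finite: "support_ideal finite"
  and support_ideal_True: "support_ideal (\<lambda>_. True)"
  by (auto simp: support_ideal_def intro: finite_subset)

lemma module_sum:
  assumes K: "cring K" and M: "\<And>i. i \<in> I \<Longrightarrow> Module.module K (M i)" and Q: "support_ideal Q"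
  shows "Module.module K (sum_module Q I M)"
  unfolding sum_module_def
proof (rule module_subset[OF module_product[OF K M]])
  have sub: "Q A" if "Q B" "A \<subseteq> B" for A B using Q that by (auto simp: support_ideal_def)
  let ?C = "{u \<in> (\<Pi>\<^sub>E i\<in>I. carrier (M i)). Q {i \<in> I. u i \<noteq> \<zero>\<^bsub>M i\<^esub>}}"
  have "{i \<in> I. (\<lambda>i\<in>I. \<zero>\<^bsub>M i\<^esub>) i \<noteq> \<zero>\<^bsub>M i\<^esub>} = {}" by auto
  then show "\<zero>\<^bsub>product_module I M\<^esub> \<in> ?C"
    using Q by (simp add: moduleD[OF M] support_ideal_def del: Collect_empty_eq)
  fix x y assume x: "x \<in> ?C" and y: "y \<in> ?C"
  have xy: "x i \<in> carrier (M i)" "y i \<in> carrier (M i)" if "i \<in> I" for i using x y that by auto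
  have "Q ({i \<in> I. x i \<noteq> \<zero>\<^bsub>M i\<^esub>} \<union> {i \<in> I. y i \<noteq> \<zero>\<^bsub>M i\<^esub>})"
    using x y Q by (simp add: support_ideal_def)
  then have "Q {i \<in> I. (x \<oplus>\<^bsub>product_module I M\<^esub> y) i \<noteq> \<zero>\<^bsub>M i\<^esub>}"
    by (rule sub) (auto simp: moduleD[OF M])
  then show "x \<oplus>\<^bsub>product_module I M\<^esub> y \<in> ?C"
    using xy by (simp add: moduleD[OF M])
next
  have sub: "Q A" if "Q B" "A \<subseteq> B" for A B using Q that by (auto simp: support_ideal_def)
  let ?C = "{u \<in> (\<Pi>\<^sub>E i\<in>I. carrier (M i)). Q {i \<in> I. u i \<noteq> \<zero>\<^bsub>M i\<^esub>}}"
  fix a x assume a: "a \<in> carrier K" and x: "x \<in> ?C"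
  then have "Q {i \<in> I. x i \<noteq> \<zero>\<^bsub>M i\<^esub>}" by simp
  then have "Q {i \<in> I. (a \<odot>\<^bsub>product_module I M\<^esub> x) i \<noteq> \<zero>\<^bsub>M i\<^esub>}"
    by (rule sub) (auto simp: moduleD[OF M] a)
  moreover have "x i \<in> carrier (M i)" if "i \<in> I" for i using x that by auto
  ultimately show "a \<odot>\<^bsub>product_module I M\<^esub> x \<in> ?C"
    using a by (simp add: moduleD[OF M])
qed auto

definition dsingle :: "'i set \<Rightarrow> ('i \<Rightarrow> ('k, 'u) module) \<Rightarrow> 'i \<Rightarrow> 'u \<Rightarrow> 'i \<Rightarrow> 'u" where
  "dsingle I M i m = (\<lambda>j\<in>I. if j = i then m else \<zero>\<^bsub>M j\<^esub>)"

lemma dsingle_closed: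
  assumes M: "\<And>i. i \<in> I \<Longrightarrow> Module.module K (M i)" and i: "i \<in> I" "m \<in> carrier (M i)"
  shows "dsingle I M i m \<in> carrier (sum_module finite I M)"
proof -
  have "{j \<in> I. dsingle I M i m j \<noteq> \<zero>\<^bsub>M j\<^esub>} \<subseteq> {i}" by (auto simp: dsingle_def)
  then have "finite {j \<in> I. dsingle I M i m j \<noteq> \<zero>\<^bsub>M j\<^esub>}" by (rule finite_subset) simp
  then show ?thesis using assms by (auto simp: dsingle_def moduleD[OF M])
qed

lemma dsingle_lin:
  assumes M: "\<And>i. i \<in> I \<Longrightarrow> Module.module K (M i)" and i: "i \<in> I"
  shows "(\<lambda>m\<in>carrier (M i). dsingle I M i m) \<in> lin_maps K (M i) (sum_module finite I M)"
proof (rule lin_mapsI)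
  fix m assume "m \<in> carrier (M i)"
  then show "dsingle I M i m \<in> carrier (sum_module finite I M)"
    using dsingle_closed[where M=M and I=I, OF M i] by simp
qed (auto simp: M i dsingle_def moduleD[OF M] fun_eq_iff)

text \<open>A direct sum is generated by its single-entry families: induction on the support,
  splitting off one entry at a time.\<close>

lemma sum_lin_maps_eq:
  assumes M: "\<And>i. i \<in> I \<Longrightarrow> Module.module K (M i)" and N: "Module.module K N"
    and h: "h \<in> lin_maps K (sum_module finite I M) N" "h' \<in> lin_maps K (sum_module finite I M) N"
    and eq: "\<And>i m. i \<in> I \<Longrightarrow> m \<in> carrier (M i) \<Longrightarrow> h (dsingle I M i m) = h' (dsingle I M i m)"
  shows "h = h'"
proof (rule lin_maps_ext[OF h])
  note K = module_cring[OF N]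
  note S = module_sum[OF K M support_ideal_finite]
  fix u assume u: "u \<in> carrier (sum_module finite I M)"
  then have "finite {i \<in> I. u i \<noteq> \<zero>\<^bsub>M i\<^esub>}" by simp
  from this u show "h u = h' u"
  proof (induction "{i \<in> I. u i \<noteq> \<zero>\<^bsub>M i\<^esub>}" arbitrary: u rule: finite_induct)
    case empty
    then have "u = \<zero>\<^bsub>sum_module finite I M\<^esub>" by (auto simp: fun_eq_iff PiE_iff extensional_def)
    then show ?case by (simp only: lin_maps_zero[OF h(1) S N] lin_maps_zero[OF h(2) S N])
  next
    case (insert i F)
    have i: "i \<in> I" "u i \<in> carrier (M i)" using insert by (auto simp: PiE_iff)
    \<comment> \<open>\<open>v\<close> is \<open>u\<close> with its entry at \<open>i\<close>
      erased; its support is \<open>F\<close>, so the induction hypothesis applies to it.\<close>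
    define v where "v = (\<lambda>j\<in>I. if j = i then \<zero>\<^bsub>M j\<^esub> else u j)"
    have F: "F = {j \<in> I. v j \<noteq> \<zero>\<^bsub>M j\<^esub>}" using insert(2,4) by (auto simp: v_def)
    then have v: "v \<in> carrier (sum_module finite I M)"
      using insert(1,5) by (auto simp: v_def PiE_iff moduleD[OF M])
    have "u j = (dsingle I M i (u i) \<oplus>\<^bsub>sum_module finite I M\<^esub> v) j" for j
    proof (cases "j \<in> I")
      case True
      then have "u j \<in> carrier (M j)" using insert(5) by auto
      then show ?thesis using i True by (simp add: v_def dsingle_def moduleD[OF M])
    next
      case False
      then show ?thesis using insert(5) by (simp add: PiE_iff extensional_def)
    qed
    then have u: "u = dsingle I M i (u i) \<oplus>\<^bsub>sum_module finite I M\<^esub> v" by (rule ext)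
    show ?case
      by (subst (1 2) u) (simp only: lin_mapsD(2)[OF h(1) dsingle_closed[where M=M and I=I, OF M i] v]
          lin_mapsD(2)[OF h(2) dsingle_closed[where M=M and I=I, OF M i] v] eq[OF i] insert(3)[OF F v])
  qed
qed

definition sum_map :: "('k, 'v) module \<Rightarrow> 'i set \<Rightarrow> ('i \<Rightarrow> ('k, 'u) module) \<Rightarrow> ('i \<Rightarrow> 'u \<Rightarrow> 'v) \<Rightarrow> ('i \<Rightarrow> 'u) \<Rightarrow> 'v" where
  "sum_map N I M f = (\<lambda>u\<in>carrier (sum_module finite I M). finsum N (\<lambda>i. f i (u i)) {i \<in> I. u i \<noteq> \<zero>\<^bsub>M i\<^esub>})"

lemma
  assumes M: "\<And>i. i \<in> I \<Longrightarrow> Module.module K (M i)" and N: "Module.module K N"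
    and f: "\<And>i. i \<in> I \<Longrightarrow> f i \<in> lin_maps K (M i) N"
  shows sum_map_lin: "sum_map N I M f \<in> lin_maps K (sum_module finite I M) N"
    and sum_map_single: "\<And>i m. i \<in> I \<Longrightarrow> m \<in> carrier (M i) \<Longrightarrow> sum_map N I M f (dsingle I M i m) = f i m"
proof -
  interpret N: Module.module K N by fact
  have S: "Module.module K (sum_module finite I M)"
    by (rule module_sum[OF module_cring[OF N] M support_ideal_finite])
  have val: "f i (u i) \<in> carrier N" if "u \<in> carrier (sum_module finite I M)" "i \<in> I" for u i
    using that by (auto intro!: lin_mapsD(1)[OF f] simp: PiE_iff)
  have f0: "f i \<zero>\<^bsub>M i\<^esub> = \<zero>\<^bsub>N\<^esub>" if "i \<in> I" for i
    using lin_maps_zero[OF f[OF that] M[OF that] N] .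
  \<comment> \<open>The defining sum runs over the support of \<open>u\<close>, which changes under
    addition and scalar multiplication. All sums are therefore moved to a common finite index set
    first.\<close>
  have on: "finsum N (\<lambda>i. f i (u i)) {i \<in> I. u i \<noteq> \<zero>\<^bsub>M i\<^esub>} = finsum N (\<lambda>i. f i (u i)) A"
    if "u \<in> carrier (sum_module finite I M)" "finite A" "A \<subseteq> I" "{i \<in> I. u i \<noteq> \<zero>\<^bsub>M i\<^esub>} \<subseteq> A" for u A
    using that val[OF that(1)] f0 by (intro N.add.finprod_mono_neutral_cong_left) auto
  show "sum_map N I M f \<in> lin_maps K (sum_module finite I M) N"
    unfolding sum_map_def
  proof (rule lin_mapsI)
    fix u assume u: "u \<in> carrier (sum_module finite I M)"
    show "finsum N (\<lambda>i. f i (u i)) {i \<in> I. u i \<noteq> \<zero>\<^bsub>M i\<^esub>} \<in> carrier N"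
      using val[OF u] by (intro N.finsum_closed) auto
  next
    fix u v assume u: "u \<in> carrier (sum_module finite I M)" and v: "v \<in> carrier (sum_module finite I M)"
    have uv: "u \<oplus>\<^bsub>sum_module finite I M\<^esub> v \<in> carrier (sum_module finite I M)"
      by (rule moduleD(2)[OF S u v])
    define A where "A = {i \<in> I. u i \<noteq> \<zero>\<^bsub>M i\<^esub>} \<union> {i \<in> I. v i \<noteq> \<zero>\<^bsub>M i\<^esub>}"
    have A: "finite A" "A \<subseteq> I" using u v by (auto simp: A_def)
    let ?w = "u \<oplus>\<^bsub>sum_module finite I M\<^esub> v"
    have um: "u i \<in> carrier (M i)" "v i \<in> carrier (M i)" if "i \<in> I" for i using u v that by auto
    have "finsum N (\<lambda>i. f i (?w i)) {i \<in> I. ?w i \<noteq> \<zero>\<^bsub>M i\<^esub>} = finsum N (\<lambda>i. f i (?w i)) A"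
      by (rule on[OF uv A]) (auto simp: A_def moduleD[OF M])
    also have "\<dots> = finsum N (\<lambda>i. f i (u i) \<oplus>\<^bsub>N\<^esub> f i (v i)) A"
      using A(2) val[OF u] val[OF v] um by (intro N.finsum_cong') (auto simp: lin_mapsD[OF f])
    also have "\<dots> = finsum N (\<lambda>i. f i (u i)) A \<oplus>\<^bsub>N\<^esub> finsum N (\<lambda>i. f i (v i)) A"
      using A(2) val[OF u] val[OF v] by (intro N.finsum_addf) auto
    also have "finsum N (\<lambda>i. f i (u i)) A = finsum N (\<lambda>i. f i (u i)) {i \<in> I. u i \<noteq> \<zero>\<^bsub>M i\<^esub>}"
      by (rule on[OF u A, symmetric]) (auto simp: A_def)
    also have "finsum N (\<lambda>i. f i (v i)) A = finsum N (\<lambda>i. f i (v i)) {i \<in> I. v i \<noteq> \<zero>\<^bsub>M i\<^esub>}"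
      by (rule on[OF v A, symmetric]) (auto simp: A_def)
    finally show "finsum N (\<lambda>i. f i (?w i)) {i \<in> I. ?w i \<noteq> \<zero>\<^bsub>M i\<^esub>} =
      finsum N (\<lambda>i. f i (u i)) {i \<in> I. u i \<noteq> \<zero>\<^bsub>M i\<^esub>} \<oplus>\<^bsub>N\<^esub> finsum N (\<lambda>i. f i (v i)) {i \<in> I. v i \<noteq> \<zero>\<^bsub>M i\<^esub>}" .
  next
    fix a u assume a: "a \<in> carrier K" and u: "u \<in> carrier (sum_module finite I M)"
    have au: "a \<odot>\<^bsub>sum_module finite I M\<^esub> u \<in> carrier (sum_module finite I M)"
      by (rule moduleD(8)[OF S a u])
    define A where "A = {i \<in> I. u i \<noteq> \<zero>\<^bsub>M i\<^esub>}"
    have A: "finite A" "A \<subseteq> I" using u by (auto simp: A_def)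
    let ?w = "a \<odot>\<^bsub>sum_module finite I M\<^esub> u"
    have um: "u i \<in> carrier (M i)" if "i \<in> I" for i using u that by auto
    have "finsum N (\<lambda>i. f i (?w i)) {i \<in> I. ?w i \<noteq> \<zero>\<^bsub>M i\<^esub>} = finsum N (\<lambda>i. f i (?w i)) A"
      by (rule on[OF au A]) (auto simp: A_def moduleD[OF M] a)
    also have "\<dots> = finsum N (\<lambda>i. a \<odot>\<^bsub>N\<^esub> f i (u i)) A"
      using A(2) val[OF u] um a by (intro N.finsum_cong') (auto simp: lin_mapsD[OF f])
    also have "\<dots> = a \<odot>\<^bsub>N\<^esub> finsum N (\<lambda>i. f i (u i)) A"
      using A val[OF u] a by (intro N.finsum_smult_ldistr[symmetric]) auto
    finally show "finsum N (\<lambda>i. f i (?w i)) {i \<in> I. ?w i \<noteq> \<zero>\<^bsub>M i\<^esub>} =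
      a \<odot>\<^bsub>N\<^esub> finsum N (\<lambda>i. f i (u i)) {i \<in> I. u i \<noteq> \<zero>\<^bsub>M i\<^esub>}" unfolding A_def .
  qed (rule S)
  fix i m assume i: "i \<in> I" "m \<in> carrier (M i)"
  have sc: "dsingle I M i m \<in> carrier (sum_module finite I M)"
    by (rule dsingle_closed[where M=M and I=I, OF M i])
  have "sum_map N I M f (dsingle I M i m) =
      finsum N (\<lambda>j. f j (dsingle I M i m j)) {j \<in> I. dsingle I M i m j \<noteq> \<zero>\<^bsub>M j\<^esub>}"
    unfolding sum_map_def by (rule restrict_apply'[OF sc])
  also have "\<dots> = finsum N (\<lambda>j. f j (dsingle I M i m j)) {i}"
    by (rule on[OF sc]) (use i in \<open>auto simp: dsingle_def\<close>)
  also have "\<dots> = f i m"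
    using i lin_mapsD(1)[OF f[OF i(1)] i(2)] by (simp add: dsingle_def)
  finally show "sum_map N I M f (dsingle I M i m) = f i m" .
qed

lemma generated_submodule:
  assumes M: "Module.module K M" and S: "S \<subseteq> carrier M"
  shows "submodule (generated_submodule K M S) K M" "S \<subseteq> generated_submodule K M S"
    and "\<And>H. submodule H K M \<Longrightarrow> S \<subseteq> H \<Longrightarrow> generated_submodule K M S \<subseteq> H"
proof -
  have "submodule (carrier M) K M" by (rule module_submoduleI[OF M]) (simp_all add: moduleD[OF M])
  then show "submodule (generated_submodule K M S) K M"
    using S unfolding generated_submodule_def
    by (intro module_submoduleI[OF M]) (auto intro: module_submoduleD(2-4)[OF M])
qed (auto simp: generated_submodule_def)

lemma submodule_kernel:
  assumes f: "f \<in> lin_maps K M N" and M: "Module.module K M" and N: "Module.module K N"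
  shows "submodule {m \<in> carrier M. f m = \<zero>\<^bsub>N\<^esub>} K M"
  by (rule module_submoduleI[OF M])
    (auto simp: moduleD[OF M] moduleD[OF N] lin_mapsD[OF f] lin_maps_zero[OF f M N])

lemma submodule_image:
  assumes f: "f \<in> lin_maps K M N" and M: "Module.module K M" and N: "Module.module K N"
  shows "submodule (f ` carrier M) K N"
proof (rule module_submoduleI[OF N])
  show "\<zero>\<^bsub>N\<^esub> \<in> f ` carrier M" using lin_maps_zero[OF f M N] moduleD(1)[OF M] by (metis imageI)
qed (auto simp: lin_mapsD[OF f] moduleD[OF M] simp flip: lin_mapsD(2,3)[OF f])

lemma
  assumes M: "Module.module K M" and H: "submodule H K M"
  shows coset_eq_iff: "\<lbrakk>m \<in> carrier M; n \<in> carrier M\<rbrakk> \<Longrightarrow> H +>\<^bsub>M\<^esub> m = H +>\<^bsub>M\<^esub> n \<longleftrightarrow> m \<ominus>\<^bsub>M\<^esub> n \<in> H"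
    and coset_self: "m \<in> carrier M \<Longrightarrow> m \<in> H +>\<^bsub>M\<^esub> m"
    and coset_subset: "m \<in> carrier M \<Longrightarrow> H +>\<^bsub>M\<^esub> m \<subseteq> carrier M"
    and coset_mem: "m \<in> carrier M \<Longrightarrow> n \<in> H +>\<^bsub>M\<^esub> m \<Longrightarrow> H +>\<^bsub>M\<^esub> n = H +>\<^bsub>M\<^esub> m"
    and coset_zero: "H +>\<^bsub>M\<^esub> \<zero>\<^bsub>M\<^esub> = H"
    and quotient_carrier: "carrier (quotient_module M H) = (\<lambda>m. H +>\<^bsub>M\<^esub> m) ` carrier M"
    and quotient_add: "\<lbrakk>m \<in> carrier M; n \<in> carrier M\<rbrakk> \<Longrightarrow>
      (H +>\<^bsub>M\<^esub> m) \<oplus>\<^bsub>quotient_module M H\<^esub> (H +>\<^bsub>M\<^esub> n) = H +>\<^bsub>M\<^esub> (m \<oplus>\<^bsub>M\<^esub> n)"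
    and quotient_smult: "\<lbrakk>a \<in> carrier K; m \<in> carrier M\<rbrakk> \<Longrightarrow>
      a \<odot>\<^bsub>quotient_module M H\<^esub> (H +>\<^bsub>M\<^esub> m) = H +>\<^bsub>M\<^esub> (a \<odot>\<^bsub>M\<^esub> m)"
    and module_quotient: "Module.module K (quotient_module M H)"
    and quotient_lin: "(\<lambda>m\<in>carrier M. H +>\<^bsub>M\<^esub> m) \<in> lin_maps K M (quotient_module M H)"
proof -
  interpret Module.module K M by fact
  note HM = module_submoduleD[OF M H]
  interpret H: abelian_subgroup H M
    by (rule abelian_subgroupI3)
      (simp_all add: additive_subgroupI submodule.axioms(1)[OF H] module_abelian[OF M])
  show eq: "H +>\<^bsub>M\<^esub> m = H +>\<^bsub>M\<^esub> n \<longleftrightarrow> m \<ominus>\<^bsub>M\<^esub> n \<in> H" if "m \<in> carrier M" "n \<in> carrier M" for m n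
    using H.a_rcos_module[OF that(2,1)] H.a_repr_independence'[of m n] H.a_rcos_self[OF that(1)] that
    unfolding a_minus_def by auto
  show self: "m \<in> H +>\<^bsub>M\<^esub> m" if "m \<in> carrier M" for m
    using that by (rule H.a_rcos_self)
  show sub: "H +>\<^bsub>M\<^esub> m \<subseteq> carrier M" if "m \<in> carrier M" for m
    using that by (intro a_r_coset_subset_G HM)
  show mem: "H +>\<^bsub>M\<^esub> n = H +>\<^bsub>M\<^esub> m" if "m \<in> carrier M" "n \<in> H +>\<^bsub>M\<^esub> m" for m n
    using H.a_repr_independence'[OF that(2,1)] by simp
  show z: "H +>\<^bsub>M\<^esub> \<zero>\<^bsub>M\<^esub> = H" using HM by simp
  show c: "carrier (quotient_module M H) = (\<lambda>m. H +>\<^bsub>M\<^esub> m) ` carrier M"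
    by (simp add: quotient_module_def A_RCOSETS_def' UNION_singleton_eq_range)
  show add: "(H +>\<^bsub>M\<^esub> m) \<oplus>\<^bsub>quotient_module M H\<^esub> (H +>\<^bsub>M\<^esub> n) = H +>\<^bsub>M\<^esub> (m \<oplus>\<^bsub>M\<^esub> n)"
    if "m \<in> carrier M" "n \<in> carrier M" for m n
    using that by (simp add: quotient_module_def H.a_rcos_sum)
  show sm: "a \<odot>\<^bsub>quotient_module M H\<^esub> (H +>\<^bsub>M\<^esub> m) = H +>\<^bsub>M\<^esub> (a \<odot>\<^bsub>M\<^esub> m)"
    if "a \<in> carrier K" "m \<in> carrier M" for a m
  proof -
    \<comment> \<open>Scalar multiplication of a coset is a union over all its members; it is a
      single coset because all members give the same one.\<close>
    have "H +>\<^bsub>M\<^esub> (a \<odot>\<^bsub>M\<^esub> c) = H +>\<^bsub>M\<^esub> (a \<odot>\<^bsub>M\<^esub> m)" if c: "c \<in> H +>\<^bsub>M\<^esub> m" for c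
    proof -
      have cM: "c \<in> carrier M" using sub c \<open>m \<in> carrier M\<close> by auto
      have "c \<ominus>\<^bsub>M\<^esub> m \<in> H"
        using mem[OF \<open>m \<in> carrier M\<close> c] eq[OF cM \<open>m \<in> carrier M\<close>] by simp
      then have "a \<odot>\<^bsub>M\<^esub> (c \<ominus>\<^bsub>M\<^esub> m) \<in> H" using HM \<open>a \<in> carrier K\<close> by simp
      then have "a \<odot>\<^bsub>M\<^esub> c \<ominus>\<^bsub>M\<^esub> a \<odot>\<^bsub>M\<^esub> m \<in> H"
        using cM \<open>m \<in> carrier M\<close> \<open>a \<in> carrier K\<close> by (simp add: a_minus_def smult_r_distr smult_r_minus)
      then show ?thesis
        using eq[of "a \<odot>\<^bsub>M\<^esub> c" "a \<odot>\<^bsub>M\<^esub> m"] cM \<open>m \<in> carrier M\<close> \<open>a \<in> carrier K\<close> by simp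
    qed
    then have "(\<Union>c\<in>H +>\<^bsub>M\<^esub> m. H +>\<^bsub>M\<^esub> (a \<odot>\<^bsub>M\<^esub> c)) = H +>\<^bsub>M\<^esub> (a \<odot>\<^bsub>M\<^esub> m)"
      using self[OF \<open>m \<in> carrier M\<close>] by blast
    then show ?thesis by (simp add: quotient_module_def)
  qed
  show Q: "Module.module K (quotient_module M H)"
    by (rule module_image[OF M c]) (simp_all add: add sm z, simp add: quotient_module_def)
  show "(\<lambda>m\<in>carrier M. H +>\<^bsub>M\<^esub> m) \<in> lin_maps K M (quotient_module M H)"
    by (rule lin_mapsI) (simp_all add: c add sm M)
qed

lemma quotient_zero: "\<zero>\<^bsub>quotient_module M H\<^esub> = H"
  by (simp add: quotient_module_def)

text \<open>\<open>Coinv_big_map\<close> forms unions over all members of a coset. Members differ by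
  elements of \<open>H\<close>, which \<open>f\<close> sends into \<open>H'\<close>, so the union
  collapses to one coset.\<close>

lemma coset_Union_map:
  assumes M: "Module.module K M" "submodule H K M" and N: "Module.module K N" "submodule H' K N"
    and f: "f \<in> lin_maps K M N" and fH: "\<And>h. h \<in> H \<Longrightarrow> f h \<in> H'" and m: "m \<in> carrier M"
  shows "(\<Union>c\<in>H +>\<^bsub>M\<^esub> m. H' +>\<^bsub>N\<^esub> f c) = H' +>\<^bsub>N\<^esub> f m"
proof -
  have "H' +>\<^bsub>N\<^esub> f c = H' +>\<^bsub>N\<^esub> f m" if c: "c \<in> H +>\<^bsub>M\<^esub> m" for c
  proof -
    have cM: "c \<in> carrier M" using coset_subset[OF M m] c by auto
    have "c \<ominus>\<^bsub>M\<^esub> m \<in> H" using coset_mem[OF M m c] coset_eq_iff[OF M cM m] by simp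
    then have "f c \<ominus>\<^bsub>N\<^esub> f m \<in> H'" using fH lin_maps_minus[OF f M(1) N(1) cM m] by fastforce
    then show ?thesis
      using coset_eq_iff[OF N lin_mapsD(1)[OF f cM] lin_mapsD(1)[OF f m]] by simp
  qed
  then show ?thesis using coset_self[OF M m] by blast
qed

text \<open>A representative is chosen, as the target is an arbitrary module in which no union of
  cosets can be formed. The choice is harmless when \<open>f\<close> kills \<open>H\<close>.\<close>

definition quotient_map :: "('k, 'u) module \<Rightarrow> 'u set \<Rightarrow> ('u \<Rightarrow> 'v) \<Rightarrow> 'u set \<Rightarrow> 'v" where
  "quotient_map M H f = (\<lambda>C\<in>carrier (quotient_module M H). f (SOME c. c \<in> C))"

lemma
  assumes M: "Module.module K M" "submodule H K M" and N: "Module.module K N"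
    and f: "f \<in> lin_maps K M N" and fH: "\<And>h. h \<in> H \<Longrightarrow> f h = \<zero>\<^bsub>N\<^esub>"
  shows quotient_map_coset: "\<And>m. m \<in> carrier M \<Longrightarrow> quotient_map M H f (H +>\<^bsub>M\<^esub> m) = f m"
    and quotient_map_lin: "quotient_map M H f \<in> lin_maps K (quotient_module M H) N"
proof -
  interpret N: Module.module K N by fact
  show c: "quotient_map M H f (H +>\<^bsub>M\<^esub> m) = f m" if m: "m \<in> carrier M" for m
  proof -
    define c where "c = (SOME c. c \<in> H +>\<^bsub>M\<^esub> m)"
    have c: "c \<in> H +>\<^bsub>M\<^esub> m" unfolding c_def using coset_self[OF M m] by (rule someI)
    then have cM: "c \<in> carrier M" using coset_subset[OF M m] by auto
    have "c \<ominus>\<^bsub>M\<^esub> m \<in> H" using coset_mem[OF M m c] coset_eq_iff[OF M cM m] by simp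
    then have "f c \<ominus>\<^bsub>N\<^esub> f m = \<zero>\<^bsub>N\<^esub>" using fH lin_maps_minus[OF f M(1) N cM m] by fastforce
    then have "f c = f m" using lin_mapsD(1)[OF f] cM m by (simp add: module_minus_eq_zero[OF N])
    then show ?thesis using m by (auto simp: quotient_map_def quotient_carrier[OF M] c_def)
  qed
  have "(\<lambda>C\<in>carrier (quotient_module M H). quotient_map M H f C) \<in> lin_maps K (quotient_module M H) N"
    by (rule lin_mapsI)
      (auto simp: quotient_carrier[OF M] quotient_add[OF M] quotient_smult[OF M] c moduleD[OF M(1)]
        lin_mapsD[OF f] intro: module_quotient[OF M])
  then show "quotient_map M H f \<in> lin_maps K (quotient_module M H) N"
    by (simp add: quotient_map_def restrict_def cong: if_cong)
qed

subsection \<open>Isomorphic copies\<close>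

text \<open>The condition under which the choice in \<open>to_copy\<close> yields an injection. It
  concerns a carrier and not a type, since a carrier can be much smaller than its type.\<close>

definition embeds :: "'b set \<Rightarrow> 'u itself \<Rightarrow> bool" where
  "embeds A _ \<longleftrightarrow> (\<exists>e :: 'b \<Rightarrow> 'u. inj_on e A)"

lemma embedsI: "inj_on (e :: 'b \<Rightarrow> 'u) A \<Longrightarrow> embeds A TYPE('u)"
  by (auto simp: embeds_def)

lemma embeds_subset: "embeds B TYPE('u) \<Longrightarrow> A \<subseteq> B \<Longrightarrow> embeds A TYPE('u)"
  by (auto simp: embeds_def intro: inj_on_subset)

lemma to_copy_inj:
  assumes "embeds (carrier P) TYPE('u)"
  shows "inj_on (to_copy P :: 'b \<Rightarrow> 'u) (carrier P)"
  using assms unfolding to_copy_def embeds_def by (rule someI_ex)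

lemma of_copy_to_copy:
  assumes "embeds (carrier P) TYPE('u)" "p \<in> carrier P"
  shows "of_copy P (to_copy P p :: 'u) = p"
  unfolding of_copy_def by (rule inv_into_f_f[OF to_copy_inj[OF assms(1)] assms(2)])

lemma copy_simps:
  assumes P: "embeds (carrier P) TYPE('u)"
  shows "carrier (copy P :: ('k, 'u) module) = to_copy P ` carrier P"
    "\<zero>\<^bsub>copy P :: ('k, 'u) module\<^esub> = to_copy P \<zero>\<^bsub>P\<^esub>"
    "p \<in> carrier P \<Longrightarrow> q \<in> carrier P \<Longrightarrow>
      (to_copy P p :: 'u) \<oplus>\<^bsub>copy P :: ('k, 'u) module\<^esub> to_copy P q = to_copy P (p \<oplus>\<^bsub>P\<^esub> q)"
    "p \<in> carrier P \<Longrightarrow> a \<odot>\<^bsub>copy P :: ('k, 'u) module\<^esub> to_copy P p = to_copy P (a \<odot>\<^bsub>P\<^esub> p)"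
  by (simp_all add: copy_def of_copy_to_copy[OF P])

lemma module_copy:
  assumes P: "embeds (carrier P) TYPE('u)" and M: "Module.module K P"
  shows "Module.module K (copy P :: ('k, 'u) module)"
  by (rule module_image[OF M, where p="to_copy P"]) (simp_all add: copy_simps[OF P])

lemma to_copy_lin:
  assumes P: "embeds (carrier P) TYPE('u)" and M: "Module.module K P"
  shows "(\<lambda>p\<in>carrier P. to_copy P p) \<in> lin_maps K P (copy P :: ('k, 'u) module)"
  by (rule lin_mapsI) (simp_all add: copy_simps[OF P] M)

lemma of_copy_lin:
  assumes P: "embeds (carrier P) TYPE('u)" and M: "Module.module K P"
  shows "(\<lambda>u\<in>carrier (copy P :: ('k, 'u) module). of_copy P u) \<in> lin_maps K (copy P :: ('k, 'u) module) P"
  by (rule lin_mapsI)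
    (auto simp: copy_simps[OF P] of_copy_to_copy[OF P] moduleD[OF M] intro: module_copy[OF P M])

lemma to_copy_of_copy:
  assumes P: "embeds (carrier P) TYPE('u)" and u: "u \<in> carrier (copy P :: ('k, 'u) module)"
  shows "to_copy P (of_copy P u) = u" "of_copy P u \<in> carrier P"
  using u by (auto simp: copy_simps[OF P] of_copy_to_copy[OF P])

section \<open>Embeddings into the universe\<close>

lemma embeds_image:
  assumes g: "inj_on g A" "g ` A \<subseteq> B" and B: "embeds B TYPE('u)"
  shows "embeds A TYPE('u)"
proof -
  obtain e :: "_ \<Rightarrow> 'u" where "inj_on e B" using B by (auto simp: embeds_def)
  then have "inj_on (\<lambda>a. e (g a)) A" using g by (auto simp: inj_on_def image_subset_iff)
  then show ?thesis by (rule embedsI)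
qed

text \<open>A function on \<open>'j\<close> is spread over the range of \<open>g\<close> and made
  constant elsewhere; its values are read back along \<open>g\<close>.\<close>

lemma closed_universe_inj:
  assumes g: "inj (g :: 'j \<Rightarrow> 'i)" and U: "closed_universe TYPE('i) TYPE('u)"
  shows "embeds (UNIV :: ('j \<Rightarrow> 'u) set) TYPE('u)"
proof -
  obtain e :: "('i \<Rightarrow> 'u) \<Rightarrow> 'u" where "inj e" using U by (auto simp: closed_universe_def)
  moreover have "inj (\<lambda>f i. if i \<in> range g then f (inv_into UNIV g i) else undefined :: 'u)"
  proof (rule injI, rule ext)
    fix f f' :: "'j \<Rightarrow> 'u" and j
    assume "(\<lambda>i. if i \<in> range g then f (inv_into UNIV g i) else undefined) = (\<lambda>i. if i \<in> range g then f' (inv_into UNIV g i) else undefined)"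
    from fun_cong[OF this, of "g j"] show "f j = f' j" using g by simp
  qed
  ultimately show ?thesis
    by (intro embeds_image[of "\<lambda>f i. if i \<in> range g then f (inv_into UNIV g i) else undefined" UNIV UNIV])
      (auto intro: embedsI)
qed

text \<open>Each value is coded by the injection of its own factor. Outside \<open>I\<close> all
  members of the product agree, so nothing has to be recovered there.\<close>

lemma embeds_funs:
  fixes I :: "'i set"
  assumes "embeds (UNIV :: ('i \<Rightarrow> 'u) set) TYPE('u)" and A: "\<And>i. i \<in> I \<Longrightarrow> embeds (A i) TYPE('u)"
  shows "embeds (\<Pi>\<^sub>E i\<in>I. A i) TYPE('u)"
proof -
  have "\<forall>i\<in>I. \<exists>e :: _ \<Rightarrow> 'u. inj_on e (A i)" using A by (auto simp: embeds_def)
  then obtain e :: "'i \<Rightarrow> _ \<Rightarrow> 'u" where e: "\<And>i. i \<in> I \<Longrightarrow> inj_on (e i) (A i)" by metis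
  have "inj_on (\<lambda>f i. e i (f i)) (\<Pi>\<^sub>E i\<in>I. A i)"
  proof (rule inj_onI)
    fix f f' assume f: "f \<in> (\<Pi>\<^sub>E i\<in>I. A i)" "f' \<in> (\<Pi>\<^sub>E i\<in>I. A i)" and eq: "(\<lambda>i. e i (f i)) = (\<lambda>i. e i (f' i))"
    show "f = f'"
    proof (rule PiE_ext[OF f])
      fix i assume "i \<in> I"
      then show "f i = f' i" using fun_cong[OF eq, of i] f by (intro inj_onD[OF e]) auto
    qed
  qed
  then show ?thesis by (rule embeds_image) (auto intro: assms(1))
qed

text \<open>A coset is recovered from any of its elements, so a chosen representative codes it: a
  quotient is no larger than the module.\<close>

lemma embeds_quotient:
  fixes M :: "('k, 'u) module" and K :: "'k ring"
  assumes M: "Module.module K M" "submodule H K M"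
  shows "embeds (carrier (quotient_module M H)) TYPE('u)"
proof -
  have "inj_on (\<lambda>C. SOME c. c \<in> C) (carrier (quotient_module M H))"
  proof (rule inj_onI)
    fix C C' assume *: "C \<in> carrier (quotient_module M H)" "C' \<in> carrier (quotient_module M H)"
      "(SOME c. c \<in> C) = (SOME c. c \<in> C')"
    have "H +>\<^bsub>M\<^esub> (SOME c. c \<in> C) = C" if C: "C \<in> carrier (quotient_module M H)" for C
    proof -
      obtain m where m: "m \<in> carrier M" "C = H +>\<^bsub>M\<^esub> m" using C by (auto simp: quotient_carrier[OF M])
      then have "(SOME c. c \<in> C) \<in> C" using coset_self[OF M] by (metis someI)
      then show ?thesis using coset_mem[OF M m(1)] m(2) by simp
    qed
    from this[OF *(1)] this[OF *(2)] *(3) show "C = C'" by metis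
  qed
  then show ?thesis by (rule embedsI)
qed

text \<open>The summands of the index type serve different constructions: points for families over
  \<open>X\<close>, scalars for \<open>K\<close> itself and for maps out of \<open>K\<close>,
  naturals for lists and hence for finitely supported functions and rationals.\<close>

locale universe =
  fixes T :: "('x + 'k + nat) itself" and U :: "'u itself"
  assumes closed: "closed_universe TYPE('x + 'k + nat) TYPE('u)"
begin

lemma embeds_x: "embeds (UNIV :: ('x \<Rightarrow> 'u) set) TYPE('u)"
  and embeds_k: "embeds (UNIV :: ('k \<Rightarrow> 'u) set) TYPE('u)"
  and embeds_nat: "embeds (UNIV :: (nat \<Rightarrow> 'u) set) TYPE('u)"
proof -
  show "embeds (UNIV :: ('x \<Rightarrow> 'u) set) TYPE('u)"
    by (rule closed_universe_inj[OF _ closed, of Inl]) simp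
  show "embeds (UNIV :: ('k \<Rightarrow> 'u) set) TYPE('u)"
    by (rule closed_universe_inj[OF _ closed, of "\<lambda>k. Inr (Inl k)"]) (simp add: inj_def)
  show "embeds (UNIV :: (nat \<Rightarrow> 'u) set) TYPE('u)"
    by (rule closed_universe_inj[OF _ closed, of "\<lambda>n. Inr (Inr n)"]) (simp add: inj_def)
qed

end

text \<open>Two distinct elements are what indicator functions are written with; through them index
  elements acquire codes in \<open>'u\<close>.\<close>

locale nontrivial_universe = universe T U for T :: "('x + 'k + nat) itself" and U :: "'u itself" +
  fixes a0 a1 :: 'u
  assumes nontrivial: "a0 \<noteq> a1"
begin

lemma embeds_char:
  assumes "embeds (UNIV :: ('i \<Rightarrow> 'u) set) TYPE('u)"
  shows "embeds (UNIV :: 'i set) TYPE('u)"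
proof (rule embeds_image[OF _ _ assms])
  show "inj (\<lambda>(i :: 'i) j. if j = i then a0 else a1)"
  proof (rule injI)
    fix i i' :: 'i assume "(\<lambda>j. if j = i then a0 else a1) = (\<lambda>j. if j = i' then a0 else a1)"
    from fun_cong[OF this, of i] show "i = i'" using nontrivial by (simp split: if_splits)
  qed
qed simp

text \<open>The even entries of the sequence mark the length of the list, the odd ones carry its elements.\<close>

lemma embeds_list: "embeds (UNIV :: 'u list set) TYPE('u)"
proof (rule embeds_image[OF _ _ embeds_nat])
  let ?c = "\<lambda>(xs :: 'u list) n. if even n then if n div 2 < length xs then a0 else a1
    else if n div 2 < length xs then xs ! (n div 2) else a1"
  show "inj ?c"
  proof (rule injI)
    fix xs ys assume eq: "?c xs = ?c ys"
    have len: "i < length xs \<longleftrightarrow> i < length ys" for i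
      using fun_cong[OF eq, of "2 * i"] nontrivial by (simp split: if_splits)
    then have "length xs = length ys" by (metis less_irrefl linorder_neqE_nat)
    moreover have "xs ! i = ys ! i" if "i < length xs" for i
      using fun_cong[OF eq, of "2 * i + 1"] that len[of i] by simp
    ultimately show "xs = ys" by (simp add: nth_equalityI)
  qed
qed simp

lemma embeds_prod:
  assumes A: "embeds A TYPE('u)" and B: "embeds B TYPE('u)"
  shows "embeds (A \<times> B) TYPE('u)"
proof -
  obtain e :: "_ \<Rightarrow> 'u" and e' :: "_ \<Rightarrow> 'u" where "inj_on e A" "inj_on e' B"
    using A B by (auto simp: embeds_def)
  then have "inj_on (\<lambda>p. [e (fst p), e' (snd p)]) (A \<times> B)" by (auto simp: inj_on_def)
  then show ?thesis by (rule embeds_image[OF _ _ embeds_list]) simp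
qed

lemma embeds_Fpow:
  assumes A: "embeds A TYPE('u)"
  shows "embeds (Fpow A) TYPE('u)"
proof -
  obtain e :: "_ \<Rightarrow> 'u" where e: "inj_on e A" using A by (auto simp: embeds_def)
  have ex: "\<exists>xs. set xs = S" if "S \<in> Fpow A" for S using that finite_list by (auto simp: Fpow_def)
  \<comment> \<open>A finite set is coded by the image under \<open>e\<close> of an enumeration of
    it; the set of entries of that list is the image of the set, which determines it.\<close>
  have "inj_on (\<lambda>S. map e (SOME xs. set xs = S)) (Fpow A)"
  proof (rule inj_onI)
    fix S S' assume S: "S \<in> Fpow A" and S': "S' \<in> Fpow A"
      and eq: "map e (SOME xs. set xs = S) = map e (SOME xs. set xs = S')"
    have "e ` S = e ` S'"
      using arg_cong[OF eq, of set] someI_ex[OF ex[OF S]] someI_ex[OF ex[OF S']] by simp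
    then show "S = S'" using S S' inj_on_image_eq_iff[OF e] by (auto simp: Fpow_def)
  qed
  then show ?thesis by (rule embeds_image[OF _ _ embeds_list]) simp
qed

text \<open>Such a function is determined by its graph over the support, a finite subset of
  \<open>I \<times> C\<close>.\<close>

lemma embeds_fin_support:
  assumes I: "embeds I TYPE('u)" and C: "embeds C TYPE('u)"
  shows "embeds {f \<in> I \<rightarrow>\<^sub>E C. finite {i \<in> I. f i \<noteq> z}} TYPE('u)"
proof (rule embeds_image[OF _ _ embeds_Fpow[OF embeds_prod[OF I C]]])
  show "inj_on (\<lambda>f. {(i, f i) | i. i \<in> I \<and> f i \<noteq> z}) {f \<in> I \<rightarrow>\<^sub>E C. finite {i \<in> I. f i \<noteq> z}}"
  proof (rule inj_onI)
    fix f g assume f: "f \<in> {f \<in> I \<rightarrow>\<^sub>E C. finite {i \<in> I. f i \<noteq> z}}" and g: "g \<in> {f \<in> I \<rightarrow>\<^sub>E C. finite {i \<in> I. f i \<noteq> z}}"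
      and eq: "{(i, f i) | i. i \<in> I \<and> f i \<noteq> z} = {(i, g i) | i. i \<in> I \<and> g i \<noteq> z}"
    show "f = g"
    proof (rule PiE_ext[of f I "\<lambda>_. C"])
      fix i assume "i \<in> I"
      then have "(f i \<noteq> z \<and> f i = c) = (g i \<noteq> z \<and> g i = c)" for c
        using eq by (auto simp: set_eq_iff)
      from this[of "f i"] this[of "g i"] show "f i = g i" by (cases "f i = z") auto
    qed (use f g in auto)
  qed
  show "(\<lambda>f. {(i, f i) | i. i \<in> I \<and> f i \<noteq> z}) ` {f \<in> I \<rightarrow>\<^sub>E C. finite {i \<in> I. f i \<noteq> z}} \<subseteq> Fpow (I \<times> C)"
  proof (rule image_subsetI)
    fix f assume f: "f \<in> {f \<in> I \<rightarrow>\<^sub>E C. finite {i \<in> I. f i \<noteq> z}}"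
    have "{(i, f i) | i. i \<in> I \<and> f i \<noteq> z} = (\<lambda>i. (i, f i)) ` {i \<in> I. f i \<noteq> z}" by auto
    then show "{(i, f i) | i. i \<in> I \<and> f i \<noteq> z} \<in> Fpow (I \<times> C)"
      using f by (auto simp: Fpow_def)
  qed
qed

text \<open>Rationals are enumerated by naturals, and a natural is coded by its indicator
  sequence.\<close>

lemma embeds_rat: "embeds (UNIV :: rat set) TYPE('u)"
  using embeds_image[OF _ _ embeds_char[OF embeds_nat], of to_nat UNIV] by simp

lemma embeds_poly_mapping: "embeds (UNIV :: ('u \<Rightarrow>\<^sub>0 rat) set) TYPE('u)"
proof -
  have "embeds (UNIV :: 'u set) TYPE('u)" by (rule embedsI[of id]) simp
  from embeds_fin_support[OF this embeds_rat, of 0]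
  show ?thesis
    by (rule embeds_image[of Poly_Mapping.lookup, rotated 2])
      (auto intro: injI simp: poly_mapping_eqI)
qed

end

section \<open>Projective and injective modules\<close>

text \<open>The element type of \<open>P\<close> is independent of that of the test modules, so that
  the property can be proved for a free module in its natural type and then moved to a copy.\<close>

definition projective_mod :: "'k ring \<Rightarrow> ('k, 'v) module \<Rightarrow> 'u itself \<Rightarrow> bool" where
  "projective_mod K P _ \<longleftrightarrow> (\<forall>(A :: ('k, 'u) module) (B :: ('k, 'u) module) e f.
     Module.module K A \<and> Module.module K B \<and> e \<in> lin_maps K A B \<and> e ` carrier A = carrier B \<and>
     f \<in> lin_maps K P B \<longrightarrow> (\<exists>h\<in>lin_maps K P A. \<forall>p\<in>carrier P. e (h p) = f p))"

definition injective_mod :: "'k ring \<Rightarrow> ('k, 'v) module \<Rightarrow> 'u itself \<Rightarrow> bool" where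
  "injective_mod K J _ \<longleftrightarrow> (\<forall>(A :: ('k, 'u) module) (B :: ('k, 'u) module) i f.
     Module.module K A \<and> Module.module K B \<and> i \<in> lin_maps K A B \<and> inj_on i (carrier A) \<and>
     f \<in> lin_maps K A J \<longrightarrow> (\<exists>h\<in>lin_maps K B J. \<forall>a\<in>carrier A. h (i a) = f a))"

lemma projective_mod_copy:
  assumes P: "embeds (carrier P) TYPE('u)" "Module.module K P" and proj: "projective_mod K P TYPE('u)"
  shows "projective_mod K (copy P :: ('k, 'u) module) TYPE('u)"
  unfolding projective_mod_def
proof (intro allI impI, elim conjE)
  let ?C = "copy P :: ('k, 'u) module"
  fix A B :: "('k, 'u) module" and e f
  assume e: "Module.module K A" "Module.module K B" "e \<in> lin_maps K A B" "e ` carrier A = carrier B"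
    and f: "f \<in> lin_maps K ?C B"
  obtain h where h: "h \<in> lin_maps K P A"
    "\<And>p. p \<in> carrier P \<Longrightarrow> e (h p) = (\<lambda>p\<in>carrier P. f ((\<lambda>p\<in>carrier P. to_copy P p) p)) p"
    using proj e lin_maps_comp[OF to_copy_lin[OF P] f P(2)] unfolding projective_mod_def by meson
  have "(\<lambda>u\<in>carrier ?C. h ((\<lambda>u\<in>carrier ?C. of_copy P u) u)) \<in> lin_maps K ?C A"
    by (rule lin_maps_comp[OF of_copy_lin[OF P] h(1) module_copy[OF P]])
  then show "\<exists>h\<in>lin_maps K ?C A. \<forall>p\<in>carrier ?C. e (h p) = f p"
    by (rule bexI[rotated]) (simp add: h(2) to_copy_of_copy[OF P(1)])
qed

lemma injective_mod_copy:
  assumes P: "embeds (carrier P) TYPE('u)" "Module.module K P" and inj: "injective_mod K P TYPE('u)"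
  shows "injective_mod K (copy P :: ('k, 'u) module) TYPE('u)"
  unfolding injective_mod_def
proof (intro allI impI, elim conjE)
  let ?C = "copy P :: ('k, 'u) module"
  fix A B :: "('k, 'u) module" and i f
  assume i: "Module.module K A" "Module.module K B" "i \<in> lin_maps K A B" "inj_on i (carrier A)"
    and f: "f \<in> lin_maps K A ?C"
  obtain h where h: "h \<in> lin_maps K B P"
    "\<And>a. a \<in> carrier A \<Longrightarrow> h (i a) = (\<lambda>a\<in>carrier A. (\<lambda>u\<in>carrier ?C. of_copy P u) (f a)) a"
    using inj i lin_maps_comp[OF f of_copy_lin[OF P] i(1)] unfolding injective_mod_def by meson
  have "(\<lambda>b\<in>carrier B. (\<lambda>p\<in>carrier P. to_copy P p) (h b)) \<in> lin_maps K B ?C"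
    by (rule lin_maps_comp[OF h(1) to_copy_lin[OF P] i(2)])
  then show "\<exists>h\<in>lin_maps K B ?C. \<forall>a\<in>carrier A. h (i a) = f a"
    by (rule bexI[rotated])
      (simp add: h(2) lin_mapsD(1)[OF i(3)] lin_mapsD(1)[OF f] to_copy_of_copy[OF P(1)])
qed

text \<open>\<open>K\<close> as a module over itself, taken as the degree zero component of
  \<open>shifted_ring\<close> so that the module laws established there can be reused.\<close>

definition regular_module :: "'k ring \<Rightarrow> ('k, 'k) module" where
  "regular_module K = shifted_ring K UNIV 0 0"

lemma module_regular:
  fixes K :: "'k ring"
  assumes "cring K"
  shows "Module.module K (regular_module K)"
  using shifted_ring_graded(1)[OF assms, of UNIV 0] by (auto simp: graded_modules_def regular_module_def)

lemma regular_module_simps [simp]: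
  "carrier (regular_module K) = carrier K" "\<zero>\<^bsub>regular_module K\<^esub> = \<zero>\<^bsub>K\<^esub>"
  "a \<oplus>\<^bsub>regular_module K\<^esub> b = a \<oplus>\<^bsub>K\<^esub> b" "a \<odot>\<^bsub>regular_module K\<^esub> b = a \<otimes>\<^bsub>K\<^esub> b"
  by (simp_all add: regular_module_def shifted_ring_def)

lemma smult_lin:
  assumes M: "Module.module K M" and m: "m \<in> carrier M"
  shows "(\<lambda>k\<in>carrier (regular_module K). k \<odot>\<^bsub>M\<^esub> m) \<in> lin_maps K (regular_module K) M"
  by (rule lin_mapsI[OF _ _ _ module_regular[OF module_cring[OF M]]]) (simp_all add: moduleD[OF M] m)

abbreviation free_module :: "'k ring \<Rightarrow> 'i set \<Rightarrow> ('k, 'i \<Rightarrow> 'k) module" where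
  "free_module K I \<equiv> sum_module finite I (\<lambda>_. regular_module K)"

lemma free_module_ext:
  assumes N: "Module.module K N" and h: "h \<in> lin_maps K (free_module K I) N" "h' \<in> lin_maps K (free_module K I) N"
    and eq: "\<And>i. i \<in> I \<Longrightarrow> h (dsingle I (\<lambda>_. regular_module K) i \<one>\<^bsub>K\<^esub>) = h' (dsingle I (\<lambda>_. regular_module K) i \<one>\<^bsub>K\<^esub>)"
  shows "h = h'"
proof (rule sum_lin_maps_eq[OF _ N h])
  interpret K: cring K by (rule module_cring[OF N])
  note R = module_regular[OF K.is_cring]
  fix i m assume i: "i \<in> I" and m: "m \<in> carrier (regular_module K)"
  let ?s = "dsingle I (\<lambda>_. regular_module K) i"
  have 1: "?s \<one>\<^bsub>K\<^esub> \<in> carrier (free_module K I)"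
    by (rule dsingle_closed[where K=K]) (simp_all add: i R)
  have "?s m = m \<odot>\<^bsub>free_module K I\<^esub> ?s \<one>\<^bsub>K\<^esub>"
    using m i by (auto simp: dsingle_def fun_eq_iff)
  moreover have "m \<in> carrier K" using m by simp
  ultimately show "h (?s m) = h' (?s m)"
    by (simp only: lin_mapsD(3)[OF h(1) _ 1] lin_mapsD(3)[OF h(2) _ 1] eq[OF i])
qed (simp add: module_regular[OF module_cring[OF N]])

lemma free_module_map:
  assumes N: "Module.module K N" and a: "\<And>i. i \<in> I \<Longrightarrow> a i \<in> carrier N"
  obtains h where "h \<in> lin_maps K (free_module K I) N"
    "\<And>i. i \<in> I \<Longrightarrow> h (dsingle I (\<lambda>_. regular_module K) i \<one>\<^bsub>K\<^esub>) = a i"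
proof
  interpret K: cring K by (rule module_cring[OF N])
  note R = module_regular[OF K.is_cring]
  let ?f = "\<lambda>i. \<lambda>k\<in>carrier (regular_module K). k \<odot>\<^bsub>N\<^esub> a i"
  show "sum_map N I (\<lambda>_. regular_module K) ?f \<in> lin_maps K (free_module K I) N"
    by (rule sum_map_lin[OF R N smult_lin[OF N a]])
  show "sum_map N I (\<lambda>_. regular_module K) ?f (dsingle I (\<lambda>_. regular_module K) i \<one>\<^bsub>K\<^esub>) = a i" if "i \<in> I" for i
    by (subst sum_map_single[OF R N smult_lin[OF N a]]) (simp_all add: that moduleD[OF N] a)
qed

lemma free_module_projective:
  fixes K :: "'k ring"
  assumes K: "cring K"
  shows "projective_mod K (free_module K I) TYPE('u)"
  unfolding projective_mod_def
proof (intro allI impI, elim conjE)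
  interpret K: cring K by fact
  note R = module_regular[OF K]
  have F: "Module.module K (free_module K I)"
    by (rule module_sum[OF K R support_ideal_finite])
  have s: "dsingle I (\<lambda>_. regular_module K) i \<one>\<^bsub>K\<^esub> \<in> carrier (free_module K I)" if "i \<in> I" for i
    by (rule dsingle_closed[where K=K]) (simp_all add: that R)
  fix A B :: "('k, 'u) module" and e f
  assume A: "Module.module K A" and B: "Module.module K B"
    and e: "e \<in> lin_maps K A B" "e ` carrier A = carrier B" and f: "f \<in> lin_maps K (free_module K I) B"
  have "\<forall>i\<in>I. \<exists>a\<in>carrier A. e a = f (dsingle I (\<lambda>_. regular_module K) i \<one>\<^bsub>K\<^esub>)"
  proof
    fix i assume "i \<in> I"
    from lin_mapsD(1)[OF f s[OF this]]
    show "\<exists>a\<in>carrier A. e a = f (dsingle I (\<lambda>_. regular_module K) i \<one>\<^bsub>K\<^esub>)" unfolding e(2)[symmetric] by auto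
  qed
  then obtain a where a: "\<And>i. i \<in> I \<Longrightarrow> a i \<in> carrier A"
    "\<And>i. i \<in> I \<Longrightarrow> e (a i) = f (dsingle I (\<lambda>_. regular_module K) i \<one>\<^bsub>K\<^esub>)" by metis
  obtain h where h: "h \<in> lin_maps K (free_module K I) A"
    "\<And>i. i \<in> I \<Longrightarrow> h (dsingle I (\<lambda>_. regular_module K) i \<one>\<^bsub>K\<^esub>) = a i"
    by (rule free_module_map[where a=a and I=I, OF A a(1)]) auto
  have eq: "(\<lambda>p\<in>carrier (free_module K I). e (h p)) = f"
    by (rule free_module_ext[OF B lin_maps_comp[OF h(1) e(1) F] f])
      (simp only: restrict_apply'[OF s] h(2) a(2))
  have "e (h p) = f p" if "p \<in> carrier (free_module K I)" for p
    using fun_cong[OF eq, of p] by (simp only: restrict_apply'[OF that])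
  with h(1) show "\<exists>h\<in>lin_maps K (free_module K I) A. \<forall>p\<in>carrier (free_module K I). e (h p) = f p"
    by blast
qed

text \<open>With a single element every carrier is the whole type and every equation between
  elements holds, so any function is linear.\<close>

lemma trivial_universe_lin:
  assumes triv: "\<And>a b :: 'u. a = b"
    and A: "Module.module K (A :: ('k, 'u) module)" and B: "Module.module K (B :: ('k, 'u) module)"
  shows "(h :: 'u \<Rightarrow> 'u) \<in> lin_maps K A B"
proof -
  have c: "carrier A = UNIV" "carrier B = UNIV"
    using moduleD(1)[OF A] moduleD(1)[OF B] triv by (metis UNIV_eq_I)+
  show ?thesis
    unfolding lin_maps_def using c triv[of "h _"] by auto
qed

text \<open>The free module on all elements of \<open>M\<close> maps onto \<open>M\<close> by
  sending each basis vector to the element that indexes it.\<close>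

lemma (in universe) enough_projective_modules:
  fixes M :: "('k, 'u) module" and K :: "'k ring"
  assumes M: "Module.module K M"
  obtains P :: "('k, 'u) module" and e where "Module.module K P" "projective_mod K P TYPE('u)"
    "e \<in> lin_maps K P M" "e ` carrier P = carrier M"
proof (cases "\<exists>a0 a1 :: 'u. a0 \<noteq> a1")
  case True
  then obtain a0 a1 :: 'u where "a0 \<noteq> a1" by auto
  then interpret nontrivial_universe T U a0 a1 by unfold_locales
  note K = module_cring[OF M]
  interpret K: cring K by (rule K)
  let ?F = "free_module K (carrier M)"
  note R = module_regular[OF K]
  have F: "Module.module K ?F"
    by (rule module_sum[OF K R support_ideal_finite])
  \<comment> \<open>These are finitely supported functions from \<open>M\<close> to
    \<open>K\<close>: the elements of \<open>M\<close> lie in \<open>'u\<close> already, and scalars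
    are coded by indicator functions on \<open>'k\<close>.\<close>
  have emb: "embeds (carrier ?F) TYPE('u)"
    using embeds_fin_support[of "carrier M" "carrier K" "\<zero>\<^bsub>K\<^esub>"]
      embeds_subset[OF embeds_char[OF embeds_k], of "carrier K"] embedsI[of id "carrier M"] by simp
  obtain e where e: "e \<in> lin_maps K ?F M"
    "\<And>m. m \<in> carrier M \<Longrightarrow> e (dsingle (carrier M) (\<lambda>_. regular_module K) m \<one>\<^bsub>K\<^esub>) = m"
    by (rule free_module_map[OF M, where a=id and I="carrier M"]) auto
  let ?C = "copy ?F :: ('k, 'u) module"
  show ?thesis
  proof (rule that)
    show "Module.module K ?C" by (rule module_copy[OF emb F])
    show "projective_mod K ?C TYPE('u)" by (rule projective_mod_copy[OF emb F free_module_projective[OF K]])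
    let ?e = "\<lambda>u\<in>carrier ?C. e ((\<lambda>u\<in>carrier ?C. of_copy ?F u) u)"
    show l: "?e \<in> lin_maps K ?C M"
      by (rule lin_maps_comp[OF of_copy_lin[OF emb F] e(1) module_copy[OF emb F]])
    have "m \<in> ?e ` carrier ?C" if m: "m \<in> carrier M" for m
    proof (rule image_eqI)
      let ?s = "dsingle (carrier M) (\<lambda>_. regular_module K) m \<one>\<^bsub>K\<^esub>"
      have s: "?s \<in> carrier ?F" by (rule dsingle_closed[where K=K]) (simp_all add: m R)
      then show "to_copy ?F ?s \<in> carrier ?C" unfolding copy_simps(1)[OF emb] by (rule imageI)
      then show "m = ?e (to_copy ?F ?s)" by (simp only: restrict_apply' of_copy_to_copy[OF emb s] e(2)[OF m])
    qed
    then show "?e ` carrier ?C = carrier M" using lin_mapsD(1)[OF l] by blast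
  qed
next
  case False
  then have triv: "a = b" for a b :: 'u by blast
  have "projective_mod K M TYPE('u)"
    unfolding projective_mod_def using trivial_universe_lin[OF triv M] triv by blast
  moreover have "(\<lambda>u\<in>carrier M. u) ` carrier M = carrier M" by simp
  ultimately show ?thesis
    using that[OF M _ trivial_universe_lin[OF triv M M]] by blast
qed

subsection \<open>Divisible groups\<close>

text \<open>Divisible abelian groups are injective. Zorn's lemma gives a maximal partial extension
  of \<open>f\<close>; divisibility supplies a value at any further \<open>b\<close>, so by
  maximality the extension is total.\<close>

lemma divisible_extension:
  assumes B: "comm_group B" and D: "comm_group D"
    and div: "\<And>y (n :: nat). y \<in> carrier D \<Longrightarrow> n > 0 \<Longrightarrow> \<exists>z\<in>carrier D. z [^]\<^bsub>D\<^esub> n = y"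
    and A: "subgroup A B" and f: "f \<in> hom (B\<lparr>carrier := A\<rparr>) D"
  obtains h where "h \<in> hom B D" "\<And>a. a \<in> A \<Longrightarrow> h a = f a"
proof -
  interpret B: comm_group B by fact
  interpret D: comm_group D by fact
  interpret A: subgroup A B by fact
  interpret f: group_hom "B\<lparr>carrier := A\<rparr>" D f
    using B.subgroup_imp_group[OF A] f D.is_group by (simp add: group_hom_def group_hom_axioms_def)
  \<comment> \<open>Partial homomorphisms are kept as graphs, so that upper bounds of chains are
    unions. Single-valuedness is encoded by the fibre over the unit, which suffices for a subgroup
    of the product.\<close>
  define ext where "ext R \<longleftrightarrow> R \<subseteq> carrier B \<times> carrier D \<and>
    (\<forall>b y b' y'. (b, y) \<in> R \<longrightarrow> (b', y') \<in> R \<longrightarrow> (b \<otimes>\<^bsub>B\<^esub> b', y \<otimes>\<^bsub>D\<^esub> y') \<in> R) \<and>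
    (\<forall>b y. (b, y) \<in> R \<longrightarrow> (inv\<^bsub>B\<^esub> b, inv\<^bsub>D\<^esub> y) \<in> R) \<and>
    (\<forall>y. (\<one>\<^bsub>B\<^esub>, y) \<in> R \<longrightarrow> y = \<one>\<^bsub>D\<^esub>) \<and> (\<forall>a\<in>A. (a, f a) \<in> R)" for R
  have fA: "f (a \<otimes>\<^bsub>B\<^esub> a') = f a \<otimes>\<^bsub>D\<^esub> f a'" if "a \<in> A" "a' \<in> A" for a a'
    using f.hom_mult that by simp
  have fi: "f (inv\<^bsub>B\<^esub> a) = inv\<^bsub>D\<^esub> (f a)" if "a \<in> A" for a
    using f.hom_inv[of a] that B.m_inv_consistent[OF A that] by simp
  have "ext {(a, f a) | a. a \<in> A}"
    using f.hom_one f.hom_closed A.subset unfolding ext_def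
    by (auto simp: fA fi)
  then have ne: "Collect ext \<noteq> {}" by auto
  obtain R where R: "ext R" and max: "\<And>S. ext S \<Longrightarrow> R \<subseteq> S \<Longrightarrow> S = R"
  proof -
    have "\<exists>M\<in>Collect ext. \<forall>X\<in>Collect ext. M \<subseteq> X \<longrightarrow> X = M"
    proof (rule subset_Zorn_nonempty[OF ne])
      fix \<C> assume C: "\<C> \<noteq> {}" "subset.chain (Collect ext) \<C>"
      then have e: "ext X" if "X \<in> \<C>" for X using that by (auto simp: subset.chain_def)
      \<comment> \<open>Two members of the union already lie in one element of the chain; this gives
        closure under multiplication.\<close>
      have two: "\<exists>Z\<in>\<C>. p \<in> Z \<and> q \<in> Z" if pq: "p \<in> \<Union>\<C>" "q \<in> \<Union>\<C>" for p q
      proof -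
        obtain Y Z where YZ: "Y \<in> \<C>" "p \<in> Y" "Z \<in> \<C>" "q \<in> Z" using pq by blast
        then have "Y \<subseteq> Z \<or> Z \<subseteq> Y" using C(2) unfolding subset_chain_def by blast
        then show ?thesis using YZ by blast
      qed
      show "\<Union>\<C> \<in> Collect ext"
        unfolding mem_Collect_eq ext_def
      proof (intro conjI allI impI ballI)
        show "\<Union>\<C> \<subseteq> carrier B \<times> carrier D" using e unfolding ext_def by blast
      next
        fix b y b' y' assume "(b, y) \<in> \<Union>\<C>" "(b', y') \<in> \<Union>\<C>"
        from two[OF this] obtain Z where "Z \<in> \<C>" "(b, y) \<in> Z" "(b', y') \<in> Z" by blast
        then show "(b \<otimes>\<^bsub>B\<^esub> b', y \<otimes>\<^bsub>D\<^esub> y') \<in> \<Union>\<C>" using e[of Z] unfolding ext_def by blast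
      next
        fix b y assume "(b, y) \<in> \<Union>\<C>"
        then show "(inv\<^bsub>B\<^esub> b, inv\<^bsub>D\<^esub> y) \<in> \<Union>\<C>" using e unfolding ext_def by blast
      next
        fix y assume "(\<one>\<^bsub>B\<^esub>, y) \<in> \<Union>\<C>"
        then show "y = \<one>\<^bsub>D\<^esub>" using e unfolding ext_def by blast
      next
        fix a assume "a \<in> A"
        then show "(a, f a) \<in> \<Union>\<C>" using C(1) e unfolding ext_def by blast
      qed
    qed
    then show ?thesis using that by auto
  qed
  have Rc: "b \<in> carrier B" "y \<in> carrier D" if "(b, y) \<in> R" for b y
    using R that unfolding ext_def by auto
  have Rm: "(b \<otimes>\<^bsub>B\<^esub> b', y \<otimes>\<^bsub>D\<^esub> y') \<in> R" if "(b, y) \<in> R" "(b', y') \<in> R" for b b' y y'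
    using R that unfolding ext_def by blast
  have Ri: "(inv\<^bsub>B\<^esub> b, inv\<^bsub>D\<^esub> y) \<in> R" if "(b, y) \<in> R" for b y
    using R that unfolding ext_def by blast
  have R1: "y = \<one>\<^bsub>D\<^esub>" if "(\<one>\<^bsub>B\<^esub>, y) \<in> R" for y
    using R that unfolding ext_def by blast
  have RA: "(a, f a) \<in> R" if "a \<in> A" for a
    using R that unfolding ext_def by blast
  have Ro: "(\<one>\<^bsub>B\<^esub>, \<one>\<^bsub>D\<^esub>) \<in> R" using RA[OF A.one_closed] f.hom_one by simp
  have Rp: "(b [^]\<^bsub>B\<^esub> n, y [^]\<^bsub>D\<^esub> n) \<in> R" if "(b, y) \<in> R" for b y and n :: int
  proof -
    have *: "(b [^]\<^bsub>B\<^esub> k, y [^]\<^bsub>D\<^esub> k) \<in> R" for k :: nat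
      by (induction k) (use that in \<open>simp_all add: Ro Rm\<close>)
    show ?thesis
      by (cases n rule: int_cases2) (use *[THEN Ri] * Rc[OF that] in \<open>simp_all add: int_pow_int B.int_pow_neg_int D.int_pow_neg_int\<close>)
  qed
  have uniq: "y = y'" if "(b, y) \<in> R" "(b, y') \<in> R" for b y y'
  proof -
    have "(b \<otimes>\<^bsub>B\<^esub> inv\<^bsub>B\<^esub> b, y \<otimes>\<^bsub>D\<^esub> inv\<^bsub>D\<^esub> y') \<in> R" using that by (intro Rm Ri)
    then have "y \<otimes>\<^bsub>D\<^esub> inv\<^bsub>D\<^esub> y' = \<one>\<^bsub>D\<^esub>" using Rc[OF that(1)] by (intro R1) simp
    then show ?thesis using Rc[OF that(1)] Rc[OF that(2)]
      by (metis D.inv_closed D.inv_equality D.inv_inv)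
  qed
  have dom: "\<exists>y. (b, y) \<in> R" if b: "b \<in> carrier B" for b
  proof -
    text \<open>The value \<open>z\<close> at \<open>b\<close> is forced up to divisibility by the values at the powers of \<open>b\<close>
      on which the partial map is already defined.\<close>
    have "\<exists>z\<in>carrier D. \<forall>(n::int) y. (b [^]\<^bsub>B\<^esub> n, y) \<in> R \<longrightarrow> y = z [^]\<^bsub>D\<^esub> n"
    proof (cases "\<exists>k::nat. k > 0 \<and> (\<exists>y. (b [^]\<^bsub>B\<^esub> int k, y) \<in> R)")
      case True
      \<comment> \<open>The exponents whose powers of \<open>b\<close> lie in the domain are the
        multiples of the least positive one, \<open>k\<close>. A \<open>k\<close>-th root of the
        value at the \<open>k\<close>-th power therefore fits all of them.\<close>
      define k where "k = (LEAST k::nat. k > 0 \<and> (\<exists>y. (b [^]\<^bsub>B\<^esub> int k, y) \<in> R))"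
      from LeastI_ex[OF True] have k: "k > 0" "\<exists>y. (b [^]\<^bsub>B\<^esub> int k, y) \<in> R" unfolding k_def by auto
      have least: "k \<le> j" if "j > 0" "(b [^]\<^bsub>B\<^esub> int j, y) \<in> R" for j y
        unfolding k_def by (rule Least_le) (use that in auto)
      obtain y0 where y0: "(b [^]\<^bsub>B\<^esub> int k, y0) \<in> R" using k by auto
      obtain z where z: "z \<in> carrier D" "z [^]\<^bsub>D\<^esub> k = y0" using div[OF Rc(2)[OF y0] k(1)] by auto
      have "y = z [^]\<^bsub>D\<^esub> n" if y: "(b [^]\<^bsub>B\<^esub> n, y) \<in> R" for n :: int and y
      proof -
        define q where "q = n div int k"
        have q: "(b [^]\<^bsub>B\<^esub> (int k * q), y0 [^]\<^bsub>D\<^esub> q) \<in> R" using Rp[OF y0, of q] b by (simp add: B.int_pow_pow)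
        have "(b [^]\<^bsub>B\<^esub> n \<otimes>\<^bsub>B\<^esub> inv\<^bsub>B\<^esub> (b [^]\<^bsub>B\<^esub> (int k * q)), y \<otimes>\<^bsub>D\<^esub> inv\<^bsub>D\<^esub> (y0 [^]\<^bsub>D\<^esub> q)) \<in> R"
          by (intro Rm Ri y q)
        moreover have "b [^]\<^bsub>B\<^esub> n \<otimes>\<^bsub>B\<^esub> inv\<^bsub>B\<^esub> (b [^]\<^bsub>B\<^esub> (int k * q)) = b [^]\<^bsub>B\<^esub> (n mod int k)"
          using b by (simp add: q_def minus_mult_div_eq_mod flip: B.int_pow_diff)
        ultimately have m: "(b [^]\<^bsub>B\<^esub> int (nat (n mod int k)), y \<otimes>\<^bsub>D\<^esub> inv\<^bsub>D\<^esub> (y0 [^]\<^bsub>D\<^esub> q)) \<in> R"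
          using k(1) by simp
        \<comment> \<open>If it were not zero, the remainder would be a positive exponent in the
          domain smaller than \<open>k\<close>.\<close>
        have "nat (n mod int k) < k" using k(1) by (simp add: nat_less_iff)
        then have "n mod int k = 0" using least[OF _ m] k(1) by (smt (verit) zero_less_nat_eq pos_mod_sign of_nat_0_less_iff not_le)
        then have "n = int k * q" unfolding q_def by auto
        then have "y = y0 [^]\<^bsub>D\<^esub> q" using uniq y q by auto
        also have "\<dots> = z [^]\<^bsub>D\<^esub> n" unfolding \<open>n = int k * q\<close> z(2)[symmetric]
          using z(1) by (simp add: D.int_pow_pow flip: int_pow_int)
        finally show ?thesis .
      qed
      with z(1) show ?thesis by blast
    next
      case False
      \<comment> \<open>No nonzero power of \<open>b\<close> lies in the domain, so any value is
        consistent; the unit is taken.\<close>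
      have "y = \<one>\<^bsub>D\<^esub> [^]\<^bsub>D\<^esub> n" if y: "(b [^]\<^bsub>B\<^esub> n, y) \<in> R" for n :: int and y
      proof -
        have "(b [^]\<^bsub>B\<^esub> int (nat \<bar>n\<bar>), if n \<ge> 0 then y else inv\<^bsub>D\<^esub> y) \<in> R"
          using y Ri[OF y] b by (auto simp: B.int_pow_neg)
        then have "n = 0" using False by (metis zero_less_abs_iff zero_less_nat_eq)
        then show ?thesis using y R1 by simp
      qed
      then show ?thesis by blast
    qed
    then obtain z where z: "z \<in> carrier D" "\<And>n y. (b [^]\<^bsub>B\<^esub> (n::int), y) \<in> R \<Longrightarrow> y = z [^]\<^bsub>D\<^esub> n" by blast
    \<comment> \<open>\<open>S\<close> is the subgroup generated by \<open>R\<close> and the pair of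
      \<open>b\<close> and \<open>z\<close>; maximality will force \<open>S = R\<close>.\<close>
    define S where "S = {(c \<otimes>\<^bsub>B\<^esub> b [^]\<^bsub>B\<^esub> n, y \<otimes>\<^bsub>D\<^esub> z [^]\<^bsub>D\<^esub> n) | c y (n::int). (c, y) \<in> R}"
    have SI: "(c \<otimes>\<^bsub>B\<^esub> b [^]\<^bsub>B\<^esub> n, y \<otimes>\<^bsub>D\<^esub> z [^]\<^bsub>D\<^esub> n) \<in> S" if "(c, y) \<in> R" for c y and n :: int
      unfolding S_def using that by blast
    have RS: "R \<subseteq> S"
    proof (rule subrelI)
      fix c y assume "(c, y) \<in> R"
      then show "(c, y) \<in> S" using SI[of c y 0] Rc by simp
    qed
    have "ext S"
      unfolding ext_def
    proof (intro conjI allI impI ballI)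
      show "S \<subseteq> carrier B \<times> carrier D" unfolding S_def using Rc b z(1) by auto
    next
      fix c y c' y' assume "(c, y) \<in> S" "(c', y') \<in> S"
      then obtain r s r' s' and n n' :: int where *: "(r, s) \<in> R" "(r', s') \<in> R"
        "c = r \<otimes>\<^bsub>B\<^esub> b [^]\<^bsub>B\<^esub> n" "y = s \<otimes>\<^bsub>D\<^esub> z [^]\<^bsub>D\<^esub> n" "c' = r' \<otimes>\<^bsub>B\<^esub> b [^]\<^bsub>B\<^esub> n'" "y' = s' \<otimes>\<^bsub>D\<^esub> z [^]\<^bsub>D\<^esub> n'"
        unfolding S_def by auto
      have "c \<otimes>\<^bsub>B\<^esub> c' = (r \<otimes>\<^bsub>B\<^esub> r') \<otimes>\<^bsub>B\<^esub> b [^]\<^bsub>B\<^esub> (n + n')" "y \<otimes>\<^bsub>D\<^esub> y' = (s \<otimes>\<^bsub>D\<^esub> s') \<otimes>\<^bsub>D\<^esub> z [^]\<^bsub>D\<^esub> (n + n')"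
        using *(3-) Rc[OF *(1)] Rc[OF *(2)] b z(1)
        by (simp_all add: B.int_pow_mult D.int_pow_mult B.m_ac D.m_ac)
      then show "(c \<otimes>\<^bsub>B\<^esub> c', y \<otimes>\<^bsub>D\<^esub> y') \<in> S" using SI[OF Rm[OF *(1,2)]] by simp
    next
      fix c y assume "(c, y) \<in> S"
      then obtain r s and n :: int where *: "(r, s) \<in> R" "c = r \<otimes>\<^bsub>B\<^esub> b [^]\<^bsub>B\<^esub> n" "y = s \<otimes>\<^bsub>D\<^esub> z [^]\<^bsub>D\<^esub> n"
        unfolding S_def by auto
      have "inv\<^bsub>B\<^esub> c = inv\<^bsub>B\<^esub> r \<otimes>\<^bsub>B\<^esub> b [^]\<^bsub>B\<^esub> (- n)" "inv\<^bsub>D\<^esub> y = inv\<^bsub>D\<^esub> s \<otimes>\<^bsub>D\<^esub> z [^]\<^bsub>D\<^esub> (- n)"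
        using *(2,3) Rc[OF *(1)] b z(1)
        by (simp_all add: B.int_pow_neg D.int_pow_neg B.inv_mult D.inv_mult)
      then show "(inv\<^bsub>B\<^esub> c, inv\<^bsub>D\<^esub> y) \<in> S" using SI[OF Ri[OF *(1)]] by simp
    next
      fix y assume "(\<one>\<^bsub>B\<^esub>, y) \<in> S"
      then obtain r s and n :: int where *: "(r, s) \<in> R" "\<one>\<^bsub>B\<^esub> = r \<otimes>\<^bsub>B\<^esub> b [^]\<^bsub>B\<^esub> n" "y = s \<otimes>\<^bsub>D\<^esub> z [^]\<^bsub>D\<^esub> n"
        unfolding S_def by auto
      \<comment> \<open>Single-valuedness of \<open>S\<close>: the relation puts the
        \<open>n\<close>-th power of \<open>b\<close> into the domain of \<open>R\<close>, where
        \<open>z\<close> was chosen to agree with the value.\<close>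
      have "inv\<^bsub>B\<^esub> r = b [^]\<^bsub>B\<^esub> n" using *(2) Rc[OF *(1)] b by (metis B.inv_equality B.inv_inv B.int_pow_closed B.m_comm)
      then have "inv\<^bsub>D\<^esub> s = z [^]\<^bsub>D\<^esub> n" using z(2) Ri[OF *(1)] by simp
      then show "y = \<one>\<^bsub>D\<^esub>" unfolding *(3) using Rc(2)[OF *(1)] by (metis D.r_inv)
    next
      fix a assume "a \<in> A"
      then show "(a, f a) \<in> S" using RA RS by auto
    qed
    from max[OF this RS] have "S = R" .
    then have "(\<one>\<^bsub>B\<^esub> \<otimes>\<^bsub>B\<^esub> b [^]\<^bsub>B\<^esub> (1::int), \<one>\<^bsub>D\<^esub> \<otimes>\<^bsub>D\<^esub> z [^]\<^bsub>D\<^esub> (1::int)) \<in> R" using SI[OF Ro, of 1] by simp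
    then show ?thesis using b z(1) by auto
  qed
  then obtain h where h: "\<And>b. b \<in> carrier B \<Longrightarrow> (b, h b) \<in> R" by metis
  show ?thesis
  proof (rule that)
    show "h \<in> hom B D"
    proof (rule homI)
      fix x y assume "x \<in> carrier B" "y \<in> carrier B"
      then show "h (x \<otimes>\<^bsub>B\<^esub> y) = h x \<otimes>\<^bsub>D\<^esub> h y" by (intro uniq[OF h Rm[OF h h]] B.m_closed)
    qed (rule Rc(2)[OF h])
    show "h a = f a" if "a \<in> A" for a
      using uniq[OF h RA[OF that]] that A.subset by auto
  qed
qed

text \<open>Write the group as a free abelian group modulo the kernel of \<open>h\<close>, embed the
  free group into a rational vector space, and divide that space by the image of the kernel. The
  last conclusion bounds the size of \<open>D\<close>: each coset is coded by one of its
  elements.\<close>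

lemma divisible_hull:
  assumes A: "comm_group (A :: ('a, 'm) monoid_scheme)"
  obtains D :: "('a \<Rightarrow>\<^sub>0 rat) set monoid" and i where "comm_group D"
    and "\<And>y (n :: nat). y \<in> carrier D \<Longrightarrow> n > 0 \<Longrightarrow> \<exists>z\<in>carrier D. z [^]\<^bsub>D\<^esub> n = y"
    and "i \<in> hom A D" "inj_on i (carrier A)" "inj_on (\<lambda>C. SOME c. c \<in> C) (carrier D)"
proof -
  interpret A: comm_group A by fact
  obtain h where h: "h \<in> hom (free_Abelian_group (carrier A)) A"
    "\<And>x. x \<in> carrier A \<Longrightarrow> h (frag_of x) = x"
    using A.free_Abelian_group_universal[of id "carrier A"] by auto
  let ?F = "free_Abelian_group (carrier A)"
  interpret h: group_hom ?F A h
    using h(1) A.is_group by (simp add: group_hom_def group_hom_axioms_def)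
  define V :: "('a \<Rightarrow>\<^sub>0 rat) monoid" where "V = \<lparr>carrier = UNIV, monoid.mult = (+), one = 0\<rparr>"
  have Vs: "carrier V = UNIV" "x \<otimes>\<^bsub>V\<^esub> y = x + y" "\<one>\<^bsub>V\<^esub> = 0" for x y by (simp_all add: V_def)
  have V: "comm_group V"
    by (rule comm_groupI) (auto simp: Vs add.assoc add.commute intro: exI[of _ "- _"])
  interpret V: comm_group V by (rule V)
  have Vinv: "inv\<^bsub>V\<^esub> x = - x" for x by (rule V.inv_equality) (simp_all add: Vs)
  have Vpow: "Poly_Mapping.lookup (x [^]\<^bsub>V\<^esub> (n::nat)) a = of_nat n * Poly_Mapping.lookup x a" for x n a
    by (induction n) (simp_all add: Vs lookup_add algebra_simps)
  define \<iota> :: "('a \<Rightarrow>\<^sub>0 int) \<Rightarrow> 'a \<Rightarrow>\<^sub>0 rat" where "\<iota> = Poly_Mapping.map of_int"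
  have lk: "Poly_Mapping.lookup (\<iota> x) a = of_int (Poly_Mapping.lookup x a)" for x a
    by (simp add: \<iota>_def map.rep_eq when_def)
  have \<iota>: "\<iota> (x + y) = \<iota> x + \<iota> y" "\<iota> (- x) = - \<iota> x" "\<iota> 0 = 0" for x y
    by (auto intro!: poly_mapping_eqI simp: lk lookup_add)
  have \<iota>_inj: "x = y" if "\<iota> x = \<iota> y" for x y
    using that by (intro poly_mapping_eqI) (metis lk of_int_eq_iff)
  \<comment> \<open>The relations of \<open>A\<close>: the kernel of \<open>h\<close> on formal sums
    supported in \<open>carrier A\<close>, viewed with rational coefficients.\<close>
  define N where "N = \<iota> ` {c. Poly_Mapping.keys c \<subseteq> carrier A \<and> h c = \<one>\<^bsub>A\<^esub>}"
  have hadd: "h (x + y) = h x \<otimes>\<^bsub>A\<^esub> h y" if "Poly_Mapping.keys x \<subseteq> carrier A" "Poly_Mapping.keys y \<subseteq> carrier A" for x y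
    using h.hom_mult[of x y] that by simp
  have hmin: "h (- x) = inv\<^bsub>A\<^esub> h x" if "Poly_Mapping.keys x \<subseteq> carrier A" for x
    using h.hom_inv[of x] that by simp
  have kadd: "Poly_Mapping.keys (x + y) \<subseteq> carrier A" if "Poly_Mapping.keys x \<subseteq> carrier A" "Poly_Mapping.keys y \<subseteq> carrier A"
    for x y :: "'a \<Rightarrow>\<^sub>0 int" using that keys_add[of x y] by auto
  have N: "subgroup N V"
  proof (rule V.subgroupI)
    have "0 \<in> N" unfolding N_def using h.hom_one by (auto intro!: image_eqI[of _ _ 0] simp: \<iota>)
    then show "N \<noteq> {}" by auto
  next
    fix x assume "x \<in> N"
    then obtain c where "Poly_Mapping.keys c \<subseteq> carrier A" "h c = \<one>\<^bsub>A\<^esub>" "x = \<iota> c" unfolding N_def by auto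
    then show "inv\<^bsub>V\<^esub> x \<in> N" unfolding N_def Vinv
      by (intro image_eqI[of _ _ "- c"]) (simp_all add: \<iota> hmin)
  next
    fix x y assume "x \<in> N" "y \<in> N"
    then obtain c c' where "Poly_Mapping.keys c \<subseteq> carrier A" "h c = \<one>\<^bsub>A\<^esub>" "x = \<iota> c"
      "Poly_Mapping.keys c' \<subseteq> carrier A" "h c' = \<one>\<^bsub>A\<^esub>" "y = \<iota> c'" unfolding N_def by blast
    then show "x \<otimes>\<^bsub>V\<^esub> y \<in> N" unfolding N_def Vs
      by (intro image_eqI[of _ _ "c + c'"]) (simp_all add: \<iota> hadd kadd)
  qed (simp add: Vs)
  have Nn: "N \<lhd> V" using N V.normal_iff_subgroup by blast
  interpret N: normal N V by fact
  have eqN: "N #>\<^bsub>V\<^esub> x = N #>\<^bsub>V\<^esub> y \<longleftrightarrow> x - y \<in> N" for x y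
  proof -
    have "x \<in> N #>\<^bsub>V\<^esub> y \<longleftrightarrow> x - y \<in> N"
      using N.rcos_module[OF V.is_group, of y x] by (simp add: Vs Vinv)
    moreover have "N #>\<^bsub>V\<^esub> x = N #>\<^bsub>V\<^esub> y \<longleftrightarrow> x \<in> N #>\<^bsub>V\<^esub> y"
      using V.repr_independence[OF _ _ N] V.rcos_self[OF _ N] by (metis UNIV_I Vs(1))
    ultimately show ?thesis by simp
  qed
  define i where "i a = N #>\<^bsub>V\<^esub> \<iota> (frag_of a)" for a
  show ?thesis
  proof (rule that)
    show "comm_group (V Mod N)" by (rule V.abelian_FactGroup[OF N])
  next
    fix y and n :: nat assume y: "y \<in> carrier (V Mod N)" and n: "n > 0"
    then obtain v where v: "y = N #>\<^bsub>V\<^esub> v" by (auto simp: carrier_FactGroup)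
    define w where "w = Poly_Mapping.map (\<lambda>q. q / of_nat n) v"
    have "w [^]\<^bsub>V\<^esub> n = v"
      by (rule poly_mapping_eqI) (use n in \<open>simp add: Vpow w_def map.rep_eq when_def\<close>)
    then have "(N #>\<^bsub>V\<^esub> w) [^]\<^bsub>V Mod N\<^esub> n = y" using N.FactGroup_pow[of w n] v by (simp add: Vs)
    then show "\<exists>z\<in>carrier (V Mod N). z [^]\<^bsub>V Mod N\<^esub> n = y"
      by (rule bexI) (auto simp: carrier_FactGroup Vs)
  next
    show "i \<in> hom A (V Mod N)"
    proof (rule homI)
      fix a b assume ab: "a \<in> carrier A" "b \<in> carrier A"
      have "i a \<otimes>\<^bsub>V Mod N\<^esub> i b = N #>\<^bsub>V\<^esub> (\<iota> (frag_of a) + \<iota> (frag_of b))"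
        unfolding i_def using hom_mult[OF N.r_coset_hom_Mod] by (simp add: Vs)
      also have "\<dots> = i (a \<otimes>\<^bsub>A\<^esub> b)"
        unfolding i_def eqN unfolding N_def
      proof (rule image_eqI)
        let ?c = "frag_of a + frag_of b + - frag_of (a \<otimes>\<^bsub>A\<^esub> b)"
        show "\<iota> (frag_of a) + \<iota> (frag_of b) - \<iota> (frag_of (a \<otimes>\<^bsub>A\<^esub> b)) = \<iota> ?c"
          unfolding \<iota> by simp
        show "?c \<in> {c. Poly_Mapping.keys c \<subseteq> carrier A \<and> h c = \<one>\<^bsub>A\<^esub>}"
          using ab by (simp add: hadd hmin kadd h(2) del: add_uminus_conv_diff)
      qed
      finally show "i (a \<otimes>\<^bsub>A\<^esub> b) = i a \<otimes>\<^bsub>V Mod N\<^esub> i b" by simp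
    qed (auto simp: i_def carrier_FactGroup Vs)
  next
    show "inj_on i (carrier A)"
    proof (rule inj_onI)
      fix a b assume ab: "a \<in> carrier A" "b \<in> carrier A" and "i a = i b"
      then have "\<iota> (frag_of a) - \<iota> (frag_of b) \<in> N" by (simp add: i_def eqN)
      then obtain c where c: "h c = \<one>\<^bsub>A\<^esub>" "\<iota> (frag_of a) - \<iota> (frag_of b) = \<iota> c" unfolding N_def by auto
      \<comment> \<open>As \<open>\<iota>\<close> is injective, an integral combination that lands
        in \<open>N\<close> is already a relation; allowing rational coefficients identifies no
        further elements of \<open>A\<close>.\<close>
      have "frag_of a + - frag_of b = c" by (rule \<iota>_inj) (use c(2) in \<open>simp only: \<iota>, simp\<close>)
      then have "a \<otimes>\<^bsub>A\<^esub> inv\<^bsub>A\<^esub> b = \<one>\<^bsub>A\<^esub>"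
        using c(1) ab hadd[of "frag_of a" "- frag_of b"] by (simp add: hmin h(2) del: add_uminus_conv_diff)
      then show "a = b" using ab by (metis A.inv_closed A.inv_equality A.inv_inv)
    qed
  next
    have self: "x \<in> N #>\<^bsub>V\<^esub> x" for x using V.rcos_self[OF _ N] by (simp add: Vs)
    show "inj_on (\<lambda>C. SOME c. c \<in> C) (carrier (V Mod N))"
    proof (rule inj_onI)
      fix C C' assume "C \<in> carrier (V Mod N)" "C' \<in> carrier (V Mod N)" and eq: "(SOME c. c \<in> C) = (SOME c. c \<in> C')"
      then obtain x y where x: "C = N #>\<^bsub>V\<^esub> x" "C' = N #>\<^bsub>V\<^esub> y" by (auto simp: carrier_FactGroup)
      have s: "N #>\<^bsub>V\<^esub> x = N #>\<^bsub>V\<^esub> (SOME c. c \<in> N #>\<^bsub>V\<^esub> x)" for x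
      proof (rule V.repr_independence[OF _ _ N])
        show "(SOME c. c \<in> N #>\<^bsub>V\<^esub> x) \<in> N #>\<^bsub>V\<^esub> x" using self by (rule someI)
      qed (simp add: Vs)
      show "C = C'" using s[of x] s[of y] eq x by simp
    qed
  qed
qed

text \<open>Additive maps from \<open>K\<close> to \<open>D\<close>, on which k acts by (k
  \<phi>)(a) = \<phi>(a k): coinduction along the integers, right adjoint to forgetting the
  scalars.\<close>

definition coinduced :: "'k ring \<Rightarrow> 'd monoid \<Rightarrow> ('k, 'k \<Rightarrow> 'd) module" where
  "coinduced K D = \<lparr>carrier = {\<phi> \<in> carrier K \<rightarrow>\<^sub>E carrier D. \<forall>a\<in>carrier K. \<forall>b\<in>carrier K. \<phi> (a \<oplus>\<^bsub>K\<^esub> b) = \<phi> a \<otimes>\<^bsub>D\<^esub> \<phi> b},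
     monoid.mult = undefined, monoid.one = undefined,
     ring.zero = (\<lambda>a\<in>carrier K. \<one>\<^bsub>D\<^esub>), ring.add = (\<lambda>\<phi> \<psi>. \<lambda>a\<in>carrier K. \<phi> a \<otimes>\<^bsub>D\<^esub> \<psi> a),
     module.smult = (\<lambda>k \<phi>. \<lambda>a\<in>carrier K. \<phi> (a \<otimes>\<^bsub>K\<^esub> k))\<rparr>"

lemma module_coinduced:
  assumes K: "cring K" and D: "comm_group D"
  shows "Module.module K (coinduced K D)"
proof -
  interpret K: cring K by fact
  interpret D: comm_group D by fact
  let ?J = "coinduced K D"
  have c: "\<phi> a \<in> carrier D" if "\<phi> \<in> carrier ?J" "a \<in> carrier K" for \<phi> a
    using that by (auto simp: coinduced_def PiE_iff)
  have add: "\<phi> (a \<oplus>\<^bsub>K\<^esub> b) = \<phi> a \<otimes>\<^bsub>D\<^esub> \<phi> b" if "\<phi> \<in> carrier ?J" "a \<in> carrier K" "b \<in> carrier K" for \<phi> a b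
    using that by (simp add: coinduced_def)
  have e: "\<phi> = \<psi>" if "\<phi> \<in> carrier ?J" "\<psi> \<in> carrier ?J" "\<And>a. a \<in> carrier K \<Longrightarrow> \<phi> a = \<psi> a" for \<phi> \<psi>
    by (rule PiE_ext[of _ "carrier K" "\<lambda>_. carrier D"]) (use that in \<open>auto simp: coinduced_def\<close>)
  have mk: "(\<lambda>a\<in>carrier K. t a) \<in> carrier ?J"
    if "\<And>a. a \<in> carrier K \<Longrightarrow> t a \<in> carrier D"
      "\<And>a b. a \<in> carrier K \<Longrightarrow> b \<in> carrier K \<Longrightarrow> t (a \<oplus>\<^bsub>K\<^esub> b) = t a \<otimes>\<^bsub>D\<^esub> t b" for t
    using that by (simp add: coinduced_def)
  have ops: "\<zero>\<^bsub>?J\<^esub> = (\<lambda>a\<in>carrier K. \<one>\<^bsub>D\<^esub>)" "\<phi> \<oplus>\<^bsub>?J\<^esub> \<psi> = (\<lambda>a\<in>carrier K. \<phi> a \<otimes>\<^bsub>D\<^esub> \<psi> a)"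
    "k \<odot>\<^bsub>?J\<^esub> \<phi> = (\<lambda>a\<in>carrier K. \<phi> (a \<otimes>\<^bsub>K\<^esub> k))" for \<phi> \<psi> k
    by (simp_all add: coinduced_def)
  have cl: "\<zero>\<^bsub>?J\<^esub> \<in> carrier ?J" "\<phi> \<in> carrier ?J \<Longrightarrow> \<psi> \<in> carrier ?J \<Longrightarrow> \<phi> \<oplus>\<^bsub>?J\<^esub> \<psi> \<in> carrier ?J"
    "k \<in> carrier K \<Longrightarrow> \<phi> \<in> carrier ?J \<Longrightarrow> k \<odot>\<^bsub>?J\<^esub> \<phi> \<in> carrier ?J" for \<phi> \<psi> k
    unfolding ops by (rule mk; simp add: c add D.m_ac K.l_distr)+
  have z: "\<phi> \<zero>\<^bsub>K\<^esub> = \<one>\<^bsub>D\<^esub>" if "\<phi> \<in> carrier ?J" for \<phi>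
    using add[OF that K.zero_closed K.zero_closed] c[OF that K.zero_closed] by simp
  show ?thesis
    by (rule module_intro[OF K]; (rule e)?)
      (simp_all add: cl, simp_all add: ops c add z D.m_ac K.l_distr K.r_distr K.m_ac)
qed

text \<open>A \<open>K\<close>-linear map into the coinduced module amounts to a group homomorphism
  into \<open>D\<close>, and such homomorphisms extend because \<open>D\<close> is
  divisible.\<close>

lemma coinduced_injective:
  fixes K :: "'k ring"
  assumes K: "cring K" and D: "comm_group D"
    and div: "\<And>y (n :: nat). y \<in> carrier D \<Longrightarrow> n > 0 \<Longrightarrow> \<exists>z\<in>carrier D. z [^]\<^bsub>D\<^esub> n = y"
  shows "injective_mod K (coinduced K D) TYPE('u)"
  unfolding injective_mod_def
proof (intro allI impI, elim conjE)
  interpret K: cring K by fact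
  fix A B :: "('k, 'u) module" and i f
  assume A: "Module.module K A" and B: "Module.module K B"
    and i: "i \<in> lin_maps K A B" "inj_on i (carrier A)" and f: "f \<in> lin_maps K A (coinduced K D)"
  interpret B: Module.module K B by fact
  let ?B = "add_monoid B"
  have cB: "comm_group ?B" by (rule B.a_comm_group)
  have sub: "subgroup (i ` carrier A) ?B"
    using submodule_image[OF i(1) A B] by (rule submodule.axioms(1))
  \<comment> \<open>The homomorphism corresponding to \<open>f\<close> is evaluation at one, moved
    along \<open>i\<close> so that it lives on a subgroup of \<open>B\<close>.\<close>
  define g where "g b = f (inv_into (carrier A) i b) \<one>\<^bsub>K\<^esub>" for b
  have g: "g (i a) = f a \<one>\<^bsub>K\<^esub>" if "a \<in> carrier A" for a
    using that i(2) by (simp add: g_def)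
  have fc: "f a \<in> carrier (coinduced K D)" if "a \<in> carrier A" for a by (rule lin_mapsD(1)[OF f that])
  have fk: "f a k \<in> carrier D" if "a \<in> carrier A" "k \<in> carrier K" for a k
    using fc[OF that(1)] that(2) by (auto simp: coinduced_def PiE_iff)
  have "g \<in> hom (?B\<lparr>carrier := i ` carrier A\<rparr>) D"
  proof (rule homI)
    fix x y assume "x \<in> carrier (?B\<lparr>carrier := i ` carrier A\<rparr>)" "y \<in> carrier (?B\<lparr>carrier := i ` carrier A\<rparr>)"
    then obtain a b where ab: "a \<in> carrier A" "b \<in> carrier A" "x = i a" "y = i b" by auto
    have "g (x \<oplus>\<^bsub>B\<^esub> y) = g x \<otimes>\<^bsub>D\<^esub> g y"
      unfolding ab(3,4) lin_mapsD(2)[OF i(1) ab(1,2), symmetric]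
      using ab by (simp add: g moduleD[OF A] lin_mapsD(2)[OF f]) (simp add: coinduced_def)
    then show "g (x \<otimes>\<^bsub>?B\<lparr>carrier := i ` carrier A\<rparr>\<^esub> y) = g x \<otimes>\<^bsub>D\<^esub> g y" by simp
  qed (auto simp: g fk)
  then obtain h where h: "h \<in> hom ?B D" "\<And>b. b \<in> i ` carrier A \<Longrightarrow> h b = g b"
    using divisible_extension[OF cB D div sub] by blast
  have hadd: "h (x \<oplus>\<^bsub>B\<^esub> y) = h x \<otimes>\<^bsub>D\<^esub> h y" if "x \<in> carrier B" "y \<in> carrier B" for x y
    using hom_mult[OF h(1)] that by simp
  have hc: "h x \<in> carrier D" if "x \<in> carrier B" for x
    using hom_in_carrier[OF h(1)] that by simp
  \<comment> \<open>Back from homomorphisms to linear maps: b goes to the additive map that sends k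
    to h(k b).\<close>
  have "(\<lambda>b\<in>carrier B. \<lambda>k\<in>carrier K. h (k \<odot>\<^bsub>B\<^esub> b)) \<in> lin_maps K B (coinduced K D)"
    by (rule lin_mapsI)
      (auto simp: coinduced_def hc hadd B.smult_l_distr B.smult_r_distr B.smult_assoc1 fun_eq_iff B)
  moreover have "(\<lambda>b\<in>carrier B. \<lambda>k\<in>carrier K. h (k \<odot>\<^bsub>B\<^esub> b)) (i a) = f a" if a: "a \<in> carrier A" for a
  proof
    fix k
    show "(\<lambda>b\<in>carrier B. \<lambda>k\<in>carrier K. h (k \<odot>\<^bsub>B\<^esub> b)) (i a) k = f a k"
    proof (cases "k \<in> carrier K")
      case True
      have "h (k \<odot>\<^bsub>B\<^esub> i a) = f (k \<odot>\<^bsub>A\<^esub> a) \<one>\<^bsub>K\<^esub>"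
        using a True by (simp add: h(2) g moduleD[OF A] flip: lin_mapsD(3)[OF i(1)])
      also have "\<dots> = f a k"
        using a True by (simp add: lin_mapsD(3)[OF f]) (simp add: coinduced_def)
      finally show ?thesis using a True by (simp add: lin_mapsD(1)[OF i(1)])
    next
      case False
      then show ?thesis using fc[OF a] lin_mapsD(1)[OF i(1) a]
        by (simp add: coinduced_def PiE_iff extensional_def)
    qed
  qed
  ultimately show "\<exists>h\<in>lin_maps K B (coinduced K D). \<forall>a\<in>carrier A. h (i a) = f a" by blast
qed

text \<open>With \<open>j\<close> the embedding of the additive group into a divisible hull, m goes
  to the additive map that sends k to j(k m); evaluation at one recovers j(m), whence
  injectivity.\<close>

lemma (in universe) enough_injective_modules:
  fixes M :: "('k, 'u) module" and K :: "'k ring"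
  assumes M: "Module.module K M"
  obtains J :: "('k, 'u) module" and i where "Module.module K J" "injective_mod K J TYPE('u)"
    "i \<in> lin_maps K M J" "inj_on i (carrier M)"
proof (cases "\<exists>a0 a1 :: 'u. a0 \<noteq> a1")
  case True
  then obtain a0 a1 :: 'u where "a0 \<noteq> a1" by auto
  then interpret nontrivial_universe T U a0 a1 by unfold_locales
  note K = module_cring[OF M]
  interpret K: cring K by (rule K)
  interpret M: Module.module K M by (rule M)
  obtain D :: "('u \<Rightarrow>\<^sub>0 rat) set monoid" and j where D: "comm_group D"
    and div: "\<And>y (n :: nat). y \<in> carrier D \<Longrightarrow> n > 0 \<Longrightarrow> \<exists>z\<in>carrier D. z [^]\<^bsub>D\<^esub> n = y"
    and j: "j \<in> hom (add_monoid M) D" "inj_on j (carrier M)"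
    and rep: "inj_on (\<lambda>C. SOME c. c \<in> C) (carrier D)"
    using divisible_hull[OF M.a_comm_group] by auto
  let ?J = "coinduced K D"
  note J = module_coinduced[OF K D]
  \<comment> \<open>Size bound: cosets in the hull are coded by rational combinations over
    \<open>'u\<close>, and maps out of \<open>K\<close> by functions on the scalars.\<close>
  have "embeds (carrier D) TYPE('u)" by (rule embeds_image[OF rep _ embeds_poly_mapping]) simp
  then have "embeds (carrier K \<rightarrow>\<^sub>E carrier D) TYPE('u)" by (intro embeds_funs embeds_k)
  then have emb: "embeds (carrier ?J) TYPE('u)" by (rule embeds_subset) (auto simp: coinduced_def)
  have jc: "j m \<in> carrier D" if "m \<in> carrier M" for m
    using hom_in_carrier[OF j(1)] that by simp
  have jadd: "j (m \<oplus>\<^bsub>M\<^esub> n) = j m \<otimes>\<^bsub>D\<^esub> j n" if "m \<in> carrier M" "n \<in> carrier M" for m n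
    using hom_mult[OF j(1)] that by simp
  let ?i = "\<lambda>m\<in>carrier M. \<lambda>k\<in>carrier K. j (k \<odot>\<^bsub>M\<^esub> m)"
  have i: "?i \<in> lin_maps K M ?J"
    by (rule lin_mapsI)
      (auto simp: coinduced_def jc jadd M.smult_l_distr M.smult_r_distr M.smult_assoc1 fun_eq_iff M)
  let ?C = "copy ?J :: ('k, 'u) module"
  show ?thesis
  proof (rule that)
    show "Module.module K ?C" by (rule module_copy[OF emb J])
    show "injective_mod K ?C TYPE('u)" by (rule injective_mod_copy[OF emb J coinduced_injective[OF K D div]])
    show "(\<lambda>m\<in>carrier M. (\<lambda>p\<in>carrier ?J. to_copy ?J p :: 'u) (?i m)) \<in> lin_maps K M ?C"
      by (rule lin_maps_comp[OF i to_copy_lin[OF emb J] M])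
    show "inj_on (\<lambda>m\<in>carrier M. (\<lambda>p\<in>carrier ?J. to_copy ?J p :: 'u) (?i m)) (carrier M)"
    proof (rule inj_onI)
      fix m n assume mn: "m \<in> carrier M" "n \<in> carrier M"
        "(\<lambda>m\<in>carrier M. (\<lambda>p\<in>carrier ?J. to_copy ?J p :: 'u) (?i m)) m = (\<lambda>m\<in>carrier M. (\<lambda>p\<in>carrier ?J. to_copy ?J p :: 'u) (?i m)) n"
      note ic = lin_mapsD(1)[OF i mn(1)] lin_mapsD(1)[OF i mn(2)]
      have "(to_copy ?J (?i m) :: 'u) = to_copy ?J (?i n)"
        using mn(3) unfolding restrict_apply'[OF mn(1)] restrict_apply'[OF mn(2)]
          restrict_apply'[OF ic(1)[unfolded restrict_apply'[OF mn(1)]]] restrict_apply'[OF ic(2)[unfolded restrict_apply'[OF mn(2)]]] .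
      then have "?i m = ?i n" using inj_onD[OF to_copy_inj[OF emb] _ ic] by blast
      then have "?i m \<one>\<^bsub>K\<^esub> = ?i n \<one>\<^bsub>K\<^esub>" by simp
      then have "j m = j n" using mn(1,2) by simp
      then show "m = n" using inj_onD[OF j(2)] mn by blast
    qed
  qed
next
  case False
  then have triv: "a = b" for a b :: 'u by blast
  have "injective_mod K M TYPE('u)"
    unfolding injective_mod_def using trivial_universe_lin[OF triv _ M] triv by blast
  moreover have "inj_on (\<lambda>u\<in>carrier M. u) (carrier M)" by simp
  ultimately show ?thesis
    using that[OF M _ trivial_universe_lin[OF triv M M]] by blast
qed

text \<open>Keeps finiteness in the form \<open>d x y < \<infinity>\<close> in which the definitions
  state it; the simplifier would otherwise rewrite it in terms of \<open>top\<close>.\<close>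

declare infinity_ennreal_def [simp del]

section \<open>Graded modules\<close>

lemma graded_modulesD: "A \<in> graded_modules K G \<Longrightarrow> g \<in> G \<Longrightarrow> Module.module K (A g)"
  by (auto simp: graded_modules_def)

lemma graded_modulesI: "(\<And>g. g \<in> G \<Longrightarrow> Module.module K (A g)) \<Longrightarrow> (\<lambda>g\<in>G. A g) \<in> graded_modules K G"
  by (auto simp: graded_modules_def)

lemma deg_maps_lin: "f \<in> deg_maps K G e A B \<Longrightarrow> g \<in> G \<Longrightarrow> f g \<in> lin_maps K (A g) (B (g + e))"
  by (auto simp: deg_maps_def)

lemma deg_mapsD:
  assumes "f \<in> deg_maps K G e A B" "g \<in> G"
  shows "m \<in> carrier (A g) \<Longrightarrow> f g m \<in> carrier (B (g + e))"
    and "m \<in> carrier (A g) \<Longrightarrow> n \<in> carrier (A g) \<Longrightarrow> f g (m \<oplus>\<^bsub>A g\<^esub> n) = f g m \<oplus>\<^bsub>B (g + e)\<^esub> f g n"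
    and "a \<in> carrier K \<Longrightarrow> m \<in> carrier (A g) \<Longrightarrow> f g (a \<odot>\<^bsub>A g\<^esub> m) = a \<odot>\<^bsub>B (g + e)\<^esub> f g m"
  using lin_mapsD[OF deg_maps_lin[OF assms]] by blast+

lemmas deg_maps0D = deg_mapsD[where e=0, simplified]

lemma deg_mapsI:
  assumes "\<And>g. g \<in> G \<Longrightarrow> f g \<in> lin_maps K (A g) (B (g + e))"
  shows "(\<lambda>g\<in>G. f g) \<in> deg_maps K G e A B"
  using assms by (auto simp: deg_maps_def)

lemma deg_maps_ext:
  assumes "f \<in> deg_maps K G e A B" "f' \<in> deg_maps K G e' A B'"
    and "\<And>g m. g \<in> G \<Longrightarrow> m \<in> carrier (A g) \<Longrightarrow> f g m = f' g m"
  shows "f = f'"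
proof
  fix g
  show "f g = f' g"
  proof (cases "g \<in> G")
    case True
    then show ?thesis using assms(3) by (intro lin_maps_ext[OF deg_maps_lin[OF assms(1)] deg_maps_lin[OF assms(2)]])
  next
    case False
    then show ?thesis using assms(1,2) by (simp add: deg_maps_def PiE_iff extensional_def)
  qed
qed

lemma deg_comp_apply: "g \<in> G \<Longrightarrow> m \<in> carrier (A g) \<Longrightarrow> deg_comp G A e f h g m = f (g + e) (h g m)"
  and deg_id_apply: "g \<in> G \<Longrightarrow> m \<in> carrier (A g) \<Longrightarrow> deg_id G A g m = m"
  and deg_zero_apply: "g \<in> G \<Longrightarrow> m \<in> carrier (A g) \<Longrightarrow> deg_zero G e A B g m = \<zero>\<^bsub>B (g + e)\<^esub>"
  by (simp_all add: deg_comp_def deg_id_def deg_zero_def)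

locale graded =
  fixes K :: "'k ring" and G :: "real set"
  assumes K: "cring K" and G: "subgroup G real_add_group"
begin

lemma G_zero: "0 \<in> G" and G_add: "a \<in> G \<Longrightarrow> b \<in> G \<Longrightarrow> a + b \<in> G"
  using subgroup_real_closed[OF G] by auto

lemma G_diff: "a \<in> G \<Longrightarrow> b \<in> G \<Longrightarrow> a - b \<in> G"
proof -
  assume a: "a \<in> G" and b: "b \<in> G"
  have "inv\<^bsub>real_add_group\<^esub> b = - b"
    unfolding m_inv_def by (rule the_equality) (auto simp: real_add_group_def)
  then have "- b \<in> G" using subgroup.m_inv_closed[OF G b] by simp
  from G_add[OF a this] show "a - b \<in> G" by simp
qed

lemma deg_maps_zero:
  assumes A: "A \<in> graded_modules K G" and B: "B \<in> graded_modules K G"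
    and f: "f \<in> deg_maps K G e A B" and g: "g \<in> G" "e \<in> G"
  shows "f g \<zero>\<^bsub>A g\<^esub> = \<zero>\<^bsub>B (g + e)\<^esub>"
  by (rule lin_maps_zero[OF deg_maps_lin[OF f g(1)] graded_modulesD[OF A g(1)] graded_modulesD[OF B G_add[OF g]]])

lemma deg_id_maps: "A \<in> graded_modules K G \<Longrightarrow> deg_id G A \<in> deg_maps K G 0 A A"
  unfolding deg_id_def by (intro deg_mapsI lin_mapsI) (auto dest: graded_modulesD)

lemma deg_zero_maps:
  assumes A: "A \<in> graded_modules K G" and B: "B \<in> graded_modules K G" and e: "e \<in> G"
  shows "deg_zero G e A B \<in> deg_maps K G e A B"
  unfolding deg_zero_def
proof (intro deg_mapsI lin_mapsI)
  fix g assume g: "g \<in> G"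
  show "Module.module K (A g)" by (rule graded_modulesD[OF A g])
qed (simp_all add: moduleD[OF graded_modulesD[OF B G_add[OF _ e]]])

lemma deg_comp_maps:
  assumes A: "A \<in> graded_modules K G" and f: "f \<in> deg_maps K G e A B" and h: "h \<in> deg_maps K G e' B C"
    and e: "e \<in> G"
  shows "deg_comp G A e h f \<in> deg_maps K G (e + e') A C"
  unfolding deg_comp_def
proof (intro deg_mapsI)
  fix g assume g: "g \<in> G"
  from lin_maps_comp[OF deg_maps_lin[OF f g] deg_maps_lin[OF h G_add[OF g e]] graded_modulesD[OF A g]]
  show "(\<lambda>m\<in>carrier (A g). h (g + e) (f g m)) \<in> lin_maps K (A g) (C (g + (e + e')))"
    by (simp add: add.assoc)
qed

lemma GrMod_simps [simp]:
  "Obj (GrMod K G) = graded_modules K G" "Arr (GrMod K G) = deg_maps K G 0" "Idt (GrMod K G) = deg_id G"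
  "Cmp (GrMod K G) A B C = deg_comp G A 0"
  by (auto simp: GrMod_def fun_eq_iff)

lemma deg_comp0_maps:
  "\<lbrakk>A \<in> graded_modules K G; f \<in> deg_maps K G 0 A B; h \<in> deg_maps K G 0 B C\<rbrakk>
    \<Longrightarrow> deg_comp G A 0 h f \<in> deg_maps K G 0 A C"
  using deg_comp_maps[of A f 0 B h 0 C] G_zero by simp

lemma category_GrMod: "category (GrMod K G :: (('k, 'u) gmod, real \<Rightarrow> 'u \<Rightarrow> 'u) cat)"
  unfolding category_def GrMod_simps
proof (intro conjI ballI)
  fix A B :: "('k, 'u) gmod" and f
  assume *: "A \<in> graded_modules K G" "B \<in> graded_modules K G" "f \<in> deg_maps K G 0 A B"
  show "deg_comp G A 0 f (deg_id G A) = f"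
    by (rule deg_maps_ext[OF deg_comp0_maps[OF *(1) deg_id_maps[OF *(1)] *(3)] *(3)])
      (simp add: deg_comp_apply deg_id_apply)
  show "deg_comp G A 0 (deg_id G B) f = f"
    by (rule deg_maps_ext[OF deg_comp0_maps[OF *(1,3) deg_id_maps[OF *(2)]] *(3)])
      (simp add: deg_comp_apply deg_id_apply deg_maps0D[OF *(3)])
next
  fix A B C D :: "('k, 'u) gmod" and f g h
  assume *: "A \<in> graded_modules K G" "B \<in> graded_modules K G" "C \<in> graded_modules K G" "D \<in> graded_modules K G"
    "f \<in> deg_maps K G 0 A B" "g \<in> deg_maps K G 0 B C" "h \<in> deg_maps K G 0 C D"
  show "deg_comp G A 0 (deg_comp G B 0 h g) f = deg_comp G A 0 h (deg_comp G A 0 g f)"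
    by (rule deg_maps_ext[OF deg_comp0_maps[OF *(1,5) deg_comp0_maps[OF *(2,6,7)]]
          deg_comp0_maps[OF *(1) deg_comp0_maps[OF *(1,5,6)] *(7)]])
      (simp add: deg_comp_apply deg_maps0D[OF *(5)])
qed (auto intro: deg_id_maps deg_comp0_maps)

end

section \<open>Distance modules\<close>

locale dist_setting = graded K G for K :: "'k ring" and G +
  fixes X :: "'x set" and d :: "'x \<Rightarrow> 'x \<Rightarrow> ennreal"
  assumes quasi: "quasimetric X d"
    and dG: "\<And>x y. x \<in> X \<Longrightarrow> y \<in> X \<Longrightarrow> d x y < \<infinity> \<Longrightarrow> enn2real (d x y) \<in> G"
begin

abbreviation \<delta> :: "'x \<Rightarrow> 'x \<Rightarrow> real" where "\<delta> x y \<equiv> enn2real (d x y)"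

lemma d_zero_iff: "x \<in> X \<Longrightarrow> y \<in> X \<Longrightarrow> d x y = 0 \<longleftrightarrow> x = y"
  and d_triangle: "x \<in> X \<Longrightarrow> y \<in> X \<Longrightarrow> z \<in> X \<Longrightarrow> d x z \<le> d x y + d y z"
  using quasi by (auto simp: quasimetric_def)

lemma d_refl [simp]: "x \<in> X \<Longrightarrow> d x x = 0"
  by (simp add: d_zero_iff)

lemma fin_trans: "\<lbrakk>x \<in> X; y \<in> X; z \<in> X; d x y < \<infinity>; d y z < \<infinity>\<rbrakk> \<Longrightarrow> d x z < \<infinity>"
  using d_triangle[of x y z] by (auto simp: less_top[symmetric] top_unique infinity_ennreal_def)

lemma zero_less_infinity_ennreal [simp]: "0 < (\<infinity> :: ennreal)"
  by (simp add: infinity_ennreal_def)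

lemma ennreal_\<delta>: "d x y < \<infinity> \<Longrightarrow> d x y = ennreal (\<delta> x y)"
  by (simp add: infinity_ennreal_def)

text \<open>For finite distances betweenness becomes an equation of reals. It is this equation that
  gives a composite of two actions the same degree as the direct action.\<close>

lemma between_iff:
  assumes "x \<in> X" "y \<in> X" "z \<in> X" and f: "d x y < \<infinity>" "d y z < \<infinity>"
  shows "between d x y z \<longleftrightarrow> \<delta> x y + \<delta> y z = \<delta> x z"
proof -
  have "d x y + d y z = ennreal (\<delta> x y + \<delta> y z)"
    using f by (simp add: ennreal_plus infinity_ennreal_def)
  then have "between d x y z \<longleftrightarrow> ennreal (\<delta> x y + \<delta> y z) = ennreal (\<delta> x z)"
    unfolding between_def using ennreal_\<delta>[OF fin_trans[OF assms]] by simp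
  also have "\<dots> \<longleftrightarrow> \<delta> x y + \<delta> y z = \<delta> x z"
    by (rule ennreal_inj) simp_all
  finally show ?thesis .
qed

lemma between_refl [simp]: "x \<in> X \<Longrightarrow> between d x x y" "y \<in> X \<Longrightarrow> between d x y y"
  by (simp_all add: between_def)

lemma between_same: "\<lbrakk>x \<in> X; y \<in> X; between d x y x\<rbrakk> \<Longrightarrow> x = y"
proof -
  assume *: "x \<in> X" "y \<in> X" "between d x y x"
  then have "d x y + d y x = 0" by (simp add: between_def)
  then have "d x y = 0" by simp
  then show "x = y" using d_zero_iff * by blast
qed

text \<open>Both sides say that \<open>w\<close>, \<open>x\<close>, \<open>y\<close>, \<open>z\<close> lie on a geodesic, that is
  $d(w,x) + d(x,y) + d(y,z) = d(w,z)$.\<close>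

lemma between_assoc:
  assumes X: "w \<in> X" "x \<in> X" "y \<in> X" "z \<in> X"
  assumes f: "d w x < \<infinity>" "d x y < \<infinity>" "d y z < \<infinity>"
  shows "between d w x z \<and> between d x y z \<longleftrightarrow> between d w y z \<and> between d w x y"
proof -
  have le: "\<delta> u t \<le> \<delta> u v + \<delta> v t" if "u \<in> X" "v \<in> X" "t \<in> X" "d u v < \<infinity>" "d v t < \<infinity>" for u v t
  proof -
    have "ennreal (\<delta> u t) \<le> ennreal (\<delta> u v + \<delta> v t)"
      using d_triangle[OF that(1-3)] that(4,5) fin_trans[OF that] by (simp add: ennreal_plus infinity_ennreal_def)
    then show ?thesis by (subst (asm) ennreal_le_iff) simp_all
  qed
  note f' = fin_trans[OF X(1-3) f(1,2)] fin_trans[OF X(2-4) f(2,3)]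
  note f'' = fin_trans[OF X(1,3,4) f'(1) f(3)]
  show ?thesis
    using le[of w x y] le[of x y z] le[of w x z] le[of w y z] X f f' f''
    by (auto simp: between_iff)
qed

text \<open>Source and target may have different element types, unlike for arrows of
  \<open>DistMod\<close>, because induced and coinduced modules have functions on \<open>X\<close>
  as elements.\<close>

definition dhom :: "('x, 'k, 'u) dmod \<Rightarrow> ('x, 'k, 'v) dmod \<Rightarrow> ('x \<Rightarrow> real \<Rightarrow> 'u \<Rightarrow> 'v) set" where
  "dhom M N = {\<phi> \<in> (\<Pi>\<^sub>E x\<in>X. deg_maps K G 0 (pts M x) (pts N x)).
     \<forall>x\<in>X. \<forall>y\<in>X. d x y < \<infinity> \<longrightarrow> (\<forall>g\<in>G. \<forall>m\<in>carrier (pts M x g).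
       act N x y g (\<phi> x g m) = \<phi> y (g + \<delta> x y) (act M x y g m))}"

lemma dist_maps_eq: "dist_maps K G X d = dhom"
  by (simp add: fun_eq_iff dist_maps_def dhom_def)

abbreviation dmods :: "('x, 'k, 'u) dmod set" where "dmods \<equiv> dist_modules K G X d"

lemma pts_graded: "M \<in> dmods \<Longrightarrow> x \<in> X \<Longrightarrow> pts M x \<in> graded_modules K G"
  by (auto simp: dist_modules_def)

lemma pts_module: "M \<in> dmods \<Longrightarrow> x \<in> X \<Longrightarrow> g \<in> G \<Longrightarrow> Module.module K (pts M x g)"
  by (rule graded_modulesD[OF pts_graded])

lemma act_maps: "\<lbrakk>M \<in> dmods; x \<in> X; y \<in> X; d x y < \<infinity>\<rbrakk> \<Longrightarrow> act M x y \<in> deg_maps K G (\<delta> x y) (pts M x) (pts M y)"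
  unfolding dist_modules_def by (auto dest: spec2)

lemma act_undefined: "\<lbrakk>M \<in> dmods; \<not> (x \<in> X \<and> y \<in> X \<and> d x y < \<infinity>)\<rbrakk> \<Longrightarrow> act M x y = undefined"
proof -
  assume "M \<in> dmods" and n: "\<not> (x \<in> X \<and> y \<in> X \<and> d x y < \<infinity>)"
  then have "if x \<in> X \<and> y \<in> X \<and> d x y < \<infinity>
      then act M x y \<in> deg_maps K G (\<delta> x y) (pts M x) (pts M y) else act M x y = undefined"
    unfolding dist_modules_def by blast
  then show "act M x y = undefined" using n by argo
qed

lemmas actD = deg_mapsD[OF act_maps]

lemma act_lin: "\<lbrakk>M \<in> dmods; x \<in> X; y \<in> X; d x y < \<infinity>; g \<in> G\<rbrakk> \<Longrightarrow> act M x y g \<in> lin_maps K (pts M x g) (pts M y (g + \<delta> x y))"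
  by (rule deg_maps_lin[OF act_maps])

lemma act_zero: "\<lbrakk>M \<in> dmods; x \<in> X; y \<in> X; d x y < \<infinity>; g \<in> G\<rbrakk> \<Longrightarrow> act M x y g \<zero>\<^bsub>pts M x g\<^esub> = \<zero>\<^bsub>pts M y (g + \<delta> x y)\<^esub>"
  by (rule deg_maps_zero[OF pts_graded pts_graded act_maps]) (auto intro: dG)

lemma act_refl: "\<lbrakk>M \<in> dmods; x \<in> X; g \<in> G; m \<in> carrier (pts M x g)\<rbrakk> \<Longrightarrow> act M x x g m = m"
  by (simp add: dist_modules_def deg_id_apply)

lemma act_act:
  assumes M: "M \<in> dmods" and X: "x \<in> X" "y \<in> X" "z \<in> X" "d x y < \<infinity>" "d y z < \<infinity>" and g: "g \<in> G" "m \<in> carrier (pts M x g)"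
  shows "act M y z (g + \<delta> x y) (act M x y g m) =
    (if between d x y z then act M x z g m else \<zero>\<^bsub>pts M z (g + (\<delta> x y + \<delta> y z))\<^esub>)"
proof -
  have "deg_comp G (pts M x) (\<delta> x y) (act M y z) (act M x y) =
        (if between d x y z then act M x z else deg_zero G (\<delta> x y + \<delta> y z) (pts M x) (pts M z))"
    using M X unfolding dist_modules_def by blast
  from fun_cong[OF fun_cong[OF this, of g], of m] show ?thesis
    using g by (simp add: deg_comp_apply deg_zero_apply split: if_splits)
qed

lemma dist_modulesI:
  assumes pts: "pts M \<in> X \<rightarrow>\<^sub>E graded_modules K G"
    and act: "\<And>x y. \<lbrakk>x \<in> X; y \<in> X; d x y < \<infinity>\<rbrakk> \<Longrightarrow> act M x y \<in> deg_maps K G (\<delta> x y) (pts M x) (pts M y)"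
    and und: "\<And>x y. \<not> (x \<in> X \<and> y \<in> X \<and> d x y < \<infinity>) \<Longrightarrow> act M x y = undefined"
    and refl: "\<And>x g m. \<lbrakk>x \<in> X; g \<in> G; m \<in> carrier (pts M x g)\<rbrakk> \<Longrightarrow> act M x x g m = m"
    and comp: "\<And>x y z g m. \<lbrakk>x \<in> X; y \<in> X; z \<in> X; d x y < \<infinity>; d y z < \<infinity>; g \<in> G; m \<in> carrier (pts M x g)\<rbrakk> \<Longrightarrow>
      act M y z (g + \<delta> x y) (act M x y g m) =
      (if between d x y z then act M x z g m else \<zero>\<^bsub>pts M z (g + (\<delta> x y + \<delta> y z))\<^esub>)"
  shows "M \<in> dmods"
  unfolding dist_modules_def mem_Collect_eq
proof (intro conjI ballI allI impI)
  fix x assume x: "x \<in> X"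
  then have p: "pts M x \<in> graded_modules K G" using pts by auto
  show "act M x x = deg_id G (pts M x)"
    by (rule deg_maps_ext[OF act[OF x x] deg_id_maps[OF p]]) (simp_all add: x refl deg_id_apply)
next
  fix x y z assume X: "x \<in> X" "y \<in> X" "z \<in> X" and f: "d x y < \<infinity> \<and> d y z < \<infinity>"
  then have p: "pts M x \<in> graded_modules K G" "pts M z \<in> graded_modules K G" using pts by auto
  from f have f: "d x y < \<infinity>" "d y z < \<infinity>" by auto
  note c = deg_comp_maps[OF p(1) act[OF X(1,2) f(1)] act[OF X(2,3) f(2)] dG[OF X(1,2) f(1)]]
  show "deg_comp G (pts M x) (\<delta> x y) (act M y z) (act M x y) =
        (if between d x y z then act M x z else deg_zero G (\<delta> x y + \<delta> y z) (pts M x) (pts M z))"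
  proof (cases "between d x y z")
    case True
    have "deg_comp G (pts M x) (\<delta> x y) (act M y z) (act M x y) = act M x z"
      by (rule deg_maps_ext[OF c act[OF X(1,3) fin_trans[OF X f]]]) (simp add: deg_comp_apply comp[OF X f] True)
    with True show ?thesis by simp
  next
    case False
    have "deg_comp G (pts M x) (\<delta> x y) (act M y z) (act M x y) = deg_zero G (\<delta> x y + \<delta> y z) (pts M x) (pts M z)"
      by (rule deg_maps_ext[OF c deg_zero_maps[OF p G_add[OF dG[OF X(1,2) f(1)] dG[OF X(2,3) f(2)]]]])
        (simp add: deg_comp_apply deg_zero_apply comp[OF X f] False)
    with False show ?thesis by simp
  qed
qed (use pts act und in simp_all)

lemma dhomI:
  assumes M: "M \<in> dmods"
    and lin: "\<And>x g. x \<in> X \<Longrightarrow> g \<in> G \<Longrightarrow> f x g \<in> lin_maps K (pts M x g) (pts N x g)"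
    and eqv: "\<And>x y g m. \<lbrakk>x \<in> X; y \<in> X; d x y < \<infinity>; g \<in> G; m \<in> carrier (pts M x g)\<rbrakk> \<Longrightarrow>
      act N x y g (f x g m) = f y (g + \<delta> x y) (act M x y g m)"
  shows "(\<lambda>x\<in>X. \<lambda>g\<in>G. f x g) \<in> dhom M N"
proof -
  have "(\<lambda>g\<in>G. f x g) \<in> deg_maps K G 0 (pts M x) (pts N x)" if "x \<in> X" for x
    by (intro deg_mapsI) (simp add: lin that)
  then show ?thesis by (simp add: dhom_def eqv G_add dG)
qed

lemma dhom_deg: "\<phi> \<in> dhom M N \<Longrightarrow> x \<in> X \<Longrightarrow> \<phi> x \<in> deg_maps K G 0 (pts M x) (pts N x)"
  by (auto simp: dhom_def)

lemma dhom_lin: "\<phi> \<in> dhom M N \<Longrightarrow> x \<in> X \<Longrightarrow> g \<in> G \<Longrightarrow> \<phi> x g \<in> lin_maps K (pts M x g) (pts N x g)"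
  using deg_maps_lin[OF dhom_deg] by fastforce

lemmas dhomD = lin_mapsD[OF dhom_lin]

lemma dhom_act:
  "\<lbrakk>\<phi> \<in> dhom M N; x \<in> X; y \<in> X; d x y < \<infinity>; g \<in> G; m \<in> carrier (pts M x g)\<rbrakk> \<Longrightarrow>
    act N x y g (\<phi> x g m) = \<phi> y (g + \<delta> x y) (act M x y g m)"
  by (simp add: dhom_def)

lemma dhom_zero:
  "\<lbrakk>\<phi> \<in> dhom M N; M \<in> dmods; N \<in> dmods; x \<in> X; g \<in> G\<rbrakk> \<Longrightarrow> \<phi> x g \<zero>\<^bsub>pts M x g\<^esub> = \<zero>\<^bsub>pts N x g\<^esub>"
  by (rule lin_maps_zero[OF dhom_lin pts_module pts_module])

lemma dhom_ext:
  assumes "\<phi> \<in> dhom M N" "\<psi> \<in> dhom M N'"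
    and "\<And>x g m. \<lbrakk>x \<in> X; g \<in> G; m \<in> carrier (pts M x g)\<rbrakk> \<Longrightarrow> \<phi> x g m = \<psi> x g m"
  shows "\<phi> = \<psi>"
proof
  fix x
  show "\<phi> x = \<psi> x"
  proof (cases "x \<in> X")
    case True
    then show ?thesis using assms(3) by (intro deg_maps_ext[OF dhom_deg[OF assms(1)] dhom_deg[OF assms(2)]])
  next
    case False
    then show ?thesis using assms(1,2) by (simp add: dhom_def PiE_iff extensional_def)
  qed
qed

text \<open>Composition across three element types, for the same reason as
  \<open>dhom\<close>.\<close>

definition cmp :: "('x, 'k, 'u) dmod \<Rightarrow> ('x \<Rightarrow> real \<Rightarrow> 'v \<Rightarrow> 'w) \<Rightarrow> ('x \<Rightarrow> real \<Rightarrow> 'u \<Rightarrow> 'v) \<Rightarrow> 'x \<Rightarrow> real \<Rightarrow> 'u \<Rightarrow> 'w" where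
  "cmp M \<psi> \<phi> = (\<lambda>x\<in>X. deg_comp G (pts M x) 0 (\<psi> x) (\<phi> x))"

lemma cmp_apply: "\<lbrakk>x \<in> X; g \<in> G; m \<in> carrier (pts M x g)\<rbrakk> \<Longrightarrow> cmp M \<psi> \<phi> x g m = \<psi> x g (\<phi> x g m)"
  by (simp add: cmp_def deg_comp_apply)

lemma dhom_cmp:
  assumes M: "M \<in> dmods" and \<phi>: "\<phi> \<in> dhom M N" and \<psi>: "\<psi> \<in> dhom N P"
  shows "cmp M \<psi> \<phi> \<in> dhom M P"
proof -
  have "(\<lambda>x\<in>X. \<lambda>g\<in>G. \<lambda>m\<in>carrier (pts M x g). \<psi> x g (\<phi> x g m)) \<in> dhom M P"
  proof (rule dhomI[OF M])
    fix x g assume *: "x \<in> X" "g \<in> G"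
    show "(\<lambda>m\<in>carrier (pts M x g). \<psi> x g (\<phi> x g m)) \<in> lin_maps K (pts M x g) (pts P x g)"
      by (rule lin_maps_comp[OF dhom_lin[OF \<phi> *] dhom_lin[OF \<psi> *] pts_module[OF M *]])
  next
    fix x y g m assume *: "x \<in> X" "y \<in> X" "d x y < \<infinity>" "g \<in> G" "m \<in> carrier (pts M x g)"
    then show "act P x y g ((\<lambda>m\<in>carrier (pts M x g). \<psi> x g (\<phi> x g m)) m) =
      (\<lambda>m\<in>carrier (pts M y (g + \<delta> x y)). \<psi> y (g + \<delta> x y) (\<phi> y (g + \<delta> x y) m)) (act M x y g m)"
      by (simp add: dhom_act[OF \<psi>] dhom_act[OF \<phi>] dhomD[OF \<phi>] actD[OF M])
  qed
  then show ?thesis by (simp add: cmp_def deg_comp_def cong: restrict_cong)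
qed

lemma dhom_id: "M \<in> dmods \<Longrightarrow> (\<lambda>x\<in>X. deg_id G (pts M x)) \<in> dhom M M"
  unfolding deg_id_def
  by (rule dhomI) (auto intro!: lin_mapsI pts_module actD simp: actD)

lemma DistMod_simps [simp]:
  "Obj (DistMod K G X d) = dmods" "Arr (DistMod K G X d) = dhom"
  "Idt (DistMod K G X d) = (\<lambda>M. \<lambda>x\<in>X. deg_id G (pts M x))"
  "Cmp (DistMod K G X d) M N P = cmp M"
  by (simp_all add: DistMod_def dist_maps_eq fun_eq_iff cmp_def)

lemma category_DistMod: "category (DistMod K G X d :: (('x, 'k, 'u) dmod, 'x \<Rightarrow> real \<Rightarrow> 'u \<Rightarrow> 'u) cat)"
  unfolding category_def DistMod_simps
proof (intro conjI ballI)
  fix A B :: "('x, 'k, 'u) dmod" and f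
  assume *: "A \<in> dmods" "B \<in> dmods" "f \<in> dhom A B"
  show "cmp A f (\<lambda>x\<in>X. deg_id G (pts A x)) = f"
    by (rule dhom_ext[OF dhom_cmp[OF *(1) dhom_id[OF *(1)] *(3)] *(3)]) (simp add: cmp_apply deg_id_apply)
  show "cmp A (\<lambda>x\<in>X. deg_id G (pts B x)) f = f"
    by (rule dhom_ext[OF dhom_cmp[OF *(1,3) dhom_id[OF *(2)]] *(3)]) (simp add: cmp_apply deg_id_apply dhomD[OF *(3)])
next
  fix A B C D :: "('x, 'k, 'u) dmod" and f g h
  assume *: "A \<in> dmods" "B \<in> dmods" "C \<in> dmods" "D \<in> dmods" "f \<in> dhom A B" "g \<in> dhom B C" "h \<in> dhom C D"
  show "cmp A (cmp B h g) f = cmp A h (cmp A g f)"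
    by (rule dhom_ext[OF dhom_cmp[OF *(1,5) dhom_cmp[OF *(2,6,7)]] dhom_cmp[OF *(1) dhom_cmp[OF *(1,5,6)] *(7)]])
      (simp add: cmp_apply dhomD[OF *(5)])
qed (auto intro: dhom_id dhom_cmp)

subsection \<open>Submodules and quotients of distance modules\<close>

definition sub_dmod :: "('x, 'k, 'u) dmod \<Rightarrow> ('x \<Rightarrow> real \<Rightarrow> 'u set) \<Rightarrow> ('x, 'k, 'u) dmod" where
  "sub_dmod M H = \<lparr>pts = (\<lambda>x\<in>X. \<lambda>g\<in>G. (pts M x g)\<lparr>carrier := H x g\<rparr>),
     act = (\<lambda>x y. if x \<in> X \<and> y \<in> X \<and> d x y < \<infinity> then \<lambda>g\<in>G. \<lambda>m\<in>H x g. act M x y g m else undefined)\<rparr>"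

lemma
  assumes M: "M \<in> dmods" and H: "\<And>x g. x \<in> X \<Longrightarrow> g \<in> G \<Longrightarrow> submodule (H x g) K (pts M x g)"
    and act: "\<And>x y g m. \<lbrakk>x \<in> X; y \<in> X; d x y < \<infinity>; g \<in> G; m \<in> H x g\<rbrakk> \<Longrightarrow> act M x y g m \<in> H y (g + \<delta> x y)"
  shows sub_dmod: "sub_dmod M H \<in> dmods"
    and sub_dmod_incl: "(\<lambda>x\<in>X. \<lambda>g\<in>G. \<lambda>m\<in>H x g. m) \<in> dhom (sub_dmod M H) M"
proof -
  have sub: "m \<in> carrier (pts M x g)" if "x \<in> X" "g \<in> G" "m \<in> H x g" for x g m
    using module_submoduleD(1)[OF pts_module[OF M that(1,2)] H[OF that(1,2)]] that(3) by auto
  have mod: "Module.module K ((pts M x g)\<lparr>carrier := H x g\<rparr>)" if "x \<in> X" "g \<in> G" for x g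
    using module_subset[OF pts_module[OF M that] module_submoduleD[OF pts_module[OF M that] H[OF that]]] .
  have p: "pts (sub_dmod M H) x g = (pts M x g)\<lparr>carrier := H x g\<rparr>" if "x \<in> X" "g \<in> G" for x g
    using that by (simp add: sub_dmod_def)
  have a: "act (sub_dmod M H) x y g m = act M x y g m"
    if "x \<in> X" "y \<in> X" "d x y < \<infinity>" "g \<in> G" "m \<in> H x g" for x y g m
    using that by (simp add: sub_dmod_def)
  show *: "sub_dmod M H \<in> dmods"
  proof (rule dist_modulesI)
    show "pts (sub_dmod M H) \<in> X \<rightarrow>\<^sub>E graded_modules K G"
      unfolding sub_dmod_def by (auto intro!: graded_modulesI mod)
  next
    fix x y assume xy: "x \<in> X" "y \<in> X" "d x y < \<infinity>"
    have "(\<lambda>g\<in>G. \<lambda>m\<in>H x g. act M x y g m) \<in> deg_maps K G (\<delta> x y) (pts (sub_dmod M H) x) (pts (sub_dmod M H) y)"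
    proof (rule deg_mapsI)
      fix g assume g: "g \<in> G"
      then have g': "g + \<delta> x y \<in> G" using xy by (intro G_add dG)
      have "(\<lambda>m\<in>carrier (pts (sub_dmod M H) x g). act M x y g m) \<in> lin_maps K (pts (sub_dmod M H) x g) (pts (sub_dmod M H) y (g + \<delta> x y))"
        by (rule lin_mapsI)
          (simp_all add: p xy g g' act mod sub actD[OF M])
      then show "(\<lambda>m\<in>H x g. act M x y g m) \<in> lin_maps K (pts (sub_dmod M H) x g) (pts (sub_dmod M H) y (g + \<delta> x y))"
        by (simp add: p xy g)
    qed
    then show "act (sub_dmod M H) x y \<in> deg_maps K G (\<delta> x y) (pts (sub_dmod M H) x) (pts (sub_dmod M H) y)"
      using xy by (simp add: sub_dmod_def)
  next
    fix x y z g m assume X: "x \<in> X" "y \<in> X" "z \<in> X" "d x y < \<infinity>" "d y z < \<infinity>" "g \<in> G" "m \<in> carrier (pts (sub_dmod M H) x g)"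
    then show "act (sub_dmod M H) y z (g + \<delta> x y) (act (sub_dmod M H) x y g m) =
      (if between d x y z then act (sub_dmod M H) x z g m else \<zero>\<^bsub>pts (sub_dmod M H) z (g + (\<delta> x y + \<delta> y z))\<^esub>)"
      by (simp add: p a act_act[OF M] G_add dG act sub fin_trans[OF X(1-5)])
  next
    fix x g m assume "x \<in> X" "g \<in> G" "m \<in> carrier (pts (sub_dmod M H) x g)"
    then show "act (sub_dmod M H) x x g m = m"
      by (simp add: p a act_refl[OF M] sub)
  qed (auto simp: sub_dmod_def)
  show "(\<lambda>x\<in>X. \<lambda>g\<in>G. \<lambda>m\<in>H x g. m) \<in> dhom (sub_dmod M H) M"
  proof (rule dhomI[OF *])
    fix x g assume xg: "x \<in> X" "g \<in> G"
    have "(\<lambda>m\<in>carrier (pts (sub_dmod M H) x g). m) \<in> lin_maps K (pts (sub_dmod M H) x g) (pts M x g)"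
      by (rule lin_mapsI) (simp_all add: p xg sub mod)
    then show "(\<lambda>m\<in>H x g. m) \<in> lin_maps K (pts (sub_dmod M H) x g) (pts M x g)"
      by (simp add: p xg)
  qed (simp add: p a act)
qed

text \<open>Transport along given surjections \<open>p\<close>, with the action computed on an
  arbitrary preimage. Bijective \<open>p\<close> give copies, projections onto quotients give
  cokernels.\<close>

definition image_dmod ::
  "('x, 'k, 'u) dmod \<Rightarrow> ('x \<Rightarrow> real \<Rightarrow> ('k, 'v) module) \<Rightarrow> ('x \<Rightarrow> real \<Rightarrow> 'u \<Rightarrow> 'v) \<Rightarrow> ('x, 'k, 'v) dmod" where
  "image_dmod M Q p = \<lparr>pts = (\<lambda>x\<in>X. \<lambda>g\<in>G. Q x g),
     act = (\<lambda>x y. if x \<in> X \<and> y \<in> X \<and> d x y < \<infinity>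
       then \<lambda>g\<in>G. \<lambda>q\<in>carrier (Q x g). p y (g + \<delta> x y) (act M x y g (inv_into (carrier (pts M x g)) (p x g) q))
       else undefined)\<rparr>"

lemma
  assumes M: "M \<in> dmods" and Q: "\<And>x g. x \<in> X \<Longrightarrow> g \<in> G \<Longrightarrow> Module.module K (Q x g)"
    and p: "\<And>x g. x \<in> X \<Longrightarrow> g \<in> G \<Longrightarrow> p x g \<in> lin_maps K (pts M x g) (Q x g)"
      "\<And>x g. x \<in> X \<Longrightarrow> g \<in> G \<Longrightarrow> p x g ` carrier (pts M x g) = carrier (Q x g)"
    and act: "\<And>x y g m. \<lbrakk>x \<in> X; y \<in> X; d x y < \<infinity>; g \<in> G; m \<in> carrier (pts M x g); p x g m = \<zero>\<^bsub>Q x g\<^esub>\<rbrakk> \<Longrightarrow>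
      p y (g + \<delta> x y) (act M x y g m) = \<zero>\<^bsub>Q y (g + \<delta> x y)\<^esub>"
  shows image_dmod: "image_dmod M Q p \<in> dmods"
    and image_dmod_proj: "(\<lambda>x\<in>X. \<lambda>g\<in>G. p x g) \<in> dhom M (image_dmod M Q p)"
proof -
  let ?I = "image_dmod M Q p"
  have pt: "pts ?I x g = Q x g" if "x \<in> X" "g \<in> G" for x g
    using that by (simp add: image_dmod_def)
  \<comment> \<open>Independence of the chosen preimage: two preimages differ by an element of the
    kernel, which the action keeps in the kernel by the hypothesis \<open>act\<close>.\<close>
  have eq: "p y (g + \<delta> x y) (act M x y g m) = p y (g + \<delta> x y) (act M x y g n)"
    if "x \<in> X" "y \<in> X" "d x y < \<infinity>" "g \<in> G" and mn: "m \<in> carrier (pts M x g)" "n \<in> carrier (pts M x g)" "p x g m = p x g n"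
    for x y g m n
  proof -
    have g': "g + \<delta> x y \<in> G" using that by (intro G_add dG)
    interpret P: Module.module K "pts M x g" by (rule pts_module[OF M that(1,4)])
    have "p x g (m \<ominus>\<^bsub>pts M x g\<^esub> n) = \<zero>\<^bsub>Q x g\<^esub>"
      using mn lin_mapsD(1)[OF p(1)[OF that(1,4)]]
      by (simp add: lin_maps_minus[OF p(1)[OF that(1,4)] pts_module[OF M that(1,4)] Q[OF that(1,4)]]
          module_minus_eq_zero[OF Q[OF that(1,4)]])
    then have "p y (g + \<delta> x y) (act M x y g (m \<ominus>\<^bsub>pts M x g\<^esub> n)) = \<zero>\<^bsub>Q y (g + \<delta> x y)\<^esub>"
      using mn by (intro act that) simp_all
    then have "p y (g + \<delta> x y) (act M x y g m) \<ominus>\<^bsub>Q y (g + \<delta> x y)\<^esub> p y (g + \<delta> x y) (act M x y g n) = \<zero>\<^bsub>Q y (g + \<delta> x y)\<^esub>"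
      using mn lin_mapsD(1)[OF act_lin[OF M that(1-4)]]
      by (simp add: lin_maps_minus[OF act_lin[OF M that(1-4)] pts_module[OF M that(1,4)] pts_module[OF M that(2) g']]
        lin_maps_minus[OF p(1)[OF that(2) g'] pts_module[OF M that(2) g'] Q[OF that(2) g']])
    then show ?thesis
      using mn lin_mapsD(1)[OF act_lin[OF M that(1-4)]] lin_mapsD(1)[OF p(1)[OF that(2) g']]
      by (simp add: module_minus_eq_zero[OF Q[OF that(2) g']])
  qed
  have pc: "p x g m \<in> carrier (Q x g)" if "x \<in> X" "g \<in> G" "m \<in> carrier (pts M x g)" for x g m
    using lin_mapsD(1)[OF p(1)[OF that(1,2)] that(3)] .
  have rep: "\<exists>m\<in>carrier (pts M x g). q = p x g m" if "x \<in> X" "g \<in> G" "q \<in> carrier (Q x g)" for x g q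
    using p(2)[OF that(1,2)] that(3) by blast
  have a: "act ?I x y g (p x g m) = p y (g + \<delta> x y) (act M x y g m)"
    if "x \<in> X" "y \<in> X" "d x y < \<infinity>" "g \<in> G" "m \<in> carrier (pts M x g)" for x y g m
  proof -
    have i: "inv_into (carrier (pts M x g)) (p x g) (p x g m) \<in> carrier (pts M x g)"
      "p x g (inv_into (carrier (pts M x g)) (p x g) (p x g m)) = p x g m"
      using that(5) by (auto intro: inv_into_into f_inv_into_f)
    show ?thesis using eq[OF that(1-4) i(1) that(5) i(2)] that pc by (simp add: image_dmod_def)
  qed
  show *: "?I \<in> dmods"
  proof (rule dist_modulesI)
    show "pts ?I \<in> X \<rightarrow>\<^sub>E graded_modules K G"
      unfolding image_dmod_def by (auto intro!: graded_modulesI Q)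
  next
    fix x y assume xy: "x \<in> X" "y \<in> X" "d x y < \<infinity>"
    have "(\<lambda>g\<in>G. \<lambda>q\<in>carrier (pts ?I x g). act ?I x y g q) \<in> deg_maps K G (\<delta> x y) (pts ?I x) (pts ?I y)"
    proof (intro deg_mapsI lin_mapsI)
      fix g assume g: "g \<in> G"
      then have g': "g + \<delta> x y \<in> G" using xy by (intro G_add dG)
      note s = pt[OF xy(1) g] pt[OF xy(2) g']
      note ma = actD[OF M xy g] moduleD[OF pts_module[OF M xy(1) g]]
      show "Module.module K (pts ?I x g)" by (simp add: s Q xy g)
      fix q assume q: "q \<in> carrier (pts ?I x g)"
      obtain m where m: "m \<in> carrier (pts M x g)" "q = p x g m" using rep[OF xy(1) g, of q] q by (auto simp: s)
      show "act ?I x y g q \<in> carrier (pts ?I y (g + \<delta> x y))"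
        using m xy g g' by (simp add: a s pc ma)
      { fix c assume c: "c \<in> carrier K"
        have "act ?I x y g (p x g (c \<odot>\<^bsub>pts M x g\<^esub> m)) = c \<odot>\<^bsub>pts ?I y (g + \<delta> x y)\<^esub> act ?I x y g q"
          using c m xy g g' by (simp add: a s ma lin_mapsD[OF p(1)[OF xy(2) g']])
        then show "act ?I x y g (c \<odot>\<^bsub>pts ?I x g\<^esub> q) = c \<odot>\<^bsub>pts ?I y (g + \<delta> x y)\<^esub> act ?I x y g q"
          using c m by (simp add: s lin_mapsD[OF p(1)[OF xy(1) g]]) }
      fix r assume r: "r \<in> carrier (pts ?I x g)"
      obtain n where n: "n \<in> carrier (pts M x g)" "r = p x g n" using rep[OF xy(1) g, of r] r by (auto simp: s)
      have "act ?I x y g (p x g (m \<oplus>\<^bsub>pts M x g\<^esub> n)) = act ?I x y g q \<oplus>\<^bsub>pts ?I y (g + \<delta> x y)\<^esub> act ?I x y g r"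
        using m n xy g g' by (simp add: a s ma lin_mapsD[OF p(1)[OF xy(2) g']])
      then show "act ?I x y g (q \<oplus>\<^bsub>pts ?I x g\<^esub> r) = act ?I x y g q \<oplus>\<^bsub>pts ?I y (g + \<delta> x y)\<^esub> act ?I x y g r"
        using m n by (simp add: s lin_mapsD[OF p(1)[OF xy(1) g]])
    qed
    moreover have "(\<lambda>g\<in>G. \<lambda>q\<in>carrier (pts ?I x g). act ?I x y g q) = act ?I x y"
      using xy by (auto simp: image_dmod_def fun_eq_iff)
    ultimately show "act ?I x y \<in> deg_maps K G (\<delta> x y) (pts ?I x) (pts ?I y)" by simp
  next
    fix x y z g q assume X: "x \<in> X" "y \<in> X" "z \<in> X" "d x y < \<infinity>" "d y z < \<infinity>" "g \<in> G" and q: "q \<in> carrier (pts ?I x g)"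
    obtain m where m: "m \<in> carrier (pts M x g)" "q = p x g m" using rep[OF X(1,6), of q] q X by (auto simp: pt)
    have G': "g + \<delta> x y \<in> G" "g + (\<delta> x y + \<delta> y z) \<in> G" using X by (auto intro!: G_add dG)
    show "act ?I y z (g + \<delta> x y) (act ?I x y g q) =
      (if between d x y z then act ?I x z g q else \<zero>\<^bsub>pts ?I z (g + (\<delta> x y + \<delta> y z))\<^esub>)"
    proof (cases "between d x y z")
      case True
      then have e: "g + \<delta> x y + \<delta> y z = g + \<delta> x z" using between_iff[OF X(1-5)] by simp
      show ?thesis using X m G' True
        by (simp add: a actD[OF M] act_act[OF M] fin_trans[OF X(1-5)] e)
    next
      case False
      have e: "g + \<delta> x y + \<delta> y z = g + (\<delta> x y + \<delta> y z)" by simp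
      show ?thesis using X m G' False
        by (simp only: a actD[OF M] act_act[OF M] e pt if_False simp_thms
          lin_maps_zero[OF p(1)[OF X(3) G'(2)] pts_module[OF M X(3) G'(2)] Q[OF X(3) G'(2)]])
    qed
  next
    fix x g q assume X: "x \<in> X" "g \<in> G" and q: "q \<in> carrier (pts ?I x g)"
    obtain m where m: "m \<in> carrier (pts M x g)" "q = p x g m" using rep[OF X, of q] q X by (auto simp: pt)
    then show "act ?I x x g q = q" using X a[of x x g m] by (simp add: act_refl[OF M])
  qed (auto simp: image_dmod_def)
  show "(\<lambda>x\<in>X. \<lambda>g\<in>G. p x g) \<in> dhom M ?I"
    by (rule dhomI[OF M]) (simp_all add: pt p(1) a)
qed

text \<open>Pointwise bijective morphisms are isomorphisms; linearity and equivariance of the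
  inverse are read off on preimages.\<close>

lemma image_dmod_inverse:
  assumes M: "M \<in> dmods" and N: "N \<in> dmods" and p: "p \<in> dhom M N"
    and bij: "\<And>x g. x \<in> X \<Longrightarrow> g \<in> G \<Longrightarrow> bij_betw (p x g) (carrier (pts M x g)) (carrier (pts N x g))"
  obtains q where "q \<in> dhom N M" "\<And>x g m. \<lbrakk>x \<in> X; g \<in> G; m \<in> carrier (pts M x g)\<rbrakk> \<Longrightarrow> q x g (p x g m) = m"
    "\<And>x g n. \<lbrakk>x \<in> X; g \<in> G; n \<in> carrier (pts N x g)\<rbrakk> \<Longrightarrow> p x g (q x g n) = n"
proof -
  define q where "q = (\<lambda>x\<in>X. \<lambda>g\<in>G. \<lambda>n\<in>carrier (pts N x g). inv_into (carrier (pts M x g)) (p x g) n)"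
  have qp: "q x g (p x g m) = m" if "x \<in> X" "g \<in> G" "m \<in> carrier (pts M x g)" for x g m
    using that bij[OF that(1,2)] dhomD(1)[OF p that] by (simp add: q_def bij_betw_def)
  have pq: "p x g (q x g n) = n" "q x g n \<in> carrier (pts M x g)" if "x \<in> X" "g \<in> G" "n \<in> carrier (pts N x g)" for x g n
    using that bij[OF that(1,2)] by (auto simp: q_def bij_betw_def intro: f_inv_into_f inv_into_into)
  have "q \<in> dhom N M"
    unfolding q_def
  proof (rule dhomI[OF N])
    fix x g assume xg: "x \<in> X" "g \<in> G"
    have qe: "q x g n = inv_into (carrier (pts M x g)) (p x g) n" if "n \<in> carrier (pts N x g)" for n
      using xg that by (simp add: q_def)
    note mM = moduleD[OF pts_module[OF M xg]] and mN = moduleD[OF pts_module[OF N xg]]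
    have "(\<lambda>n\<in>carrier (pts N x g). q x g n) \<in> lin_maps K (pts N x g) (pts M x g)"
    proof (rule lin_mapsI)
      fix m n assume mn: "m \<in> carrier (pts N x g)" "n \<in> carrier (pts N x g)"
      have "p x g (q x g m \<oplus>\<^bsub>pts M x g\<^esub> q x g n) = m \<oplus>\<^bsub>pts N x g\<^esub> n"
        using mn xg by (simp add: dhomD[OF p] pq)
      then show "q x g (m \<oplus>\<^bsub>pts N x g\<^esub> n) = q x g m \<oplus>\<^bsub>pts M x g\<^esub> q x g n"
        using qp[OF xg, of "q x g m \<oplus>\<^bsub>pts M x g\<^esub> q x g n"] mn xg by (simp add: pq mM)
    next
      fix c m assume mn: "c \<in> carrier K" "m \<in> carrier (pts N x g)"
      have "p x g (c \<odot>\<^bsub>pts M x g\<^esub> q x g m) = c \<odot>\<^bsub>pts N x g\<^esub> m"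
        using mn xg by (simp add: dhomD[OF p] pq)
      then show "q x g (c \<odot>\<^bsub>pts N x g\<^esub> m) = c \<odot>\<^bsub>pts M x g\<^esub> q x g m"
        using qp[OF xg, of "c \<odot>\<^bsub>pts M x g\<^esub> q x g m"] mn xg by (simp add: pq mM)
    qed (simp_all add: pq xg pts_module[OF N])
    then show "(\<lambda>n\<in>carrier (pts N x g). inv_into (carrier (pts M x g)) (p x g) n) \<in> lin_maps K (pts N x g) (pts M x g)"
      by (simp add: qe cong: restrict_cong)
  next
    fix x y g n assume *: "x \<in> X" "y \<in> X" "d x y < \<infinity>" "g \<in> G" and n: "n \<in> carrier (pts N x g)"
    define m where "m = q x g n"
    have m: "m \<in> carrier (pts M x g)" "n = p x g m" using pq * n by (auto simp: m_def)
    have g': "g + \<delta> x y \<in> G" using * by (intro G_add dG)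
    have "q y (g + \<delta> x y) (act N x y g n) = act M x y g m"
      using m * g' by (simp add: dhom_act[OF p] qp actD[OF M])
    then show "act M x y g ((\<lambda>n\<in>carrier (pts N x g). inv_into (carrier (pts M x g)) (p x g) n) n) =
      (\<lambda>n\<in>carrier (pts N y (g + \<delta> x y)). inv_into (carrier (pts M y (g + \<delta> x y))) (p y (g + \<delta> x y)) n) (act N x y g n)"
      using m_def n * g' by (simp add: q_def)
  qed
  then show ?thesis using that qp pq(1) by blast
qed

text \<open>Induced and coinduced modules enter the category over \<open>'u\<close> in this way. The
  isomorphisms \<open>p\<close> and \<open>q\<close> allow lifting and extension problems to be
  solved on the original.\<close>

lemma dmod_copy:
  assumes M: "M \<in> dmods" and emb: "\<And>x g. x \<in> X \<Longrightarrow> g \<in> G \<Longrightarrow> embeds (carrier (pts M x g)) TYPE('u)"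
  obtains N :: "('x, 'k, 'u) dmod" and p q where "N \<in> dmods" "p \<in> dhom M N" "q \<in> dhom N M"
    "\<And>x g m. \<lbrakk>x \<in> X; g \<in> G; m \<in> carrier (pts M x g)\<rbrakk> \<Longrightarrow> q x g (p x g m) = m"
    "\<And>x g n. \<lbrakk>x \<in> X; g \<in> G; n \<in> carrier (pts N x g)\<rbrakk> \<Longrightarrow> p x g (q x g n) = n"
proof -
  define Q where "Q x g = (copy (pts M x g) :: ('k, 'u) module)" for x g
  define p where "p x g = (\<lambda>m\<in>carrier (pts M x g). to_copy (pts M x g) m :: 'u)" for x g
  have Q: "Module.module K (Q x g)" if "x \<in> X" "g \<in> G" for x g
    unfolding Q_def by (rule module_copy[OF emb[OF that] pts_module[OF M that]])
  have lin: "p x g \<in> lin_maps K (pts M x g) (Q x g)" if "x \<in> X" "g \<in> G" for x g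
    unfolding Q_def p_def by (rule to_copy_lin[OF emb[OF that] pts_module[OF M that]])
  have surj: "p x g ` carrier (pts M x g) = carrier (Q x g)" if "x \<in> X" "g \<in> G" for x g
    unfolding Q_def p_def copy_simps(1)[OF emb[OF that]] by auto
  have inj: "inj_on (p x g) (carrier (pts M x g))" if "x \<in> X" "g \<in> G" for x g
    using to_copy_inj[OF emb[OF that]] unfolding p_def by (auto simp: inj_on_def)
  have act: "p y (g + \<delta> x y) (act M x y g m) = \<zero>\<^bsub>Q y (g + \<delta> x y)\<^esub>"
    if *: "x \<in> X" "y \<in> X" "d x y < \<infinity>" "g \<in> G" "m \<in> carrier (pts M x g)" "p x g m = \<zero>\<^bsub>Q x g\<^esub>" for x y g m
  proof -
    have g': "g + \<delta> x y \<in> G" using * by (intro G_add dG)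
    have "m = \<zero>\<^bsub>pts M x g\<^esub>"
      by (rule inj_onD[OF inj[OF *(1,4)]])
        (simp_all add: * lin_maps_zero[OF lin[OF *(1,4)] pts_module[OF M *(1,4)] Q[OF *(1,4)]] moduleD(1)[OF pts_module[OF M]])
    then show ?thesis
      by (simp add: act_zero[OF M *(1-4)] lin_maps_zero[OF lin[OF *(2) g'] pts_module[OF M *(2) g'] Q[OF *(2) g']])
  qed
  have I: "image_dmod M Q p \<in> dmods" "(\<lambda>x\<in>X. \<lambda>g\<in>G. p x g) \<in> dhom M (image_dmod M Q p)"
    by (rule image_dmod[OF M] image_dmod_proj[OF M]; fact Q lin surj act)+
  have pt: "pts (image_dmod M Q p) x g = Q x g" if "x \<in> X" "g \<in> G" for x g
    using that by (simp add: image_dmod_def)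
  show ?thesis
  proof (rule image_dmod_inverse[OF M I(1,2)])
    fix x g assume "x \<in> X" "g \<in> G"
    then show "bij_betw ((\<lambda>x\<in>X. \<lambda>g\<in>G. p x g) x g) (carrier (pts M x g)) (carrier (pts (image_dmod M Q p) x g))"
      using inj surj by (simp add: pt bij_betw_def)
  qed (use I that in blast)
qed

section \<open>Monomorphisms and epimorphisms are detected pointwise\<close>

definition zero_hom :: "('x, 'k, 'u) dmod \<Rightarrow> ('x, 'k, 'v) dmod \<Rightarrow> 'x \<Rightarrow> real \<Rightarrow> 'u \<Rightarrow> 'v" where
  "zero_hom M N = (\<lambda>x\<in>X. \<lambda>g\<in>G. \<lambda>m\<in>carrier (pts M x g). \<zero>\<^bsub>pts N x g\<^esub>)"

lemma zero_hom: "M \<in> dmods \<Longrightarrow> N \<in> dmods \<Longrightarrow> zero_hom M N \<in> dhom M N"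
  unfolding zero_hom_def
  by (rule dhomI) (auto intro!: lin_mapsI pts_module simp: moduleD[OF pts_module] act_zero actD)

text \<open>\<open>i\<close> equalises the inclusion of its kernel and the zero morphism, so the
  kernel vanishes.\<close>

lemma mono_injective:
  assumes mono: "mono_arr (DistMod K G X d) A B i" and A: "A \<in> dmods" and B: "B \<in> dmods"
    and x: "x \<in> X" "g \<in> G"
  shows "inj_on (i x g) (carrier (pts A x g))"
proof -
  note i = mono[unfolded mono_arr_def DistMod_simps, THEN conjunct1]
    and can = mono[unfolded mono_arr_def DistMod_simps, THEN conjunct2, rule_format]
  define H where "H x g = {m \<in> carrier (pts A x g). i x g m = \<zero>\<^bsub>pts B x g\<^esub>}" for x g
  have H: "submodule (H x g) K (pts A x g)" if "x \<in> X" "g \<in> G" for x g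
    unfolding H_def by (rule submodule_kernel[OF dhom_lin[OF i that] pts_module[OF A that] pts_module[OF B that]])
  have act: "act A x y g m \<in> H y (g + \<delta> x y)" if "x \<in> X" "y \<in> X" "d x y < \<infinity>" "g \<in> G" "m \<in> H x g" for x y g m
    using that unfolding H_def by (simp add: actD[OF A] act_zero[OF B] flip: dhom_act[OF i])
    let ?Z = "sub_dmod A H" and ?u = "\<lambda>x\<in>X. \<lambda>g\<in>G. \<lambda>m\<in>H x g. m"
  have Z: "?Z \<in> dmods" and u: "?u \<in> dhom ?Z A"
    by (rule sub_dmod[OF A] sub_dmod_incl[OF A]; fact H act)+
  have c: "carrier (pts ?Z x g) = H x g" if "x \<in> X" "g \<in> G" for x g
    using that by (simp add: sub_dmod_def)
  have eq: "?u = zero_hom ?Z A"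
  proof (rule can[OF Z u zero_hom[OF Z A]], rule dhom_ext[OF dhom_cmp[OF Z u i] dhom_cmp[OF Z zero_hom[OF Z A] i]])
    fix x g m assume *: "x \<in> X" "g \<in> G" "m \<in> carrier (pts ?Z x g)"
    then show "cmp ?Z i ?u x g m = cmp ?Z i (zero_hom ?Z A) x g m"
      by (simp add: cmp_apply zero_hom_def dhom_zero[OF i A B]) (simp add: c H_def)
  qed
  have z: "m = \<zero>\<^bsub>pts A x g\<^esub>" if "m \<in> H x g" for m
    using that x fun_cong[OF fun_cong[OF fun_cong[OF eq, of x], of g], of m] by (simp add: zero_hom_def c)
  show ?thesis
    by (rule lin_maps_injI[OF dhom_lin[OF i x] pts_module[OF A x] pts_module[OF B x]]) (simp add: z H_def)
qed

lemma mono_arrI: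
  assumes i: "i \<in> dhom A B" and A: "A \<in> dmods"
    and inj: "\<And>x g. x \<in> X \<Longrightarrow> g \<in> G \<Longrightarrow> inj_on (i x g) (carrier (pts A x g))"
  shows "mono_arr (DistMod K G X d) A B i"
  unfolding mono_arr_def
proof (intro conjI ballI impI)
  fix Z u v assume "Z \<in> Obj (DistMod K G X d)" "u \<in> Arr (DistMod K G X d) Z A" "v \<in> Arr (DistMod K G X d) Z A"
    and eq: "Cmp (DistMod K G X d) Z A B i u = Cmp (DistMod K G X d) Z A B i v"
  then have Z: "Z \<in> dmods" and u: "u \<in> dhom Z A" and v: "v \<in> dhom Z A" by simp_all
  show "u = v"
  proof (rule dhom_ext[OF u v])
    fix x g m assume *: "x \<in> X" "g \<in> G" "m \<in> carrier (pts Z x g)"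
    have "cmp Z i u x g m = cmp Z i v x g m" using eq by simp
    then show "u x g m = v x g m"
      using * inj_onD[OF inj[OF *(1,2)]] by (simp add: cmp_apply dhomD[OF u] dhomD[OF v])
  qed
qed (simp add: i)

text \<open>\<open>e\<close> coequalises the projection to its cokernel and the zero morphism, so
  the cokernel vanishes. The quotient is copied because only objects over \<open>'u\<close> may be
  used for cancelling.\<close>

lemma epi_surjective:
  fixes A B :: "('x, 'k, 'u) dmod"
  assumes epi: "epi_arr (DistMod K G X d) A B e" and A: "A \<in> dmods" and B: "B \<in> dmods"
    and x: "x \<in> X" "g \<in> G"
  shows "e x g ` carrier (pts A x g) = carrier (pts B x g)"
proof -
  note e = epi[unfolded epi_arr_def DistMod_simps, THEN conjunct1]
    and can = epi[unfolded epi_arr_def DistMod_simps, THEN conjunct2, rule_format]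
  define H where "H x g = e x g ` carrier (pts A x g)" for x g
  have H: "submodule (H x g) K (pts B x g)" if "x \<in> X" "g \<in> G" for x g
    unfolding H_def by (rule submodule_image[OF dhom_lin[OF e that] pts_module[OF A that] pts_module[OF B that]])
  define Q where "Q x g = (copy (quotient_module (pts B x g) (H x g)) :: ('k, 'u) module)" for x g
  define p where "p x g = (\<lambda>m\<in>carrier (pts B x g). to_copy (quotient_module (pts B x g) (H x g)) (H x g +>\<^bsub>pts B x g\<^esub> m) :: 'u)" for x g
  have M: "Module.module K (quotient_module (pts B x g) (H x g))"
    and emb: "embeds (carrier (quotient_module (pts B x g) (H x g))) TYPE('u)" if "x \<in> X" "g \<in> G" for x g
    using module_quotient[OF pts_module[OF B that] H[OF that]] embeds_quotient[OF pts_module[OF B that] H[OF that]] .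
  have Q: "Module.module K (Q x g)" if "x \<in> X" "g \<in> G" for x g
    unfolding Q_def by (rule module_copy[OF emb[OF that] M[OF that]])
  have cc: "H x g +>\<^bsub>pts B x g\<^esub> m \<in> carrier (quotient_module (pts B x g) (H x g))"
    if "x \<in> X" "g \<in> G" "m \<in> carrier (pts B x g)" for x g m
    using that by (simp add: quotient_carrier[OF pts_module[OF B that(1,2)] H[OF that(1,2)]])
  have lin: "p x g \<in> lin_maps K (pts B x g) (Q x g)" if "x \<in> X" "g \<in> G" for x g
    using lin_maps_comp[OF quotient_lin[OF pts_module[OF B that] H[OF that]] to_copy_lin[OF emb[OF that] M[OF that]] pts_module[OF B that]]
    unfolding Q_def p_def by (simp add: cc[OF that] cong: restrict_cong)
  have surj: "p x g ` carrier (pts B x g) = carrier (Q x g)" if "x \<in> X" "g \<in> G" for x g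
    unfolding Q_def p_def copy_simps(1)[OF emb[OF that]] quotient_carrier[OF pts_module[OF B that] H[OF that]]
    by auto
  have zero: "\<zero>\<^bsub>Q x g\<^esub> = to_copy (quotient_module (pts B x g) (H x g)) (H x g)" if "x \<in> X" "g \<in> G" for x g
    unfolding Q_def copy_simps(2)[OF emb[OF that]] quotient_zero ..
  have ker: "p x g m = \<zero>\<^bsub>Q x g\<^esub> \<longleftrightarrow> m \<in> H x g" if "x \<in> X" "g \<in> G" "m \<in> carrier (pts B x g)" for x g m
  proof -
    note B' = pts_module[OF B that(1,2)] and H' = H[OF that(1,2)]
    interpret P: Module.module K "pts B x g" by (rule B')
    have "p x g m = \<zero>\<^bsub>Q x g\<^esub> \<longleftrightarrow> H x g +>\<^bsub>pts B x g\<^esub> m = H x g"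
      using inj_on_eq_iff[OF to_copy_inj[OF emb[OF that(1,2)]] cc[OF that] moduleD(1)[OF M[OF that(1,2)]]] that
      by (simp add: p_def zero quotient_zero)
    also have "\<dots> \<longleftrightarrow> m \<ominus>\<^bsub>pts B x g\<^esub> \<zero>\<^bsub>pts B x g\<^esub> \<in> H x g"
      using coset_eq_iff[OF B' H' that(3) P.zero_closed] by (simp only: coset_zero[OF B' H'])
    finally show ?thesis
      using that monoid.inv_one[OF group.is_monoid[OF abelian_group.a_group[OF module_abelian[OF B']]]]
      by (simp add: a_minus_def a_inv_def)
  qed
  \<comment> \<open>The kernel of the projection is the image of \<open>e\<close>, and equivariance
    of \<open>e\<close> makes that image stable under the action.\<close>
  have act: "p y (g + \<delta> x y) (act B x y g m) = \<zero>\<^bsub>Q y (g + \<delta> x y)\<^esub>"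
    if *: "x \<in> X" "y \<in> X" "d x y < \<infinity>" "g \<in> G" "m \<in> carrier (pts B x g)" "p x g m = \<zero>\<^bsub>Q x g\<^esub>" for x y g m
  proof -
    have g': "g + \<delta> x y \<in> G" using * by (intro G_add dG)
    obtain a where a: "a \<in> carrier (pts A x g)" "m = e x g a" using ker[OF *(1,4,5)] *(6) by (auto simp: H_def)
    then have "act B x y g m \<in> H y (g + \<delta> x y)"
      using * by (auto simp: dhom_act[OF e] H_def intro!: imageI actD[OF A])
    then show ?thesis using ker[OF *(2) g'] * by (simp add: actD[OF B])
  qed
  let ?I = "image_dmod B Q p" and ?p = "\<lambda>x\<in>X. \<lambda>g\<in>G. p x g"
  have I: "?I \<in> dmods" "?p \<in> dhom B ?I"
    by (rule image_dmod[OF B] image_dmod_proj[OF B]; fact Q lin surj act)+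
  have pt: "pts ?I x g = Q x g" if "x \<in> X" "g \<in> G" for x g
    using that by (simp add: image_dmod_def)
  have eq: "?p = zero_hom B ?I"
  proof (rule can[OF I(1,2) zero_hom[OF B I(1)]], rule dhom_ext[OF dhom_cmp[OF A e I(2)] dhom_cmp[OF A e zero_hom[OF B I(1)]]])
    fix x g m assume *: "x \<in> X" "g \<in> G" "m \<in> carrier (pts A x g)"
    then show "cmp A ?p e x g m = cmp A (zero_hom B ?I) e x g m"
      by (simp add: cmp_apply zero_hom_def dhomD[OF e] pt ker) (simp add: H_def)
  qed
  have "p x g m = \<zero>\<^bsub>Q x g\<^esub>" if "m \<in> carrier (pts B x g)" for m
    using that x fun_cong[OF fun_cong[OF fun_cong[OF eq, of x], of g], of m] by (simp add: zero_hom_def pt)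
  then have "carrier (pts B x g) \<subseteq> H x g" using ker[OF x] by blast
  then show ?thesis using dhomD(1)[OF e x] by (auto simp: H_def)
qed

lemma epi_arrI:
  assumes e: "e \<in> dhom A B" and A: "A \<in> dmods"
    and surj: "\<And>x g. x \<in> X \<Longrightarrow> g \<in> G \<Longrightarrow> e x g ` carrier (pts A x g) = carrier (pts B x g)"
  shows "epi_arr (DistMod K G X d) A B e"
  unfolding epi_arr_def
proof (intro conjI ballI impI)
  fix Z u v assume "Z \<in> Obj (DistMod K G X d)" "u \<in> Arr (DistMod K G X d) B Z" "v \<in> Arr (DistMod K G X d) B Z"
    and eq: "Cmp (DistMod K G X d) A B Z u e = Cmp (DistMod K G X d) A B Z v e"
  then have Z: "Z \<in> dmods" and u: "u \<in> dhom B Z" and v: "v \<in> dhom B Z" by simp_all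
  show "u = v"
  proof (rule dhom_ext[OF u v])
    fix x g m assume *: "x \<in> X" "g \<in> G" "m \<in> carrier (pts B x g)"
    then obtain a where a: "a \<in> carrier (pts A x g)" "m = e x g a" using surj[OF *(1,2)] by auto
    have "cmp A u e x g a = cmp A v e x g a" using eq by simp
    then show "u x g m = v x g m" using * a by (simp add: cmp_apply)
  qed
qed (simp add: e)

end

section \<open>Trivial modules, invariants and coinvariants\<close>

text \<open>The arrow parts of \<open>Inv\<close> and \<open>Coinv\<close> have this shape: a map
  \<open>t\<close> between the original modules, conjugated by the copying bijections.\<close>

lemma copy_map:
  assumes P: "embeds (carrier P) TYPE('u)" "Module.module K P" and Q: "embeds (carrier Q) TYPE('u)" "Module.module K Q"
    and t: "(\<lambda>p\<in>carrier P. t p) \<in> lin_maps K P Q"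
  shows "(\<lambda>u\<in>to_copy P ` carrier P. to_copy Q (t (of_copy P u))) \<in> lin_maps K (copy P :: ('k, 'u) module) (copy Q :: ('k, 'u) module)"
    and "p \<in> carrier P \<Longrightarrow> (\<lambda>u\<in>to_copy P ` carrier P. to_copy Q (t (of_copy P u)) :: 'u) (to_copy P p :: 'u) = to_copy Q (t p)"
proof -
  have "(\<lambda>u\<in>carrier (copy P :: ('k, 'u) module). to_copy Q (t (of_copy P u))) \<in> lin_maps K (copy P) (copy Q :: ('k, 'u) module)"
    using lin_maps_comp[OF lin_maps_comp[OF of_copy_lin[OF P] t module_copy[OF P]] to_copy_lin[OF Q] module_copy[OF P]]
      lin_mapsD(1)[OF t]
    by (simp add: to_copy_of_copy[OF P(1)] cong: restrict_cong)
  then show "(\<lambda>u\<in>to_copy P ` carrier P. to_copy Q (t (of_copy P u))) \<in> lin_maps K (copy P :: ('k, 'u) module) (copy Q :: ('k, 'u) module)"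
    by (simp add: copy_simps(1)[OF P(1)])
qed (simp add: of_copy_to_copy[OF P(1)])

lemma sum_module_map:
  assumes K: "cring K" and M: "\<And>i. i \<in> I \<Longrightarrow> Module.module K (M i)" and N: "\<And>i. i \<in> I \<Longrightarrow> Module.module K (N i)"
    and c: "\<And>i. i \<in> I \<Longrightarrow> c i \<in> lin_maps K (M i) (N i)"
  shows "(\<lambda>u\<in>carrier (sum_module finite I M). \<lambda>i\<in>I. c i (u i)) \<in> lin_maps K (sum_module finite I M) (sum_module finite I N)"
proof (rule lin_mapsI)
  show "Module.module K (sum_module finite I M)" using K M by (rule module_sum[OF _ _ support_ideal_finite])
  fix u assume u: "u \<in> carrier (sum_module finite I M)"
  then have um: "u i \<in> carrier (M i)" if "i \<in> I" for i using that by auto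
  have "{i \<in> I. c i (u i) \<noteq> \<zero>\<^bsub>N i\<^esub>} \<subseteq> {i \<in> I. u i \<noteq> \<zero>\<^bsub>M i\<^esub>}"
    using lin_maps_zero[OF c M N] by auto
  moreover have "finite {i \<in> I. u i \<noteq> \<zero>\<^bsub>M i\<^esub>}" using u by simp
  ultimately have "finite {i \<in> I. c i (u i) \<noteq> \<zero>\<^bsub>N i\<^esub>}" by (rule finite_subset)
  then show "(\<lambda>i\<in>I. c i (u i)) \<in> carrier (sum_module finite I N)"
    using um by (auto simp: lin_mapsD(1)[OF c] cong: conj_cong)
  { fix a assume "a \<in> carrier K"
    then show "(\<lambda>i\<in>I. c i ((a \<odot>\<^bsub>sum_module finite I M\<^esub> u) i)) = a \<odot>\<^bsub>sum_module finite I N\<^esub> (\<lambda>i\<in>I. c i (u i))"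
      using um by (auto simp: fun_eq_iff lin_mapsD(3)[OF c]) }
  fix v assume v: "v \<in> carrier (sum_module finite I M)"
  then have "v i \<in> carrier (M i)" if "i \<in> I" for i using that by auto
  then show "(\<lambda>i\<in>I. c i ((u \<oplus>\<^bsub>sum_module finite I M\<^esub> v) i)) = (\<lambda>i\<in>I. c i (u i)) \<oplus>\<^bsub>sum_module finite I N\<^esub> (\<lambda>i\<in>I. c i (v i))"
    using um by (auto simp: fun_eq_iff lin_mapsD(2)[OF c])
qed

section \<open>The trivial module functor\<close>

context dist_setting
begin

abbreviation triv :: "('k, 'u) gmod \<Rightarrow> ('x, 'k, 'u) dmod" where "triv A \<equiv> FObj (Triv G X d) A"

lemma Triv_simps [simp]:
  "x \<in> X \<Longrightarrow> pts (triv A) x = A"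
  "FArr (Triv G X d) A B f = (\<lambda>x\<in>X. f)"
  by (simp_all add: Triv_def)

lemma triv_act: "\<lbrakk>x \<in> X; y \<in> X; d x y < \<infinity>; g \<in> G; m \<in> carrier (A g)\<rbrakk> \<Longrightarrow>
    act (triv A) x y g m = (if x = y then m else \<zero>\<^bsub>A (g + \<delta> x y)\<^esub>)"
  by (simp add: Triv_def deg_id_apply deg_zero_apply)

lemma triv_dmods:
  assumes A: "A \<in> graded_modules K G"
  shows "triv A \<in> dmods"
proof (rule dist_modulesI)
  show "pts (triv A) \<in> X \<rightarrow>\<^sub>E graded_modules K G" using A by (auto simp: Triv_def)
next
  fix x y assume xy: "x \<in> X" "y \<in> X" "d x y < \<infinity>"
  then show "act (triv A) x y \<in> deg_maps K G (\<delta> x y) (pts (triv A) x) (pts (triv A) y)"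
    using deg_id_maps[OF A] deg_zero_maps[OF A A dG[OF xy]] by (simp add: Triv_def)
next
  fix x y z g m assume X: "x \<in> X" "y \<in> X" "z \<in> X" "d x y < \<infinity>" "d y z < \<infinity>" "g \<in> G" "m \<in> carrier (pts (triv A) x g)"
  have g': "g + \<delta> x y \<in> G" using X by (intro G_add dG)
  have m: "m \<in> carrier (A g)" using X by simp
  note z = moduleD(1)[OF graded_modulesD[OF A g']]
  show "act (triv A) y z (g + \<delta> x y) (act (triv A) x y g m) =
    (if between d x y z then act (triv A) x z g m else \<zero>\<^bsub>pts (triv A) z (g + (\<delta> x y + \<delta> y z))\<^esub>)"
  proof (cases "x = y \<or> y = z")
    case True
    then show ?thesis using X m g' z by (auto simp: triv_act)
  next
    case False
    then have 0: "act (triv A) y z (g + \<delta> x y) (act (triv A) x y g m) = \<zero>\<^bsub>A (g + (\<delta> x y + \<delta> y z))\<^esub>"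
      using X m g' z by (simp add: triv_act add.assoc)
    show ?thesis
    proof (cases "between d x y z")
      case True
      \<comment> \<open>Were \<open>x = z\<close>, betweenness would force \<open>x = y\<close>.
        Hence the direct action from \<open>x\<close> to \<open>z\<close> vanishes, as does the
        composite.\<close>
      then have "x \<noteq> z" using False X between_same by blast
      then show ?thesis unfolding 0 using True X m fin_trans[OF X(1-5)] by (simp add: triv_act between_iff)
    next
      case False
      then show ?thesis unfolding 0 using X by simp
    qed
  qed
qed (auto simp: Triv_def deg_id_apply)

lemma triv_hom:
  assumes A: "A \<in> graded_modules K G" and B: "B \<in> graded_modules K G" and f: "f \<in> deg_maps K G 0 A B"
  shows "(\<lambda>x\<in>X. f) \<in> dhom (triv A) (triv B)"
proof -
  have "(\<lambda>g\<in>G. f g) = f" using f by (auto simp: deg_maps_def PiE_iff extensional_restrict)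
  moreover have "(\<lambda>x\<in>X. \<lambda>g\<in>G. f g) \<in> dhom (triv A) (triv B)"
  proof (rule dhomI[OF triv_dmods[OF A]])
    fix x y g m assume *: "x \<in> X" "y \<in> X" "d x y < \<infinity>" "g \<in> G" "m \<in> carrier (pts (triv A) x g)"
    then have "g + \<delta> x y \<in> G" by (intro G_add dG)
    then show "act (triv B) x y g (f g m) = f (g + \<delta> x y) (act (triv A) x y g m)"
      using * deg_maps_zero[OF A B f] G_zero by (auto simp: triv_act deg_maps0D[OF f])
  qed (use deg_maps_lin[OF f] in simp)
  ultimately show ?thesis by simp
qed

lemma Triv_functor:
  "ftor_between (GrMod K G) (DistMod K G X d)
     (Triv G X d :: (('k, 'u) gmod, real \<Rightarrow> 'u \<Rightarrow> 'u, ('x, 'k, 'u) dmod, 'x \<Rightarrow> real \<Rightarrow> 'u \<Rightarrow> 'u) ftor)"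
  unfolding ftor_between_def
  by (auto simp: category_GrMod category_DistMod triv_dmods triv_hom cmp_def fun_eq_iff)

end

locale dist_universe = dist_setting K G X d + universe T U
  for K :: "'k ring" and G and X :: "'x set" and d and T :: "('x + 'k + nat) itself" and U :: "'u itself"
begin

subsection \<open>Invariants\<close>

abbreviation inv_module :: "('x, 'k, 'u) dmod \<Rightarrow> real \<Rightarrow> ('k, 'x \<Rightarrow> 'u) module" where
  "inv_module M l \<equiv> Inv_big X d M l"

lemma submodule_inv_part:
  assumes M: "M \<in> dmods" and x: "x \<in> X" "l \<in> G"
  shows "submodule (inv_part X d M l x) K (pts M x l)"
proof (rule module_submoduleI[OF pts_module[OF M x]])
  note m = moduleD[OF pts_module[OF M x]]
  show "\<zero>\<^bsub>pts M x l\<^esub> \<in> inv_part X d M l x"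
    using x by (simp add: inv_part_def m act_zero[OF M])
  have y: "Module.module K (pts M y (l + \<delta> x y))" if "y \<in> X" "d x y < \<infinity>" for y
    using that x by (intro pts_module[OF M] G_add dG)
  show "u \<oplus>\<^bsub>pts M x l\<^esub> v \<in> inv_part X d M l x" if "u \<in> inv_part X d M l x" "v \<in> inv_part X d M l x" for u v
    using that x by (simp add: inv_part_def m actD[OF M] moduleD[OF y])
  show "a \<odot>\<^bsub>pts M x l\<^esub> v \<in> inv_part X d M l x" if "a \<in> carrier K" "v \<in> inv_part X d M l x" for a v
    using that x by (simp add: inv_part_def m actD[OF M] moduleD[OF y])
qed (auto simp: inv_part_def)

lemma inv_module_simps [simp]:
  "carrier (inv_module M l) = (\<Pi>\<^sub>E x\<in>X. inv_part X d M l x)"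
  "\<zero>\<^bsub>inv_module M l\<^esub> = (\<lambda>x\<in>X. \<zero>\<^bsub>pts M x l\<^esub>)"
  "u \<oplus>\<^bsub>inv_module M l\<^esub> v = (\<lambda>x\<in>X. u x \<oplus>\<^bsub>pts M x l\<^esub> v x)"
  "a \<odot>\<^bsub>inv_module M l\<^esub> u = (\<lambda>x\<in>X. a \<odot>\<^bsub>pts M x l\<^esub> u x)"
  by (simp_all add: Inv_big_def)

lemma module_inv: "M \<in> dmods \<Longrightarrow> l \<in> G \<Longrightarrow> Module.module K (inv_module M l)"
  unfolding Inv_big_def
  using module_subset[OF pts_module module_submoduleD[OF pts_module submodule_inv_part]]
  by (intro module_product K)

lemma embeds_inv: "embeds (carrier (inv_module M l)) TYPE('u)"
  by (rule embeds_subset[OF embeds_x]) simp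

lemma inv_part_hom:
  assumes \<phi>: "\<phi> \<in> dhom M N" and M: "M \<in> dmods" and N: "N \<in> dmods" and x: "x \<in> X" "l \<in> G" "m \<in> inv_part X d M l x"
  shows "\<phi> x l m \<in> inv_part X d N l x"
  unfolding inv_part_def
proof (intro CollectI conjI ballI impI)
  have m: "m \<in> carrier (pts M x l)" using x(3) by (simp add: inv_part_def)
  then show "\<phi> x l m \<in> carrier (pts N x l)" by (rule dhomD(1)[OF \<phi> x(1,2)])
  fix y assume y: "y \<in> X" "y \<noteq> x \<and> d x y < \<infinity>"
  then have "l + \<delta> x y \<in> G" using x by (intro G_add dG) auto
  then show "act N x y l (\<phi> x l m) = \<zero>\<^bsub>pts N y (l + \<delta> x y)\<^esub>"
    using x y m by (simp add: dhom_act[OF \<phi>] inv_part_def dhom_zero[OF \<phi> M N])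
qed

lemma inv_map_lin:
  assumes \<phi>: "\<phi> \<in> dhom M N" and M: "M \<in> dmods" and N: "N \<in> dmods" and l: "l \<in> G"
  shows "(\<lambda>u\<in>carrier (inv_module M l). \<lambda>x\<in>X. \<phi> x l (u x)) \<in> lin_maps K (inv_module M l) (inv_module N l)"
proof (rule lin_mapsI[OF _ _ _ module_inv[OF M l]])
  fix u assume u: "u \<in> carrier (inv_module M l)"
  then have um: "u x \<in> inv_part X d M l x" "u x \<in> carrier (pts M x l)" if "x \<in> X" for x
    using that by (auto simp: inv_part_def PiE_iff)
  show "(\<lambda>x\<in>X. \<phi> x l (u x)) \<in> carrier (inv_module N l)"
    using um l by (simp add: inv_part_hom[OF \<phi> M N])
  show "(\<lambda>x\<in>X. \<phi> x l ((a \<odot>\<^bsub>inv_module M l\<^esub> u) x)) = a \<odot>\<^bsub>inv_module N l\<^esub> (\<lambda>x\<in>X. \<phi> x l (u x))" if "a \<in> carrier K" for a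
    using um l that by (auto simp: fun_eq_iff dhomD[OF \<phi>])
  fix v assume v: "v \<in> carrier (inv_module M l)"
  then have "v x \<in> carrier (pts M x l)" if "x \<in> X" for x
    using that by (auto simp: inv_part_def PiE_iff)
  then show "(\<lambda>x\<in>X. \<phi> x l ((u \<oplus>\<^bsub>inv_module M l\<^esub> v) x)) = (\<lambda>x\<in>X. \<phi> x l (u x)) \<oplus>\<^bsub>inv_module N l\<^esub> (\<lambda>x\<in>X. \<phi> x l (v x))"
    using um l by (auto simp: fun_eq_iff dhomD[OF \<phi>])
qed

abbreviation INV :: "(('x, 'k, 'u) dmod, 'x \<Rightarrow> real \<Rightarrow> 'u \<Rightarrow> 'u, ('k, 'u) gmod, real \<Rightarrow> 'u \<Rightarrow> 'u) ftor" where
  "INV \<equiv> Inv G X d"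

lemma Inv_Obj [simp]: "l \<in> G \<Longrightarrow> FObj INV M l = copy (inv_module M l)"
  by (simp add: Inv_def)

lemma Inv_graded: "M \<in> dmods \<Longrightarrow> FObj INV M \<in> graded_modules K G"
  unfolding Inv_def by (auto intro!: graded_modulesI module_copy embeds_inv module_inv)

lemma Inv_elem: "l \<in> G \<Longrightarrow> u \<in> carrier (FObj INV M l) \<Longrightarrow> \<exists>p\<in>carrier (inv_module M l). u = to_copy (inv_module M l) p"
  by (auto simp: copy_simps(1)[OF embeds_inv])

lemma Inv_Arr:
  assumes \<phi>: "\<phi> \<in> dhom M N" and M: "M \<in> dmods" and N: "N \<in> dmods"
  shows "FArr INV M N \<phi> \<in> deg_maps K G 0 (FObj INV M) (FObj INV N)"
    and "\<lbrakk>l \<in> G; u \<in> carrier (inv_module M l)\<rbrakk> \<Longrightarrow>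
      FArr INV M N \<phi> l (to_copy (inv_module M l) u) = to_copy (inv_module N l) (\<lambda>x\<in>X. \<phi> x l (u x))"
proof -
  note c = copy_map[where t="\<lambda>u. \<lambda>x\<in>X. \<phi> x l (u x)" for l,
      OF embeds_inv module_inv[OF M] embeds_inv module_inv[OF N] inv_map_lin[OF \<phi> M N]]
  show "FArr INV M N \<phi> \<in> deg_maps K G 0 (FObj INV M) (FObj INV N)"
    unfolding Inv_def ftor.simps by (rule deg_mapsI) (use c(1) in simp)
  show "FArr INV M N \<phi> l (to_copy (inv_module M l) u) = to_copy (inv_module N l) (\<lambda>x\<in>X. \<phi> x l (u x))"
    if "l \<in> G" "u \<in> carrier (inv_module M l)"
    using c(2)[of l u] that by (simp add: Inv_def)
qed

lemma Inv_functor: "ftor_between (DistMod K G X d) (GrMod K G) INV"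
  unfolding ftor_between_def DistMod_simps GrMod_simps
proof (intro conjI ballI category_GrMod category_DistMod)
  fix M :: "('x, 'k, 'u) dmod" assume M: "M \<in> dmods"
  show "FObj INV M \<in> graded_modules K G" by (rule Inv_graded[OF M])
  show "FArr INV M M (\<lambda>x\<in>X. deg_id G (pts M x)) = deg_id G (FObj INV M)"
  proof (rule deg_maps_ext[OF Inv_Arr(1)[OF dhom_id[OF M] M M] deg_id_maps[OF Inv_graded[OF M]]])
    fix l u assume l: "l \<in> G" and u: "u \<in> carrier (FObj INV M l)"
    obtain p where p: "p \<in> carrier (inv_module M l)" "u = to_copy (inv_module M l) p" using Inv_elem[OF l u] by auto
    have "(\<lambda>x\<in>X. (\<lambda>x\<in>X. deg_id G (pts M x)) x l (p x)) = p"
      using p(1) l by (auto simp: fun_eq_iff PiE_iff extensional_def deg_id_apply inv_part_def)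
    then show "FArr INV M M (\<lambda>x\<in>X. deg_id G (pts M x)) l u = deg_id G (FObj INV M) l u"
      using p u l by (simp only: Inv_Arr(2)[OF dhom_id[OF M] M M] deg_id_apply)
  qed
next
  fix M N :: "('x, 'k, 'u) dmod" and \<phi> assume "M \<in> dmods" "N \<in> dmods" "\<phi> \<in> dhom M N"
  then show "FArr INV M N \<phi> \<in> deg_maps K G 0 (FObj INV M) (FObj INV N)" by (intro Inv_Arr(1))
next
  fix M N P :: "('x, 'k, 'u) dmod" and \<phi> \<psi>
  assume M: "M \<in> dmods" and N: "N \<in> dmods" and P: "P \<in> dmods" and \<phi>: "\<phi> \<in> dhom M N" and \<psi>: "\<psi> \<in> dhom N P"
  show "FArr INV M P (cmp M \<psi> \<phi>) = deg_comp G (FObj INV M) 0 (FArr INV N P \<psi>) (FArr INV M N \<phi>)"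
  proof (rule deg_maps_ext[OF Inv_Arr(1)[OF dhom_cmp[OF M \<phi> \<psi>] M P]
        deg_comp0_maps[OF Inv_graded[OF M] Inv_Arr(1)[OF \<phi> M N] Inv_Arr(1)[OF \<psi> N P]]])
    fix l u assume l: "l \<in> G" and u: "u \<in> carrier (FObj INV M l)"
    obtain p where p: "p \<in> carrier (inv_module M l)" "u = to_copy (inv_module M l) p" using Inv_elem[OF l u] by auto
    have q: "(\<lambda>x\<in>X. \<phi> x l (p x)) \<in> carrier (inv_module N l)"
      using lin_mapsD(1)[OF inv_map_lin[OF \<phi> M N l] p(1)] p(1) by simp
    have "(\<lambda>x\<in>X. cmp M \<psi> \<phi> x l (p x)) = (\<lambda>x\<in>X. \<psi> x l ((\<lambda>x\<in>X. \<phi> x l (p x)) x))"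
      using p(1) l by (auto simp: fun_eq_iff PiE_iff cmp_apply inv_part_def)
    then show "FArr INV M P (cmp M \<psi> \<phi>) l u = deg_comp G (FObj INV M) 0 (FArr INV N P \<psi>) (FArr INV M N \<phi>) l u"
      unfolding deg_comp_apply[where A="FObj INV M", OF l u]
      unfolding p(2) add_0_right
      by (simp only: Inv_Arr(2)[OF dhom_cmp[OF M \<phi> \<psi>] M P l p(1)] Inv_Arr(2)[OF \<phi> M N l p(1)] Inv_Arr(2)[OF \<psi> N P l q])
  qed
qed

text \<open>Transposition collects the values of a morphism at all points into one tuple, and its
  inverse takes coordinates; both pass through the copying bijections.\<close>

lemma Triv_Inv_adjunction: "adjunction (GrMod K G) (DistMod K G X d) (Triv G X d) INV"
proof -
  define \<theta> where "\<theta> A M \<phi> = (\<lambda>g\<in>G. \<lambda>a\<in>carrier (A g). to_copy (inv_module M g) (\<lambda>x\<in>X. \<phi> x g a) :: 'u)"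
    for A :: "('k, 'u) gmod" and M :: "('x, 'k, 'u) dmod" and \<phi> :: "'x \<Rightarrow> real \<Rightarrow> 'u \<Rightarrow> 'u"
  define \<kappa> where "\<kappa> A M \<psi> = (\<lambda>x\<in>X. \<lambda>g\<in>G. \<lambda>a\<in>carrier (A g). of_copy (inv_module M g) (\<psi> g a) x)"
    for A :: "('k, 'u) gmod" and M :: "('x, 'k, 'u) dmod" and \<psi> :: "real \<Rightarrow> 'u \<Rightarrow> 'u"
  have mem: "(\<lambda>x\<in>X. \<phi> x g a) \<in> carrier (inv_module M g)"
    if A: "A \<in> graded_modules K G" and M: "M \<in> dmods" and \<phi>: "\<phi> \<in> dhom (triv A) M" and g: "g \<in> G" "a \<in> carrier (A g)"
    for A M \<phi> g a
  proof -
    \<comment> \<open>Every element of a trivial module is invariant, and morphisms preserve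
      invariance.\<close>
    have "\<phi> x g a \<in> inv_part X d M g x" if x: "x \<in> X" for x
    proof (rule inv_part_hom[OF \<phi> triv_dmods[OF A] M x g(1)])
      show "a \<in> inv_part X d (triv A) g x"
        using x g by (auto simp: inv_part_def triv_act)
    qed
    then show ?thesis by simp
  qed
  have \<theta>: "\<theta> A M \<phi> \<in> deg_maps K G 0 A (FObj INV M)"
    if A: "A \<in> graded_modules K G" and M: "M \<in> dmods" and \<phi>: "\<phi> \<in> dhom (triv A) M" for A M \<phi>
    unfolding \<theta>_def
  proof (rule deg_mapsI)
    fix g assume g: "g \<in> G"
    note Ag = graded_modulesD[OF A g]
    have "(\<lambda>a\<in>carrier (A g). \<lambda>x\<in>X. \<phi> x g a) \<in> lin_maps K (A g) (inv_module M g)"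
    proof (rule lin_mapsI[OF _ _ _ Ag])
      fix a assume a: "a \<in> carrier (A g)"
      show "(\<lambda>x\<in>X. \<phi> x g a) \<in> carrier (inv_module M g)" by (rule mem[OF A M \<phi> g a])
    next
      fix a b assume "a \<in> carrier (A g)" "b \<in> carrier (A g)"
      then show "(\<lambda>x\<in>X. \<phi> x g (a \<oplus>\<^bsub>A g\<^esub> b)) = (\<lambda>x\<in>X. \<phi> x g a) \<oplus>\<^bsub>inv_module M g\<^esub> (\<lambda>x\<in>X. \<phi> x g b)"
        using g lin_mapsD(2)[OF dhom_lin[OF \<phi>]] by (auto simp: fun_eq_iff)
    next
      fix k a assume "k \<in> carrier K" "a \<in> carrier (A g)"
      then show "(\<lambda>x\<in>X. \<phi> x g (k \<odot>\<^bsub>A g\<^esub> a)) = k \<odot>\<^bsub>inv_module M g\<^esub> (\<lambda>x\<in>X. \<phi> x g a)"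
        using g lin_mapsD(3)[OF dhom_lin[OF \<phi>]] by (auto simp: fun_eq_iff)
    qed
    from lin_maps_comp[OF this to_copy_lin[OF embeds_inv module_inv[OF M g]] Ag]
    show "(\<lambda>a\<in>carrier (A g). to_copy (inv_module M g) (\<lambda>x\<in>X. \<phi> x g a)) \<in> lin_maps K (A g) (FObj INV M (g + 0))"
      using g mem[OF A M \<phi> g] by (simp cong: restrict_cong)
  qed
  have psi: "of_copy (inv_module M g) (\<psi> g a) \<in> carrier (inv_module M g)"
    "to_copy (inv_module M g) (of_copy (inv_module M g) (\<psi> g a)) = \<psi> g a"
    if "\<psi> \<in> deg_maps K G 0 A (FObj INV M)" "g \<in> G" "a \<in> carrier (A g)" for A M \<psi> g a
    using to_copy_of_copy[OF embeds_inv, of "\<psi> g a" M g] deg_maps0D(1)[OF that] that(2) by simp_all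
  have \<kappa>: "\<kappa> A M \<psi> \<in> dhom (triv A) M"
    if A: "A \<in> graded_modules K G" and M: "M \<in> dmods" and \<psi>: "\<psi> \<in> deg_maps K G 0 A (FObj INV M)" for A M \<psi>
    unfolding \<kappa>_def
  proof (rule dhomI[OF triv_dmods[OF A]])
    fix x g assume x: "x \<in> X" "g \<in> G"
    note Ag = graded_modulesD[OF A x(2)]
    have ev: "(\<lambda>u\<in>carrier (inv_module M g). u x) \<in> lin_maps K (inv_module M g) (pts M x g)"
      by (rule lin_mapsI[OF _ _ _ module_inv[OF M x(2)]]) (use x in \<open>auto simp: inv_part_def PiE_iff\<close>)
    have "\<psi> g \<in> lin_maps K (A g) (copy (inv_module M g))" using deg_maps_lin[OF \<psi> x(2)] x by simp
    from lin_maps_comp[OF lin_maps_comp[OF this of_copy_lin[OF embeds_inv module_inv[OF M x(2)]] Ag] ev Ag]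
    show "(\<lambda>a\<in>carrier (A g). of_copy (inv_module M g) (\<psi> g a) x) \<in> lin_maps K (pts (triv A) x g) (pts M x g)"
      using x psi(1)[OF \<psi> x(2)] deg_maps0D(1)[OF \<psi> x(2)] by (simp cong: restrict_cong del: inv_module_simps)
  next
    fix x y g m assume x: "x \<in> X" "y \<in> X" "d x y < \<infinity>" "g \<in> G" and m: "m \<in> carrier (pts (triv A) x g)"
    have g': "g + \<delta> x y \<in> G" using x by (intro G_add dG)
    have m: "m \<in> carrier (A g)" using m x by simp
    have p: "of_copy (inv_module M g) (\<psi> g m) x \<in> inv_part X d M g x" using psi(1)[OF \<psi> x(4) m] x by auto
    show "act M x y g ((\<lambda>a\<in>carrier (A g). of_copy (inv_module M g) (\<psi> g a) x) m) =
        (\<lambda>a\<in>carrier (A (g + \<delta> x y)). of_copy (inv_module M (g + \<delta> x y)) (\<psi> (g + \<delta> x y) a) y) (act (triv A) x y g m)"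
    proof (cases "x = y")
      case True
      then show ?thesis using x m p by (simp add: triv_act act_refl[OF M] inv_part_def)
    next
      case False
      \<comment> \<open>For distinct points both sides are zero; on the right the zero tuple has to
        be recognised behind its copy.\<close>
      have "\<psi> (g + \<delta> x y) \<zero>\<^bsub>A (g + \<delta> x y)\<^esub> = to_copy (inv_module M (g + \<delta> x y)) \<zero>\<^bsub>inv_module M (g + \<delta> x y)\<^esub>"
        using deg_maps_zero[OF A Inv_graded[OF M] \<psi> g' G_zero] g' by (simp add: copy_simps(2)[OF embeds_inv])
      then have "of_copy (inv_module M (g + \<delta> x y)) (\<psi> (g + \<delta> x y) \<zero>\<^bsub>A (g + \<delta> x y)\<^esub>) y = \<zero>\<^bsub>pts M y (g + \<delta> x y)\<^esub>"
        using x by (simp add: of_copy_to_copy[OF embeds_inv moduleD(1)[OF module_inv[OF M g']], unfolded inv_module_simps])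
      then show ?thesis
        using False x m p moduleD(1)[OF graded_modulesD[OF A g']] by (simp add: triv_act inv_part_def)
    qed
  qed
  show ?thesis
  proof (rule adjunctionI[OF Triv_functor Inv_functor, where \<theta>=\<theta>])
    fix A :: "('k, 'u) gmod" and M :: "('x, 'k, 'u) dmod"
    assume "A \<in> Obj (GrMod K G)" "M \<in> Obj (DistMod K G X d)"
    then have A: "A \<in> graded_modules K G" and M: "M \<in> dmods" by simp_all
    have "bij_betw (\<theta> A M) (dhom (triv A) M) (deg_maps K G 0 A (FObj INV M))"
    proof (rule bij_betw_byWitness[where f'="\<kappa> A M"])
      show "\<forall>\<phi>\<in>dhom (triv A) M. \<kappa> A M (\<theta> A M \<phi>) = \<phi>"
      proof
        fix \<phi> assume \<phi>: "\<phi> \<in> dhom (triv A) M"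
        show "\<kappa> A M (\<theta> A M \<phi>) = \<phi>"
        proof (rule dhom_ext[OF \<kappa>[OF A M \<theta>[OF A M \<phi>]] \<phi>])
          fix x g a assume "x \<in> X" "g \<in> G" "a \<in> carrier (pts (triv A) x g)"
          then show "\<kappa> A M (\<theta> A M \<phi>) x g a = \<phi> x g a"
            using of_copy_to_copy[OF embeds_inv mem[OF A M \<phi>, of g a]] by (simp add: \<kappa>_def \<theta>_def)
        qed
      qed
      show "\<forall>\<psi>\<in>deg_maps K G 0 A (FObj INV M). \<theta> A M (\<kappa> A M \<psi>) = \<psi>"
      proof
        fix \<psi> assume \<psi>: "\<psi> \<in> deg_maps K G 0 A (FObj INV M)"
        show "\<theta> A M (\<kappa> A M \<psi>) = \<psi>"
        proof (rule deg_maps_ext[OF \<theta>[OF A M \<kappa>[OF A M \<psi>]] \<psi>])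
          fix g a assume ga: "g \<in> G" "a \<in> carrier (A g)"
          have "(\<lambda>x\<in>X. \<kappa> A M \<psi> x g a) = of_copy (inv_module M g) (\<psi> g a)"
            using psi(1)[OF \<psi> ga] ga by (auto simp: \<kappa>_def fun_eq_iff PiE_iff extensional_def)
          then show "\<theta> A M (\<kappa> A M \<psi>) g a = \<psi> g a"
            using ga psi(2)[OF \<psi> ga] by (simp add: \<theta>_def)
        qed
      qed
    qed (auto intro: \<theta>[OF A M] \<kappa>[OF A M])
    then show "bij_betw (\<theta> A M) (Arr (DistMod K G X d) (triv A) M) (Arr (GrMod K G) A (FObj INV M))" by simp
  next
    fix A' A :: "('k, 'u) gmod" and M :: "('x, 'k, 'u) dmod" and f \<phi>
    assume "A' \<in> Obj (GrMod K G)" "A \<in> Obj (GrMod K G)" "M \<in> Obj (DistMod K G X d)"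
      "f \<in> Arr (GrMod K G) A' A" "\<phi> \<in> Arr (DistMod K G X d) (triv A) M"
    then have A: "A' \<in> graded_modules K G" "A \<in> graded_modules K G" and M: "M \<in> dmods"
      and f: "f \<in> deg_maps K G 0 A' A" and \<phi>: "\<phi> \<in> dhom (triv A) M" by simp_all
    have "\<theta> A' M (cmp (triv A') \<phi> (\<lambda>x\<in>X. f)) = deg_comp G A' 0 (\<theta> A M \<phi>) f"
    proof (rule deg_maps_ext[OF \<theta>[OF A(1) M dhom_cmp[OF triv_dmods[OF A(1)] triv_hom[OF A f] \<phi>]]
          deg_comp0_maps[OF A(1) f \<theta>[OF A(2) M \<phi>]]])
      fix g a assume "g \<in> G" "a \<in> carrier (A' g)"
      then show "\<theta> A' M (cmp (triv A') \<phi> (\<lambda>x\<in>X. f)) g a = deg_comp G A' 0 (\<theta> A M \<phi>) f g a"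
        by (simp add: \<theta>_def deg_comp_apply cmp_apply deg_maps0D[OF f] cong: restrict_cong)
    qed
    then show "\<theta> A' M (Cmp (DistMod K G X d) (triv A') (triv A) M \<phi> (FArr (Triv G X d) A' A f)) =
      Cmp (GrMod K G) A' A (FObj INV M) (\<theta> A M \<phi>) f" by simp
  next
    fix A :: "('k, 'u) gmod" and M N :: "('x, 'k, 'u) dmod" and \<psi> \<phi>
    assume "A \<in> Obj (GrMod K G)" "M \<in> Obj (DistMod K G X d)" "N \<in> Obj (DistMod K G X d)"
      "\<phi> \<in> Arr (DistMod K G X d) (triv A) M" "\<psi> \<in> Arr (DistMod K G X d) M N"
    then have A: "A \<in> graded_modules K G" and M: "M \<in> dmods" and N: "N \<in> dmods"
      and \<psi>: "\<psi> \<in> dhom M N" and \<phi>: "\<phi> \<in> dhom (triv A) M" by simp_all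
    have "\<theta> A N (cmp (triv A) \<psi> \<phi>) = deg_comp G A 0 (FArr INV M N \<psi>) (\<theta> A M \<phi>)"
    proof (rule deg_maps_ext[OF \<theta>[OF A N dhom_cmp[OF triv_dmods[OF A] \<phi> \<psi>]]
          deg_comp0_maps[OF A \<theta>[OF A M \<phi>] Inv_Arr(1)[OF \<psi> M N]]])
      fix g a assume ga: "g \<in> G" "a \<in> carrier (A g)"
      have "(\<lambda>x\<in>X. cmp (triv A) \<psi> \<phi> x g a) = (\<lambda>x\<in>X. \<psi> x g ((\<lambda>x\<in>X. \<phi> x g a) x))"
        using ga by (auto simp: fun_eq_iff cmp_apply)
      then show "\<theta> A N (cmp (triv A) \<psi> \<phi>) g a = deg_comp G A 0 (FArr INV M N \<psi>) (\<theta> A M \<phi>) g a"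
        using ga Inv_Arr(2)[OF \<psi> M N ga(1) mem[OF A M \<phi> ga]] by (simp add: \<theta>_def deg_comp_apply)
    qed
    then show "\<theta> A N (Cmp (DistMod K G X d) (triv A) M N \<psi> \<phi>) =
      Cmp (GrMod K G) A (FObj INV M) (FObj INV N) (FArr INV M N \<psi>) (\<theta> A M \<phi>)" by simp
  qed
qed

subsection \<open>Coinvariants\<close>

abbreviation rel :: "('x, 'k, 'u) dmod \<Rightarrow> real \<Rightarrow> 'x \<Rightarrow> 'u set" where
  "rel M l x \<equiv> coinv_rel K X d M l x"

abbreviation quot :: "('x, 'k, 'u) dmod \<Rightarrow> real \<Rightarrow> 'x \<Rightarrow> ('k, 'u set) module" where
  "quot M l x \<equiv> quotient_module (pts M x l) (rel M l x)"

abbreviation coinv_module :: "('x, 'k, 'u) dmod \<Rightarrow> real \<Rightarrow> ('k, 'x \<Rightarrow> 'u set) module" where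
  "coinv_module M l \<equiv> sum_module finite X (quot M l)"

abbreviation COINV :: "(('x, 'k, 'u) dmod, 'x \<Rightarrow> real \<Rightarrow> 'u \<Rightarrow> 'u, ('k, 'u) gmod, real \<Rightarrow> 'u \<Rightarrow> 'u) ftor" where
  "COINV \<equiv> Coinv K G X d"

lemma Coinv_big_eq: "Coinv_big K X d M l = coinv_module M l"
  by (simp add: Coinv_big_def direct_sum_module_eq)

lemma
  assumes M: "M \<in> dmods" and x: "x \<in> X" "l \<in> G"
  shows submodule_rel: "submodule (rel M l x) K (pts M x l)"
    and act_rel: "\<And>y m. \<lbrakk>y \<in> X; y \<noteq> x; d y x < \<infinity>; m \<in> carrier (pts M y (l - \<delta> y x))\<rbrakk> \<Longrightarrow>
      act M y x (l - \<delta> y x) m \<in> rel M l x"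
    and rel_least: "\<And>H. submodule H K (pts M x l) \<Longrightarrow>
      (\<And>y m. \<lbrakk>y \<in> X; y \<noteq> x; d y x < \<infinity>; m \<in> carrier (pts M y (l - \<delta> y x))\<rbrakk> \<Longrightarrow> act M y x (l - \<delta> y x) m \<in> H) \<Longrightarrow>
      rel M l x \<subseteq> H"
proof -
  let ?S = "{act M y x (l - \<delta> y x) m | y m. y \<in> X \<and> y \<noteq> x \<and> d y x < \<infinity> \<and> m \<in> carrier (pts M y (l - \<delta> y x))}"
  have "act M y x (l - \<delta> y x) m \<in> carrier (pts M x l)"
    if "y \<in> X" "d y x < \<infinity>" "m \<in> carrier (pts M y (l - \<delta> y x))" for y m
    using actD(1)[OF M that(1) x(1) that(2) G_diff[OF x(2) dG[OF that(1) x(1) that(2)]] that(3)] by simp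
  then have S: "?S \<subseteq> carrier (pts M x l)" by auto
  note g = generated_submodule[OF pts_module[OF M x] S]
  show "submodule (rel M l x) K (pts M x l)" unfolding coinv_rel_def by (rule g(1))
  show "act M y x (l - \<delta> y x) m \<in> rel M l x"
    if "y \<in> X" "y \<noteq> x" "d y x < \<infinity>" "m \<in> carrier (pts M y (l - \<delta> y x))" for y m
    unfolding coinv_rel_def using g(2) that by blast
  show "rel M l x \<subseteq> H" if "submodule H K (pts M x l)"
    "\<And>y m. \<lbrakk>y \<in> X; y \<noteq> x; d y x < \<infinity>; m \<in> carrier (pts M y (l - \<delta> y x))\<rbrakk> \<Longrightarrow> act M y x (l - \<delta> y x) m \<in> H" for H
    unfolding coinv_rel_def by (rule g(3)[OF that(1)]) (use that(2) in auto)
qed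

lemma module_quot: "\<lbrakk>M \<in> dmods; x \<in> X; l \<in> G\<rbrakk> \<Longrightarrow> Module.module K (quot M l x)"
  by (rule module_quotient[OF pts_module submodule_rel])

lemma module_coinv: "M \<in> dmods \<Longrightarrow> l \<in> G \<Longrightarrow> Module.module K (coinv_module M l)"
  by (rule module_sum[OF K module_quot support_ideal_finite])

lemma embeds_coinv:
  assumes M: "M \<in> dmods" and l: "l \<in> G"
  shows "embeds (carrier (coinv_module M l)) TYPE('u)"
proof (rule embeds_subset)
  show "embeds (\<Pi>\<^sub>E x\<in>X. carrier (quot M l x)) TYPE('u)"
    by (intro embeds_funs embeds_x embeds_quotient[where K=K] pts_module submodule_rel M l)
qed auto

lemma Coinv_Obj [simp]: "l \<in> G \<Longrightarrow> FObj COINV M l = copy (coinv_module M l)"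
  by (simp add: Coinv_def Coinv_big_eq)

lemma Coinv_graded: "M \<in> dmods \<Longrightarrow> FObj COINV M \<in> graded_modules K G"
  unfolding Coinv_def by (auto intro!: graded_modulesI module_copy embeds_coinv module_coinv simp: Coinv_big_eq)

text \<open>The canonical map from the module at \<open>x\<close> to the coinvariants. The functor
  laws and the adjunction are checked on these classes, away from cosets and copies.\<close>

definition coinv_class :: "('x, 'k, 'u) dmod \<Rightarrow> real \<Rightarrow> 'x \<Rightarrow> 'u \<Rightarrow> 'u" where
  "coinv_class M l x = (\<lambda>m\<in>carrier (pts M x l). to_copy (coinv_module M l) (dsingle X (quot M l) x (rel M l x +>\<^bsub>pts M x l\<^esub> m)))"

lemma coset_quot: "\<lbrakk>M \<in> dmods; x \<in> X; l \<in> G; m \<in> carrier (pts M x l)\<rbrakk> \<Longrightarrow> rel M l x +>\<^bsub>pts M x l\<^esub> m \<in> carrier (quot M l x)"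
  by (simp add: quotient_carrier[OF pts_module submodule_rel])

lemma single_quot: "\<lbrakk>M \<in> dmods; x \<in> X; l \<in> G; C \<in> carrier (quot M l x)\<rbrakk> \<Longrightarrow> dsingle X (quot M l) x C \<in> carrier (coinv_module M l)"
  by (rule dsingle_closed[where K=K]) (auto intro: module_quot)

lemma coinv_class_lin:
  assumes M: "M \<in> dmods" and x: "x \<in> X" "l \<in> G"
  shows "coinv_class M l x \<in> lin_maps K (pts M x l) (FObj COINV M l)"
proof -
  note P = pts_module[OF M x]
  have s: "(\<lambda>C\<in>carrier (quot M l x). dsingle X (quot M l) x C) \<in> lin_maps K (quot M l x) (coinv_module M l)"
    by (rule dsingle_lin[where M="quot M l"]) (auto intro: module_quot M x)
  from lin_maps_comp[OF lin_maps_comp[OF quotient_lin[OF P submodule_rel[OF M x]] s P] to_copy_lin[OF embeds_coinv[OF M x(2)] module_coinv[OF M x(2)]] P]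
  show ?thesis
    using x by (simp add: coinv_class_def coset_quot[OF M] single_quot[OF M] del: sum_module_simps cong: restrict_cong)
qed

lemma coinv_class_rel:
  assumes M: "M \<in> dmods" and x: "x \<in> X" "l \<in> G" and m: "m \<in> rel M l x"
  shows "coinv_class M l x m = \<zero>\<^bsub>FObj COINV M l\<^esub>"
proof -
  note P = pts_module[OF M x] and R = submodule_rel[OF M x]
  have mc: "m \<in> carrier (pts M x l)" using module_submoduleD(1)[OF P R] m by auto
  have "rel M l x +>\<^bsub>pts M x l\<^esub> m = rel M l x +>\<^bsub>pts M x l\<^esub> \<zero>\<^bsub>pts M x l\<^esub>"
    using coset_mem[OF P R moduleD(1)[OF P]] m unfolding coset_zero[OF P R] by blast
  then have "coinv_class M l x m = coinv_class M l x \<zero>\<^bsub>pts M x l\<^esub>"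
    using mc moduleD(1)[OF P] by (simp add: coinv_class_def)
  also have "\<dots> = \<zero>\<^bsub>FObj COINV M l\<^esub>"
    by (rule lin_maps_zero[OF coinv_class_lin[OF M x] P graded_modulesD[OF Coinv_graded[OF M] x(2)]])
  finally show ?thesis .
qed

text \<open>The classes from single points generate the coinvariants, being the copies of the
  single-entry families.\<close>

lemma coinv_ext:
  fixes N :: "('k, 'b) module"
  assumes M: "M \<in> dmods" and l: "l \<in> G" and N: "Module.module K N"
    and f: "f \<in> lin_maps K (FObj COINV M l) N" "f' \<in> lin_maps K (FObj COINV M l) N"
    and eq: "\<And>x m. \<lbrakk>x \<in> X; m \<in> carrier (pts M x l)\<rbrakk> \<Longrightarrow> f (coinv_class M l x m) = f' (coinv_class M l x m)"
  shows "f = f'"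
proof (rule lin_maps_ext[OF f])
  let ?C = "coinv_module M l"
  note E = embeds_coinv[OF M l] module_coinv[OF M l]
  define h where "h f = (\<lambda>p\<in>carrier ?C. f ((\<lambda>p\<in>carrier ?C. to_copy ?C p) p))" for f :: "'u \<Rightarrow> 'b"
  have h: "h f \<in> lin_maps K ?C N" if "f \<in> lin_maps K (FObj COINV M l) N" for f
    unfolding h_def using that l by (intro lin_maps_comp[OF to_copy_lin[OF E] _ E(2)]) simp
  have hv: "h f p = f (to_copy ?C p)" if "p \<in> carrier ?C" for f p
    unfolding h_def restrict_apply'[OF that] ..
  have "h f = h f'"
  proof (rule sum_lin_maps_eq[OF module_quot[OF M _ l] N h[OF f(1)] h[OF f(2)]])
    fix x C assume x: "x \<in> X" and C: "C \<in> carrier (quot M l x)"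
    then obtain m where m: "m \<in> carrier (pts M x l)" "C = rel M l x +>\<^bsub>pts M x l\<^esub> m"
      by (auto simp: quotient_carrier[OF pts_module[OF M x l] submodule_rel[OF M x l]])
    have "coinv_class M l x m = to_copy ?C (dsingle X (quot M l) x C)" using m by (simp add: coinv_class_def)
    then show "h f (dsingle X (quot M l) x C) = h f' (dsingle X (quot M l) x C)"
      using eq[OF x m(1)] by (simp only: hv[OF single_quot[OF M x l C]])
  qed
  fix u assume "u \<in> carrier (FObj COINV M l)"
  then obtain p where p: "p \<in> carrier ?C" "u = to_copy ?C p"
    unfolding Coinv_Obj[OF l] copy_simps(1)[OF E(1)] by (rule imageE)
  then show "f u = f' u" using hv[OF p(1)] \<open>h f = h f'\<close> by metis
qed

text \<open>The maps at the points factor through the quotients and then combine on the direct sum.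
  Killing the images of the actions is enough, because kernels are submodules.\<close>

lemma coinv_universal:
  assumes M: "M \<in> dmods" and l: "l \<in> G" and N: "Module.module K N"
    and \<phi>: "\<And>x. x \<in> X \<Longrightarrow> \<phi> x \<in> lin_maps K (pts M x l) N"
    and kill: "\<And>x y m. \<lbrakk>x \<in> X; y \<in> X; y \<noteq> x; d y x < \<infinity>; m \<in> carrier (pts M y (l - \<delta> y x))\<rbrakk> \<Longrightarrow>
      \<phi> x (act M y x (l - \<delta> y x) m) = \<zero>\<^bsub>N\<^esub>"
  obtains f where "f \<in> lin_maps K (FObj COINV M l) N"
    "\<And>x m. \<lbrakk>x \<in> X; m \<in> carrier (pts M x l)\<rbrakk> \<Longrightarrow> f (coinv_class M l x m) = \<phi> x m"
proof -
  let ?C = "coinv_module M l"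
  note E = embeds_coinv[OF M l] module_coinv[OF M l]
  have ker: "\<phi> x r = \<zero>\<^bsub>N\<^esub>" if x: "x \<in> X" and r: "r \<in> rel M l x" for x r
  proof -
    have "rel M l x \<subseteq> {m \<in> carrier (pts M x l). \<phi> x m = \<zero>\<^bsub>N\<^esub>}"
    proof (rule rel_least[OF M x l submodule_kernel[OF \<phi>[OF x] pts_module[OF M x l] N]])
      fix y m assume y: "y \<in> X" "y \<noteq> x" "d y x < \<infinity>" "m \<in> carrier (pts M y (l - \<delta> y x))"
      have "act M y x (l - \<delta> y x) m \<in> carrier (pts M x l)"
        using act_rel[OF M x l y] module_submoduleD(1)[OF pts_module[OF M x l] submodule_rel[OF M x l]] by auto
      then show "act M y x (l - \<delta> y x) m \<in> {m \<in> carrier (pts M x l). \<phi> x m = \<zero>\<^bsub>N\<^esub>}"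
        using kill[OF x y] by simp
    qed
    then show ?thesis using r by auto
  qed
  have q: "quotient_map (pts M x l) (rel M l x) (\<phi> x) \<in> lin_maps K (quot M l x) N" if x: "x \<in> X" for x
    by (rule quotient_map_lin[OF pts_module[OF M x l] submodule_rel[OF M x l] N \<phi>[OF x] ker[OF x]])
  have qv: "quotient_map (pts M x l) (rel M l x) (\<phi> x) (rel M l x +>\<^bsub>pts M x l\<^esub> m) = \<phi> x m"
    if x: "x \<in> X" and m: "m \<in> carrier (pts M x l)" for x m
    by (rule quotient_map_coset[OF pts_module[OF M x l] submodule_rel[OF M x l] N \<phi>[OF x] ker[OF x] m])
  define s where "s = sum_map N X (quot M l) (\<lambda>x. quotient_map (pts M x l) (rel M l x) (\<phi> x))"
  have s: "s \<in> lin_maps K ?C N" unfolding s_def by (rule sum_map_lin[OF module_quot[OF M _ l] N q])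
  show ?thesis
  proof (rule that)
    show "(\<lambda>u\<in>carrier (copy ?C). s ((\<lambda>u\<in>carrier (copy ?C :: ('k, 'u) module). of_copy ?C u) u)) \<in> lin_maps K (FObj COINV M l) N"
      unfolding Coinv_Obj[OF l] by (rule lin_maps_comp[OF of_copy_lin[OF E] s module_copy[OF E]])
    fix x m assume x: "x \<in> X" and m: "m \<in> carrier (pts M x l)"
    note c = coset_quot[OF M x l m]
    have "coinv_class M l x m \<in> carrier (FObj COINV M l)" by (rule lin_mapsD(1)[OF coinv_class_lin[OF M x l] m])
    then have u: "coinv_class M l x m \<in> carrier (copy ?C)" unfolding Coinv_Obj[OF l] .
    have "of_copy ?C (coinv_class M l x m) = dsingle X (quot M l) x (rel M l x +>\<^bsub>pts M x l\<^esub> m)"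
      unfolding coinv_class_def restrict_apply'[OF m] by (rule of_copy_to_copy[OF E(1) single_quot[OF M x l c]])
    moreover have "s (dsingle X (quot M l) x (rel M l x +>\<^bsub>pts M x l\<^esub> m)) = \<phi> x m"
      unfolding s_def
      by (subst sum_map_single[where M="quot M l" and I=X and i=x, OF module_quot[OF M _ l] N q x c]) (simp_all add: qv x m)
    ultimately show "(\<lambda>u\<in>carrier (copy ?C). s ((\<lambda>u\<in>carrier (copy ?C :: ('k, 'u) module). of_copy ?C u) u)) (coinv_class M l x m) = \<phi> x m"
      by (simp only: restrict_apply'[OF u])
  qed
qed

text \<open>The preimage of the relations of \<open>N\<close> is a submodule, and by equivariance it
  contains the generating relations of \<open>M\<close>.\<close>

lemma rel_hom:
  assumes \<phi>: "\<phi> \<in> dhom M N" and M: "M \<in> dmods" and N: "N \<in> dmods" and x: "x \<in> X" "l \<in> G" and r: "r \<in> rel M l x"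
  shows "\<phi> x l r \<in> rel N l x"
proof -
  note P = pts_module[OF M x] pts_module[OF N x] and R = submodule_rel[OF N x]
  have "rel M l x \<subseteq> {m \<in> carrier (pts M x l). \<phi> x l m \<in> rel N l x}"
  proof (rule rel_least[OF M x module_submoduleI[OF P(1)]])
    fix y m assume y: "y \<in> X" "y \<noteq> x" "d y x < \<infinity>" "m \<in> carrier (pts M y (l - \<delta> y x))"
    have g: "l - \<delta> y x \<in> G" using x y by (intro G_diff dG)
    have "\<phi> x l (act M y x (l - \<delta> y x) m) = act N y x (l - \<delta> y x) (\<phi> y (l - \<delta> y x) m)"
      using dhom_act[OF \<phi> y(1) x(1) y(3) g y(4)] by simp
    also have "\<dots> \<in> rel N l x" using y by (intro act_rel[OF N x]) (auto intro: dhomD(1)[OF \<phi> y(1) g])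
    finally show "act M y x (l - \<delta> y x) m \<in> {m \<in> carrier (pts M x l). \<phi> x l m \<in> rel N l x}"
      using act_rel[OF M x y] module_submoduleD(1)[OF P(1) submodule_rel[OF M x]] by auto
  qed (use x in \<open>auto simp: moduleD[OF P(1)] dhomD[OF \<phi>] dhom_zero[OF \<phi> M N] intro: module_submoduleD[OF P(2) R]\<close>)
  then show ?thesis using r by auto
qed

lemma
  assumes \<phi>: "\<phi> \<in> dhom M N" and M: "M \<in> dmods" and N: "N \<in> dmods"
  shows Coinv_Arr: "FArr COINV M N \<phi> \<in> deg_maps K G 0 (FObj COINV M) (FObj COINV N)"
    and Coinv_Arr_class: "\<And>l x m. \<lbrakk>l \<in> G; x \<in> X; m \<in> carrier (pts M x l)\<rbrakk> \<Longrightarrow>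
      FArr COINV M N \<phi> l (coinv_class M l x m) = coinv_class N l x (\<phi> x l m)"
proof -
  have coset: "(\<Union>m\<in>rel M l x +>\<^bsub>pts M x l\<^esub> m. rel N l x +>\<^bsub>pts N x l\<^esub> \<phi> x l m) = rel N l x +>\<^bsub>pts N x l\<^esub> \<phi> x l m"
    if "l \<in> G" "x \<in> X" "m \<in> carrier (pts M x l)" for l x m
    by (rule coset_Union_map[OF pts_module[OF M that(2,1)] submodule_rel[OF M that(2,1)]
          pts_module[OF N that(2,1)] submodule_rel[OF N that(2,1)] dhom_lin[OF \<phi> that(2,1)] rel_hom[OF \<phi> M N that(2,1)] that(3)])
  have lin: "(\<lambda>u\<in>carrier (coinv_module M l). Coinv_big_map K X d N \<phi> l u) \<in> lin_maps K (coinv_module M l) (coinv_module N l)"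
    if l: "l \<in> G" for l
  proof -
    have "(\<lambda>C\<in>carrier (quot M l x). \<Union>m\<in>C. rel N l x +>\<^bsub>pts N x l\<^esub> \<phi> x l m) \<in> lin_maps K (quot M l x) (quot N l x)"
      if x: "x \<in> X" for x
    proof -
      note P = pts_module[OF M x l] and R = submodule_rel[OF M x l] and P' = pts_module[OF N x l] and R' = submodule_rel[OF N x l]
      show ?thesis
      proof (rule lin_mapsI[OF _ _ _ module_quot[OF M x l]])
        fix C assume "C \<in> carrier (quot M l x)"
        then obtain m where m: "m \<in> carrier (pts M x l)" "C = rel M l x +>\<^bsub>pts M x l\<^esub> m"
          unfolding quotient_carrier[OF P R] by blast
        show "(\<Union>m\<in>C. rel N l x +>\<^bsub>pts N x l\<^esub> \<phi> x l m) \<in> carrier (quot N l x)"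
          unfolding m(2) coset[OF l x m(1)] by (rule coset_quot[OF N x l dhomD(1)[OF \<phi> x l m(1)]])
        show "(\<Union>m\<in>a \<odot>\<^bsub>quot M l x\<^esub> C. rel N l x +>\<^bsub>pts N x l\<^esub> \<phi> x l m) =
          a \<odot>\<^bsub>quot N l x\<^esub> (\<Union>m\<in>C. rel N l x +>\<^bsub>pts N x l\<^esub> \<phi> x l m)" if a: "a \<in> carrier K" for a
          unfolding m(2) coset[OF l x m(1)] quotient_smult[OF P R a m(1)] coset[OF l x moduleD(8)[OF P a m(1)]]
            quotient_smult[OF P' R' a dhomD(1)[OF \<phi> x l m(1)]] dhomD(3)[OF \<phi> x l a m(1)] ..
        fix D assume "D \<in> carrier (quot M l x)"
        then obtain n where n: "n \<in> carrier (pts M x l)" "D = rel M l x +>\<^bsub>pts M x l\<^esub> n"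
          unfolding quotient_carrier[OF P R] by blast
        show "(\<Union>m\<in>C \<oplus>\<^bsub>quot M l x\<^esub> D. rel N l x +>\<^bsub>pts N x l\<^esub> \<phi> x l m) =
          (\<Union>m\<in>C. rel N l x +>\<^bsub>pts N x l\<^esub> \<phi> x l m) \<oplus>\<^bsub>quot N l x\<^esub> (\<Union>m\<in>D. rel N l x +>\<^bsub>pts N x l\<^esub> \<phi> x l m)"
          unfolding m(2) n(2) coset[OF l x m(1)] coset[OF l x n(1)] quotient_add[OF P R m(1) n(1)]
            coset[OF l x moduleD(2)[OF P m(1) n(1)]] dhomD(2)[OF \<phi> x l m(1) n(1)]
            quotient_add[OF P' R' dhomD(1)[OF \<phi> x l m(1)] dhomD(1)[OF \<phi> x l n(1)]] ..
      qed
    qed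
    from sum_module_map[OF K module_quot[OF M _ l] module_quot[OF N _ l] this]
    show ?thesis
      by (rule back_subst[where P="\<lambda>f. f \<in> _"]) (auto simp: Coinv_big_map_def fun_eq_iff)
  qed
  note c = copy_map[where t="Coinv_big_map K X d N \<phi> l" for l,
      OF embeds_coinv[OF M] module_coinv[OF M] embeds_coinv[OF N] module_coinv[OF N] lin]
  show "FArr COINV M N \<phi> \<in> deg_maps K G 0 (FObj COINV M) (FObj COINV N)"
    unfolding Coinv_def ftor.simps Coinv_big_eq by (rule deg_mapsI) (use c(1) in simp)
  fix l x m assume *: "l \<in> G" "x \<in> X" "m \<in> carrier (pts M x l)"
  let ?s = "dsingle X (quot M l) x (rel M l x +>\<^bsub>pts M x l\<^esub> m)"
  have s: "?s \<in> carrier (coinv_module M l)" using * by (intro single_quot coset_quot M)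
  \<comment> \<open>The other entries of a single-entry family are zero cosets, and the union
    formula has to send them to zero cosets.\<close>
  have z: "(\<Union>m\<in>\<zero>\<^bsub>quot M l y\<^esub>. rel N l y +>\<^bsub>pts N y l\<^esub> \<phi> y l m) = \<zero>\<^bsub>quot N l y\<^esub>" if y: "y \<in> X" for y
    using coset[OF *(1) y moduleD(1)[OF pts_module[OF M y *(1)]]]
    by (simp only: coset_zero[OF pts_module[OF M y *(1)] submodule_rel[OF M y *(1)]] quotient_zero
        dhom_zero[OF \<phi> M N y *(1)] coset_zero[OF pts_module[OF N y *(1)] submodule_rel[OF N y *(1)]])
  have "Coinv_big_map K X d N \<phi> l ?s = dsingle X (quot N l) x (rel N l x +>\<^bsub>pts N x l\<^esub> \<phi> x l m)"
  proof
    fix y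
    show "Coinv_big_map K X d N \<phi> l ?s y = dsingle X (quot N l) x (rel N l x +>\<^bsub>pts N x l\<^esub> \<phi> x l m) y"
      using coset[OF *] z[of y] by (cases "y = x") (simp_all add: Coinv_big_map_def dsingle_def restrict_def *)
  qed
  then show "FArr COINV M N \<phi> l (coinv_class M l x m) = coinv_class N l x (\<phi> x l m)"
    using c(2)[OF *(1,1,1,1,1) s] * by (simp add: Coinv_def Coinv_big_eq coinv_class_def dhomD[OF \<phi>] del: sum_module_simps)
qed

lemma coinv_hom_ext:
  assumes M: "M \<in> dmods" and A: "A \<in> graded_modules K G"
    and f: "f \<in> deg_maps K G 0 (FObj COINV M) A" "f' \<in> deg_maps K G 0 (FObj COINV M) A"
    and eq: "\<And>l x m. \<lbrakk>l \<in> G; x \<in> X; m \<in> carrier (pts M x l)\<rbrakk> \<Longrightarrow> f l (coinv_class M l x m) = f' l (coinv_class M l x m)"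
  shows "f = f'"
proof (rule deg_maps_ext[OF f])
  fix l u assume l: "l \<in> G"
  have "f l = f' l"
    by (rule coinv_ext[OF M l graded_modulesD[OF A l]])
      (use deg_maps_lin[OF f(1) l] deg_maps_lin[OF f(2) l] eq[OF l] in simp_all)
  then show "f l u = f' l u" by simp
qed

lemma coinv_class_closed: "\<lbrakk>M \<in> dmods; x \<in> X; l \<in> G; m \<in> carrier (pts M x l)\<rbrakk> \<Longrightarrow> coinv_class M l x m \<in> carrier (FObj COINV M l)"
  by (rule lin_mapsD(1)[OF coinv_class_lin])

lemma Coinv_functor: "ftor_between (DistMod K G X d) (GrMod K G) COINV"
  unfolding ftor_between_def DistMod_simps GrMod_simps
proof (intro conjI ballI category_GrMod category_DistMod)
  fix M :: "('x, 'k, 'u) dmod" assume M: "M \<in> dmods"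
  show "FObj COINV M \<in> graded_modules K G" by (rule Coinv_graded[OF M])
  show "FArr COINV M M (\<lambda>x\<in>X. deg_id G (pts M x)) = deg_id G (FObj COINV M)"
    by (rule coinv_hom_ext[OF M Coinv_graded[OF M] Coinv_Arr[OF dhom_id[OF M] M M] deg_id_maps[OF Coinv_graded[OF M]]])
      (simp add: Coinv_Arr_class[OF dhom_id[OF M] M M] deg_id_apply coinv_class_closed[OF M] del: Coinv_Obj)
next
  fix M N :: "('x, 'k, 'u) dmod" and \<phi> assume "M \<in> dmods" "N \<in> dmods" "\<phi> \<in> dhom M N"
  then show "FArr COINV M N \<phi> \<in> deg_maps K G 0 (FObj COINV M) (FObj COINV N)" by (intro Coinv_Arr)
next
  fix M N P :: "('x, 'k, 'u) dmod" and \<phi> \<psi>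
  assume M: "M \<in> dmods" and N: "N \<in> dmods" and P: "P \<in> dmods" and \<phi>: "\<phi> \<in> dhom M N" and \<psi>: "\<psi> \<in> dhom N P"
  show "FArr COINV M P (cmp M \<psi> \<phi>) = deg_comp G (FObj COINV M) 0 (FArr COINV N P \<psi>) (FArr COINV M N \<phi>)"
    by (rule coinv_hom_ext[OF M Coinv_graded[OF P] Coinv_Arr[OF dhom_cmp[OF M \<phi> \<psi>] M P]
        deg_comp0_maps[OF Coinv_graded[OF M] Coinv_Arr[OF \<phi> M N] Coinv_Arr[OF \<psi> N P]]])
      (simp add: Coinv_Arr_class[OF dhom_cmp[OF M \<phi> \<psi>] M P] Coinv_Arr_class[OF \<phi> M N] Coinv_Arr_class[OF \<psi> N P]
        deg_comp_apply coinv_class_closed[OF M] cmp_apply dhomD[OF \<phi>] del: Coinv_Obj)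
qed

lemma Coinv_Triv_adjunction: "adjunction (DistMod K G X d) (GrMod K G) COINV (Triv G X d)"
proof -
  define \<theta> where "\<theta> M A f = (\<lambda>x\<in>X. \<lambda>l\<in>G. \<lambda>m\<in>carrier (pts M x l). f l (coinv_class M l x m))"
    for M :: "('x, 'k, 'u) dmod" and A :: "('k, 'u) gmod" and f :: "real \<Rightarrow> 'u \<Rightarrow> 'u"
  have \<theta>a: "\<theta> M A f x l m = f l (coinv_class M l x m)" if "x \<in> X" "l \<in> G" "m \<in> carrier (pts M x l)" for M A f x l m
    using that by (simp add: \<theta>_def)
  have \<theta>: "\<theta> M A f \<in> dhom M (triv A)"
    if M: "M \<in> dmods" and A: "A \<in> graded_modules K G" and f: "f \<in> deg_maps K G 0 (FObj COINV M) A" for M A f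
    unfolding \<theta>_def
  proof (rule dhomI[OF M])
    fix x l assume x: "x \<in> X" "l \<in> G"
    have "f l \<in> lin_maps K (FObj COINV M l) (A l)" using deg_maps_lin[OF f x(2)] by simp
    from lin_maps_comp[OF coinv_class_lin[OF M x] this pts_module[OF M x]]
    show "(\<lambda>m\<in>carrier (pts M x l). f l (coinv_class M l x m)) \<in> lin_maps K (pts M x l) (pts (triv A) x l)"
      using x by simp
  next
    fix x y g m assume x: "x \<in> X" "y \<in> X" "d x y < \<infinity>" "g \<in> G" and m: "m \<in> carrier (pts M x g)"
    have g': "g + \<delta> x y \<in> G" using x by (intro G_add dG)
    note a = actD(1)[OF M x m]
    have c: "f g (coinv_class M g x m) \<in> carrier (A g)"
      using deg_maps0D(1)[OF f x(4) coinv_class_closed[OF M x(1,4) m]] .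
    have "act (triv A) x y g (f g (coinv_class M g x m)) = f (g + \<delta> x y) (coinv_class M (g + \<delta> x y) y (act M x y g m))"
    proof (cases "x = y")
      case True
      then show ?thesis using x m c by (simp add: triv_act act_refl[OF M])
    next
      case False
      \<comment> \<open>The image of the action is a defining relation at \<open>y\<close>: in
        degree \<open>g + \<delta> x y\<close> the subtraction in \<open>act_rel\<close> leads back
        to \<open>g\<close>.\<close>
      have "act M x y g m \<in> rel M (g + \<delta> x y) y"
        using act_rel[OF M x(2) g' x(1) False x(3), of m] m by simp
      from coinv_class_rel[OF M x(2) g' this]
      show ?thesis using False x c deg_maps_zero[OF Coinv_graded[OF M] A f g' G_zero] by (simp add: triv_act del: Coinv_Obj)
    qed
    then show "act (triv A) x y g ((\<lambda>m\<in>carrier (pts M x g). f g (coinv_class M g x m)) m) =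
      (\<lambda>m\<in>carrier (pts M y (g + \<delta> x y)). f (g + \<delta> x y) (coinv_class M (g + \<delta> x y) y m)) (act M x y g m)"
      using m a by simp
  qed
  show ?thesis
  proof (rule adjunctionI[OF Coinv_functor Triv_functor, where \<theta>=\<theta>])
    fix M :: "('x, 'k, 'u) dmod" and A :: "('k, 'u) gmod"
    assume "M \<in> Obj (DistMod K G X d)" "A \<in> Obj (GrMod K G)"
    then have M: "M \<in> dmods" and A: "A \<in> graded_modules K G" by simp_all
    have "inj_on (\<theta> M A) (deg_maps K G 0 (FObj COINV M) A)"
    proof (rule inj_onI)
      fix f f' assume f: "f \<in> deg_maps K G 0 (FObj COINV M) A" "f' \<in> deg_maps K G 0 (FObj COINV M) A" and eq: "\<theta> M A f = \<theta> M A f'"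
      show "f = f'"
      proof (rule coinv_hom_ext[OF M A f])
        fix l x m assume "l \<in> G" "x \<in> X" "m \<in> carrier (pts M x l)"
        then show "f l (coinv_class M l x m) = f' l (coinv_class M l x m)" using \<theta>a[of x l m M A] eq by metis
      qed
    qed
    moreover have "\<phi> \<in> \<theta> M A ` deg_maps K G 0 (FObj COINV M) A" if \<phi>: "\<phi> \<in> dhom M (triv A)" for \<phi>
    proof -
      have "\<exists>f. f \<in> lin_maps K (FObj COINV M l) (A l) \<and> (\<forall>x\<in>X. \<forall>m\<in>carrier (pts M x l). f (coinv_class M l x m) = \<phi> x l m)"
        if l: "l \<in> G" for l
      proof -
        \<comment> \<open>Equivariance compares this value with the trivial action, which is zero
          between distinct points.\<close>
        have kill: "\<phi> x l (act M y x (l - \<delta> y x) m) = \<zero>\<^bsub>A l\<^esub>"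
          if y: "x \<in> X" "y \<in> X" "y \<noteq> x" "d y x < \<infinity>" "m \<in> carrier (pts M y (l - \<delta> y x))" for x y m
        proof -
          have g: "l - \<delta> y x \<in> G" using l y by (intro G_diff dG)
          have "\<phi> x l (act M y x (l - \<delta> y x) m) = act (triv A) y x (l - \<delta> y x) (\<phi> y (l - \<delta> y x) m)"
            using dhom_act[OF \<phi> y(2,1,4) g y(5)] by simp
          also have "\<dots> = \<zero>\<^bsub>A l\<^esub>"
            using y g dhomD(1)[OF \<phi> y(2) g y(5)] by (simp add: triv_act)
          finally show ?thesis .
        qed
        have lin: "\<phi> x l \<in> lin_maps K (pts M x l) (A l)" if "x \<in> X" for x
          using dhom_lin[OF \<phi> that l] that by simp
        show ?thesis
          by (rule coinv_universal[where \<phi>="\<lambda>x. \<phi> x l", OF M l graded_modulesD[OF A l] lin kill]) auto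
      qed
      then obtain f where f: "\<And>l. l \<in> G \<Longrightarrow> f l \<in> lin_maps K (FObj COINV M l) (A l)"
        "\<And>l x m. \<lbrakk>l \<in> G; x \<in> X; m \<in> carrier (pts M x l)\<rbrakk> \<Longrightarrow> f l (coinv_class M l x m) = \<phi> x l m" by metis
      have F: "(\<lambda>l\<in>G. f l) \<in> deg_maps K G 0 (FObj COINV M) A" by (rule deg_mapsI) (use f(1) in \<open>simp del: Coinv_Obj\<close>)
      have "\<phi> = \<theta> M A (\<lambda>l\<in>G. f l)"
        by (rule dhom_ext[OF \<phi> \<theta>[OF M A F]]) (simp add: \<theta>a f(2))
      with F show ?thesis by blast
    qed
    ultimately have "bij_betw (\<theta> M A) (deg_maps K G 0 (FObj COINV M) A) (dhom M (triv A))"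
      using \<theta>[OF M A] by (auto simp: bij_betw_def)
    then show "bij_betw (\<theta> M A) (Arr (GrMod K G) (FObj COINV M) A) (Arr (DistMod K G X d) M (triv A))" by simp
  next
    fix M' M :: "('x, 'k, 'u) dmod" and A :: "('k, 'u) gmod" and \<phi> f
    assume "M' \<in> Obj (DistMod K G X d)" "M \<in> Obj (DistMod K G X d)" "A \<in> Obj (GrMod K G)"
      "\<phi> \<in> Arr (DistMod K G X d) M' M" "f \<in> Arr (GrMod K G) (FObj COINV M) A"
    then have M: "M' \<in> dmods" "M \<in> dmods" and A: "A \<in> graded_modules K G"
      and \<phi>: "\<phi> \<in> dhom M' M" and f: "f \<in> deg_maps K G 0 (FObj COINV M) A" by simp_all
    have "\<theta> M' A (deg_comp G (FObj COINV M') 0 f (FArr COINV M' M \<phi>)) = cmp M' (\<theta> M A f) \<phi>"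
      by (rule dhom_ext[OF \<theta>[OF M(1) A deg_comp0_maps[OF Coinv_graded[OF M(1)] Coinv_Arr[OF \<phi> M] f]] dhom_cmp[OF M(1) \<phi> \<theta>[OF M(2) A f]]])
        (simp add: \<theta>a cmp_apply deg_comp_apply coinv_class_closed[OF M(1)] Coinv_Arr_class[OF \<phi> M] dhomD[OF \<phi>] del: Coinv_Obj)
    then show "\<theta> M' A (Cmp (GrMod K G) (FObj COINV M') (FObj COINV M) A f (FArr COINV M' M \<phi>)) =
      Cmp (DistMod K G X d) M' M (triv A) (\<theta> M A f) \<phi>" by simp
  next
    fix M :: "('x, 'k, 'u) dmod" and A B :: "('k, 'u) gmod" and g f
    assume "M \<in> Obj (DistMod K G X d)" "A \<in> Obj (GrMod K G)" "B \<in> Obj (GrMod K G)"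
      "f \<in> Arr (GrMod K G) (FObj COINV M) A" "g \<in> Arr (GrMod K G) A B"
    then have M: "M \<in> dmods" and A: "A \<in> graded_modules K G" and B: "B \<in> graded_modules K G"
      and f: "f \<in> deg_maps K G 0 (FObj COINV M) A" and g: "g \<in> deg_maps K G 0 A B" by simp_all
    have "\<theta> M B (deg_comp G (FObj COINV M) 0 g f) = cmp M (\<lambda>x\<in>X. g) (\<theta> M A f)"
      by (rule dhom_ext[OF \<theta>[OF M B deg_comp0_maps[OF Coinv_graded[OF M] f g]] dhom_cmp[OF M \<theta>[OF M A f] triv_hom[OF A B g]]])
        (simp add: \<theta>a cmp_apply deg_comp_apply coinv_class_closed[OF M] del: Coinv_Obj)
    then show "\<theta> M B (Cmp (GrMod K G) (FObj COINV M) A B g f) =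
      Cmp (DistMod K G X d) M (triv A) (triv B) (FArr (Triv G X d) A B g) (\<theta> M A f)" by simp
  qed
qed

end

section \<open>Distance modules as modules over the enriched category\<close>

context graded
begin

lemma inner_hom_simps:
  assumes "e \<in> G"
  shows "carrier (inner_hom K G A B e) = deg_maps K G e A B" "\<zero>\<^bsub>inner_hom K G A B e\<^esub> = deg_zero G e A B"
    and "g \<in> G \<Longrightarrow> m \<in> carrier (A g) \<Longrightarrow> (a \<odot>\<^bsub>inner_hom K G A B e\<^esub> f) g m = a \<odot>\<^bsub>B (g + e)\<^esub> f g m"
  using assms by (simp_all add: inner_hom_def)

lemma module_inner_hom:
  "\<lbrakk>A \<in> graded_modules K G; B \<in> graded_modules K G; e \<in> G\<rbrakk> \<Longrightarrow> Module.module K (inner_hom K G A B e)"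
  by (rule graded_modulesD[OF inner_hom_graded[OF K _ _ G]])

end

section \<open>The isomorphism with modules over the enriched category\<close>

context dist_setting
begin

abbreviation \<Sigma> :: "('x, 'k, 'k) gcat" where "\<Sigma> \<equiv> Sigma_gcat K G X d"

abbreviation gmods :: "('x, 'k, 'k, 'u) gcat_module set" where
  "gmods \<equiv> gftors K G \<Sigma> (GrMod_enr K G)"

lemma Sigma_simps [simp]:
  "GObj \<Sigma> = X" "GIdt \<Sigma> x = \<one>\<^bsub>K\<^esub>"
  "GCmp \<Sigma> x y z b a s r = (if between d x y z then s \<otimes>\<^bsub>K\<^esub> r else \<zero>\<^bsub>K\<^esub>)"
  by (simp_all add: Sigma_gcat_def)

lemma Sigma_Hom:
  assumes "g \<in> G"
  shows "carrier (GHom \<Sigma> x y g) = (if d x y < \<infinity> \<and> g = \<delta> x y then carrier K else {\<zero>\<^bsub>K\<^esub>})"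
    and "r \<oplus>\<^bsub>GHom \<Sigma> x y g\<^esub> s = r \<oplus>\<^bsub>K\<^esub> s" "a \<odot>\<^bsub>GHom \<Sigma> x y g\<^esub> r = a \<otimes>\<^bsub>K\<^esub> r" "\<zero>\<^bsub>GHom \<Sigma> x y g\<^esub> = \<zero>\<^bsub>K\<^esub>"
  using assms by (auto simp: Sigma_gcat_def shifted_ring_def zero_gmod_def)

lemma module_Sigma: "g \<in> G \<Longrightarrow> Module.module K (GHom \<Sigma> x y g)"
  using shifted_ring_graded[OF K, of G] by (auto simp: Sigma_gcat_def graded_modules_def)

lemma GrMod_enr_simps [simp]:
  "GObj (GrMod_enr K G) = graded_modules K G" "GHom (GrMod_enr K G) A B = inner_hom K G A B"
  "GIdt (GrMod_enr K G) A = deg_id G A" "GCmp (GrMod_enr K G) A B C b a \<psi> \<phi> = deg_comp G A a \<psi> \<phi>"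
  by (simp_all add: GrMod_enr_def)

text \<open>Linear extension from the generator (x,y). In all other degrees the hom module is zero,
  and the zero map of that degree must be given explicitly because \<open>act M x y\<close> has
  degree \<open>\<delta> x y\<close>.\<close>

definition to_gmod :: "('x, 'k, 'u) dmod \<Rightarrow> ('x, 'k, 'k, 'u) gcat_module" where
  "to_gmod M = \<lparr>GFObj = pts M,
     GFHom = (\<lambda>x y. if x \<in> X \<and> y \<in> X then \<lambda>g\<in>G. \<lambda>r\<in>carrier (GHom \<Sigma> x y g).
       if d x y < \<infinity> \<and> g = \<delta> x y then r \<odot>\<^bsub>inner_hom K G (pts M x) (pts M y) g\<^esub> act M x y
       else \<zero>\<^bsub>inner_hom K G (pts M x) (pts M y) g\<^esub> else undefined)\<rparr>"

definition of_gmod :: "('x, 'k, 'k, 'u) gcat_module \<Rightarrow> ('x, 'k, 'u) dmod" where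
  "of_gmod F = \<lparr>pts = GFObj F,
     act = (\<lambda>x y. if x \<in> X \<and> y \<in> X \<and> d x y < \<infinity> then GFHom F x y (\<delta> x y) \<one>\<^bsub>K\<^esub> else undefined)\<rparr>"

lemma gmodsD:
  assumes F: "F \<in> gmods"
  shows "GFObj F \<in> X \<rightarrow>\<^sub>E graded_modules K G"
    and "x \<in> X \<Longrightarrow> GFObj F x \<in> graded_modules K G"
    and "\<lbrakk>x \<in> X; y \<in> X\<rbrakk> \<Longrightarrow> GFHom F x y \<in> deg_maps K G 0 (GHom \<Sigma> x y) (inner_hom K G (GFObj F x) (GFObj F y))"
    and "\<not> (x \<in> X \<and> y \<in> X) \<Longrightarrow> GFHom F x y = undefined"
    and "x \<in> X \<Longrightarrow> GFHom F x x 0 \<one>\<^bsub>K\<^esub> = deg_id G (GFObj F x)"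
    and "\<lbrakk>x \<in> X; y \<in> X; z \<in> X; a \<in> G; b \<in> G; r \<in> carrier (GHom \<Sigma> x y a); s \<in> carrier (GHom \<Sigma> y z b)\<rbrakk> \<Longrightarrow>
      GFHom F x z (a + b) (if between d x y z then s \<otimes>\<^bsub>K\<^esub> r else \<zero>\<^bsub>K\<^esub>) =
      deg_comp G (GFObj F x) a (GFHom F y z b s) (GFHom F x y a r)"
proof -
  note f = F[unfolded gftors_def mem_Collect_eq Sigma_simps GrMod_enr_simps]
  show 1: "GFObj F \<in> X \<rightarrow>\<^sub>E graded_modules K G" using f by blast
  then show "GFObj F x \<in> graded_modules K G" if "x \<in> X" using that by auto
  have h: "if x \<in> X \<and> y \<in> X then GFHom F x y \<in> deg_maps K G 0 (GHom \<Sigma> x y) (inner_hom K G (GFObj F x) (GFObj F y))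
      else GFHom F x y = undefined" for x y using f by blast
  show "GFHom F x y \<in> deg_maps K G 0 (GHom \<Sigma> x y) (inner_hom K G (GFObj F x) (GFObj F y))" if "x \<in> X" "y \<in> X"
    using h[of x y] that by argo
  show "GFHom F x y = undefined" if "\<not> (x \<in> X \<and> y \<in> X)"
    using h[of x y] that by argo
  show "GFHom F x x 0 \<one>\<^bsub>K\<^esub> = deg_id G (GFObj F x)" if "x \<in> X" using f that by blast
  show "GFHom F x z (a + b) (if between d x y z then s \<otimes>\<^bsub>K\<^esub> r else \<zero>\<^bsub>K\<^esub>) =
      deg_comp G (GFObj F x) a (GFHom F y z b s) (GFHom F x y a r)"
    if "x \<in> X" "y \<in> X" "z \<in> X" "a \<in> G" "b \<in> G" "r \<in> carrier (GHom \<Sigma> x y a)" "s \<in> carrier (GHom \<Sigma> y z b)"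
    using f that by blast
qed

lemma
  assumes M: "M \<in> dmods"
  shows to_gmod_Obj [simp]: "GFObj (to_gmod M) = pts M"
    and to_gmod_maps: "\<And>x y. \<lbrakk>x \<in> X; y \<in> X\<rbrakk> \<Longrightarrow>
      GFHom (to_gmod M) x y \<in> deg_maps K G 0 (GHom \<Sigma> x y) (inner_hom K G (pts M x) (pts M y))"
    and to_gmod_apply: "\<And>x y g r h m. \<lbrakk>x \<in> X; y \<in> X; g \<in> G; r \<in> carrier (GHom \<Sigma> x y g); h \<in> G; m \<in> carrier (pts M x h)\<rbrakk> \<Longrightarrow>
      GFHom (to_gmod M) x y g r h m =
      (if d x y < \<infinity> \<and> g = \<delta> x y then r \<odot>\<^bsub>pts M y (h + g)\<^esub> act M x y h m else \<zero>\<^bsub>pts M y (h + g)\<^esub>)"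
proof -
  show "GFObj (to_gmod M) = pts M" by (simp add: to_gmod_def)
  show "GFHom (to_gmod M) x y \<in> deg_maps K G 0 (GHom \<Sigma> x y) (inner_hom K G (pts M x) (pts M y))"
    if x: "x \<in> X" "y \<in> X" for x y
  proof -
    have "(\<lambda>g\<in>G. \<lambda>r\<in>carrier (GHom \<Sigma> x y g).
        if d x y < \<infinity> \<and> g = \<delta> x y then r \<odot>\<^bsub>inner_hom K G (pts M x) (pts M y) g\<^esub> act M x y
        else \<zero>\<^bsub>inner_hom K G (pts M x) (pts M y) g\<^esub>) \<in> deg_maps K G 0 (GHom \<Sigma> x y) (inner_hom K G (pts M x) (pts M y))"
    proof (intro deg_mapsI lin_mapsI module_Sigma)
      fix g assume g: "g \<in> G"
      note I = moduleD[OF module_inner_hom[OF pts_graded[OF M x(1)] pts_graded[OF M x(2)] g]]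
      have a: "act M x y \<in> carrier (inner_hom K G (pts M x) (pts M y) g)" if "d x y < \<infinity>" "g = \<delta> x y"
        using act_maps[OF M x that(1)] that(2) g by (simp add: inner_hom_simps)
      fix r assume r: "r \<in> carrier (GHom \<Sigma> x y g)"
      show "(if d x y < \<infinity> \<and> g = \<delta> x y then r \<odot>\<^bsub>inner_hom K G (pts M x) (pts M y) g\<^esub> act M x y
        else \<zero>\<^bsub>inner_hom K G (pts M x) (pts M y) g\<^esub>) \<in> carrier (inner_hom K G (pts M x) (pts M y) (g + 0))"
      proof (cases "d x y < \<infinity> \<and> g = \<delta> x y")
        case True
        then have "r \<in> carrier K" using r g by (simp add: Sigma_Hom)
        from I(8)[OF this a] show ?thesis using True by simp
      next
        case False
        then show ?thesis by (auto simp: I(1))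
      qed
      show "(if d x y < \<infinity> \<and> g = \<delta> x y then (c \<odot>\<^bsub>GHom \<Sigma> x y g\<^esub> r) \<odot>\<^bsub>inner_hom K G (pts M x) (pts M y) g\<^esub> act M x y
          else \<zero>\<^bsub>inner_hom K G (pts M x) (pts M y) g\<^esub>) =
        c \<odot>\<^bsub>inner_hom K G (pts M x) (pts M y) (g + 0)\<^esub> (if d x y < \<infinity> \<and> g = \<delta> x y then r \<odot>\<^bsub>inner_hom K G (pts M x) (pts M y) g\<^esub> act M x y
          else \<zero>\<^bsub>inner_hom K G (pts M x) (pts M y) g\<^esub>)" if c: "c \<in> carrier K" for c
      proof (cases "d x y < \<infinity> \<and> g = \<delta> x y")
        case True
        then have "r \<in> carrier K" using r g by (simp add: Sigma_Hom)
        from I(11)[OF c this a] show ?thesis using True g by (simp add: Sigma_Hom)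
      next
        case False
        then show ?thesis using I(14)[OF c] by auto
      qed
      fix s assume s: "s \<in> carrier (GHom \<Sigma> x y g)"
      show "(if d x y < \<infinity> \<and> g = \<delta> x y then (r \<oplus>\<^bsub>GHom \<Sigma> x y g\<^esub> s) \<odot>\<^bsub>inner_hom K G (pts M x) (pts M y) g\<^esub> act M x y
          else \<zero>\<^bsub>inner_hom K G (pts M x) (pts M y) g\<^esub>) =
        (if d x y < \<infinity> \<and> g = \<delta> x y then r \<odot>\<^bsub>inner_hom K G (pts M x) (pts M y) g\<^esub> act M x y
          else \<zero>\<^bsub>inner_hom K G (pts M x) (pts M y) g\<^esub>) \<oplus>\<^bsub>inner_hom K G (pts M x) (pts M y) (g + 0)\<^esub>
        (if d x y < \<infinity> \<and> g = \<delta> x y then s \<odot>\<^bsub>inner_hom K G (pts M x) (pts M y) g\<^esub> act M x y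
          else \<zero>\<^bsub>inner_hom K G (pts M x) (pts M y) g\<^esub>)"
      proof (cases "d x y < \<infinity> \<and> g = \<delta> x y")
        case True
        then have "r \<in> carrier K" "s \<in> carrier K" using r s g by (simp_all add: Sigma_Hom)
        from I(9)[OF this a] show ?thesis using True g by (simp add: Sigma_Hom)
      next
        case False
        then show ?thesis using I(6)[OF I(1)] by auto
      qed
    qed
    then show ?thesis using x by (simp add: to_gmod_def)
  qed
  show "GFHom (to_gmod M) x y g r h m =
      (if d x y < \<infinity> \<and> g = \<delta> x y then r \<odot>\<^bsub>pts M y (h + g)\<^esub> act M x y h m else \<zero>\<^bsub>pts M y (h + g)\<^esub>)"
    if "x \<in> X" "y \<in> X" "g \<in> G" "r \<in> carrier (GHom \<Sigma> x y g)" "h \<in> G" "m \<in> carrier (pts M x h)" for x y g r h m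
  proof (cases "d x y < \<infinity> \<and> g = \<delta> x y")
    case True
    then show ?thesis using that by (auto simp: to_gmod_def inner_hom_simps)
  next
    case False
    then have "GFHom (to_gmod M) x y g r = \<zero>\<^bsub>inner_hom K G (pts M x) (pts M y) g\<^esub>"
      using that by (auto simp: to_gmod_def)
    with False show ?thesis using that by (auto simp: inner_hom_simps deg_zero_apply)
  qed
qed

lemma to_gmod_deg:
  assumes M: "M \<in> dmods" and x: "x \<in> X" "y \<in> X" "g \<in> G" "r \<in> carrier (GHom \<Sigma> x y g)"
  shows "GFHom (to_gmod M) x y g r \<in> deg_maps K G g (pts M x) (pts M y)"
  using deg_maps0D(1)[OF to_gmod_maps[OF M x(1,2)] x(3,4)] x(3) by (simp add: inner_hom_simps)

lemma to_gmod:
  assumes M: "M \<in> dmods"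
  shows "to_gmod M \<in> gmods"
  unfolding gftors_def mem_Collect_eq Sigma_simps GrMod_enr_simps to_gmod_Obj[OF M]
proof (intro conjI allI ballI)
  interpret K: cring K by (rule K)
  show "pts M \<in> X \<rightarrow>\<^sub>E graded_modules K G" using M by (simp add: dist_modules_def)
  show "if x \<in> X \<and> y \<in> X then GFHom (to_gmod M) x y \<in> deg_maps K G 0 (GHom \<Sigma> x y) (inner_hom K G (pts M x) (pts M y))
      else GFHom (to_gmod M) x y = undefined" for x y
    using to_gmod_maps[OF M] by (simp add: to_gmod_def)
  have one: "\<one>\<^bsub>K\<^esub> \<in> carrier (GHom \<Sigma> x x 0)" if "x \<in> X" for x
    using that G_zero by (simp add: Sigma_Hom)
  show "GFHom (to_gmod M) x x 0 \<one>\<^bsub>K\<^esub> = deg_id G (pts M x)" if x: "x \<in> X" for x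
    by (rule deg_maps_ext[OF to_gmod_deg[OF M x x G_zero one[OF x]] deg_id_maps[OF pts_graded[OF M x]]])
      (simp add: to_gmod_apply[OF M x x G_zero one[OF x]] x deg_id_apply act_refl[OF M] moduleD[OF pts_module[OF M x]])
  fix x y z a b r s
  assume x: "x \<in> X" and y: "y \<in> X" and z: "z \<in> X" and a: "a \<in> G" and b: "b \<in> G"
    and r: "r \<in> carrier (GHom \<Sigma> x y a)" and s: "s \<in> carrier (GHom \<Sigma> y z b)"
  let ?c = "if between d x y z then s \<otimes>\<^bsub>K\<^esub> r else \<zero>\<^bsub>K\<^esub>"
  have ab: "a + b \<in> G" by (rule G_add[OF a b])
  have rK: "r \<in> carrier K" "s \<in> carrier K" using r s a b by (auto simp: Sigma_Hom split: if_splits)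
  have c: "?c \<in> carrier (GHom \<Sigma> x z (a + b))"
    using gcategory_cmp_closed[OF Sigma_gcategory[OF K quasi G dG], of x y z a b r s] x y z a b r s by simp
  show "GFHom (to_gmod M) x z (a + b) ?c = deg_comp G (pts M x) a (GFHom (to_gmod M) y z b s) (GFHom (to_gmod M) x y a r)"
  proof (rule deg_maps_ext[OF to_gmod_deg[OF M x z ab c]
        deg_comp_maps[OF pts_graded[OF M x] to_gmod_deg[OF M x y a r] to_gmod_deg[OF M y z b s] a]])
    fix h m assume h: "h \<in> G" and m: "m \<in> carrier (pts M x h)"
    have h': "h + a \<in> G" "h + a + b \<in> G" by (intro G_add h a b)+
    note mz = moduleD[OF pts_module[OF M z h'(2)]]
    have v: "GFHom (to_gmod M) x y a r h m \<in> carrier (pts M y (h + a))"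
      by (rule deg_mapsD(1)[OF to_gmod_deg[OF M x y a r] h m])
    have R: "deg_comp G (pts M x) a (GFHom (to_gmod M) y z b s) (GFHom (to_gmod M) x y a r) h m =
      (if d y z < \<infinity> \<and> b = \<delta> y z then s \<odot>\<^bsub>pts M z (h + a + b)\<^esub> act M y z (h + a) (GFHom (to_gmod M) x y a r h m)
       else \<zero>\<^bsub>pts M z (h + a + b)\<^esub>)"
      unfolding deg_comp_apply[where A="pts M x", OF h m] by (rule to_gmod_apply[OF M y z b s h'(1) v])
    have L: "GFHom (to_gmod M) x z (a + b) ?c h m =
      (if d x z < \<infinity> \<and> a + b = \<delta> x z then ?c \<odot>\<^bsub>pts M z (h + a + b)\<^esub> act M x z h m else \<zero>\<^bsub>pts M z (h + a + b)\<^esub>)"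
      using to_gmod_apply[OF M x z ab c h m] by (simp add: add.assoc)
    have cl: "act M x z h m \<in> carrier (pts M z (h + a + b))" if "d x z < \<infinity>" "a + b = \<delta> x z"
      using actD(1)[OF M x z that(1) h m] that(2) by (simp add: add.assoc)
    \<comment> \<open>Only the degrees of the two generators matter. In every other case one of the
      scalars \<open>r\<close> and \<open>s\<close> is zero, and both sides vanish.\<close>
    show "GFHom (to_gmod M) x z (a + b) ?c h m =
      deg_comp G (pts M x) a (GFHom (to_gmod M) y z b s) (GFHom (to_gmod M) x y a r) h m"
    proof (cases "d x y < \<infinity> \<and> a = \<delta> x y \<and> d y z < \<infinity> \<and> b = \<delta> y z")
      case True
      then have f: "d x y < \<infinity>" "d y z < \<infinity>" and e: "a = \<delta> x y" "b = \<delta> y z" by auto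
      have xz: "d x z < \<infinity>" by (rule fin_trans[OF x y z f])
      have A: "act M x y h m \<in> carrier (pts M y (h + a))" using actD(1)[OF M x y f(1) h m] e by simp
      have "act M y z (h + a) (GFHom (to_gmod M) x y a r h m) = r \<odot>\<^bsub>pts M z (h + a + b)\<^esub> act M y z (h + a) (act M x y h m)"
      proof -
        have "GFHom (to_gmod M) x y a r h m = r \<odot>\<^bsub>pts M y (h + a)\<^esub> act M x y h m"
          using f e by (subst to_gmod_apply[OF M x y a r h m]) simp
        then show ?thesis using e actD(3)[OF M y z f(2) h'(1) rK(1) A] by simp
      qed
      also have "act M y z (h + a) (act M x y h m) = (if between d x y z then act M x z h m else \<zero>\<^bsub>pts M z (h + a + b)\<^esub>)"
        using act_act[OF M x y z f h m] by (simp add: e add.assoc)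
      finally have 1: "act M y z (h + a) (GFHom (to_gmod M) x y a r h m) =
        r \<odot>\<^bsub>pts M z (h + a + b)\<^esub> (if between d x y z then act M x z h m else \<zero>\<^bsub>pts M z (h + a + b)\<^esub>)" .
      \<comment> \<open>Reconciles two conditions: \<open>\<Sigma>\<close> composes by betweenness,
        while \<open>to_gmod\<close> decides by the degree of the generator (x,z).\<close>
      have bt: "between d x y z \<longleftrightarrow> a + b = \<delta> x z" unfolding e by (rule between_iff[OF x y z f])
      show ?thesis
      proof (cases "between d x y z")
        case True
        then have e': "a + b = \<delta> x z" using bt by simp
        have "GFHom (to_gmod M) x z (a + b) ?c h m = ?c \<odot>\<^bsub>pts M z (h + a + b)\<^esub> act M x z h m"
          unfolding L using xz e' by simp
        moreover have "deg_comp G (pts M x) a (GFHom (to_gmod M) y z b s) (GFHom (to_gmod M) x y a r) h m =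
          s \<odot>\<^bsub>pts M z (h + a + b)\<^esub> act M y z (h + a) (GFHom (to_gmod M) x y a r h m)"
          unfolding R using f e by simp
        ultimately show ?thesis using True rK cl[OF xz e'] 1 by (simp add: mz)
      next
        case False
        then have "GFHom (to_gmod M) x z (a + b) ?c h m = \<zero>\<^bsub>pts M z (h + a + b)\<^esub>"
          unfolding L using bt by simp
        moreover have "deg_comp G (pts M x) a (GFHom (to_gmod M) y z b s) (GFHom (to_gmod M) x y a r) h m =
          s \<odot>\<^bsub>pts M z (h + a + b)\<^esub> act M y z (h + a) (GFHom (to_gmod M) x y a r h m)"
          unfolding R using f e by simp
        ultimately show ?thesis using False rK 1 by (simp add: mz)
      qed
    next
      case False
      then consider "\<not> (d x y < \<infinity> \<and> a = \<delta> x y)" | "\<not> (d y z < \<infinity> \<and> b = \<delta> y z)" by blast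
      then have "?c = \<zero>\<^bsub>K\<^esub>"
        using r s rK by cases (auto simp: Sigma_Hom[OF a] Sigma_Hom[OF b])
      then have L0: "GFHom (to_gmod M) x z (a + b) ?c h m = \<zero>\<^bsub>pts M z (h + a + b)\<^esub>"
        unfolding L using cl by (simp add: mz)
      have "deg_comp G (pts M x) a (GFHom (to_gmod M) y z b s) (GFHom (to_gmod M) x y a r) h m = \<zero>\<^bsub>pts M z (h + a + b)\<^esub>"
      proof (cases "d y z < \<infinity> \<and> b = \<delta> y z")
        case True
        then have "GFHom (to_gmod M) x y a r h m = \<zero>\<^bsub>pts M y (h + a)\<^esub>"
          using False by (subst to_gmod_apply[OF M x y a r h m]) auto
        then show ?thesis
          unfolding R using True act_zero[OF M y z _ h'(1)] mz(14)[OF rK(2)] by simp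
      next
        case False
        then show ?thesis unfolding R by auto
      qed
      with L0 show ?thesis by simp
    qed
  qed
qed

text \<open>The composition rule is functoriality on two generators. If \<open>y\<close> is not
  between \<open>x\<close> and \<open>z\<close> their composite is the zero scalar, which the linear
  map sends to the zero map.\<close>

lemma of_gmod:
  assumes F: "F \<in> gmods"
  shows "of_gmod F \<in> dmods"
proof -
  interpret K: cring K by (rule K)
  have p: "pts (of_gmod F) = GFObj F" by (simp add: of_gmod_def)
  have a: "act (of_gmod F) x y = GFHom F x y (\<delta> x y) \<one>\<^bsub>K\<^esub>" if "x \<in> X" "y \<in> X" "d x y < \<infinity>" for x y
    using that by (simp add: of_gmod_def)
  have one: "\<one>\<^bsub>K\<^esub> \<in> carrier (GHom \<Sigma> x y (\<delta> x y))" if "x \<in> X" "y \<in> X" "d x y < \<infinity>" for x y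
    using that dG[OF that] by (simp add: Sigma_Hom)
  have deg: "act (of_gmod F) x y \<in> deg_maps K G (\<delta> x y) (GFObj F x) (GFObj F y)" if "x \<in> X" "y \<in> X" "d x y < \<infinity>" for x y
    using deg_maps0D(1)[OF gmodsD(3)[OF F that(1,2)] dG[OF that] one[OF that]] dG[OF that]
    by (simp add: a[OF that] inner_hom_simps)
  show ?thesis
  proof (rule dist_modulesI)
    fix x g m assume *: "x \<in> X" "g \<in> G" "m \<in> carrier (pts (of_gmod F) x g)"
    then have "act (of_gmod F) x x = deg_id G (GFObj F x)" using gmodsD(5)[OF F] by (simp add: a)
    then show "act (of_gmod F) x x g m = m" using * by (simp add: p deg_id_apply)
  next
    fix x y z g m
    assume x: "x \<in> X" "y \<in> X" "z \<in> X" "d x y < \<infinity>" "d y z < \<infinity>" and g: "g \<in> G" and m: "m \<in> carrier (pts (of_gmod F) x g)"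
    note xz = fin_trans[OF x]
    note dg = dG[OF x(1,2,4)] dG[OF x(2,3,5)]
    have m: "m \<in> carrier (GFObj F x g)" using m by (simp add: p)
    have "act (of_gmod F) y z (g + \<delta> x y) (act (of_gmod F) x y g m) =
      deg_comp G (GFObj F x) (\<delta> x y) (GFHom F y z (\<delta> y z) \<one>\<^bsub>K\<^esub>) (GFHom F x y (\<delta> x y) \<one>\<^bsub>K\<^esub>) g m"
      using x g m by (simp add: a deg_comp_apply)
    also have "\<dots> = GFHom F x z (\<delta> x y + \<delta> y z) (if between d x y z then \<one>\<^bsub>K\<^esub> else \<zero>\<^bsub>K\<^esub>) g m"
      by (rule fun_cong[OF fun_cong[OF gmodsD(6)[OF F x(1-3) dg one[OF x(1,2,4)] one[OF x(2,3,5)],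
          unfolded K.r_one[OF K.one_closed], symmetric]]])
    also have "\<dots> = (if between d x y z then act (of_gmod F) x z g m else \<zero>\<^bsub>pts (of_gmod F) z (g + (\<delta> x y + \<delta> y z))\<^esub>)"
    proof (cases "between d x y z")
      case True
      then show ?thesis using x xz by (simp add: a between_iff)
    next
      case False
      note ab = G_add[OF dg]
      have "GFHom F x z (\<delta> x y + \<delta> y z) \<zero>\<^bsub>K\<^esub> = deg_zero G (\<delta> x y + \<delta> y z) (GFObj F x) (GFObj F z)"
        using lin_maps_zero[OF deg_maps_lin[OF gmodsD(3)[OF F x(1,3)] ab] module_Sigma[OF ab]] ab
          module_inner_hom[OF gmodsD(2)[OF F x(1)] gmodsD(2)[OF F x(3)] ab]
        by (simp add: Sigma_Hom inner_hom_simps)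
      with False show ?thesis using g m by (simp add: deg_zero_apply p)
    qed
    finally show "act (of_gmod F) y z (g + \<delta> x y) (act (of_gmod F) x y g m) =
      (if between d x y z then act (of_gmod F) x z g m else \<zero>\<^bsub>pts (of_gmod F) z (g + (\<delta> x y + \<delta> y z))\<^esub>)" .
  qed (use gmodsD(1)[OF F] deg p in \<open>auto simp: of_gmod_def\<close>)
qed

lemma of_to_gmod:
  assumes M: "M \<in> dmods"
  shows "of_gmod (to_gmod M) = M"
proof -
  interpret K: cring K by (rule K)
  have "act (of_gmod (to_gmod M)) x y = act M x y" for x y
  proof (cases "x \<in> X \<and> y \<in> X \<and> d x y < \<infinity>")
    case True
    then have x: "x \<in> X" "y \<in> X" "d x y < \<infinity>" by auto
    have one: "\<one>\<^bsub>K\<^esub> \<in> carrier (GHom \<Sigma> x y (\<delta> x y))" using x dG[OF x] by (simp add: Sigma_Hom)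
    have "GFHom (to_gmod M) x y (\<delta> x y) \<one>\<^bsub>K\<^esub> = act M x y"
      by (rule deg_maps_ext[OF to_gmod_deg[OF M x(1,2) dG[OF x] one] act_maps[OF M x]])
        (simp add: to_gmod_apply[OF M x(1,2) dG[OF x] one] x moduleD(12)[OF pts_module[OF M x(2) G_add[OF _ dG[OF x]]]] actD[OF M x])
    then show ?thesis using x by (simp add: of_gmod_def)
  next
    case False
    then show ?thesis using act_undefined[OF M False] by (auto simp: of_gmod_def)
  qed
  then show ?thesis by (intro dmod.equality) (auto simp: of_gmod_def to_gmod_def)
qed

text \<open>A linear map on a cyclic module is determined by its value at the generator; in the
  remaining degrees the hom module is zero.\<close>

lemma to_of_gmod:
  assumes F: "F \<in> gmods"
  shows "to_gmod (of_gmod F) = F"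
proof -
  interpret K: cring K by (rule K)
  note M = of_gmod[OF F]
  have p: "pts (of_gmod F) = GFObj F" by (simp add: of_gmod_def)
  have "GFHom (to_gmod (of_gmod F)) x y = GFHom F x y" for x y
  proof (cases "x \<in> X \<and> y \<in> X")
    case True
    then have x: "x \<in> X" "y \<in> X" by auto
    note f = gmodsD(3)[OF F x] and ob = gmodsD(2)[OF F x(1)] gmodsD(2)[OF F x(2)]
    show ?thesis
    proof (rule deg_maps_ext[OF to_gmod_maps[OF M x] f])
      fix g r assume g: "g \<in> G" and r: "r \<in> carrier (GHom \<Sigma> x y g)"
      show "GFHom (to_gmod (of_gmod F)) x y g r = GFHom F x y g r"
      proof (cases "d x y < \<infinity> \<and> g = \<delta> x y")
        case True
        then have rK: "r \<in> carrier K" and one: "\<one>\<^bsub>K\<^esub> \<in> carrier (GHom \<Sigma> x y g)" using r g by (simp_all add: Sigma_Hom)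
        have "GFHom (to_gmod (of_gmod F)) x y g r = r \<odot>\<^bsub>inner_hom K G (GFObj F x) (GFObj F y) g\<^esub> GFHom F x y g \<one>\<^bsub>K\<^esub>"
          using True x g r by (simp add: to_gmod_def of_gmod_def)
        also have "\<dots> = GFHom F x y g (r \<odot>\<^bsub>GHom \<Sigma> x y g\<^esub> \<one>\<^bsub>K\<^esub>)"
          using deg_maps0D(3)[OF f g rK one] by simp
        finally show ?thesis using rK g by (simp add: Sigma_Hom)
      next
        case False
        then have "r = \<zero>\<^bsub>GHom \<Sigma> x y g\<^esub>" using r g by (auto simp: Sigma_Hom)
        then have "GFHom F x y g r = \<zero>\<^bsub>inner_hom K G (GFObj F x) (GFObj F y) g\<^esub>"
          using lin_maps_zero[OF deg_maps_lin[OF f g] module_Sigma[OF g]] module_inner_hom[OF ob g] by simp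
        moreover have "GFHom (to_gmod (of_gmod F)) x y g r = \<zero>\<^bsub>inner_hom K G (GFObj F x) (GFObj F y) g\<^esub>"
          using False x g r by (auto simp: to_gmod_def of_gmod_def)
        ultimately show ?thesis by simp
      qed
    qed
  next
    case False
    then show ?thesis using gmodsD(4)[OF F False] by (auto simp: to_gmod_def)
  qed
  then show ?thesis by (intro gftor.equality) (auto simp: to_gmod_def p)
qed

text \<open>Naturality against r times a generator is r times equivariance, so the scalar one
  already tests it. Equality of the two sets of maps is what lets the isomorphism be the identity on
  arrows.\<close>

lemma gnats_to_gmod:
  assumes M: "M \<in> dmods" and N: "N \<in> dmods"
  shows "gnats G \<Sigma> (GrMod_enr K G) (to_gmod M) (to_gmod N) = dhom M N"
proof -
  interpret K: cring K by (rule K)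
  have nat: "deg_comp G (pts M x) g (\<alpha> y) (GFHom (to_gmod M) x y g r) h m = (if d x y < \<infinity> \<and> g = \<delta> x y
        then r \<odot>\<^bsub>pts N y (h + g)\<^esub> \<alpha> y (h + g) (act M x y h m) else \<zero>\<^bsub>pts N y (h + g)\<^esub>)"
      "deg_comp G (pts M x) 0 (GFHom (to_gmod N) x y g r) (\<alpha> x) h m = (if d x y < \<infinity> \<and> g = \<delta> x y
        then r \<odot>\<^bsub>pts N y (h + g)\<^esub> act N x y h (\<alpha> x h m) else \<zero>\<^bsub>pts N y (h + g)\<^esub>)"
    if \<alpha>: "\<alpha> x \<in> deg_maps K G 0 (pts M x) (pts N x)" "\<alpha> y \<in> deg_maps K G 0 (pts M y) (pts N y)"
      and x: "x \<in> X" "y \<in> X" "g \<in> G" "r \<in> carrier (GHom \<Sigma> x y g)" and h: "h \<in> G" "m \<in> carrier (pts M x h)" for \<alpha> x y g r h m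
  proof -
    have hg: "h + g \<in> G" by (rule G_add[OF h(1) x(3)])
    show "deg_comp G (pts M x) g (\<alpha> y) (GFHom (to_gmod M) x y g r) h m = (if d x y < \<infinity> \<and> g = \<delta> x y
        then r \<odot>\<^bsub>pts N y (h + g)\<^esub> \<alpha> y (h + g) (act M x y h m) else \<zero>\<^bsub>pts N y (h + g)\<^esub>)"
    proof (cases "d x y < \<infinity> \<and> g = \<delta> x y")
      case True
      then have r: "r \<in> carrier K" and a: "act M x y h m \<in> carrier (pts M y (h + g))"
        using x actD(1)[OF M x(1,2) _ h] by (simp_all add: Sigma_Hom)
      have "GFHom (to_gmod M) x y g r h m = r \<odot>\<^bsub>pts M y (h + g)\<^esub> act M x y h m"
        using True by (subst to_gmod_apply[OF M x h]) simp
      then show ?thesis using True h deg_maps0D(3)[OF \<alpha>(2) hg r a]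
        by (simp add: deg_comp_apply[where A="pts M x"])
    next
      case False
      then show ?thesis
        using h hg deg_maps_zero[OF pts_graded[OF M x(2)] pts_graded[OF N x(2)] \<alpha>(2) hg G_zero]
        by (auto simp: deg_comp_apply[where A="pts M x"] to_gmod_apply[OF M x h])
    qed
    show "deg_comp G (pts M x) 0 (GFHom (to_gmod N) x y g r) (\<alpha> x) h m = (if d x y < \<infinity> \<and> g = \<delta> x y
        then r \<odot>\<^bsub>pts N y (h + g)\<^esub> act N x y h (\<alpha> x h m) else \<zero>\<^bsub>pts N y (h + g)\<^esub>)"
      using to_gmod_apply[OF N x h(1) deg_maps0D(1)[OF \<alpha>(1) h]] h
      by (simp add: deg_comp_apply[where A="pts M x"])
  qed
  show ?thesis
  proof (rule subset_antisym; rule subsetI)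
    fix \<alpha> assume "\<alpha> \<in> gnats G \<Sigma> (GrMod_enr K G) (to_gmod M) (to_gmod N)"
    then have \<alpha>: "\<alpha> \<in> (\<Pi>\<^sub>E x\<in>X. deg_maps K G 0 (pts M x) (pts N x))"
      and eq: "\<And>x y g r. \<lbrakk>x \<in> X; y \<in> X; g \<in> G; r \<in> carrier (GHom \<Sigma> x y g)\<rbrakk> \<Longrightarrow>
        deg_comp G (pts M x) g (\<alpha> y) (GFHom (to_gmod M) x y g r) = deg_comp G (pts M x) 0 (GFHom (to_gmod N) x y g r) (\<alpha> x)"
      unfolding gnats_def mem_Collect_eq Sigma_simps GrMod_enr_simps to_gmod_Obj[OF M] to_gmod_Obj[OF N]
      by (simp_all add: inner_hom_simps G_zero)
    have "act N x y h (\<alpha> x h m) = \<alpha> y (h + \<delta> x y) (act M x y h m)"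
      if x: "x \<in> X" "y \<in> X" "d x y < \<infinity>" and h: "h \<in> G" "m \<in> carrier (pts M x h)" for x y h m
    proof -
      note dg = dG[OF x]
      have one: "\<one>\<^bsub>K\<^esub> \<in> carrier (GHom \<Sigma> x y (\<delta> x y))" using x dg by (simp add: Sigma_Hom)
      have \<alpha>x: "\<alpha> x \<in> deg_maps K G 0 (pts M x) (pts N x)" "\<alpha> y \<in> deg_maps K G 0 (pts M y) (pts N y)"
        using \<alpha> x by auto
      have hg: "h + \<delta> x y \<in> G" by (rule G_add[OF h(1) dg])
      have "\<alpha> x h m \<in> carrier (pts N x h)" by (rule deg_maps0D(1)[OF \<alpha>x(1) h])
      then have c: "act N x y h (\<alpha> x h m) \<in> carrier (pts N y (h + \<delta> x y))" "\<alpha> y (h + \<delta> x y) (act M x y h m) \<in> carrier (pts N y (h + \<delta> x y))"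
        using actD(1)[OF N x h(1)] deg_maps0D(1)[OF \<alpha>x(2) hg actD(1)[OF M x h]] by auto
      from fun_cong[OF fun_cong[OF eq[OF x(1,2) dg one], of h], of m]
      show ?thesis
        unfolding nat[OF \<alpha>x x(1,2) dg one h]
        using x c by (simp add: moduleD[OF pts_module[OF N x(2) hg]])
    qed
    then show "\<alpha> \<in> dhom M N" using \<alpha> by (simp add: dhom_def)
  next
    fix \<alpha> assume \<alpha>: "\<alpha> \<in> dhom M N"
    have "deg_comp G (pts M x) g (\<alpha> y) (GFHom (to_gmod M) x y g r) = deg_comp G (pts M x) 0 (GFHom (to_gmod N) x y g r) (\<alpha> x)"
      if x: "x \<in> X" "y \<in> X" "g \<in> G" "r \<in> carrier (GHom \<Sigma> x y g)" for x y g r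
    proof (rule deg_maps_ext[OF deg_comp_maps[OF pts_graded[OF M x(1)] to_gmod_deg[OF M x] dhom_deg[OF \<alpha> x(2)] x(3)]
          deg_comp_maps[OF pts_graded[OF M x(1)] dhom_deg[OF \<alpha> x(1)] to_gmod_deg[OF N x] G_zero]])
      fix h m assume h: "h \<in> G" "m \<in> carrier (pts M x h)"
      show "deg_comp G (pts M x) g (\<alpha> y) (GFHom (to_gmod M) x y g r) h m = deg_comp G (pts M x) 0 (GFHom (to_gmod N) x y g r) (\<alpha> x) h m"
        unfolding nat[OF dhom_deg[OF \<alpha> x(1)] dhom_deg[OF \<alpha> x(2)] x h]
        using x h by (auto simp: dhom_act[OF \<alpha>])
    qed
    moreover have "\<alpha> \<in> (\<Pi>\<^sub>E x\<in>X. deg_maps K G 0 (pts M x) (pts N x))" using \<alpha> by (simp add: dhom_def)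
    ultimately show "\<alpha> \<in> gnats G \<Sigma> (GrMod_enr K G) (to_gmod M) (to_gmod N)"
      unfolding gnats_def mem_Collect_eq Sigma_simps GrMod_enr_simps to_gmod_Obj[OF M] to_gmod_Obj[OF N]
      by (simp add: inner_hom_simps G_zero)
  qed
qed

abbreviation \<Phi> :: "(('x, 'k, 'u) dmod, 'x \<Rightarrow> real \<Rightarrow> 'u \<Rightarrow> 'u, ('x, 'k, 'k, 'u) gcat_module, 'x \<Rightarrow> real \<Rightarrow> 'u \<Rightarrow> 'u) ftor" where
  "\<Phi> \<equiv> \<lparr>FObj = to_gmod, FArr = (\<lambda>A B f. f)\<rparr>"

abbreviation \<Psi> :: "(('x, 'k, 'k, 'u) gcat_module, 'x \<Rightarrow> real \<Rightarrow> 'u \<Rightarrow> 'u, ('x, 'k, 'u) dmod, 'x \<Rightarrow> real \<Rightarrow> 'u \<Rightarrow> 'u) ftor" where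
  "\<Psi> \<equiv> \<lparr>FObj = of_gmod, FArr = (\<lambda>A B f. f)\<rparr>"

lemma
  shows \<Phi>_functor: "ftor_between (DistMod K G X d) (ModCat K G \<Sigma>)
      (\<Phi> :: (('x, 'k, 'u) dmod, 'x \<Rightarrow> real \<Rightarrow> 'u \<Rightarrow> 'u, _, _) ftor)"
    and \<Psi>_functor: "ftor_between (ModCat K G \<Sigma>) (DistMod K G X d)
      (\<Psi> :: (_, _, ('x, 'k, 'u) dmod, 'x \<Rightarrow> real \<Rightarrow> 'u \<Rightarrow> 'u) ftor)"
    and \<Psi>_\<Phi>: "ftor_eq (DistMod K G X d) (ftor_comp \<Psi> \<Phi> :: (('x, 'k, 'u) dmod, 'x \<Rightarrow> real \<Rightarrow> 'u \<Rightarrow> 'u, _, _) ftor) ftor_id"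
    and \<Phi>_\<Psi>: "ftor_eq (ModCat K G \<Sigma>) (ftor_comp \<Phi> \<Psi> :: (('x, 'k, 'k, 'u) gcat_module, 'x \<Rightarrow> real \<Rightarrow> 'u \<Rightarrow> 'u, _, _) ftor) ftor_id"
proof -
  have c: "Idt (ModCat K G \<Sigma>) (to_gmod M) = Idt (DistMod K G X d) M"
    "Cmp (ModCat K G \<Sigma>) (to_gmod M) N' P' g f = Cmp (DistMod K G X d) M N P g f"
    if "M \<in> dmods" for M N P :: "('x, 'k, 'u) dmod" and N' P' g f
    using that by (simp_all add: ModCat_def gftor_cat_def cmp_def)
  have o: "Obj (ModCat K G \<Sigma>) = gmods" by (simp add: ModCat_def gftor_cat_def)
  have a: "Arr (ModCat K G \<Sigma>) (to_gmod M) (to_gmod N) = Arr (DistMod K G X d) M N"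
    if "M \<in> dmods" "N \<in> dmods" for M N :: "('x, 'k, 'u) dmod"
    using gnats_to_gmod[OF that] by (simp add: ModCat_def gftor_cat_def)
  note b = bijective_functor[OF category_DistMod, where P=to_gmod and Q=of_gmod and D="ModCat K G \<Sigma>",
      unfolded o DistMod_simps(1), OF to_gmod of_gmod of_to_gmod to_of_gmod a c(1) c(2)]
  show "ftor_between (DistMod K G X d) (ModCat K G \<Sigma>)
      (\<Phi> :: (('x, 'k, 'u) dmod, 'x \<Rightarrow> real \<Rightarrow> 'u \<Rightarrow> 'u, _, _) ftor)"
    by (rule b(1))
  show "ftor_between (ModCat K G \<Sigma>) (DistMod K G X d)
      (\<Psi> :: (_, _, ('x, 'k, 'u) dmod, 'x \<Rightarrow> real \<Rightarrow> 'u \<Rightarrow> 'u) ftor)"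
    by (rule b(2))
  show "ftor_eq (DistMod K G X d) (ftor_comp \<Psi> \<Phi> :: (('x, 'k, 'u) dmod, 'x \<Rightarrow> real \<Rightarrow> 'u \<Rightarrow> 'u, _, _) ftor) ftor_id"
    by (rule b(3))
  show "ftor_eq (ModCat K G \<Sigma>) (ftor_comp \<Phi> \<Psi> :: (('x, 'k, 'k, 'u) gcat_module, 'x \<Rightarrow> real \<Rightarrow> 'u \<Rightarrow> 'u, _, _) ftor) ftor_id"
    by (rule b(4))
qed

text \<open>The modules are equal and not merely isomorphic: on the diagonal both send r to r times
  the identity, off the diagonal both are zero.\<close>

lemma Triv_eps_pullback:
  "ftor_eq (GrMod K G :: (('k, 'u) gmod, real \<Rightarrow> 'u \<Rightarrow> 'u) cat) (ftor_comp \<Phi> (Triv G X d)) (eps_pullback K G X d)"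
proof -
  interpret K: cring K by (rule K)
  have "to_gmod (triv A) = FObj (eps_pullback K G X d) A" if A: "A \<in> graded_modules K G" for A :: "('k, 'u) gmod"
  proof -
    let ?I = "\<lambda>g. inner_hom K G A A g"
    note I = moduleD[OF module_inner_hom[OF A A]]
    have id: "deg_id G A \<in> carrier (?I 0)" using deg_id_maps[OF A] G_zero by (simp add: inner_hom_simps)
    have aug: "GFHom (augmentation K G X d) x y g r = (if x = y then r else \<zero>\<^bsub>K\<^esub>)"
      if "x \<in> X" "y \<in> X" "g \<in> G" "r \<in> carrier (GHom \<Sigma> x y g)" for x y g r
      using that by (simp add: augmentation_def)
    have sr: "carrier (shifted_ring K G 0 g) = (if g = 0 then carrier K else {\<zero>\<^bsub>K\<^esub>})" if "g \<in> G" for g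
      using that by (simp add: shifted_ring_def)
    have eq: "(if d x y < \<infinity> \<and> g = \<delta> x y then r \<odot>\<^bsub>?I g\<^esub> act (triv A) x y else \<zero>\<^bsub>?I g\<^esub>) =
      GFHom (FObj (pt_module K G) A) () () g (GFHom (augmentation K G X d) x y g r)"
      if x: "x \<in> X" "y \<in> X" and g: "g \<in> G" and r: "r \<in> carrier (GHom \<Sigma> x y g)" for x y g r
    proof (cases "x = y")
      case True
      have "act (triv A) x x = deg_id G A" using x by (simp add: Triv_def)
      then show ?thesis using True x r unfolding aug[OF x g r]
        by (simp add: pt_module_def g sr Sigma_Hom[OF g])
    next
      case False
      have "r \<in> carrier K" using r by (auto simp: Sigma_Hom[OF g] split: if_splits)
      note z = I(14)[OF g this]
      have "act (triv A) x y = \<zero>\<^bsub>?I g\<^esub>" if "d x y < \<infinity>" "g = \<delta> x y"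
        using x that g False by (simp add: Triv_def inner_hom_simps)
      with z have "(if d x y < \<infinity> \<and> g = \<delta> x y then r \<odot>\<^bsub>?I g\<^esub> act (triv A) x y else \<zero>\<^bsub>?I g\<^esub>) = \<zero>\<^bsub>?I g\<^esub>"
        by auto
      \<comment> \<open>In degree zero the module over the point sends the zero scalar to zero times
        the identity; in the other degrees its value is zero by definition.\<close>
      also have "\<dots> = GFHom (FObj (pt_module K G) A) () () g \<zero>\<^bsub>K\<^esub>"
        using id by (simp add: pt_module_def g sr I(13)[OF G_zero])
      finally show ?thesis using False unfolding aug[OF x g r] by simp
    qed
    have "GFHom (to_gmod (triv A)) x y = GFHom (FObj (eps_pullback K G X d) A) x y" for x y
    proof (cases "x \<in> X \<and> y \<in> X")
      case True
      then have x: "x \<in> X" "y \<in> X" by auto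
      have "(\<lambda>g\<in>G. \<lambda>r\<in>carrier (GHom \<Sigma> x y g). if d x y < \<infinity> \<and> g = \<delta> x y then r \<odot>\<^bsub>?I g\<^esub> act (triv A) x y else \<zero>\<^bsub>?I g\<^esub>) =
        (\<lambda>g\<in>G. \<lambda>r\<in>carrier (GHom \<Sigma> x y g). GFHom (FObj (pt_module K G) A) () () g (GFHom (augmentation K G X d) x y g r))"
        using eq[OF x] by (auto simp: fun_eq_iff simp del: split_paired_All)
      moreover have p: "pts (triv A) x = A" "pts (triv A) y = A" using x by simp_all
      ultimately show ?thesis
        using x unfolding to_gmod_def gftor.simps p
        by (simp add: eps_pullback_def restriction_def gftor_comp_def augmentation_def[of K G X d])
    next
      case False
      then show ?thesis by (auto simp: to_gmod_def eps_pullback_def restriction_def gftor_comp_def)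
    qed
    moreover have "GFObj (to_gmod (triv A)) = GFObj (FObj (eps_pullback K G X d) A)"
      by (simp add: to_gmod_def eps_pullback_def restriction_def gftor_comp_def pt_module_def Triv_def)
    ultimately show ?thesis by (intro gftor.equality) auto
  qed
  then show ?thesis
    by (simp add: ftor_eq_def) (simp add: eps_pullback_def restriction_def pt_module_def)
qed

end

section \<open>Enough projectives and injectives\<close>

text \<open>Summing (for \<open>Q = finite\<close>) or multiplying (for \<open>Q = (\<lambda>_. True)\<close>) over all \<open>i\<close> the
  modules induced and coinduced from a point \<open>i\<close>: the \<open>i\<close>-th component survives the step from
  \<open>y\<close> to \<open>z\<close> if \<open>\<beta> y z i\<close> and is killed otherwise.\<close>

definition masked_dmod ::
  "real set \<Rightarrow> 'x set \<Rightarrow> ('x \<Rightarrow> 'x \<Rightarrow> ennreal) \<Rightarrow> ('i set \<Rightarrow> bool) \<Rightarrow> ('x \<Rightarrow> 'i set) \<Rightarrow>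
   ('x \<Rightarrow> real \<Rightarrow> 'i \<Rightarrow> ('k, 'u) module) \<Rightarrow> ('x \<Rightarrow> 'x \<Rightarrow> 'i \<Rightarrow> bool) \<Rightarrow> ('x, 'k, 'i \<Rightarrow> 'u) dmod" where
  "masked_dmod G X d Q S N \<beta> = \<lparr>pts = (\<lambda>y\<in>X. \<lambda>g\<in>G. sum_module Q (S y) (N y g)),
     act = (\<lambda>y z. if y \<in> X \<and> z \<in> X \<and> d y z < \<infinity>
       then \<lambda>g\<in>G. \<lambda>u\<in>carrier (sum_module Q (S y) (N y g)). \<lambda>i\<in>S z.
         if i \<in> S y \<and> \<beta> y z i then u i else \<zero>\<^bsub>N z (g + enn2real (d y z)) i\<^esub>
       else undefined)\<rparr>"

context dist_setting
begin

lemma masked_pts: "\<lbrakk>y \<in> X; g \<in> G\<rbrakk> \<Longrightarrow> pts (masked_dmod G X d Q S N \<beta>) y g = sum_module Q (S y) (N y g)"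
  by (simp add: masked_dmod_def)

lemma masked_act: "\<lbrakk>y \<in> X; z \<in> X; d y z < \<infinity>; g \<in> G; u \<in> carrier (sum_module Q (S y) (N y g))\<rbrakk> \<Longrightarrow>
    act (masked_dmod G X d Q S N \<beta>) y z g u =
    (\<lambda>i\<in>S z. if i \<in> S y \<and> \<beta> y z i then u i else \<zero>\<^bsub>N z (g + \<delta> y z) i\<^esub>)"
  unfolding masked_dmod_def by simp

text \<open>\<open>compat\<close> keeps a surviving component in the same module although the degree
  changes. \<open>comp\<close> is the action law: surviving two steps means that the middle point
  lies between and that the direct step is survived.\<close>

lemma masked_dmod:
  assumes Q: "support_ideal Q"
    and N: "\<And>y g i. \<lbrakk>y \<in> X; g \<in> G; i \<in> S y\<rbrakk> \<Longrightarrow> Module.module K (N y g i)"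
    and compat: "\<And>y z g i. \<lbrakk>y \<in> X; z \<in> X; d y z < \<infinity>; g \<in> G; i \<in> S y; i \<in> S z; \<beta> y z i\<rbrakk> \<Longrightarrow> N z (g + \<delta> y z) i = N y g i"
    and refl: "\<And>y i. \<lbrakk>y \<in> X; i \<in> S y\<rbrakk> \<Longrightarrow> \<beta> y y i"
    and comp: "\<And>x y z i. \<lbrakk>x \<in> X; y \<in> X; z \<in> X; d x y < \<infinity>; d y z < \<infinity>; i \<in> S z\<rbrakk> \<Longrightarrow>
      (i \<in> S y \<and> \<beta> y z i) \<and> (i \<in> S x \<and> \<beta> x y i) \<longleftrightarrow> between d x y z \<and> i \<in> S x \<and> \<beta> x z i"
  shows "masked_dmod G X d Q S N \<beta> \<in> dmods"
proof -
  let ?M = "masked_dmod G X d Q S N \<beta>" and ?P = "\<lambda>y g. sum_module Q (S y) (N y g)"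
  have mP: "Module.module K (?P y g)" if "y \<in> X" "g \<in> G" for y g
    by (rule module_sum[OF K N Q]) (use that in auto)
  have cl: "(\<lambda>i\<in>S z. if i \<in> S y \<and> \<beta> y z i then u i else \<zero>\<^bsub>N z (g + \<delta> y z) i\<^esub>) \<in> carrier (?P z (g + \<delta> y z))"
    if *: "y \<in> X" "z \<in> X" "d y z < \<infinity>" "g \<in> G" and u: "u \<in> carrier (?P y g)" for y z g u
  proof -
    let ?v = "\<lambda>i\<in>S z. if i \<in> S y \<and> \<beta> y z i then u i else \<zero>\<^bsub>N z (g + \<delta> y z) i\<^esub>"
    have g': "g + \<delta> y z \<in> G" using * by (intro G_add dG)
    have "?v i \<in> carrier (N z (g + \<delta> y z) i)" if "i \<in> S z" for i
      using that * u moduleD(1)[OF N[OF *(2) g' that]] by (auto simp: compat PiE_iff)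
    moreover have "Q {i \<in> S z. ?v i \<noteq> \<zero>\<^bsub>N z (g + \<delta> y z) i\<^esub>}"
    proof -
      \<comment> \<open>A step creates no new nonzero entries, so the support stays in the
        ideal.\<close>
      have sub: "{i \<in> S z. ?v i \<noteq> \<zero>\<^bsub>N z (g + \<delta> y z) i\<^esub>} \<subseteq> {i \<in> S y. u i \<noteq> \<zero>\<^bsub>N y g i\<^esub>}"
        using * by (auto simp: compat split: if_splits)
      have "Q {i \<in> S y. u i \<noteq> \<zero>\<^bsub>N y g i\<^esub>}" using u by simp
      with sub show ?thesis using Q unfolding support_ideal_def by blast
    qed
    ultimately show ?thesis by simp
  qed
  show ?thesis
  proof (rule dist_modulesI)
    show "pts ?M \<in> X \<rightarrow>\<^sub>E graded_modules K G"
      unfolding masked_dmod_def by (auto intro!: graded_modulesI mP)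
  next
    fix y z assume x: "y \<in> X" "z \<in> X" "d y z < \<infinity>"
    have "(\<lambda>g\<in>G. \<lambda>u\<in>carrier (?P y g). \<lambda>i\<in>S z. if i \<in> S y \<and> \<beta> y z i then u i else \<zero>\<^bsub>N z (g + \<delta> y z) i\<^esub>)
      \<in> deg_maps K G (\<delta> y z) (pts ?M y) (pts ?M z)"
    proof (rule deg_mapsI)
      fix g assume g: "g \<in> G"
      have g': "g + \<delta> y z \<in> G" using x g by (intro G_add dG)
      note m = moduleD[OF N[OF x(2) g']]
      show "(\<lambda>u\<in>carrier (?P y g). \<lambda>i\<in>S z. if i \<in> S y \<and> \<beta> y z i then u i else \<zero>\<^bsub>N z (g + \<delta> y z) i\<^esub>)
        \<in> lin_maps K (pts ?M y g) (pts ?M z (g + \<delta> y z))"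
        unfolding masked_pts[OF x(1) g] masked_pts[OF x(2) g']
      proof (rule lin_mapsI[OF cl[OF x g] _ _ mP[OF x(1) g]])
        fix u v assume "u \<in> carrier (?P y g)" "v \<in> carrier (?P y g)"
        then show "(\<lambda>i\<in>S z. if i \<in> S y \<and> \<beta> y z i then (u \<oplus>\<^bsub>?P y g\<^esub> v) i else \<zero>\<^bsub>N z (g + \<delta> y z) i\<^esub>) =
          (\<lambda>i\<in>S z. if i \<in> S y \<and> \<beta> y z i then u i else \<zero>\<^bsub>N z (g + \<delta> y z) i\<^esub>) \<oplus>\<^bsub>?P z (g + \<delta> y z)\<^esub>
          (\<lambda>i\<in>S z. if i \<in> S y \<and> \<beta> y z i then v i else \<zero>\<^bsub>N z (g + \<delta> y z) i\<^esub>)"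
          using x g by (auto simp: fun_eq_iff m compat)
      next
        fix a u assume "a \<in> carrier K" "u \<in> carrier (?P y g)"
        then show "(\<lambda>i\<in>S z. if i \<in> S y \<and> \<beta> y z i then (a \<odot>\<^bsub>?P y g\<^esub> u) i else \<zero>\<^bsub>N z (g + \<delta> y z) i\<^esub>) =
          a \<odot>\<^bsub>?P z (g + \<delta> y z)\<^esub> (\<lambda>i\<in>S z. if i \<in> S y \<and> \<beta> y z i then u i else \<zero>\<^bsub>N z (g + \<delta> y z) i\<^esub>)"
          using x g by (auto simp: fun_eq_iff m compat)
      qed
    qed
    then show "act ?M y z \<in> deg_maps K G (\<delta> y z) (pts ?M y) (pts ?M z)"
      using x by (simp add: masked_dmod_def)
  next
    fix y g u assume *: "y \<in> X" "g \<in> G" "u \<in> carrier (pts ?M y g)"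
    then have u: "u \<in> carrier (?P y g)" by (simp add: masked_pts del: sum_module_simps)
    have "u \<in> extensional (S y)" using u by (simp add: PiE_iff)
    then have "(\<lambda>i\<in>S y. u i) = u" by (rule extensional_restrict)
    then show "act ?M y y g u = u"
      using * masked_act[where Q=Q and S=S and N=N and \<beta>=\<beta>, OF *(1,1) _ *(2) u] refl[OF *(1)] by (simp cong: restrict_cong)
  next
    fix x y z g u
    assume x: "x \<in> X" "y \<in> X" "z \<in> X" "d x y < \<infinity>" "d y z < \<infinity>" and g: "g \<in> G" and "u \<in> carrier (pts ?M x g)"
    then have u: "u \<in> carrier (?P x g)" by (simp add: masked_pts del: sum_module_simps)
    have g': "g + \<delta> x y \<in> G" "g + (\<delta> x y + \<delta> y z) \<in> G" using x g by (auto intro!: G_add dG)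
    note c = comp[OF x]
    have L: "act ?M y z (g + \<delta> x y) (act ?M x y g u) =
      (\<lambda>i\<in>S z. if between d x y z \<and> i \<in> S x \<and> \<beta> x z i then u i else \<zero>\<^bsub>N z (g + (\<delta> x y + \<delta> y z)) i\<^esub>)"
    proof -
      have "act ?M y z (g + \<delta> x y) (act ?M x y g u) =
        (\<lambda>i\<in>S z. if i \<in> S y \<and> \<beta> y z i then if i \<in> S x \<and> \<beta> x y i then u i else \<zero>\<^bsub>N y (g + \<delta> x y) i\<^esub>
          else \<zero>\<^bsub>N z (g + \<delta> x y + \<delta> y z) i\<^esub>)"
        unfolding masked_act[where N=N and S=S and Q=Q, OF x(1,2,4) g u]
          masked_act[where N=N and S=S and Q=Q, OF x(2,3,5) g'(1) cl[OF x(1,2,4) g u]]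
        by (auto simp: fun_eq_iff)
      also have "\<dots> = (\<lambda>i\<in>S z. if between d x y z \<and> i \<in> S x \<and> \<beta> x z i then u i else \<zero>\<^bsub>N z (g + (\<delta> x y + \<delta> y z)) i\<^esub>)"
      proof (rule restrict_ext)
        fix i assume i: "i \<in> S z"
        show "(if i \<in> S y \<and> \<beta> y z i then if i \<in> S x \<and> \<beta> x y i then u i else \<zero>\<^bsub>N y (g + \<delta> x y) i\<^esub>
            else \<zero>\<^bsub>N z (g + \<delta> x y + \<delta> y z) i\<^esub>) =
          (if between d x y z \<and> i \<in> S x \<and> \<beta> x z i then u i else \<zero>\<^bsub>N z (g + (\<delta> x y + \<delta> y z)) i\<^esub>)"
          using c[OF i] compat[OF x(2,3,5) g'(1) _ i] by (auto simp: add.assoc)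
      qed
      finally show ?thesis .
    qed
    show "act ?M y z (g + \<delta> x y) (act ?M x y g u) =
      (if between d x y z then act ?M x z g u else \<zero>\<^bsub>pts ?M z (g + (\<delta> x y + \<delta> y z))\<^esub>)"
    proof (cases "between d x y z")
      case True
      then have e: "\<delta> x y + \<delta> y z = \<delta> x z" using between_iff[OF x] by simp
      show ?thesis
        using True unfolding L e masked_act[where N=N and S=S and Q=Q, OF x(1,3) fin_trans[OF x] g u] by simp
    next
      case False
      then show ?thesis unfolding L masked_pts[OF x(3) g'(2)] by simp
    qed
  qed (auto simp: masked_dmod_def)
qed

subsection \<open>Induced modules\<close>

text \<open>At \<open>y\<close> these are formal sums of elements of \<open>F x\<close> carried
  along the arrow from \<open>x\<close> to \<open>y\<close>; the arrow raises degrees by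
  \<open>\<delta> x y\<close>, hence the shift. Moving on to \<open>z\<close> keeps a term if
  \<open>y\<close> lies between \<open>x\<close> and \<open>z\<close>. All points and degrees are
  induced at once.\<close>

abbreviation induced :: "('x \<Rightarrow> real \<Rightarrow> ('k, 'u) module) \<Rightarrow> ('x, 'k, 'x \<Rightarrow> 'u) dmod" where
  "induced F \<equiv> masked_dmod G X d finite (\<lambda>y. {x \<in> X. d x y < \<infinity>}) (\<lambda>y g x. F x (g - \<delta> x y)) (\<lambda>y z x. between d x y z)"

abbreviation induced_gen :: "('x \<Rightarrow> real \<Rightarrow> ('k, 'u) module) \<Rightarrow> 'x \<Rightarrow> real \<Rightarrow> 'x \<Rightarrow> 'u \<Rightarrow> 'x \<Rightarrow> 'u" where
  "induced_gen F y g \<equiv> dsingle {x \<in> X. d x y < \<infinity>} (\<lambda>x. F x (g - \<delta> x y))"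

context
  fixes F :: "'x \<Rightarrow> real \<Rightarrow> ('k, 'u) module"
  assumes F: "\<And>x g. x \<in> X \<Longrightarrow> g \<in> G \<Longrightarrow> Module.module K (F x g)"
begin

lemma induced_summand: "\<lbrakk>y \<in> X; g \<in> G; x \<in> {x \<in> X. d x y < \<infinity>}\<rbrakk> \<Longrightarrow> Module.module K (F x (g - \<delta> x y))"
  by (intro F G_diff dG) auto

text \<open>The action law is \<open>between_assoc\<close> for the base point together with the
  three points of the composition.\<close>

lemma induced_dmod: "induced F \<in> dmods"
proof (rule masked_dmod[OF support_ideal_finite induced_summand])
  fix y z g i assume *: "y \<in> X" "z \<in> X" "d y z < \<infinity>" "g \<in> G" "i \<in> {x \<in> X. d x y < \<infinity>}" "i \<in> {x \<in> X. d x z < \<infinity>}" "between d i y z"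
  then have "\<delta> i y + \<delta> y z = \<delta> i z" using between_iff[of i y z] by simp
  then have "g + \<delta> y z - \<delta> i z = g - \<delta> i y" by linarith
  then show "F i (g + \<delta> y z - \<delta> i z) = F i (g - \<delta> i y)" by (rule arg_cong)
next
  fix x y z i assume *: "x \<in> X" "y \<in> X" "z \<in> X" "d x y < \<infinity>" "d y z < \<infinity>" "i \<in> {x \<in> X. d x z < \<infinity>}"
  then show "(i \<in> {x \<in> X. d x y < \<infinity>} \<and> between d i y z) \<and> (i \<in> {xa \<in> X. d xa x < \<infinity>} \<and> between d i x y) \<longleftrightarrow>
    between d x y z \<and> i \<in> {xa \<in> X. d xa x < \<infinity>} \<and> between d i x z"
    using between_assoc[of i x y z] fin_trans[of i x y] by auto
qed auto

lemma induced_pts: "\<lbrakk>y \<in> X; g \<in> G\<rbrakk> \<Longrightarrow> pts (induced F) y g = sum_module finite {x \<in> X. d x y < \<infinity>} (\<lambda>x. F x (g - \<delta> x y))"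
  by (rule masked_pts)

lemma induced_act: "\<lbrakk>y \<in> X; z \<in> X; d y z < \<infinity>; g \<in> G; u \<in> carrier (pts (induced F) y g)\<rbrakk> \<Longrightarrow>
    act (induced F) y z g u = (\<lambda>x\<in>{x \<in> X. d x z < \<infinity>}.
      if x \<in> {x \<in> X. d x y < \<infinity>} \<and> between d x y z then u x else \<zero>\<^bsub>F x (g + \<delta> y z - \<delta> x z)\<^esub>)"
  by (rule masked_act) (simp_all only: induced_pts)

lemma induced_gen_closed:
  "\<lbrakk>y \<in> X; g \<in> G; x \<in> X; d x y < \<infinity>; k \<in> carrier (F x (g - \<delta> x y))\<rbrakk> \<Longrightarrow> induced_gen F y g x k \<in> carrier (pts (induced F) y g)"
  unfolding induced_pts by (rule dsingle_closed[where K=K]) (auto intro: induced_summand)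

lemma induced_gen_act:
  assumes y: "y \<in> X" "z \<in> X" "d y z < \<infinity>" "g \<in> G" and x: "x \<in> X" "d x y < \<infinity>" "k \<in> carrier (F x (g - \<delta> x y))"
  shows "act (induced F) y z g (induced_gen F y g x k) =
    (if between d x y z then induced_gen F z (g + \<delta> y z) x k else \<zero>\<^bsub>pts (induced F) z (g + \<delta> y z)\<^esub>)"
proof -
  have g': "g + \<delta> y z \<in> G" using y by (intro G_add dG)
  have e: "F i (g - \<delta> i y) = F i (g + \<delta> y z - \<delta> i z)" if "i \<in> X" "d i y < \<infinity>" "between d i y z" for i
  proof -
    have "\<delta> i y + \<delta> y z = \<delta> i z" using that y between_iff[of i y z] by simp
    then have "g - \<delta> i y = g + \<delta> y z - \<delta> i z" by linarith
    then show ?thesis by (rule arg_cong)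
  qed
  show ?thesis
    unfolding induced_act[OF y induced_gen_closed[OF y(1,4) x]] induced_pts[OF y(2) g']
    using x y fin_trans[of x y z] e by (auto simp: dsingle_def fun_eq_iff)
qed

text \<open>A term at \<open>y\<close> based at \<open>x\<close> is the action from \<open>x\<close>
  to \<open>y\<close> of a generator at \<open>x\<close>, so equivariance determines a morphism from
  its values at the base points.\<close>

lemma induced_ext:
  assumes A: "A \<in> dmods" and f: "f \<in> dhom (induced F) A" "f' \<in> dhom (induced F) A"
    and eq: "\<And>x g k. \<lbrakk>x \<in> X; g \<in> G; k \<in> carrier (F x g)\<rbrakk> \<Longrightarrow> f x g (induced_gen F x g x k) = f' x g (induced_gen F x g x k)"
  shows "f = f'"
proof (rule dhom_ext[OF f])
  fix y g u assume y: "y \<in> X" "g \<in> G"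
  have "f y g = f' y g"
  proof (rule sum_lin_maps_eq[OF induced_summand[OF y] pts_module[OF A y]
        dhom_lin[OF f(1) y, unfolded induced_pts[OF y]] dhom_lin[OF f(2) y, unfolded induced_pts[OF y]]])
    fix x k assume "x \<in> {x \<in> X. d x y < \<infinity>}" and k: "k \<in> carrier (F x (g - \<delta> x y))"
    then have x: "x \<in> X" "d x y < \<infinity>" by auto
    have h: "g - \<delta> x y \<in> G" using x y by (intro G_diff dG)
    have s: "induced_gen F x (g - \<delta> x y) x k \<in> carrier (pts (induced F) x (g - \<delta> x y))"
      using x h k by (intro induced_gen_closed) auto
    have "act (induced F) x y (g - \<delta> x y) (induced_gen F x (g - \<delta> x y) x k) = induced_gen F y g x k"
      using induced_gen_act[OF x(1) y(1) x(2) h x(1), of k] x y k by simp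
    then have key: "\<phi> y g (induced_gen F y g x k) = act A x y (g - \<delta> x y) (\<phi> x (g - \<delta> x y) (induced_gen F x (g - \<delta> x y) x k))"
      if "\<phi> \<in> dhom (induced F) A" for \<phi>
      using dhom_act[OF that x(1) y(1) x(2) h s] by simp
    then show "f y g (induced_gen F y g x k) = f' y g (induced_gen F y g x k)"
      by (simp only: key[OF f(1)] key[OF f(2)] eq[OF x(1) h k])
  qed
  then show "f y g u = f' y g u" by simp
qed

text \<open>Together with \<open>induced_ext\<close> this is the universal property of induction:
  linear maps on the \<open>F x g\<close> extend uniquely to a morphism.\<close>

lemma induced_map:
  assumes A: "A \<in> dmods" and a: "\<And>x g. x \<in> X \<Longrightarrow> g \<in> G \<Longrightarrow> a x g \<in> lin_maps K (F x g) (pts A x g)"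
  obtains f where "f \<in> dhom (induced F) A"
    "\<And>x g k. \<lbrakk>x \<in> X; g \<in> G; k \<in> carrier (F x g)\<rbrakk> \<Longrightarrow> f x g (induced_gen F x g x k) = a x g k"
proof -
  \<comment> \<open>Forced by equivariance: the term based at \<open>x\<close> goes to the action
    towards \<open>y\<close> of the value prescribed at \<open>x\<close>.\<close>
  define c where "c y g x = (\<lambda>k\<in>carrier (F x (g - \<delta> x y)). act A x y (g - \<delta> x y) (a x (g - \<delta> x y) k))" for y g x
  define f where "f y g = sum_map (pts A y g) {x \<in> X. d x y < \<infinity>} (\<lambda>x. F x (g - \<delta> x y)) (c y g)" for y g
  have c: "c y g x \<in> lin_maps K (F x (g - \<delta> x y)) (pts A y g)" if y: "y \<in> X" "g \<in> G" and x: "x \<in> {x \<in> X. d x y < \<infinity>}" for y g x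
  proof -
    have h: "g - \<delta> x y \<in> G" using x y by (intro G_diff dG) auto
    have "act A x y (g - \<delta> x y) \<in> lin_maps K (pts A x (g - \<delta> x y)) (pts A y g)"
      using act_lin[OF A, of x y "g - \<delta> x y"] x y h by simp
    then show ?thesis unfolding c_def using x h by (intro lin_maps_comp[OF a] F) auto
  qed
  have lin: "f y g \<in> lin_maps K (pts (induced F) y g) (pts A y g)" if y: "y \<in> X" "g \<in> G" for y g
    unfolding f_def induced_pts[OF y] by (rule sum_map_lin[OF induced_summand[OF y] pts_module[OF A y] c[OF y]])
  have single: "f y g (induced_gen F y g x k) = act A x y (g - \<delta> x y) (a x (g - \<delta> x y) k)"
    if y: "y \<in> X" "g \<in> G" and x: "x \<in> X" "d x y < \<infinity>" "k \<in> carrier (F x (g - \<delta> x y))" for y g x k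
  proof -
    have "f y g (induced_gen F y g x k) = c y g x k"
      unfolding f_def
      by (rule sum_map_single[where M="\<lambda>x. F x (g - \<delta> x y)", OF induced_summand[OF y] pts_module[OF A y] c[OF y]])
        (use x in auto)
    then show ?thesis using x by (simp add: c_def)
  qed
  \<comment> \<open>Both sides are linear in \<open>u\<close>; on a single term the equation becomes
    the composition rule of \<open>A\<close>.\<close>
  have eqv: "act A y z g (f y g u) = f z (g + \<delta> y z) (act (induced F) y z g u)"
    if y: "y \<in> X" "z \<in> X" "d y z < \<infinity>" "g \<in> G" and u: "u \<in> carrier (pts (induced F) y g)" for y z g u
  proof -
    have g': "g + \<delta> y z \<in> G" using y by (intro G_add dG)
    let ?L = "\<lambda>u\<in>carrier (pts (induced F) y g). act A y z g (f y g u)"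
    let ?R = "\<lambda>u\<in>carrier (pts (induced F) y g). f z (g + \<delta> y z) (act (induced F) y z g u)"
    note P = pts_module[OF induced_dmod y(1,4)]
    have L: "?L \<in> lin_maps K (sum_module finite {x \<in> X. d x y < \<infinity>} (\<lambda>x. F x (g - \<delta> x y))) (pts A z (g + \<delta> y z))"
      unfolding induced_pts[OF y(1,4), symmetric]
      by (rule lin_maps_comp[OF lin[OF y(1,4)] act_lin[OF A y] P])
    have R: "?R \<in> lin_maps K (sum_module finite {x \<in> X. d x y < \<infinity>} (\<lambda>x. F x (g - \<delta> x y))) (pts A z (g + \<delta> y z))"
      unfolding induced_pts[OF y(1,4), symmetric]
      by (rule lin_maps_comp[OF act_lin[OF induced_dmod y] lin[OF y(2) g'] P])
    have "?L = ?R"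
    proof (rule sum_lin_maps_eq[OF induced_summand[OF y(1,4)] pts_module[OF A y(2) g'] L R])
      fix x k assume "x \<in> {x \<in> X. d x y < \<infinity>}" and k: "k \<in> carrier (F x (g - \<delta> x y))"
      then have x: "x \<in> X" "d x y < \<infinity>" by auto
      have h: "g - \<delta> x y \<in> G" using x y by (intro G_diff dG)
      note s = induced_gen_closed[OF y(1,4) x k]
      note ak = lin_mapsD(1)[OF a[OF x(1) h] k]
      have "act A y z g (act A x y (g - \<delta> x y) (a x (g - \<delta> x y) k)) =
        (if between d x y z then act A x z (g - \<delta> x y) (a x (g - \<delta> x y) k) else \<zero>\<^bsub>pts A z (g + \<delta> y z)\<^esub>)"
        using act_act[OF A x(1) y(1,2) x(2) y(3) h ak] by (simp add: add.assoc)
      also have "\<dots> = f z (g + \<delta> y z) (act (induced F) y z g (induced_gen F y g x k))"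
      proof (cases "between d x y z")
        case True
        have "\<delta> x z = \<delta> x y + \<delta> y z" using True between_iff[OF x(1) y(1,2) x(2) y(3)] by simp
        then have e: "g + \<delta> y z - \<delta> x z = g - \<delta> x y" by simp
        show ?thesis
          using True single[OF y(2) g' x(1) fin_trans[OF x(1) y(1,2) x(2) y(3)], of k] k
          by (simp add: induced_gen_act[OF y x k] e)
      next
        case False
        then show ?thesis
          using lin_maps_zero[OF lin[OF y(2) g'] pts_module[OF induced_dmod y(2) g'] pts_module[OF A y(2) g']]
          by (simp add: induced_gen_act[OF y x k])
      qed
      finally show "?L (induced_gen F y g x k) = ?R (induced_gen F y g x k)"
        unfolding restrict_apply'[OF s] single[OF y(1,4) x k] .
    qed
    from fun_cong[OF this, of u] show ?thesis unfolding restrict_apply'[OF u] .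
  qed
  show ?thesis
  proof (rule that)
    show "(\<lambda>y\<in>X. \<lambda>g\<in>G. f y g) \<in> dhom (induced F) A"
      by (rule dhomI[where N=A and f=f, OF induced_dmod lin eqv])
    fix x g k assume x: "x \<in> X" and g: "g \<in> G" and k: "k \<in> carrier (F x g)"
    then show "(\<lambda>y\<in>X. \<lambda>g\<in>G. f y g) x g (induced_gen F x g x k) = a x g k"
      using single[OF x g x, of k] lin_mapsD(1)[OF a[OF x g] k] by (simp add: act_refl[OF A])
  qed
qed

end

subsection \<open>Coinduced modules\<close>

text \<open>The component at \<open>x\<close> of an element at \<open>y\<close> records what is seen
  after moving to \<open>x\<close>, hence the degree raised by \<open>\<delta> y x\<close>. Moving
  to \<open>z\<close> keeps this component if \<open>z\<close> lies between \<open>y\<close> and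
  \<open>x\<close>.\<close>

abbreviation coind :: "('x \<Rightarrow> real \<Rightarrow> ('k, 'u) module) \<Rightarrow> ('x, 'k, 'x \<Rightarrow> 'u) dmod" where
  "coind J \<equiv> masked_dmod G X d (\<lambda>_. True) (\<lambda>y. {x \<in> X. d y x < \<infinity>}) (\<lambda>y g x. J x (g + \<delta> y x)) (\<lambda>y z x. between d y z x)"

context
  fixes J :: "'x \<Rightarrow> real \<Rightarrow> ('k, 'u) module"
  assumes J: "\<And>x g. x \<in> X \<Longrightarrow> g \<in> G \<Longrightarrow> Module.module K (J x g)"
begin

lemma coind_factor: "\<lbrakk>y \<in> X; g \<in> G; x \<in> {x \<in> X. d y x < \<infinity>}\<rbrakk> \<Longrightarrow> Module.module K (J x (g + \<delta> y x))"
  by (intro J G_add dG) auto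

lemma coind_degree:
  "\<lbrakk>y \<in> X; z \<in> X; x \<in> X; d y z < \<infinity>; d z x < \<infinity>; between d y z x\<rbrakk> \<Longrightarrow> g + \<delta> y z + \<delta> z x = g + \<delta> y x"
  using between_iff[of y z x] by simp

lemma coind_dmod: "coind J \<in> dmods"
proof (rule masked_dmod[OF support_ideal_True coind_factor])
  fix y z g i assume *: "y \<in> X" "z \<in> X" "d y z < \<infinity>" "g \<in> G" "i \<in> {x \<in> X. d y x < \<infinity>}" "i \<in> {x \<in> X. d z x < \<infinity>}" "between d y z i"
  then have "g + \<delta> y z + \<delta> z i = g + \<delta> y i" by (intro coind_degree) auto
  then show "J i (g + \<delta> y z + \<delta> z i) = J i (g + \<delta> y i)" by (rule arg_cong)
next
  fix x y z i assume *: "x \<in> X" "y \<in> X" "z \<in> X" "d x y < \<infinity>" "d y z < \<infinity>" "i \<in> {x \<in> X. d z x < \<infinity>}"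
  then show "(i \<in> {x \<in> X. d y x < \<infinity>} \<and> between d y z i) \<and> (i \<in> {xa \<in> X. d x xa < \<infinity>} \<and> between d x y i) \<longleftrightarrow>
    between d x y z \<and> i \<in> {xa \<in> X. d x xa < \<infinity>} \<and> between d x z i"
    using between_assoc[of x y z i] fin_trans[of y z i] by auto
qed auto

lemma coind_pts: "\<lbrakk>y \<in> X; g \<in> G\<rbrakk> \<Longrightarrow> pts (coind J) y g = sum_module (\<lambda>_. True) {x \<in> X. d y x < \<infinity>} (\<lambda>x. J x (g + \<delta> y x))"
  by (rule masked_pts)

lemma coind_act: "\<lbrakk>y \<in> X; z \<in> X; d y z < \<infinity>; g \<in> G; u \<in> carrier (pts (coind J) y g)\<rbrakk> \<Longrightarrow>
    act (coind J) y z g u = (\<lambda>x\<in>{x \<in> X. d z x < \<infinity>}.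
      if x \<in> {x \<in> X. d y x < \<infinity>} \<and> between d y z x then u x else \<zero>\<^bsub>J x (g + \<delta> y z + \<delta> z x)\<^esub>)"
  by (rule masked_act) (simp_all only: coind_pts)

lemma coind_carrier:
  "\<lbrakk>y \<in> X; g \<in> G\<rbrakk> \<Longrightarrow> carrier (pts (coind J) y g) = (\<Pi>\<^sub>E x\<in>{x \<in> X. d y x < \<infinity>}. carrier (J x (g + \<delta> y x)))"
  by (simp add: masked_pts)

text \<open>The counit of coinduction reads off the component based at the point itself, where the
  degree shift is zero.\<close>

lemma coind_counit_lin:
  assumes x: "x \<in> X" "g \<in> G"
  shows "(\<lambda>u\<in>carrier (pts (coind J) x g). u x) \<in> lin_maps K (pts (coind J) x g) (J x g)"
proof (rule lin_mapsI[OF _ _ _ pts_module[OF coind_dmod x]])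
  fix u assume "u \<in> carrier (pts (coind J) x g)"
  then have "u x \<in> carrier (J x (g + \<delta> x x))" unfolding coind_carrier[OF x] by (rule PiE_mem) (simp add: x)
  then show "u x \<in> carrier (J x g)" using x by simp
qed (simp_all add: coind_pts[OF x] x)

text \<open>Equivariance along the arrow from \<open>y\<close> to \<open>x\<close>, which preserves
  the component \<open>x\<close>: all components are determined by the counit.\<close>

lemma coind_apply:
  assumes f: "f \<in> dhom A (coind J)" and y: "y \<in> X" "g \<in> G" "n \<in> carrier (pts A y g)" and x: "x \<in> X" "d y x < \<infinity>"
  shows "f y g n x = f x (g + \<delta> y x) (act A y x g n) x"
proof -
  have s: "f y g n \<in> carrier (pts (coind J) y g)" by (rule dhomD(1)[OF f y])
  have "act (coind J) y x g (f y g n) x = f y g n x"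
    unfolding coind_act[OF y(1) x y(2) s] using x y by simp
  then show ?thesis using dhom_act[OF f y(1) x y(2,3)] by simp
qed

lemma coind_ext:
  assumes f: "f \<in> dhom A (coind J)" "f' \<in> dhom A (coind J)" and A: "A \<in> dmods"
    and eq: "\<And>x g n. \<lbrakk>x \<in> X; g \<in> G; n \<in> carrier (pts A x g)\<rbrakk> \<Longrightarrow> f x g n x = f' x g n x"
  shows "f = f'"
proof (rule dhom_ext[OF f])
  fix y g n assume y: "y \<in> X" "g \<in> G" "n \<in> carrier (pts A y g)"
  show "f y g n = f' y g n"
  proof (rule PiE_ext[of _ "{x \<in> X. d y x < \<infinity>}" "\<lambda>x. carrier (J x (g + \<delta> y x))"])
    show "f y g n \<in> (\<Pi>\<^sub>E x\<in>{x \<in> X. d y x < \<infinity>}. carrier (J x (g + \<delta> y x)))"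
      "f' y g n \<in> (\<Pi>\<^sub>E x\<in>{x \<in> X. d y x < \<infinity>}. carrier (J x (g + \<delta> y x)))"
      using dhomD(1)[OF f(1) y] dhomD(1)[OF f(2) y] unfolding coind_carrier[OF y(1,2)] by auto
    fix x assume "x \<in> {x \<in> X. d y x < \<infinity>}"
    then have x: "x \<in> X" "d y x < \<infinity>" by auto
    have "g + \<delta> y x \<in> G" using x y by (intro G_add dG)
    from eq[OF x(1) this actD(1)[OF A y(1) x y(2,3)]]
    show "f y g n x = f' y g n x"
      unfolding coind_apply[OF f(1) y x] coind_apply[OF f(2) y x] .
  qed
qed

text \<open>By \<open>coind_apply\<close> the component at \<open>x\<close> has to be
  \<open>a\<close> applied after acting towards \<open>x\<close>. With \<open>coind_ext\<close> this
  is the universal property of coinduction.\<close>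

lemma coind_map:
  assumes A: "A \<in> dmods" and a: "\<And>x g. x \<in> X \<Longrightarrow> g \<in> G \<Longrightarrow> a x g \<in> lin_maps K (pts A x g) (J x g)"
  obtains f where "f \<in> dhom A (coind J)"
    "\<And>x g n. \<lbrakk>x \<in> X; g \<in> G; n \<in> carrier (pts A x g)\<rbrakk> \<Longrightarrow> f x g n x = a x g n"
proof -
  define f where "f y g = (\<lambda>n\<in>carrier (pts A y g). \<lambda>x\<in>{x \<in> X. d y x < \<infinity>}. a x (g + \<delta> y x) (act A y x g n))" for y g
  have lin: "f y g \<in> lin_maps K (pts A y g) (pts (coind J) y g)" if y: "y \<in> X" "g \<in> G" for y g
    unfolding f_def coind_pts[OF y]
  proof (rule lin_mapsI[OF _ _ _ pts_module[OF A y]])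
    have g': "g + \<delta> y x \<in> G" if "x \<in> X" "d y x < \<infinity>" for x using that y by (intro G_add dG)
    fix n assume n: "n \<in> carrier (pts A y g)"
    show "(\<lambda>x\<in>{x \<in> X. d y x < \<infinity>}. a x (g + \<delta> y x) (act A y x g n)) \<in>
      carrier (sum_module (\<lambda>_. True) {x \<in> X. d y x < \<infinity>} (\<lambda>x. J x (g + \<delta> y x)))"
      using y n g' by (auto simp: actD[OF A] intro!: lin_mapsD(1)[OF a])
    show "(\<lambda>x\<in>{x \<in> X. d y x < \<infinity>}. a x (g + \<delta> y x) (act A y x g (k \<odot>\<^bsub>pts A y g\<^esub> n))) =
      k \<odot>\<^bsub>sum_module (\<lambda>_. True) {x \<in> X. d y x < \<infinity>} (\<lambda>x. J x (g + \<delta> y x))\<^esub>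
      (\<lambda>x\<in>{x \<in> X. d y x < \<infinity>}. a x (g + \<delta> y x) (act A y x g n))" if "k \<in> carrier K" for k
      using y n g' that by (auto simp: fun_eq_iff actD[OF A] lin_mapsD[OF a])
    fix m assume m: "m \<in> carrier (pts A y g)"
    show "(\<lambda>x\<in>{x \<in> X. d y x < \<infinity>}. a x (g + \<delta> y x) (act A y x g (n \<oplus>\<^bsub>pts A y g\<^esub> m))) =
      (\<lambda>x\<in>{x \<in> X. d y x < \<infinity>}. a x (g + \<delta> y x) (act A y x g n))
      \<oplus>\<^bsub>sum_module (\<lambda>_. True) {x \<in> X. d y x < \<infinity>} (\<lambda>x. J x (g + \<delta> y x))\<^esub>
      (\<lambda>x\<in>{x \<in> X. d y x < \<infinity>}. a x (g + \<delta> y x) (act A y x g m))"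
      using y n g' m by (auto simp: fun_eq_iff actD[OF A] lin_mapsD[OF a])
  qed
  show ?thesis
  proof (rule that)
    show "(\<lambda>y\<in>X. \<lambda>g\<in>G. f y g) \<in> dhom A (coind J)"
    proof (rule dhomI[OF A lin])
      fix y z g n assume y: "y \<in> X" "z \<in> X" "d y z < \<infinity>" "g \<in> G" and n: "n \<in> carrier (pts A y g)"
      have g': "g + \<delta> y z \<in> G" using y by (intro G_add dG)
      have s: "f y g n \<in> carrier (pts (coind J) y g)" by (rule lin_mapsD(1)[OF lin[OF y(1,4)] n])
      show "act (coind J) y z g (f y g n) = f z (g + \<delta> y z) (act A y z g n)"
        unfolding coind_act[OF y s] f_def[of z] restrict_apply'[OF actD(1)[OF A y n]]
      proof (rule restrict_ext)
        fix x assume "x \<in> {x \<in> X. d z x < \<infinity>}"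
        then have x: "x \<in> X" "d z x < \<infinity>" by auto
        note yx = fin_trans[OF y(1,2) x(1) y(3) x(2)]
        have gx: "g + \<delta> y z + \<delta> z x \<in> G" using g' x y by (intro G_add dG)
        have "a x (g + \<delta> y z + \<delta> z x) (act A z x (g + \<delta> y z) (act A y z g n)) =
          (if between d y z x then a x (g + \<delta> y x) (act A y x g n) else \<zero>\<^bsub>J x (g + \<delta> y z + \<delta> z x)\<^esub>)"
          using act_act[OF A y(1,2) x(1) y(3) x(2) y(4) n] coind_degree[OF y(1,2) x(1) y(3) x(2), of g]
            lin_maps_zero[OF a[OF x(1) gx] pts_module[OF A x(1) gx] J[OF x(1) gx]]
          by (simp add: add.assoc)
        then show "(if x \<in> {x \<in> X. d y x < \<infinity>} \<and> between d y z x then f y g n x else \<zero>\<^bsub>J x (g + \<delta> y z + \<delta> z x)\<^esub>) =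
          a x (g + \<delta> y z + \<delta> z x) (act A z x (g + \<delta> y z) (act A y z g n))"
          using x yx n by (simp add: f_def)
      qed
    qed
    fix x g n assume "x \<in> X" "g \<in> G" "n \<in> carrier (pts A x g)"
    then show "(\<lambda>y\<in>X. \<lambda>g\<in>G. f y g) x g n x = a x g n"
      by (simp add: f_def act_refl[OF A])
  qed
qed

end

end

section \<open>Projective and injective distance modules from those over \<open>K\<close>\<close>

context dist_universe
begin

text \<open>Epimorphisms are surjective pointwise and maps out of an induced module are given freely
  at the base points, so a lifting problem splits into lifting problems over \<open>K\<close>, one
  for each point and degree.\<close>

lemma DistMod_enough_projectives: "enough_projectives (DistMod K G X d :: (('x, 'k, 'u) dmod, 'x \<Rightarrow> real \<Rightarrow> 'u \<Rightarrow> 'u) cat)"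
  unfolding enough_projectives_def
proof
  fix M :: "('x, 'k, 'u) dmod" assume "M \<in> Obj (DistMod K G X d)"
  then have M: "M \<in> dmods" by simp
  \<comment> \<open>\<open>R\<close> here and \<open>S\<close> below bundle the conditions, so that
    one use of choice supplies the data for all points and degrees.\<close>
  define R where "R x g P e \<longleftrightarrow> Module.module K P \<and> projective_mod K P TYPE('u) \<and>
    e \<in> lin_maps K P (pts M x g) \<and> e ` carrier P = carrier (pts M x g)" for x g and P :: "('k, 'u) module" and e
  have "\<exists>P e. R x g P e" if "x \<in> X" "g \<in> G" for x g
    unfolding R_def by (rule enough_projective_modules[OF pts_module[OF M that]]) blast
  then obtain F s where R: "\<And>x g. x \<in> X \<Longrightarrow> g \<in> G \<Longrightarrow> R x g (F x g) (s x g)" by metis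
  have F: "\<And>x g. x \<in> X \<Longrightarrow> g \<in> G \<Longrightarrow> Module.module K (F x g)"
    and proj: "\<And>x g. x \<in> X \<Longrightarrow> g \<in> G \<Longrightarrow> projective_mod K (F x g) TYPE('u)"
    and s: "\<And>x g. x \<in> X \<Longrightarrow> g \<in> G \<Longrightarrow> s x g \<in> lin_maps K (F x g) (pts M x g)"
      "\<And>x g. x \<in> X \<Longrightarrow> g \<in> G \<Longrightarrow> s x g ` carrier (F x g) = carrier (pts M x g)"
    using R unfolding R_def by simp_all
  have I: "induced F \<in> dmods" by (rule induced_dmod) (fact F)
  have gen: "induced_gen F x g x k \<in> carrier (pts (induced F) x g)" if "x \<in> X" "g \<in> G" "k \<in> carrier (F x g)" for x g k
    by (rule induced_gen_closed[OF F]) (use that in auto)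
  have gen_lin: "(\<lambda>k\<in>carrier (F x g). f x g (induced_gen F x g x k)) \<in> lin_maps K (F x g) (pts B x g)"
    if f: "f \<in> dhom (induced F) B" and x: "x \<in> X" "g \<in> G" for B :: "('x, 'k, 'u) dmod" and f x g
  proof -
    have "(\<lambda>k\<in>carrier (F x (g - \<delta> x x)). induced_gen F x g x k) \<in>
      lin_maps K (F x (g - \<delta> x x)) (sum_module finite {y \<in> X. d y x < \<infinity>} (\<lambda>y. F y (g - \<delta> y x)))"
      by (rule dsingle_lin[where M="\<lambda>y. F y (g - \<delta> y x)"]) (auto intro: induced_summand[OF F] x simp: x)
    then have "(\<lambda>k\<in>carrier (F x g). induced_gen F x g x k) \<in> lin_maps K (F x g) (pts (induced F) x g)"
      using x by (simp add: masked_pts)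
    from lin_maps_comp[OF this dhom_lin[OF f x] F[OF x]] show ?thesis by (simp cong: restrict_cong)
  qed
  obtain P :: "('x, 'k, 'u) dmod" and p q where P: "P \<in> dmods" and p: "p \<in> dhom (induced F) P" and q: "q \<in> dhom P (induced F)"
    and qp: "\<And>x g m. \<lbrakk>x \<in> X; g \<in> G; m \<in> carrier (pts (induced F) x g)\<rbrakk> \<Longrightarrow> q x g (p x g m) = m"
    and pq: "\<And>x g n. \<lbrakk>x \<in> X; g \<in> G; n \<in> carrier (pts P x g)\<rbrakk> \<Longrightarrow> p x g (q x g n) = n"
    by (rule dmod_copy[OF I embeds_subset[OF embeds_x subset_UNIV]])
      (rule that, assumption, assumption, assumption, simp_all)
  obtain e where e: "e \<in> dhom (induced F) M"
    "\<And>x g k. \<lbrakk>x \<in> X; g \<in> G; k \<in> carrier (F x g)\<rbrakk> \<Longrightarrow> e x g (induced_gen F x g x k) = s x g k"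
    by (rule induced_map[where F=F and A=M and a=s]) (rule F, assumption, assumption, rule M, rule s(1), assumption, assumption, rule that, assumption, simp_all)
  have "epi_arr (DistMod K G X d) P M (cmp P e q)"
  proof (rule epi_arrI[OF dhom_cmp[OF P q e(1)] P])
    fix x g assume x: "x \<in> X" "g \<in> G"
    show "cmp P e q x g ` carrier (pts P x g) = carrier (pts M x g)"
    proof (rule subset_antisym; rule subsetI)
      fix m assume "m \<in> carrier (pts M x g)"
      then obtain k where k: "k \<in> carrier (F x g)" "m = s x g k" using s(2)[OF x] by auto
      \<comment> \<open>A preimage is found already among the generators based at
        \<open>x\<close>.\<close>
      have "m = cmp P e q x g (p x g (induced_gen F x g x k))"
        using x k by (simp add: cmp_apply dhomD(1)[OF p] gen qp e(2))
      then show "m \<in> cmp P e q x g ` carrier (pts P x g)"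
        using dhomD(1)[OF p x gen[OF x k(1)]] by (rule image_eqI)
    qed (auto intro: dhomD(1)[OF dhom_cmp[OF P q e(1)] x])
  qed
  moreover have "projective_obj (DistMod K G X d) P"
    unfolding projective_obj_def DistMod_simps
  proof (intro conjI ballI allI impI P, elim conjE)
    fix A B :: "('x, 'k, 'u) dmod" and e f
    assume A: "A \<in> dmods" and B: "B \<in> dmods" and epi: "epi_arr (DistMod K G X d) A B e" and f: "f \<in> dhom P B"
    have e: "e \<in> dhom A B" using epi by (simp add: epi_arr_def)
    note fp = dhom_cmp[OF I p f]
    define S where "S x g a \<longleftrightarrow> a \<in> lin_maps K (F x g) (pts A x g) \<and>
      (\<forall>k\<in>carrier (F x g). e x g (a k) = cmp (induced F) f p x g (induced_gen F x g x k))" for x g a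
    have "\<exists>a. S x g a"
      if x: "x \<in> X" "g \<in> G" for x g
    proof -
      have "\<exists>a\<in>lin_maps K (F x g) (pts A x g). \<forall>k\<in>carrier (F x g). e x g (a k) =
        (\<lambda>k\<in>carrier (F x g). cmp (induced F) f p x g (induced_gen F x g x k)) k"
        using proj[OF x] pts_module[OF A x] pts_module[OF B x] dhom_lin[OF e x] epi_surjective[OF epi A B x] gen_lin[OF fp x]
        unfolding projective_mod_def by blast
      then show ?thesis unfolding S_def by auto
    qed
    then obtain a where S: "\<And>x g. x \<in> X \<Longrightarrow> g \<in> G \<Longrightarrow> S x g (a x g)" by metis
    have a: "\<And>x g. x \<in> X \<Longrightarrow> g \<in> G \<Longrightarrow> a x g \<in> lin_maps K (F x g) (pts A x g)"
      "\<And>x g k. \<lbrakk>x \<in> X; g \<in> G; k \<in> carrier (F x g)\<rbrakk> \<Longrightarrow> e x g (a x g k) = cmp (induced F) f p x g (induced_gen F x g x k)"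
      using S unfolding S_def by simp_all
    obtain h where h: "h \<in> dhom (induced F) A"
      "\<And>x g k. \<lbrakk>x \<in> X; g \<in> G; k \<in> carrier (F x g)\<rbrakk> \<Longrightarrow> h x g (induced_gen F x g x k) = a x g k"
      by (rule induced_map[where F=F and A=A and a=a])
        (rule F, assumption, assumption, rule A, rule a(1), assumption, assumption, rule that, assumption, simp_all)
    \<comment> \<open>Agreement on generators suffices. This solves the lifting problem on the
      original induced module; \<open>p\<close> and \<open>q\<close> then carry the solution to the
      copy.\<close>
    have eh: "cmp (induced F) e h = cmp (induced F) f p"
    proof (rule induced_ext[OF _ B dhom_cmp[OF I h(1) e] fp])
      show "cmp (induced F) e h x g (induced_gen F x g x k) = cmp (induced F) f p x g (induced_gen F x g x k)"
        if x: "x \<in> X" "g \<in> G" "k \<in> carrier (F x g)" for x g k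
        unfolding cmp_apply[where M="induced F" and \<psi>=e, OF x(1,2) gen[OF x]] h(2)[OF x] by (rule a(2)[OF x])
    qed (rule F)
    show "\<exists>h\<in>dhom P A. cmp P e h = f"
    proof (rule bexI[of _ "cmp P h q"], rule dhom_ext[OF dhom_cmp[OF P _ e] f])
      show "cmp P h q \<in> dhom P A" "cmp P h q \<in> dhom P A" by (rule dhom_cmp[OF P q h(1)])+
      fix x g n assume x: "x \<in> X" "g \<in> G" "n \<in> carrier (pts P x g)"
      note qn = dhomD(1)[OF q x]
      have "e x g (h x g (q x g n)) = f x g (p x g (q x g n))"
        using fun_cong[OF fun_cong[OF fun_cong[OF eh, of x], of g], of "q x g n"]
        by (simp only: cmp_apply[where M="induced F", OF x(1,2) qn])
      then show "cmp P e (cmp P h q) x g n = f x g n"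
        using x by (simp add: cmp_apply pq)
    qed
  qed
  ultimately show "\<exists>P e. projective_obj (DistMod K G X d) P \<and> epi_arr (DistMod K G X d) P M e" by blast
qed

text \<open>Dually, monomorphisms are injective pointwise and maps into a coinduced module are given
  freely by their components at the base points, so an extension problem splits into problems over
  \<open>K\<close>.\<close>

lemma DistMod_enough_injectives: "enough_injectives (DistMod K G X d :: (('x, 'k, 'u) dmod, 'x \<Rightarrow> real \<Rightarrow> 'u \<Rightarrow> 'u) cat)"
  unfolding enough_injectives_def
proof
  fix M :: "('x, 'k, 'u) dmod" assume "M \<in> Obj (DistMod K G X d)"
  then have M: "M \<in> dmods" by simp
  define R where "R x g P i \<longleftrightarrow> Module.module K P \<and> injective_mod K P TYPE('u) \<and>
    i \<in> lin_maps K (pts M x g) P \<and> inj_on i (carrier (pts M x g))" for x g and P :: "('k, 'u) module" and i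
  have "\<exists>P i. R x g P i" if "x \<in> X" "g \<in> G" for x g
    unfolding R_def by (rule enough_injective_modules[OF pts_module[OF M that]]) blast
  then obtain J s where R: "\<And>x g. x \<in> X \<Longrightarrow> g \<in> G \<Longrightarrow> R x g (J x g) (s x g)" by metis
  have J: "\<And>x g. x \<in> X \<Longrightarrow> g \<in> G \<Longrightarrow> Module.module K (J x g)"
    and inj: "\<And>x g. x \<in> X \<Longrightarrow> g \<in> G \<Longrightarrow> injective_mod K (J x g) TYPE('u)"
    and s: "\<And>x g. x \<in> X \<Longrightarrow> g \<in> G \<Longrightarrow> s x g \<in> lin_maps K (pts M x g) (J x g)"
      "\<And>x g. x \<in> X \<Longrightarrow> g \<in> G \<Longrightarrow> inj_on (s x g) (carrier (pts M x g))"
    using R unfolding R_def by simp_all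
  have I: "coind J \<in> dmods" by (rule coind_dmod) (fact J)
  obtain P :: "('x, 'k, 'u) dmod" and p q where P: "P \<in> dmods" and p: "p \<in> dhom (coind J) P" and q: "q \<in> dhom P (coind J)"
    and qp: "\<And>x g m. \<lbrakk>x \<in> X; g \<in> G; m \<in> carrier (pts (coind J) x g)\<rbrakk> \<Longrightarrow> q x g (p x g m) = m"
    and pq: "\<And>x g n. \<lbrakk>x \<in> X; g \<in> G; n \<in> carrier (pts P x g)\<rbrakk> \<Longrightarrow> p x g (q x g n) = n"
    by (rule dmod_copy[OF I embeds_subset[OF embeds_x subset_UNIV]])
      (rule that, assumption, assumption, assumption, simp_all)
  obtain i where i: "i \<in> dhom M (coind J)"
    "\<And>x g n. \<lbrakk>x \<in> X; g \<in> G; n \<in> carrier (pts M x g)\<rbrakk> \<Longrightarrow> i x g n x = s x g n"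
    by (rule coind_map[where J=J and A=M and a=s]) (rule J, assumption, assumption, rule M, rule s(1), assumption, assumption, rule that, assumption, simp_all)
  have counit: "(\<lambda>u\<in>carrier (pts (coind J) x g). u x) \<in> lin_maps K (pts (coind J) x g) (J x g)" if "x \<in> X" "g \<in> G" for x g
    by (rule coind_counit_lin) (use J that in auto)
  have "mono_arr (DistMod K G X d) M P (cmp M p i)"
  proof (rule mono_arrI[OF dhom_cmp[OF M i(1) p] M])
    fix x g assume x: "x \<in> X" "g \<in> G"
    show "inj_on (cmp M p i x g) (carrier (pts M x g))"
    proof (rule inj_onI)
      fix m n assume m: "m \<in> carrier (pts M x g)" and n: "n \<in> carrier (pts M x g)" and "cmp M p i x g m = cmp M p i x g n"
      then have "p x g (i x g m) = p x g (i x g n)" using x by (simp add: cmp_apply)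
      then have "q x g (p x g (i x g m)) = q x g (p x g (i x g n))" by (rule arg_cong)
      then have "i x g m = i x g n" unfolding qp[OF x dhomD(1)[OF i(1) x m]] qp[OF x dhomD(1)[OF i(1) x n]] .
      \<comment> \<open>The component based at \<open>x\<close> alone separates elements, since
        \<open>s x g\<close> is injective.\<close>
      then have "s x g m = s x g n" using i(2)[OF x m] i(2)[OF x n] by simp
      then show "m = n" using inj_onD[OF s(2)[OF x]] m n by blast
    qed
  qed
  moreover have "injective_obj (DistMod K G X d) P"
    unfolding injective_obj_def DistMod_simps
  proof (intro conjI ballI allI impI P, elim conjE)
    fix A B :: "('x, 'k, 'u) dmod" and i f
    assume A: "A \<in> dmods" and B: "B \<in> dmods" and mono: "mono_arr (DistMod K G X d) A B i" and f: "f \<in> dhom A P"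
    have i: "i \<in> dhom A B" using mono by (simp add: mono_arr_def)
    note qf = dhom_cmp[OF A f q]
    have qc: "cmp A q f x g n x \<in> carrier (J x g)" if x: "x \<in> X" "g \<in> G" "n \<in> carrier (pts A x g)" for x g n
      using lin_mapsD(1)[OF counit[OF x(1,2)] dhomD(1)[OF qf x]] dhomD(1)[OF qf x] by simp
    define S where "S x g a \<longleftrightarrow> a \<in> lin_maps K (pts B x g) (J x g) \<and>
      (\<forall>n\<in>carrier (pts A x g). a (i x g n) = cmp A q f x g n x)" for x g a
    have "\<exists>a. S x g a"
      if x: "x \<in> X" "g \<in> G" for x g
    proof -
      from lin_maps_comp[OF dhom_lin[OF qf x] counit[OF x] pts_module[OF A x]]
      have "(\<lambda>n\<in>carrier (pts A x g). cmp A q f x g n x) \<in> lin_maps K (pts A x g) (J x g)"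
        using dhomD(1)[OF qf x] by (simp cong: restrict_cong)
      then have "\<exists>a\<in>lin_maps K (pts B x g) (J x g). \<forall>n\<in>carrier (pts A x g). a (i x g n) =
        (\<lambda>n\<in>carrier (pts A x g). cmp A q f x g n x) n"
        using inj[OF x] pts_module[OF A x] pts_module[OF B x] dhom_lin[OF i x] mono_injective[OF mono A B x]
        unfolding injective_mod_def by blast
      then show ?thesis unfolding S_def by auto
    qed
    then obtain a where S: "\<And>x g. x \<in> X \<Longrightarrow> g \<in> G \<Longrightarrow> S x g (a x g)" by metis
    have a: "\<And>x g. x \<in> X \<Longrightarrow> g \<in> G \<Longrightarrow> a x g \<in> lin_maps K (pts B x g) (J x g)"
      "\<And>x g n. \<lbrakk>x \<in> X; g \<in> G; n \<in> carrier (pts A x g)\<rbrakk> \<Longrightarrow> a x g (i x g n) = cmp A q f x g n x"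
      using S unfolding S_def by simp_all
    obtain h where h: "h \<in> dhom B (coind J)"
      "\<And>x g n. \<lbrakk>x \<in> X; g \<in> G; n \<in> carrier (pts B x g)\<rbrakk> \<Longrightarrow> h x g n x = a x g n"
      by (rule coind_map[where J=J and A=B and a=a])
        (rule J, assumption, assumption, rule B, rule a(1), assumption, assumption, rule that, assumption, simp_all)
    have hi: "cmp A h i = cmp A q f"
    proof (rule coind_ext[OF _ dhom_cmp[OF A i h(1)] qf A])
      show "cmp A h i x g n x = cmp A q f x g n x" if x: "x \<in> X" "g \<in> G" "n \<in> carrier (pts A x g)" for x g n
        unfolding cmp_apply[where \<psi>=h, OF x] h(2)[OF x(1,2) dhomD(1)[OF i x]] by (rule a(2)[OF x])
    qed (rule J)
    show "\<exists>h\<in>dhom B P. cmp A h i = f"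
    proof (rule bexI[of _ "cmp B p h"], rule dhom_ext[OF dhom_cmp[OF A i] f])
      show "cmp B p h \<in> dhom B P" "cmp B p h \<in> dhom B P" by (rule dhom_cmp[OF B h(1) p])+
      fix x g n assume x: "x \<in> X" "g \<in> G" "n \<in> carrier (pts A x g)"
      have "h x g (i x g n) = q x g (f x g n)"
        using fun_cong[OF fun_cong[OF fun_cong[OF hi, of x], of g], of n] by (simp add: cmp_apply[OF x])
      then show "cmp A (cmp B p h) i x g n = f x g n"
        using x by (simp add: cmp_apply dhomD(1)[OF i] dhomD(1)[OF f] pq)
    qed
  qed
  ultimately show "\<exists>P i. injective_obj (DistMod K G X d) P \<and> mono_arr (DistMod K G X d) M P i" by blast
qed

end

theorem proposition4p4:
  fixes K :: "'k ring" and G :: "real set"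
    and X :: "'x set" and d :: "'x \<Rightarrow> 'x \<Rightarrow> ennreal"
  assumes "cring K"
    and "quasimetric X d"
    and "subgroup G real_add_group"
    and "\<And>x y. x \<in> X \<Longrightarrow> y \<in> X \<Longrightarrow> d x y < \<infinity> \<Longrightarrow> enn2real (d x y) \<in> G"
    and "closed_universe TYPE('x + 'k + nat) TYPE('u)"
  shows "let \<A> = (GrMod K G :: (('k, 'u) gmod, real \<Rightarrow> 'u \<Rightarrow> 'u) cat);
             \<D> = (DistMod K G X d :: (('x, 'k, 'u) dmod, 'x \<Rightarrow> real \<Rightarrow> 'u \<Rightarrow> 'u) cat);
             \<M> = (ModCat K G (Sigma_gcat K G X d) ::
                  (('x, 'k, 'k, 'u) gcat_module, 'x \<Rightarrow> real \<Rightarrow> 'u \<Rightarrow> 'u) cat)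
         in (\<exists>\<Phi>. cat_isomorphism \<D> \<M> \<Phi> \<and>
               ftor_eq \<A> (ftor_comp \<Phi> (Triv G X d)) (eps_pullback K G X d) \<and>
               (\<exists>R. adjunction \<A> \<M> (eps_pullback K G X d) R) \<and>
               (\<forall>R. adjunction \<A> \<M> (eps_pullback K G X d) R \<longrightarrow>
                  nat_isomorphic \<D> \<A> (ftor_comp R \<Phi>) (Inv G X d)) \<and>
               (\<exists>L. adjunction \<M> \<A> L (eps_pullback K G X d)) \<and>
               (\<forall>L. adjunction \<M> \<A> L (eps_pullback K G X d) \<longrightarrow>
                  nat_isomorphic \<D> \<A> (ftor_comp L \<Phi>) (Coinv K G X d))) \<and>
            enough_projectives \<D> \<and> enough_injectives \<D> \<and>
            adjunction \<D> \<A> (Coinv K G X d) (Triv G X d) \<and>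
            adjunction \<A> \<D> (Triv G X d) (Inv G X d)"
proof -
  interpret dist_universe K G X d "TYPE('x + 'k + nat)" "TYPE('u)"
    by (intro dist_universe.intro dist_setting.intro graded.intro dist_setting_axioms.intro universe.intro) (fact assms)+
  let ?A = "GrMod K G :: (('k, 'u) gmod, real \<Rightarrow> 'u \<Rightarrow> 'u) cat"
  let ?D = "DistMod K G X d :: (('x, 'k, 'u) dmod, 'x \<Rightarrow> real \<Rightarrow> 'u \<Rightarrow> 'u) cat"
  let ?M = "ModCat K G (Sigma_gcat K G X d) :: (('x, 'k, 'k, 'u) gcat_module, 'x \<Rightarrow> real \<Rightarrow> 'u \<Rightarrow> 'u) cat"
  let ?\<epsilon> = "eps_pullback K G X d :: (('k, 'u) gmod, real \<Rightarrow> 'u \<Rightarrow> 'u, ('x, 'k, 'k, 'u) gcat_module, 'x \<Rightarrow> real \<Rightarrow> 'u \<Rightarrow> 'u) ftor"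
  let ?T = "Triv G X d :: (('k, 'u) gmod, real \<Rightarrow> 'u \<Rightarrow> 'u, ('x, 'k, 'u) dmod, 'x \<Rightarrow> real \<Rightarrow> 'u \<Rightarrow> 'u) ftor"
  let ?F = "\<Phi> :: (('x, 'k, 'u) dmod, 'x \<Rightarrow> real \<Rightarrow> 'u \<Rightarrow> 'u, ('x, 'k, 'k, 'u) gcat_module, 'x \<Rightarrow> real \<Rightarrow> 'u \<Rightarrow> 'u) ftor"
  let ?H = "\<Psi> :: (('x, 'k, 'k, 'u) gcat_module, 'x \<Rightarrow> real \<Rightarrow> 'u \<Rightarrow> 'u, ('x, 'k, 'u) dmod, 'x \<Rightarrow> real \<Rightarrow> 'u \<Rightarrow> 'u) ftor"
  \<comment> \<open>An isomorphism is both left and right adjoint to its inverse, so adjunctions can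
    be carried along it on either side.\<close>
  note FH = isomorphism_adjunction[OF \<Phi>_functor \<Psi>_functor \<Psi>_\<Phi> \<Phi>_\<Psi>]
    and HF = isomorphism_adjunction[OF \<Psi>_functor \<Phi>_functor \<Phi>_\<Psi> \<Psi>_\<Phi>]
  have \<epsilon>: "ftor_eq ?A (ftor_comp ?F ?T) ?\<epsilon>" by (rule Triv_eps_pullback)
  have "FObj ?\<epsilon> A = to_gmod (triv A)" if "A \<in> graded_modules K G" for A
    using \<epsilon> that by (simp add: ftor_eq_def)
  moreover have "FArr ?\<epsilon> A B f = (\<lambda>x\<in>X. f)"
    if "A \<in> graded_modules K G" "B \<in> graded_modules K G" "f \<in> deg_maps K G 0 A B" for A B f
    using \<epsilon> that by (simp add: ftor_eq_def)
  \<comment> \<open>The identification read through the inverse: the pullback followed by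
    \<open>\<Psi>\<close> is \<open>Triv\<close>, so adjoints of the pullback become adjoints of
    \<open>Triv\<close>.\<close>
  ultimately have T: "ftor_eq ?A (ftor_comp ?H ?\<epsilon>) ?T"
    by (simp add: ftor_eq_def of_to_gmod triv_dmods)
  \<comment> \<open>Existence of both adjoints of the pullback: \<open>Inv\<close> and
    \<open>Coinv\<close> preceded by the inverse isomorphism.\<close>
  have R: "adjunction ?A ?M ?\<epsilon> (ftor_comp INV ?H)"
    by (rule adjunction_cong[OF adjunction_comp[OF Triv_Inv_adjunction FH] \<epsilon> ftor_eq_refl])
  have L: "adjunction ?M ?A (ftor_comp COINV ?H) ?\<epsilon>"
    by (rule adjunction_cong[OF adjunction_comp[OF HF Coinv_Triv_adjunction] ftor_eq_refl \<epsilon>])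
  \<comment> \<open>Any right adjoint of the pullback becomes, preceded by \<open>\<Phi>\<close>, a
    right adjoint of \<open>Triv\<close>, and uniqueness compares it with \<open>Inv\<close>. The
    left adjoints are treated dually.\<close>
  have R': "nat_isomorphic ?D ?A (ftor_comp R ?F) INV" if "adjunction ?A ?M ?\<epsilon> R" for R
    by (rule adjunction_right_unique[OF adjunction_cong[OF adjunction_comp[OF that HF] T ftor_eq_refl] Triv_Inv_adjunction])
  have L': "nat_isomorphic ?D ?A (ftor_comp L ?F) COINV" if "adjunction ?M ?A L ?\<epsilon>" for L
    by (rule adjunction_left_unique[OF adjunction_cong[OF adjunction_comp[OF FH that] ftor_eq_refl T] Coinv_Triv_adjunction])
  have iso: "cat_isomorphism ?D ?M ?F"
    unfolding cat_isomorphism_def using \<Phi>_functor \<Psi>_functor \<Psi>_\<Phi> \<Phi>_\<Psi> by blast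
  show ?thesis
    unfolding Let_def
    using iso \<epsilon> R R' L L' DistMod_enough_projectives DistMod_enough_injectives Coinv_Triv_adjunction Triv_Inv_adjunction
    by blast
qed

end
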